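(* Let $G=(V,E)$ be a Seymour graph with two sources $s_1,s_2$ and two sinks $t_1,t_2$, and let $c: E\rightarrow\mathbb{Z}_+$ be a capacity function. Then a maximum integral biflow in $G$ (with respect to $c$) can be found in $O(n^3+m^2)$ time, where $n=|V|$ and $m=|E|$.
   Context: $\mathbb{Z}_+$ and $\mathbb{R}_+$ denote the nonnegative integers and the nonnegative reals. Let $G=(V,E)$ be a finite undirected graph with four distinguished vertices: two sources $s_1,s_2$ and two sinks $t_1,t_2$. Let $c:E\to\mathbb{Z}_+$ be a capacity function and let $\mathcal{P}$ be the set of all simple paths in $G$ from $s_1$ to $t_1$ or from $s_2$ to $t_2$. A biflow is an assignment $f:\mathcal{P}\to\mathbb{R}_+$ such that $\sum_{Q\in\mathcal{P},\,e\in Q} f(Q)\le c(e)$ for all $e\in E$; its value is $\sum_{Q\in\mathcal{P}} f(Q)$. It is integral if all $f(Q)$ are integers. A maximum integral biflow is an integral biflow of maximum value among integral biflows. (Equivalently, a biflow may be represented in arc form as a pair consisting of an $s_1$-$t_1$ flow and an $s_2$-$t_2$ flow which together use at most $c(e)$ units on each edge $e$, counting both directions.) A bicut is a subset $K\subseteq E$ containing at least one edge from each member of $\mathcal{P}$; its capacity is $\sum_{e\in K}c(e)$. $G$ (with $s_1,t_1,s_2,t_2$) is a Seymour graph if for every capacity function $c:E\to\mathbb{Z}_+$ the maximum value of an integral biflow equals the minimum capacity of a bicut. Running times count elementary operations, including arithmetic operations and comparisons on capacities, as is usual for network flow algorithms. *)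

theory Defs
  imports Complex_Main
begin

section \<open>Biflows, bicuts and Seymour graphs\<close>

text \<open>
  Undirected graphs with two source-sink pairs.  Edges have an identity of their own, so parallel
  edges and loops are possible (loops lie on no simple path); simple graphs are the special case
  where \<open>ends\<close> is injective on the edges and yields two-element sets.
\<close>

record ('v, 'e) terminal_graph =
  verts :: "'v set"
  edges :: "'e set"
  ends :: "'e \<Rightarrow> 'v set"
  source1 :: 'v
  sink1 :: 'v
  source2 :: 'v
  sink2 :: 'v

definition wf_terminal_graph :: "('v, 'e) terminal_graph \<Rightarrow> bool" where
  "wf_terminal_graph G \<longleftrightarrow>
     finite (verts G) \<and> finite (edges G) \<and>
     (\<forall>e\<in>edges G. \<exists>u\<in>verts G. \<exists>v\<in>verts G. ends G e = {u, v}) \<and>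
     {source1 G, sink1 G, source2 G, sink2 G} \<subseteq> verts G \<and>
     distinct [source1 G, sink1 G, source2 G, sink2 G]"

text \<open>
  A simple path is represented by its list of edges, in order from \<open>s\<close> to \<open>t\<close>; \<open>vs\<close> is the list of
  its vertices.
\<close>

definition simple_path :: "('v, 'e) terminal_graph \<Rightarrow> 'v \<Rightarrow> 'e list \<Rightarrow> 'v \<Rightarrow> bool" where
  "simple_path G s es t \<longleftrightarrow>
     (\<exists>vs. length vs = length es + 1 \<and> distinct vs \<and> set vs \<subseteq> verts G \<and>
           hd vs = s \<and> last vs = t \<and>
           (\<forall>i<length es. es ! i \<in> edges G \<and> ends G (es ! i) = {vs ! i, vs ! Suc i}))"

definition terminal_paths :: "('v, 'e) terminal_graph \<Rightarrow> 'e list set" where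
  "terminal_paths G =
     {Q. simple_path G (source1 G) Q (sink1 G) \<or> simple_path G (source2 G) Q (sink2 G)}"

definition biflow :: "('v, 'e) terminal_graph \<Rightarrow> ('e \<Rightarrow> nat) \<Rightarrow> ('e list \<Rightarrow> real) \<Rightarrow> bool" where
  "biflow G c f \<longleftrightarrow>
     (\<forall>Q\<in>terminal_paths G. 0 \<le> f Q) \<and>
     (\<forall>e\<in>edges G. (\<Sum>Q\<in>{Q \<in> terminal_paths G. e \<in> set Q}. f Q) \<le> real (c e))"

definition biflow_value :: "('v, 'e) terminal_graph \<Rightarrow> ('e list \<Rightarrow> real) \<Rightarrow> real" where
  "biflow_value G f = (\<Sum>Q\<in>terminal_paths G. f Q)"

definition integral_biflow ::
  "('v, 'e) terminal_graph \<Rightarrow> ('e \<Rightarrow> nat) \<Rightarrow> ('e list \<Rightarrow> real) \<Rightarrow> bool" where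
  "integral_biflow G c f \<longleftrightarrow> biflow G c f \<and> (\<forall>Q\<in>terminal_paths G. f Q \<in> \<int>)"

definition max_integral_biflow ::
  "('v, 'e) terminal_graph \<Rightarrow> ('e \<Rightarrow> nat) \<Rightarrow> ('e list \<Rightarrow> real) \<Rightarrow> bool" where
  "max_integral_biflow G c f \<longleftrightarrow>
     integral_biflow G c f \<and>
     (\<forall>g. integral_biflow G c g \<longrightarrow> biflow_value G g \<le> biflow_value G f)"

definition bicut :: "('v, 'e) terminal_graph \<Rightarrow> 'e set \<Rightarrow> bool" where
  "bicut G K \<longleftrightarrow> K \<subseteq> edges G \<and> (\<forall>Q\<in>terminal_paths G. set Q \<inter> K \<noteq> {})"

definition min_bicut :: "('v, 'e) terminal_graph \<Rightarrow> ('e \<Rightarrow> nat) \<Rightarrow> 'e set \<Rightarrow> bool" where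
  "min_bicut G c K \<longleftrightarrow> bicut G K \<and> (\<forall>L. bicut G L \<longrightarrow> sum c K \<le> sum c L)"

definition Seymour_graph :: "('v, 'e) terminal_graph \<Rightarrow> bool" where
  "Seymour_graph G \<longleftrightarrow>
     wf_terminal_graph G \<and>
     (\<forall>c. \<exists>f K. max_integral_biflow G c f \<and> min_bicut G c K \<and>
                biflow_value G f = real (sum c K))"

text \<open>The sums over paths above are genuine: there are only finitely many paths.\<close>

lemma finite_terminal_paths:
  assumes "wf_terminal_graph G"
  shows "finite (terminal_paths G)"
proof (rule finite_subset)
  show "terminal_paths G \<subseteq> {es. set es \<subseteq> edges G \<and> length es \<le> card (verts G)}"
  proof -
    have "set es \<subseteq> edges G \<and> length es \<le> card (verts G)" if sp: "simple_path G s es t" for s t es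
    proof -
      obtain vs where vs: "length vs = length es + 1" "distinct vs" "set vs \<subseteq> verts G"
        and es: "\<forall>i<length es. es ! i \<in> edges G"
        using sp unfolding simple_path_def by auto
      have "length vs \<le> card (verts G)"
        using vs(2,3) assms card_mono[of "verts G" "set vs"]
        by (simp add: distinct_card wf_terminal_graph_def)
      with vs(1) es show ?thesis by (auto simp: in_set_conv_nth)
    qed
    then show ?thesis by (auto simp: terminal_paths_def)
  qed
  show "finite {es. set es \<subseteq> edges G \<and> length es \<le> card (verts G)}"
    using assms by (simp add: wf_terminal_graph_def finite_lists_length_le)
qed


section \<open>Programs and their running time\<close>

text \<open>
  A random access machine in structured form: a program has integer registers and integer arrays
  (both named by numbers; a program mentions only finitely many of them), and every operation,
  array access, comparison and control step costs one unit.  The arithmetic operations are addition,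
  subtraction and halving (rounding down).  Unrestricted multiplication and division are left out on
  purpose: on integers of unbounded size they are not realistic unit-cost operations, whereas here
  each operation lengthens the operands by at most one bit.
\<close>

record store =
  regs :: "nat \<Rightarrow> int"
  arrs :: "nat \<Rightarrow> int \<Rightarrow> int"

datatype aexp =
    Num int
  | Reg nat
  | Elem nat aexp
  | Plus aexp aexp
  | Minus aexp aexp
  | Half aexp

datatype bexp =
    Less aexp aexp
  | Equal aexp aexp
  | Not bexp
  | And bexp bexp

datatype com =
    Skip
  | Assign nat aexp
  | Update nat aexp aexp
  | Seq com com
  | If bexp com com
  | While bexp com

primrec aval :: "store \<Rightarrow> aexp \<Rightarrow> int" where
  "aval \<sigma> (Num k) = k"
| "aval \<sigma> (Reg x) = regs \<sigma> x"
| "aval \<sigma> (Elem a i) = arrs \<sigma> a (aval \<sigma> i)"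
| "aval \<sigma> (Plus p q) = aval \<sigma> p + aval \<sigma> q"
| "aval \<sigma> (Minus p q) = aval \<sigma> p - aval \<sigma> q"
| "aval \<sigma> (Half p) = aval \<sigma> p div 2"

primrec bval :: "store \<Rightarrow> bexp \<Rightarrow> bool" where
  "bval \<sigma> (Less p q) \<longleftrightarrow> aval \<sigma> p < aval \<sigma> q"
| "bval \<sigma> (Equal p q) \<longleftrightarrow> aval \<sigma> p = aval \<sigma> q"
| "bval \<sigma> (Not b) \<longleftrightarrow> \<not> bval \<sigma> b"
| "bval \<sigma> (And b d) \<longleftrightarrow> bval \<sigma> b \<and> bval \<sigma> d"

primrec acost :: "aexp \<Rightarrow> nat" where
  "acost (Num k) = 1"
| "acost (Reg x) = 1"
| "acost (Elem a i) = 1 + acost i"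
| "acost (Plus p q) = 1 + acost p + acost q"
| "acost (Minus p q) = 1 + acost p + acost q"
| "acost (Half p) = 1 + acost p"

primrec bcost :: "bexp \<Rightarrow> nat" where
  "bcost (Less p q) = 1 + acost p + acost q"
| "bcost (Equal p q) = 1 + acost p + acost q"
| "bcost (Not b) = 1 + bcost b"
| "bcost (And b d) = 1 + bcost b + bcost d"

text \<open>\<open>exec C \<sigma> t \<tau>\<close>: started in \<open>\<sigma>\<close>, the program \<open>C\<close> halts in \<open>\<tau>\<close> after \<open>t\<close> units of time.\<close>

inductive exec :: "com \<Rightarrow> store \<Rightarrow> nat \<Rightarrow> store \<Rightarrow> bool" where
  Skip: "exec Skip \<sigma> 1 \<sigma>"
| Assign: "exec (Assign x p) \<sigma> (1 + acost p) (\<sigma>\<lparr>regs := (regs \<sigma>)(x := aval \<sigma> p)\<rparr>)"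
| Update: "exec (Update a i p) \<sigma> (1 + acost i + acost p)
    (\<sigma>\<lparr>arrs := (arrs \<sigma>)(a := (arrs \<sigma> a)(aval \<sigma> i := aval \<sigma> p))\<rparr>)"
| Seq: "exec C \<sigma> t \<sigma>' \<Longrightarrow> exec D \<sigma>' t' \<sigma>'' \<Longrightarrow> exec (Seq C D) \<sigma> (t + t') \<sigma>''"
| IfTrue: "bval \<sigma> b \<Longrightarrow> exec C \<sigma> t \<sigma>' \<Longrightarrow> exec (If b C D) \<sigma> (1 + bcost b + t) \<sigma>'"
| IfFalse: "\<not> bval \<sigma> b \<Longrightarrow> exec D \<sigma> t \<sigma>' \<Longrightarrow> exec (If b C D) \<sigma> (1 + bcost b + t) \<sigma>'"
| WhileFalse: "\<not> bval \<sigma> b \<Longrightarrow> exec (While b C) \<sigma> (1 + bcost b) \<sigma>"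
| WhileTrue: "bval \<sigma> b \<Longrightarrow> exec C \<sigma> t \<sigma>' \<Longrightarrow> exec (While b C) \<sigma>' t' \<sigma>'' \<Longrightarrow>
    exec (While b C) \<sigma> (1 + bcost b + t + t') \<sigma>''"

lemma exec_deterministic:
  assumes "exec C \<sigma> t \<tau>" and "exec C \<sigma> t' \<tau>'"
  shows "t = t' \<and> \<tau> = \<tau>'"
  using assms
proof (induction arbitrary: t' \<tau>' rule: exec.induct)
  case (Skip \<sigma>)
  from Skip.prems show ?case by cases simp
next
  case (Assign x p \<sigma>)
  from Assign.prems show ?case by cases simp
next
  case (Update a i p \<sigma>)
  from Update.prems show ?case by cases simp
next
  case (Seq C \<sigma> t1 \<sigma>1 D t2 \<sigma>2)
  from Seq.prems show ?case by cases (metis Seq.IH)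
next
  case (IfTrue \<sigma> b C t1 \<sigma>1 D)
  from IfTrue.prems IfTrue.hyps show ?case by cases (metis IfTrue.IH, simp)
next
  case (IfFalse \<sigma> b D t1 \<sigma>1 C)
  from IfFalse.prems IfFalse.hyps show ?case by cases (simp, metis IfFalse.IH)
next
  case (WhileFalse \<sigma> b C)
  from WhileFalse.prems WhileFalse.hyps show ?case by cases simp_all
next
  case (WhileTrue \<sigma> b C t1 \<sigma>1 t2 \<sigma>2)
  from WhileTrue.prems WhileTrue.hyps show ?case by cases (simp, metis WhileTrue.IH)
qed


section \<open>Input and output\<close>

text \<open>
  The vertices and edges of an input graph are numbered from 0.  The input consists of
  \<open>n, m, s\<^sub>1, t\<^sub>1, s\<^sub>2, t\<^sub>2\<close> in registers 0 to 5, of the two ends of edge \<open>i\<close> (in either order) in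
  position \<open>i\<close> of arrays 0 and 1, and of its capacity in position \<open>i\<close> of array 2.  Everything else
  is initially 0.
\<close>

definition numbered_graph :: "(nat, nat) terminal_graph \<Rightarrow> (nat \<Rightarrow> nat) \<Rightarrow> (nat \<Rightarrow> nat) \<Rightarrow> bool" where
  "numbered_graph G u v \<longleftrightarrow>
     verts G = {..<card (verts G)} \<and> edges G = {..<card (edges G)} \<and>
     (\<forall>e\<in>edges G. ends G e = {u e, v e})"

definition list_array :: "nat list \<Rightarrow> int \<Rightarrow> int" where
  "list_array xs i = (if 0 \<le> i \<and> i < int (length xs) then int (xs ! nat i) else 0)"

definition input_store ::
  "(nat, nat) terminal_graph \<Rightarrow> (nat \<Rightarrow> nat) \<Rightarrow> (nat \<Rightarrow> nat) \<Rightarrow> (nat \<Rightarrow> nat) \<Rightarrow> store" where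
  "input_store G u v c =
     (let n = card (verts G); m = card (edges G) in
      \<lparr>regs = (\<lambda>x. list_array [n, m, source1 G, sink1 G, source2 G, sink2 G] (int x)),
       arrs = (\<lambda>_ _. 0)(0 := list_array (map u [0..<m]),
                        1 := list_array (map v [0..<m]),
                        2 := list_array (map c [0..<m]))\<rparr>)"

text \<open>
  The output is a biflow given by a list of pairwise distinct paths with their values; the paths not
  listed have value 0.  Register 0 holds the number of listed paths, and array 0 holds, one after
  the other, for each listed path its value, its number of edges, and its edges.
\<close>

definition listed_biflow :: "('e list \<times> nat) list \<Rightarrow> 'e list \<Rightarrow> real" where
  "listed_biflow L Q = (case map_of L Q of None \<Rightarrow> 0 | Some w \<Rightarrow> real w)"

definition outputs_biflow :: "(nat, nat) terminal_graph \<Rightarrow> store \<Rightarrow> (nat list \<Rightarrow> real) \<Rightarrow> bool" where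
  "outputs_biflow G \<sigma> f \<longleftrightarrow>
     (\<exists>L. distinct (map fst L) \<and> fst ` set L \<subseteq> terminal_paths G \<and> f = listed_biflow L \<and>
          regs \<sigma> 0 = int (length L) \<and>
          (let out = concat (map (\<lambda>(Q, w). w # length Q # Q) L)
           in \<forall>i<length out. arrs \<sigma> 0 (int i) = int (out ! i)))"

end

theory Submission
  imports Defs
begin

text \<open>
  Let \<open>\<tau>\<close> be the minimum capacity of a bicut.  A minimal bicut is a cut separating both pairs of
  terminals, so two maximum flow computations yield \<open>\<tau>\<close>, and residual networks then tell in linear
  time whether a given edge lies in a cut of capacity \<open>\<tau>\<close>.  First every edge that is in no such cut has
  its capacity lowered by one, where possible, updating the flows by one augmentation.  By the Seymour
  property there is an integral biflow of value \<open>\<tau>\<close> for the lowered capacities; it saturates all edges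
  in minimum cuts, so the edges on which its load differs in parity from the capacity are among those
  whose capacity was lowered (or has become 0).  Hence the vertices of wrong parity can be paired up by
  augmenting paths of lowered edges, that is, by restoring the capacity of some of them.  This gives
  capacities \<open>c*\<close> with \<open>c* \<le> c\<close> whose minimum bicut still is \<open>\<tau>\<close> and for which the degree of every
  vertex other than the terminals is even, and the degrees of the two terminals of a pair have the same
  parity.  For such capacities the classical construction works: with a suitable split
  \<open>\<tau> = d1 + d2\<close> there are integral flows \<open>g, h\<close>, both congruent to \<open>c*\<close> modulo 2 on every edge, for the
  demands \<open>d1\<close> from \<open>s\<^sub>1\<close> to \<open>t\<^sub>1\<close> and \<open>d2\<close> from \<open>s\<^sub>2\<close> to \<open>t\<^sub>2\<close>, respectively from \<open>t\<^sub>2\<close> to \<open>s\<^sub>2\<close>; then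
  \<open>(g + h) / 2\<close> and \<open>(g - h) / 2\<close> form an integral biflow.
\<close>

text \<open>The obstacle is time. One maximum flow per edge is far too slow, so beyond five maximum
  flows each phase may spend only linear time on an edge or a path. Therefore the lower bound on all
  separating cuts is kept as a circulation: its return arc carries the bound \<tau>, and a single
  search decides whether an edge can be lowered. Lowering by one is enough, because only the parity
  of the final capacity matters, and a unit given back later never exceeds the original capacity.
  The edges to be restored form a T-join for the vertices of wrong parity. It is found greedily:
  edges are deleted one by one, and a deleted edge is taken if and only if the component left at its
  tail has odd parity. The Seymour property only shows that such a T-join exists among the lowered
  edges; the loads that witness it are never computed. The n^3 term comes from push-relabel
  organised in O(n^2) rounds with linear overhead each, the m^2 term from one search per edge or
  extracted path.\<close>

section \<open>Time credits\<close>

text \<open>The credit of a postcondition is what remains of the initial credit; it may be negative in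
  between and is an ordinary ghost variable, so amortized bounds become loop invariants.\<close>

definition wp :: "com \<Rightarrow> (store \<Rightarrow> int \<Rightarrow> bool) \<Rightarrow> store \<Rightarrow> int \<Rightarrow> bool" where
  "wp C Q \<sigma> k \<longleftrightarrow> (\<exists>t \<tau>. exec C \<sigma> t \<tau> \<and> Q \<tau> (k - int t))"

inductive_cases exec_SkipE: "exec Skip \<sigma> t \<tau>"
inductive_cases exec_AssignE: "exec (Assign x p) \<sigma> t \<tau>"
inductive_cases exec_UpdateE: "exec (Update a i p) \<sigma> t \<tau>"
inductive_cases exec_SeqE: "exec (Seq C D) \<sigma> t \<tau>"
inductive_cases exec_IfE: "exec (If b C D) \<sigma> t \<tau>"

lemma wp_Skip [simp]: "wp Skip Q \<sigma> k \<longleftrightarrow> Q \<sigma> (k - 1)"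
  unfolding wp_def by (auto elim!: exec_SkipE intro: exec.intros) (metis exec.Skip of_nat_1)

lemma wp_Assign [simp]:
  "wp (Assign x p) Q \<sigma> k \<longleftrightarrow>
     Q (\<sigma>\<lparr>regs := (regs \<sigma>)(x := aval \<sigma> p)\<rparr>) (k - 1 - int (acost p))"
proof
  assume "wp (Assign x p) Q \<sigma> k"
  then show "Q (\<sigma>\<lparr>regs := (regs \<sigma>)(x := aval \<sigma> p)\<rparr>) (k - 1 - int (acost p))"
    unfolding wp_def by (auto elim!: exec_AssignE simp: algebra_simps)
next
  assume "Q (\<sigma>\<lparr>regs := (regs \<sigma>)(x := aval \<sigma> p)\<rparr>) (k - 1 - int (acost p))"
  then show "wp (Assign x p) Q \<sigma> k"
    unfolding wp_def using exec.Assign[of x p \<sigma>] by (auto simp: algebra_simps intro!: exI)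
qed

lemma wp_Update [simp]:
  "wp (Update a i p) Q \<sigma> k \<longleftrightarrow>
     Q (\<sigma>\<lparr>arrs := (arrs \<sigma>)(a := (arrs \<sigma> a)(aval \<sigma> i := aval \<sigma> p))\<rparr>)
       (k - 1 - int (acost i) - int (acost p))"
proof
  assume "wp (Update a i p) Q \<sigma> k"
  then show "Q (\<sigma>\<lparr>arrs := (arrs \<sigma>)(a := (arrs \<sigma> a)(aval \<sigma> i := aval \<sigma> p))\<rparr>)
       (k - 1 - int (acost i) - int (acost p))"
    unfolding wp_def by (auto elim!: exec_UpdateE simp: algebra_simps)
next
  assume "Q (\<sigma>\<lparr>arrs := (arrs \<sigma>)(a := (arrs \<sigma> a)(aval \<sigma> i := aval \<sigma> p))\<rparr>)
       (k - 1 - int (acost i) - int (acost p))"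
  then show "wp (Update a i p) Q \<sigma> k"
    unfolding wp_def using exec.Update[of a i p \<sigma>] by (auto simp: algebra_simps intro!: exI)
qed

lemma wp_Seq [simp]: "wp (Seq C D) Q \<sigma> k \<longleftrightarrow> wp C (wp D Q) \<sigma> k"
proof
  assume "wp (Seq C D) Q \<sigma> k"
  then obtain t \<tau> where e: "exec (Seq C D) \<sigma> t \<tau>" and Q: "Q \<tau> (k - int t)"
    unfolding wp_def by auto
  from e obtain t1 \<sigma>1 t2 where "exec C \<sigma> t1 \<sigma>1" "exec D \<sigma>1 t2 \<tau>" "t = t1 + t2"
    by (auto elim!: exec_SeqE)
  with Q show "wp C (wp D Q) \<sigma> k"
    unfolding wp_def by (auto simp: diff_diff_eq intro!: exI)
next
  assume "wp C (wp D Q) \<sigma> k"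
  then obtain t1 \<sigma>1 t2 \<tau> where "exec C \<sigma> t1 \<sigma>1" "exec D \<sigma>1 t2 \<tau>" "Q \<tau> (k - int t1 - int t2)"
    unfolding wp_def by auto
  then show "wp (Seq C D) Q \<sigma> k"
    unfolding wp_def by (intro exI[of _ "t1 + t2"] exI[of _ \<tau>]) (auto intro: exec.Seq simp: diff_diff_eq)
qed

lemma wp_If [simp]:
  "wp (If b C D) Q \<sigma> k \<longleftrightarrow>
     (bval \<sigma> b \<longrightarrow> wp C Q \<sigma> (k - 1 - int (bcost b))) \<and>
     (\<not> bval \<sigma> b \<longrightarrow> wp D Q \<sigma> (k - 1 - int (bcost b)))"
proof
  assume "wp (If b C D) Q \<sigma> k"
  then show "(bval \<sigma> b \<longrightarrow> wp C Q \<sigma> (k - 1 - int (bcost b))) \<and>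
     (\<not> bval \<sigma> b \<longrightarrow> wp D Q \<sigma> (k - 1 - int (bcost b)))"
    unfolding wp_def by (auto elim!: exec_IfE simp: diff_diff_eq add.assoc intro!: exI)
next
  assume *: "(bval \<sigma> b \<longrightarrow> wp C Q \<sigma> (k - 1 - int (bcost b))) \<and>
     (\<not> bval \<sigma> b \<longrightarrow> wp D Q \<sigma> (k - 1 - int (bcost b)))"
  show "wp (If b C D) Q \<sigma> k"
  proof (cases "bval \<sigma> b")
    case True
    with * obtain t \<tau> where "exec C \<sigma> t \<tau>" "Q \<tau> (k - 1 - int (bcost b) - int t)"
      unfolding wp_def by auto
    with True show ?thesis
      unfolding wp_def by (intro exI[of _ "1 + bcost b + t"] exI[of _ \<tau>])
        (auto intro: exec.IfTrue[simplified] simp: diff_diff_eq add.assoc)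
  next
    case False
    with * obtain t \<tau> where "exec D \<sigma> t \<tau>" "Q \<tau> (k - 1 - int (bcost b) - int t)"
      unfolding wp_def by auto
    with False show ?thesis
      unfolding wp_def by (intro exI[of _ "1 + bcost b + t"] exI[of _ \<tau>])
        (auto intro: exec.IfFalse[simplified] simp: diff_diff_eq add.assoc)
  qed
qed

primrec written_regs :: "com \<Rightarrow> nat set" where
  "written_regs Skip = {}"
| "written_regs (Assign x p) = {x}"
| "written_regs (Update a i p) = {}"
| "written_regs (Seq C D) = written_regs C \<union> written_regs D"
| "written_regs (If b C D) = written_regs C \<union> written_regs D"
| "written_regs (While b C) = written_regs C"

primrec written_arrs :: "com \<Rightarrow> nat set" where
  "written_arrs Skip = {}"
| "written_arrs (Assign x p) = {}"
| "written_arrs (Update a i p) = {a}"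
| "written_arrs (Seq C D) = written_arrs C \<union> written_arrs D"
| "written_arrs (If b C D) = written_arrs C \<union> written_arrs D"
| "written_arrs (While b C) = written_arrs C"

text \<open>A purely syntactic frame condition. The rules \<open>wp_While\<close> and
  \<open>wp_spec\<close> supply it automatically, so invariants and specifications mention only what
  a program changes.\<close>

definition agree :: "com \<Rightarrow> store \<Rightarrow> store \<Rightarrow> bool" where
  "agree C \<sigma> \<tau> \<longleftrightarrow> (\<forall>x. x \<notin> written_regs C \<longrightarrow> regs \<tau> x = regs \<sigma> x) \<and>
                   (\<forall>a. a \<notin> written_arrs C \<longrightarrow> arrs \<tau> a = arrs \<sigma> a)"

lemma agree_refl: "agree C \<sigma> \<sigma>"
  by (simp add: agree_def)

lemma agree_trans: "agree C \<sigma> \<sigma>' \<Longrightarrow> agree C \<sigma>' \<sigma>'' \<Longrightarrow> agree C \<sigma> \<sigma>''"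
  by (simp add: agree_def)

lemma exec_agree: "exec C \<sigma> t \<tau> \<Longrightarrow> agree C \<sigma> \<tau>"
  by (induction rule: exec.induct) (auto simp: agree_def)

lemma agree_regs: "agree C \<sigma> \<tau> \<Longrightarrow> x \<notin> written_regs C \<Longrightarrow> regs \<tau> x = regs \<sigma> x"
  by (simp add: agree_def)

lemma agree_arrs: "agree C \<sigma> \<tau> \<Longrightarrow> a \<notin> written_arrs C \<Longrightarrow> arrs \<tau> a = arrs \<sigma> a"
  by (simp add: agree_def)

lemma wp_agree:
  assumes "wp C Q \<sigma> k" and "\<And>\<tau> k'. Q \<tau> k' \<Longrightarrow> agree C \<sigma> \<tau> \<Longrightarrow> R \<tau> k'"
  shows "wp C R \<sigma> k"
  using assms exec_agree unfolding wp_def by blast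

text \<open>The rule for procedure calls. Specifications are proved for one starting credit
  \<open>T\<close> with a nonnegative rest; since a run does not depend on the credit, the same run
  started with credit \<open>k\<close> leaves at least \<open>k - T\<close>.\<close>

lemma wp_spec:
  assumes "wp C (\<lambda>\<tau> k'. P \<tau> \<and> 0 \<le> k') \<sigma> T"
    and "\<And>\<tau> k'. P \<tau> \<Longrightarrow> agree C \<sigma> \<tau> \<Longrightarrow> k - T \<le> k' \<Longrightarrow> R \<tau> k'"
  shows "wp C R \<sigma> k"
proof -
  obtain t \<tau> where e: "exec C \<sigma> t \<tau>" and P: "P \<tau>" and t: "0 \<le> T - int t"
    using assms(1) unfolding wp_def by auto
  have "R \<tau> (k - int t)" using assms(2)[OF P exec_agree[OF e]] t by simp
  with e show ?thesis unfolding wp_def by blast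
qed

text \<open>Total correctness without a separate variant: every iteration pays at least one unit for
  its guard, so the credit itself decreases, and it has to be nonnegative only while the guard
  holds.\<close>

lemma wp_While:
  assumes inv: "I \<sigma> k"
    and credit: "\<And>\<sigma>' k'. I \<sigma>' k' \<Longrightarrow> agree C \<sigma> \<sigma>' \<Longrightarrow> bval \<sigma>' b \<Longrightarrow> 0 \<le> k'"
    and step: "\<And>\<sigma>' k'. I \<sigma>' k' \<Longrightarrow> agree C \<sigma> \<sigma>' \<Longrightarrow> bval \<sigma>' b \<Longrightarrow>
                 wp C I \<sigma>' (k' - 1 - int (bcost b))"
    and exit: "\<And>\<sigma>' k'. I \<sigma>' k' \<Longrightarrow> agree C \<sigma> \<sigma>' \<Longrightarrow> \<not> bval \<sigma>' b \<Longrightarrow> Q \<sigma>' (k' - 1 - int (bcost b))"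
  shows "wp (While b C) Q \<sigma> k"
proof -
  have "wp (While b C) Q \<sigma>' k'" if "I \<sigma>' k'" "agree C \<sigma> \<sigma>'" for \<sigma>' k'
    using that
  \<comment> \<open>The shift by one gives credit 0 a positive measure, so an iteration entered with
    credit 0 still decreases it.\<close>
  proof (induction "nat (k' + 1)" arbitrary: \<sigma>' k' rule: less_induct)
    case less
    show ?case
    proof (cases "bval \<sigma>' b")
      case False
      then show ?thesis
        using exit[OF less.prems False] exec.WhileFalse[OF False]
        unfolding wp_def by (intro exI[of _ "1 + bcost b"] exI[of _ \<sigma>']) (auto simp: diff_diff_eq)
    next
      case True
      from step[OF less.prems True] obtain t \<sigma>'' where e: "exec C \<sigma>' t \<sigma>''"
        and I: "I \<sigma>'' (k' - 1 - int (bcost b) - int t)" unfolding wp_def by auto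
      have "wp (While b C) Q \<sigma>'' (k' - 1 - int (bcost b) - int t)"
        using credit[OF less.prems True] less.prems(2) exec_agree[OF e]
        by (intro less.hyps[OF _ I]) (auto intro: agree_trans)
      then obtain t' \<tau> where "exec (While b C) \<sigma>'' t' \<tau>"
        "Q \<tau> (k' - 1 - int (bcost b) - int t - int t')" unfolding wp_def by auto
      then show ?thesis using exec.WhileTrue[OF True e]
        unfolding wp_def by (intro exI[of _ "1 + bcost b + t + t'"] exI[of _ \<tau>]) (auto simp: algebra_simps)
    qed
  qed
  from this[OF inv agree_refl] show ?thesis .
qed

declare wp_def [no_atp]

section \<open>Flows, cuts and residual capacities over a fixed-point-free reversal of arcs\<close>

section \<open>Arc graphs\<close>

text \<open>Each undirected edge becomes two arcs exchanged by \<open>rv\<close>. As only arcs are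
  compared, parallel edges and loops need no special treatment.\<close>

locale arc_graph =
  fixes V :: "'v set" and A :: "'a set" and tail :: "'a \<Rightarrow> 'v" and rv :: "'a \<Rightarrow> 'a"
  assumes finV [simp]: "finite V" and finA [simp]: "finite A"
    and tailV [simp]: "a \<in> A \<Longrightarrow> tail a \<in> V"
    and rvA [simp]: "a \<in> A \<Longrightarrow> rv a \<in> A"
    and rv_rv [simp]: "a \<in> A \<Longrightarrow> rv (rv a) = a"
    and rv_ne [simp]: "a \<in> A \<Longrightarrow> rv a \<noteq> a"
begin

definition head :: "'a \<Rightarrow> 'v" where
  "head a = tail (rv a)"

definition out_arcs :: "'v \<Rightarrow> 'a set" where
  "out_arcs v = {a \<in> A. tail a = v}"

definition outs :: "'v set \<Rightarrow> 'a set" where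
  "outs X = {a \<in> A. tail a \<in> X \<and> head a \<notin> X}"

lemma headV [simp]: "a \<in> A \<Longrightarrow> head a \<in> V"
  by (simp add: head_def)

lemma head_rv [simp]: "a \<in> A \<Longrightarrow> head (rv a) = tail a"
  by (simp add: head_def)

lemma finite_out_arcs [simp]: "finite (out_arcs v)"
  by (simp add: out_arcs_def)

lemma finite_outs [simp]: "finite (outs X)"
  by (simp add: outs_def)

lemma rv_ne' [simp]: "a \<in> A \<Longrightarrow> a \<noteq> rv a"
  using rv_ne by metis

lemma rv_eq_iff: "a \<in> A \<Longrightarrow> b \<in> A \<Longrightarrow> rv a = b \<longleftrightarrow> a = rv b"
  by auto

text \<open>The involution \<open>rv\<close> permutes the arcs inside \<open>X\<close> and flips
  every sign.\<close>

lemma sum_inner_antisym: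
  fixes h :: "'a \<Rightarrow> int"
  assumes "\<And>a. a \<in> A \<Longrightarrow> h (rv a) = - h a"
  shows "(\<Sum>a\<in>{a \<in> A. tail a \<in> X \<and> head a \<in> X}. h a) = 0"
proof -
  let ?I = "{a \<in> A. tail a \<in> X \<and> head a \<in> X}"
  have "(\<Sum>a\<in>?I. h a) = (\<Sum>a\<in>?I. h (rv a))"
    by (rule sum.reindex_bij_witness[of _ rv rv]) (auto simp: head_def)
  also have "\<dots> = - (\<Sum>a\<in>?I. h a)"
    using assms by (simp add: sum_negf)
  finally show ?thesis by simp
qed

lemma sum_out_arcs:
  assumes "X \<subseteq> V"
  shows "(\<Sum>v\<in>X. \<Sum>a\<in>out_arcs v. h a) = (\<Sum>a\<in>{a \<in> A. tail a \<in> X}. h a)"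
proof -
  have fX: "finite X" using assms finV by (rule finite_subset)
  have "(\<Sum>v\<in>X. \<Sum>a\<in>out_arcs v. h a) = (\<Sum>a\<in>(\<Union>v\<in>X. out_arcs v). h a)"
    by (rule sum.UNION_disjoint[symmetric]) (auto simp: fX out_arcs_def)
  also have "(\<Union>v\<in>X. out_arcs v) = {a \<in> A. tail a \<in> X}"
    by (auto simp: out_arcs_def)
  finally show ?thesis .
qed

lemma sum_tail_split:
  "(\<Sum>a\<in>{a \<in> A. tail a \<in> X}. h a) = (\<Sum>a\<in>outs X. h a) + (\<Sum>a\<in>{a \<in> A. tail a \<in> X \<and> head a \<in> X}. h a)"
  by (subst sum.union_disjoint[symmetric]) (auto simp: outs_def intro!: sum.cong)

lemma sum_cut_antisym:
  fixes h :: "'a \<Rightarrow> int"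
  assumes "X \<subseteq> V" and "\<And>a. a \<in> A \<Longrightarrow> h (rv a) = - h a"
  shows "(\<Sum>v\<in>X. \<Sum>a\<in>out_arcs v. h a) = (\<Sum>a\<in>outs X. h a)"
  using sum_out_arcs[OF assms(1), of h] sum_tail_split[of h X] sum_inner_antisym[of h X] assms(2)
  by simp

text \<open>A flow encoded by what it leaves over: the invariant pair sum makes
  \<open>r0 a - r a\<close> antisymmetric, and nonnegativity is the capacity bound. The values of
  \<open>r0\<close> may be negative, which later expresses a lower bound on the return arc.\<close>

definition residual :: "('a \<Rightarrow> int) \<Rightarrow> ('a \<Rightarrow> int) \<Rightarrow> bool" where
  "residual r0 r \<longleftrightarrow> (\<forall>a\<in>A. 0 \<le> r a \<and> r a + r (rv a) = r0 a + r0 (rv a))"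

text \<open>The flow along \<open>a\<close> is \<open>r0 a - r a\<close>, so this is inflow minus outflow.\<close>

definition excess :: "('a \<Rightarrow> int) \<Rightarrow> ('a \<Rightarrow> int) \<Rightarrow> 'v \<Rightarrow> int" where
  "excess r0 r v = (\<Sum>a\<in>out_arcs v. r a - r0 a)"

lemma excess_cut:
  assumes "residual r0 r" "X \<subseteq> V"
  shows "(\<Sum>v\<in>X. excess r0 r v) = (\<Sum>a\<in>outs X. r a - r0 a)"
  unfolding excess_def using assms
  by (intro sum_cut_antisym) (auto simp: residual_def algebra_simps)

definition push :: "'a \<Rightarrow> int \<Rightarrow> ('a \<Rightarrow> int) \<Rightarrow> 'a \<Rightarrow> int" where
  "push a \<delta> r = r(a := r a - \<delta>, rv a := r (rv a) + \<delta>)"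

lemma push_apply:
  "a \<in> A \<Longrightarrow> b \<in> A \<Longrightarrow> push a \<delta> r b = r b - (if b = a then \<delta> else 0) + (if b = rv a then \<delta> else 0)"
  by (auto simp: push_def)

lemma residual_push:
  assumes "residual r0 r" "a \<in> A" "0 \<le> \<delta>" "\<delta> \<le> r a"
  shows "residual r0 (push a \<delta> r)"
  using assms unfolding residual_def by (auto simp: push_apply rv_eq_iff)

lemma excess_push:
  assumes "a \<in> A"
  shows "excess r0 (push a \<delta> r) v =
    excess r0 r v - (if v = tail a then \<delta> else 0) + (if v = head a then \<delta> else 0)"
proof -
  have "excess r0 (push a \<delta> r) v = (\<Sum>b\<in>out_arcs v. (r b - r0 b)
      - (if b = a then \<delta> else 0) + (if b = rv a then \<delta> else 0))"
    unfolding excess_def by (rule sum.cong) (auto simp: push_apply out_arcs_def assms)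
  also have "\<dots> = excess r0 r v - (\<Sum>b\<in>out_arcs v. if b = a then \<delta> else 0)
       + (\<Sum>b\<in>out_arcs v. if b = rv a then \<delta> else 0)"
    by (simp add: excess_def sum.distrib sum_subtractf)
  also have "\<dots> = excess r0 r v - (if v = tail a then \<delta> else 0) + (if v = head a then \<delta> else 0)"
    using assms by (auto simp: sum.delta out_arcs_def head_def)
  finally show ?thesis .
qed

text \<open>For residual capacities these are the sets all of whose leaving arcs are saturated; for
  a symmetric function that marks edges they are the unions of connected components. Both readings
  are used.\<close>

definition closed :: "('a \<Rightarrow> int) \<Rightarrow> 'v set \<Rightarrow> bool" where
  "closed r X \<longleftrightarrow> (\<forall>a\<in>outs X. r a \<le> 0)"

text \<open>Max-flow min-cut in its equality form: on a closed set every leaving arc has residual 0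
  and is therefore filled to capacity.\<close>

lemma closed_value:
  assumes "residual r0 r" "closed r X" "X \<subseteq> V"
  shows "(\<Sum>v\<in>X. excess r0 r v) = - (\<Sum>a\<in>outs X. r0 a)"
proof -
  have "r a = 0" if "a \<in> outs X" for a
    using assms(1,2) that unfolding residual_def closed_def outs_def by fastforce
  then show ?thesis using excess_cut[OF assms(1,3)] by (simp add: sum_negf)
qed

lemma cut_value_bound:
  assumes "residual r0 r" "X \<subseteq> V"
  shows "- (\<Sum>a\<in>outs X. r0 a) \<le> (\<Sum>v\<in>X. excess r0 r v)"
proof -
  have "- (\<Sum>a\<in>outs X. r0 a) = (\<Sum>a\<in>outs X. - r0 a)" by (simp add: sum_negf)
  also have "\<dots> \<le> (\<Sum>a\<in>outs X. r a - r0 a)"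
    using assms(1) by (intro sum_mono) (auto simp: residual_def outs_def)
  finally show ?thesis using excess_cut[OF assms] by simp
qed

section \<open>Push-relabel labels and the gap argument\<close>

subsection \<open>Distance labels\<close>

definition valid_labels :: "('a \<Rightarrow> int) \<Rightarrow> ('v \<Rightarrow> int) \<Rightarrow> bool" where
  "valid_labels r d \<longleftrightarrow> (\<forall>a\<in>A. 0 < r a \<longrightarrow> d (tail a) \<le> d (head a) + 1)"

text \<open>The pigeonhole behind the gap argument, which takes the place of residual paths in the
  two bounds below.\<close>

lemma unused_label:
  fixes d :: "'v \<Rightarrow> int"
  assumes "finite W" "int (card W) < h - l"
  obtains g where "l < g" "g \<le> h" "\<forall>w\<in>W. d w \<noteq> g"
proof -
  have "\<not> {l<..h} \<subseteq> d ` W"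
  proof
    assume "{l<..h} \<subseteq> d ` W"
    then have "card {l<..h} \<le> card (d ` W)" using assms(1) by (intro card_mono) auto
    also have "\<dots> \<le> card W" using assms(1) by (rule card_image_le)
    finally show False using assms(2) by simp
  qed
  then obtain g where "g \<in> {l<..h}" "g \<notin> d ` W" by blast
  then show ?thesis using that[of g] by auto
qed

text \<open>A residual arc descends by at most one label, so none can jump across an unoccupied
  value.\<close>

lemma label_gap_closed:
  assumes "valid_labels r d" "\<forall>w\<in>V. d w \<noteq> g"
  shows "closed r {w \<in> V. g < d w}"
  unfolding closed_def
proof
  fix a assume a: "a \<in> outs {w \<in> V. g < d w}"
  then have aA: "a \<in> A" and t: "g < d (tail a)" and h: "\<not> g < d (head a)"
    by (auto simp: outs_def)
  then have "d (head a) < g" using assms(2) headV[OF aA] by (metis not_less_iff_gr_or_eq)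
  with t have "\<not> d (tail a) \<le> d (head a) + 1" by simp
  with assms(1) aA show "r a \<le> 0" unfolding valid_labels_def by force
qed

text \<open>The usual proof follows a residual path from \<open>v\<close> back to the source. Here
  pigeonhole yields a label in the upper half that no vertex has; the vertices above this gap would
  form a closed set avoiding \<open>s\<close>, whose total excess is at most 0 although it contains
  the active vertex \<open>v\<close>.\<close>

lemma active_label_bound:
  assumes res: "residual r0 r" and lab: "valid_labels r d" and r0: "\<forall>a\<in>A. 0 \<le> r0 a"
    and s: "s \<in> V" "d s = int (card V)" and ex: "\<forall>w\<in>V. w \<noteq> s \<longrightarrow> 0 \<le> excess r0 r w"
    and v: "v \<in> V" "0 < excess r0 r v"
  shows "d v < 2 * int (card V)"
proof (rule ccontr)
  assume "\<not> ?thesis"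
  then have dv: "2 * int (card V) \<le> d v" by simp
  have cV: "0 < card V" using v(1) by (auto simp: card_gt_0_iff)
  have "int (card (V - {s})) < 2 * int (card V) - int (card V)"
    using s(1) cV by (auto simp: card_Diff_singleton_if)
  then obtain g where g: "int (card V) < g" "g \<le> 2 * int (card V)" "\<forall>w\<in>V - {s}. d w \<noteq> g"
    using unused_label[of "V - {s}" "2 * int (card V)" "int (card V)" d] finV by (metis finite_Diff)
  let ?X = "{w \<in> V. g < d w}"
  have gap: "\<forall>w\<in>V. d w \<noteq> g" using g s by auto
  have "d v \<noteq> g" using gap v by blast
  then have vX: "v \<in> ?X" using dv g v by auto
  have sX: "s \<notin> ?X" using s g by auto
  have "(\<Sum>w\<in>?X. excess r0 r w) = - (\<Sum>a\<in>outs ?X. r0 a)"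
    by (rule closed_value[OF res label_gap_closed[OF lab gap]]) auto
  also have "\<dots> \<le> 0" using r0 by (auto intro!: sum_nonneg simp: outs_def)
  finally have "(\<Sum>w\<in>?X. excess r0 r w) \<le> 0" .
  moreover have "0 < (\<Sum>w\<in>?X. excess r0 r w)"
    using vX v sX ex by (intro sum_pos2[of _ v]) auto
  ultimately show False by simp
qed

text \<open>With \<open>s\<close> at label \<open>card V\<close> and \<open>t\<close> at 0, only
  \<open>card V - 2\<close> vertices remain for the \<open>card V - 1\<close> labels strictly
  between. So there is a gap, and the vertices above it form a cut without residual arcs.\<close>

lemma labels_min_cut:
  assumes lab: "valid_labels r d" and s: "s \<in> V" "d s = int (card V)" and t: "t \<in> V" "d t = 0"
    and "s \<noteq> t"
  obtains X where "X \<subseteq> V" "s \<in> X" "t \<notin> X" "closed r X"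
proof -
  have "card {s, t} \<le> card V" using s t by (intro card_mono) auto
  then have c2: "2 \<le> card V" using \<open>s \<noteq> t\<close> by simp
  have "card (V - {s, t}) = card V - 2" using s t \<open>s \<noteq> t\<close> by (simp add: card_Diff_subset)
  then have "int (card (V - {s, t})) < (int (card V) - 1) - 0" using c2 by simp
  then obtain g where g: "0 < g" "g \<le> int (card V) - 1" "\<forall>w\<in>V - {s, t}. d w \<noteq> g"
    using unused_label[of "V - {s, t}" "int (card V) - 1" 0 d] finV by (metis finite_Diff)
  have gap: "\<forall>w\<in>V. d w \<noteq> g" using g s t by auto
  show ?thesis
    by (rule that[of "{w \<in> V. g < d w}"]) (use s t g label_gap_closed[OF lab gap] in auto)
qed

subsection \<open>Search trees\<close>

text \<open>\<open>rk v\<close> is 0 on unreached vertices and the position in the queue (from 1) on reached ones.\<close>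

definition search_tree :: "('a \<Rightarrow> int) \<Rightarrow> 'v \<Rightarrow> ('v \<Rightarrow> int) \<Rightarrow> ('v \<Rightarrow> 'a) \<Rightarrow> bool" where
  "search_tree r x rk par \<longleftrightarrow>
     x \<in> V \<and> 0 < rk x \<and> (\<forall>v\<in>V. 0 \<le> rk v \<and> rk v \<le> int (card V)) \<and>
     closed r {v \<in> V. 0 < rk v} \<and>
     (\<forall>v\<in>V. 0 < rk v \<and> v \<noteq> x \<longrightarrow> par v \<in> A \<and> head (par v) = v \<and> 0 < r (par v) \<and>
        0 < rk (tail (par v)) \<and> rk (tail (par v)) < rk v)"

text \<open>A closed set containing the root cannot miss a reached vertex, because the tree arc into
  it has positive residual; the ranks give the induction.\<close>

lemma search_tree_minimal:
  assumes st: "search_tree r x rk par" and Y: "x \<in> Y" "closed r Y"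
  shows "{v \<in> V. 0 < rk v} \<subseteq> Y"
proof -
  have "v \<in> Y" if "v \<in> V" "0 < rk v" for v
    using that
  proof (induction "nat (rk v)" arbitrary: v rule: less_induct)
    case less
    show ?case
    proof (cases "v = x")
      case False
      with less.prems st have p: "par v \<in> A" "head (par v) = v" "0 < r (par v)"
        "0 < rk (tail (par v))" "rk (tail (par v)) < rk v"
        unfolding search_tree_def by auto
      have "tail (par v) \<in> Y" using less.hyps[of "tail (par v)"] p by auto
      then show ?thesis using Y(2) p unfolding closed_def outs_def by fastforce
    qed (use Y in simp)
  qed
  then show ?thesis by auto
qed

end

section \<open>T-joins as a parity condition on closed sets\<close>

context arc_graph
begin

subsection \<open>Parity\<close>

text \<open>For symmetric \<open>H\<close> this is the criterion for a T-join inside the support of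
  \<open>H\<close>, where T is the set of vertices with odd \<open>D\<close>: every component must
  contain an even number of vertices of T.\<close>

definition even_on_closed :: "('a \<Rightarrow> int) \<Rightarrow> ('v \<Rightarrow> int) \<Rightarrow> bool" where
  "even_on_closed H D \<longleftrightarrow> (\<forall>Y. Y \<subseteq> V \<and> closed H Y \<longrightarrow> even (\<Sum>v\<in>Y. D v))"

lemma closed_complement:
  assumes "closed H Y" "\<forall>a\<in>A. H (rv a) = H a"
  shows "closed H (V - Y)"
  unfolding closed_def
proof
  fix a assume a: "a \<in> outs (V - Y)"
  then have "a \<in> A" "rv a \<in> outs Y" by (auto simp: outs_def head_def)
  then have "H (rv a) \<le> 0" "H (rv a) = H a" using assms by (auto simp: closed_def)
  then show "H a \<le> 0" by simp
qed

text \<open>An arc leaving \<open>Y - X\<close> leaves \<open>Y\<close> or enters \<open>X\<close>;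
  the symmetry of \<open>H\<close> turns entering into leaving.\<close>

lemma closed_Diff:
  assumes "closed H Y" "closed H X" "\<forall>a\<in>A. H (rv a) = H a"
  shows "closed H (Y - X)"
  unfolding closed_def
proof
  fix a assume a: "a \<in> outs (Y - X)"
  then have aA: "a \<in> A" and "a \<in> outs Y \<or> rv a \<in> outs X" by (auto simp: outs_def head_def)
  then show "H a \<le> 0"
  proof (elim disjE)
    assume "rv a \<in> outs X"
    then have "H (rv a) \<le> 0" using assms(2) by (simp add: closed_def)
    then show ?thesis using assms(3) aA by simp
  qed (use assms(1) in \<open>simp add: closed_def\<close>)
qed

text \<open>The greedy step for T-joins. \<open>X\<close> is the component of \<open>tail e\<close>
  after the deletion of \<open>e\<close>. If its sum is odd, every T-join has to use
  \<open>e\<close>, so both endpoints change parity. If the deletion leaves the endpoints connected,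
  the invariant already makes the sum even.\<close>

lemma even_on_closed_drop:
  assumes sym: "\<forall>a\<in>A. H (rv a) = H a" and e: "e \<in> A" and inv: "even_on_closed H D"
    and H': "H' = H(e := 0, rv e := 0)"
    and X: "X \<subseteq> V" "tail e \<in> X" "closed H' X"
    and min: "\<And>Y. tail e \<in> Y \<Longrightarrow> closed H' Y \<Longrightarrow> X \<subseteq> Y"
    and D': "\<And>v. v \<in> V \<Longrightarrow> D' v = D v + (if odd (\<Sum>v\<in>X. D v) then of_bool (v = tail e) + of_bool (v = head e) else 0)"
  shows "even_on_closed H' D'"
proof -
  let ?u = "tail e" and ?w = "head e"
  have sym': "\<forall>a\<in>A. H' (rv a) = H' a" using sym e by (auto simp: H' rv_eq_iff)
  define p where "p = (if odd (\<Sum>v\<in>X. D v) then 1 else 0 :: int)"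
  have fin: "finite Y" if "Y \<subseteq> V" for Y using that finV by (rule finite_subset)
  have sumD': "(\<Sum>v\<in>Y. D' v) = (\<Sum>v\<in>Y. D v) + p * (of_bool (?u \<in> Y) + of_bool (?w \<in> Y))"
    if Y: "Y \<subseteq> V" for Y
  proof -
    have "(\<Sum>v\<in>Y. D' v) = (\<Sum>v\<in>Y. D v + p * ((if v = ?u then 1 else 0) + (if v = ?w then 1 else 0)))"
    proof (rule sum.cong)
      fix v assume "v \<in> Y"
      with Y have "v \<in> V" by blast
      from D'[OF this] show "D' v = D v + p * ((if v = ?u then 1 else 0) + (if v = ?w then 1 else 0))"
        by (simp add: p_def)
    qed simp
    also have "\<dots> = (\<Sum>v\<in>Y. D v) + p * ((\<Sum>v\<in>Y. if v = ?u then 1 else 0) + (\<Sum>v\<in>Y. if v = ?w then 1 else 0))"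
      by (simp add: sum.distrib sum_distrib_left distrib_left)
    also have "\<dots> = (\<Sum>v\<in>Y. D v) + p * (of_bool (?u \<in> Y) + of_bool (?w \<in> Y))"
      using fin[OF Y] by (simp add: sum.delta of_bool_def)
    finally show ?thesis .
  qed
  \<comment> \<open>A set closed without \<open>e\<close> that does not split the endpoints of
    \<open>e\<close> is also closed with \<open>e\<close>, so the old invariant applies to
    it.\<close>
  have same: "even (\<Sum>v\<in>Y. D v)" if "Y \<subseteq> V" "closed H' Y" "?u \<in> Y \<longleftrightarrow> ?w \<in> Y" for Y
  proof -
    have "closed H Y" unfolding closed_def
    proof
      fix a assume a: "a \<in> outs Y"
      then have "a \<noteq> e" "a \<noteq> rv e" using that(3) e by (auto simp: outs_def head_def)
      then have "H' a = H a" by (simp add: H')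
      then show "H a \<le> 0" using that(2) a unfolding closed_def by force
    qed
    then show ?thesis using inv that(1) unfolding even_on_closed_def by blast
  qed
  have same': "even (\<Sum>v\<in>Y. D' v)" if "Y \<subseteq> V" "closed H' Y" "?u \<in> Y \<longleftrightarrow> ?w \<in> Y" for Y
    using same[OF that] sumD'[OF that(1)] that(3) by auto
  \<comment> \<open>\<open>Y - X\<close> contains neither endpoint, so its sum is even and
    \<open>Y\<close> has the parity of \<open>X\<close>; the correction at \<open>tail e\<close> was
    chosen to cancel precisely this parity.\<close>
  have uw: "even (\<Sum>v\<in>Y. D' v)" if Y: "Y \<subseteq> V" "closed H' Y" "?u \<in> Y" "?w \<notin> Y" for Y
  proof -
    have XY: "X \<subseteq> Y" using min Y by blast
    have "even (\<Sum>v\<in>Y - X. D v)"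
      by (rule same) (use Y X XY closed_Diff[OF Y(2) X(3) sym'] in auto)
    moreover have "(\<Sum>v\<in>Y. D v) = (\<Sum>v\<in>Y - X. D v) + (\<Sum>v\<in>X. D v)"
      using sum.subset_diff[OF XY fin[OF Y(1)], of D] by simp
    ultimately show ?thesis using sumD'[OF Y(1)] Y(3,4) by (auto simp: p_def)
  qed
  show ?thesis unfolding even_on_closed_def
  proof (intro allI impI, elim conjE)
    fix Y assume Y: "Y \<subseteq> V" "closed H' Y"
    show "even (\<Sum>v\<in>Y. D' v)"
    proof (cases "?u \<in> Y \<longleftrightarrow> ?w \<in> Y")
      case True then show ?thesis using same'[OF Y] by simp
    next
      case False
      show ?thesis
      proof (cases "?u \<in> Y")
        case True then show ?thesis using uw[OF Y] False by simp
      next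
        case False': False
        \<comment> \<open>Only the head lies in \<open>Y\<close>. Its complement falls under the
          previous case, and the sum over all of \<open>V\<close> is even.\<close>
        have "even (\<Sum>v\<in>V - Y. D' v)"
          using uw[of "V - Y"] closed_complement[OF Y(2) sym'] False False' e by auto
        moreover have "even (\<Sum>v\<in>V. D' v)"
          by (rule same') (use e in \<open>auto simp: closed_def outs_def\<close>)
        moreover have "(\<Sum>v\<in>V. D' v) = (\<Sum>v\<in>V - Y. D' v) + (\<Sum>v\<in>Y. D' v)"
          using sum.subset_diff[OF Y(1) finV, of D'] by simp
        ultimately show ?thesis by simp
      qed
    qed
  qed
qed

end

section \<open>The concrete network, its adjacency lists and its sums over arcs\<close>

section \<open>The flow network\<close>

text \<open>The vertices of the network are those of the graph, \<open>0..<n\<close>, together with a source \<open>n\<close> and a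
  sink \<open>n + 1\<close>.  Its edges are the edges \<open>0..<m\<close> of the graph, an edge \<open>m + v\<close> from the source to
  \<open>v\<close> and an edge \<open>m + n + v\<close> from \<open>v\<close> to the sink for each \<open>v\<close>, and the edge \<open>m + 2 n\<close> from the source
  to the sink.  Edge \<open>e\<close> gives rise to the arc \<open>e\<close> and to the reversed arc \<open>e + M\<close>, where \<open>M\<close> is the
  number of edges.\<close>

locale network =
  fixes n m :: int and us vs :: "int \<Rightarrow> int"
  assumes n0: "0 \<le> n" and m0: "0 \<le> m"
    and us: "\<And>e. 0 \<le> e \<Longrightarrow> e < m \<Longrightarrow> 0 \<le> us e \<and> us e < n"
    and vs: "\<And>e. 0 \<le> e \<Longrightarrow> e < m \<Longrightarrow> 0 \<le> vs e \<and> vs e < n"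
begin

definition ret :: int where "ret = m + n + n"

definition M :: int where "M = ret + 1"

definition tl :: "int \<Rightarrow> int" where
  "tl a = (if a < m then us a else if a < m + n then n else if a < ret then a - (m + n)
     else if a < M then n
     else if a - M < m then vs (a - M) else if a - M < m + n then a - M - m else n + 1)"

definition rev_arc :: "int \<Rightarrow> int" where
  "rev_arc a = (if a < M then a + M else a - M)"

abbreviation "V \<equiv> {0..<n + 2}"
abbreviation "A \<equiv> {0..<2 * M}"

lemma M_pos: "0 < M" "m < M"
  using n0 m0 by (auto simp: M_def ret_def)

sublocale arc_graph V A tl rev_arc
proof
  fix a assume a: "a \<in> A"
  show "tl a \<in> V" using a us[of a] vs[of "a - M"] n0 m0 by (auto simp: tl_def M_def ret_def)
  show "rev_arc a \<in> A" "rev_arc (rev_arc a) = a" "rev_arc a \<noteq> a"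
    using a M_pos by (auto simp: rev_arc_def)
qed auto

lemma card_V: "int (card V) = n + 2"
  using n0 by simp

lemma card_A: "int (card A) = 2 * M"
  using M_pos by simp

text \<open>Adjacency lists are linked downwards and end with -1. A traversal starts at
  \<open>pred_arc v (2 * M)\<close>, so the arcs already passed are always those above the current
  pointer.\<close>

definition pred_arc :: "int \<Rightarrow> int \<Rightarrow> int" where
  "pred_arc v a = Max (insert (-1) {b \<in> A. tl b = v \<and> b < a})"

definition arcs_upto :: "int \<Rightarrow> int \<Rightarrow> int set" where
  "arcs_upto v a = {b \<in> A. tl b = v \<and> b \<le> a}"

lemma finite_arcs_upto [simp]: "finite (arcs_upto v a)"
  by (auto simp: arcs_upto_def intro: finite_subset[OF _ finA])

lemma pred_arc_in: "pred_arc v a = -1 \<or> pred_arc v a \<in> A \<and> tl (pred_arc v a) = v \<and> pred_arc v a < a"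
proof -
  have "pred_arc v a \<in> insert (-1) {b \<in> A. tl b = v \<and> b < a}"
    unfolding pred_arc_def by (rule Max_in) (auto intro: finite_subset[OF _ finA])
  then show ?thesis by auto
qed

lemma pred_arc_max: "b \<in> A \<Longrightarrow> tl b = v \<Longrightarrow> b < a \<Longrightarrow> b \<le> pred_arc v a"
  unfolding pred_arc_def by (rule Max_ge) (auto intro: finite_subset[OF _ finA])

lemma arcs_upto_pred: "arcs_upto v (pred_arc v a) = {b \<in> A. tl b = v \<and> b < a}"
  using pred_arc_in[of v a] pred_arc_max[of _ v a] by (fastforce simp: arcs_upto_def)

lemma arcs_upto_first: "arcs_upto v (pred_arc v (2 * M)) = out_arcs v"
  unfolding arcs_upto_pred by (auto simp: out_arcs_def)

lemma arcs_upto_next: "a \<in> A \<Longrightarrow> tl a = v \<Longrightarrow> arcs_upto v a = insert a (arcs_upto v (pred_arc v a))"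
  unfolding arcs_upto_pred by (auto simp: arcs_upto_def)

lemma arcs_upto_neg [simp]: "arcs_upto v (-1) = {}"
  by (auto simp: arcs_upto_def)

lemma card_arcs_upto_next:
  assumes "a \<in> A" "tl a = v"
  shows "int (card (arcs_upto v a)) = int (card (arcs_upto v (pred_arc v a))) + 1"
proof -
  have "a \<notin> arcs_upto v (pred_arc v a)" unfolding arcs_upto_pred by auto
  then show ?thesis by (subst arcs_upto_next[OF assms]) simp
qed

lemma pred_arc_step:
  "b \<in> A \<Longrightarrow> tl b = v \<Longrightarrow> pred_arc v a < b \<Longrightarrow> b \<noteq> a \<Longrightarrow> a < b"
  using pred_arc_max[of b v a] by force

definition edge_of :: "int \<Rightarrow> int" where
  "edge_of a = (if a < M then a else a - M)"

lemma sum_shift: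
  fixes f :: "int \<Rightarrow> int"
  shows "sum f {a..<a + b} = (\<Sum>i\<in>{0..<b}. f (a + i))"
  by (rule sum.reindex_bij_witness[of _ "\<lambda>i. a + i" "\<lambda>i. i - a"]) auto

lemma sum_concat:
  fixes f :: "int \<Rightarrow> int"
  shows "0 \<le> a \<Longrightarrow> 0 \<le> b \<Longrightarrow> sum f {0..<a + b} = sum f {0..<a} + (\<Sum>i\<in>{0..<b}. f (a + i))"
  unfolding sum_shift[of f a b, symmetric]
  by (subst sum.union_disjoint[symmetric]) (auto intro!: sum.cong)

lemma sum_edges:
  fixes f :: "int \<Rightarrow> int"
  shows "sum f {0..<M} = (\<Sum>e\<in>{0..<m}. f e) + (\<Sum>v\<in>{0..<n}. f (m + v)) +
     (\<Sum>v\<in>{0..<n}. f (m + n + v)) + f (ret)"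
proof -
  have "{0..<1} = {0::int}" by auto
  then show ?thesis
    unfolding M_def
    using sum_concat[of "ret" 1 f] sum_concat[of "m + n" n f, folded ret_def] sum_concat[of m n f] n0 m0
    by (simp add: ret_def)
qed

lemma sum_arcs_pairs:
  fixes f :: "int \<Rightarrow> int"
  shows "sum f A = (\<Sum>e\<in>{0..<M}. f e + f (e + M))"
proof -
  have "sum f {0..<M + M} = sum f {0..<M} + (\<Sum>e\<in>{0..<M}. f (M + e))"
    using M_pos by (intro sum_concat) auto
  then show ?thesis by (simp add: sum.distrib add.commute)
qed

lemma sum_arcs:
  fixes f :: "int \<Rightarrow> int"
  shows "sum f A = (\<Sum>e\<in>{0..<m}. f e + f (e + M)) + (\<Sum>v\<in>{0..<n}. f (m + v) + f (m + v + M)) +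
     (\<Sum>v\<in>{0..<n}. f (m + n + v) + f (m + n + v + M)) + f (ret) + f (ret + M)"
  unfolding sum_arcs_pairs sum_edges by simp

lemma tl_simps:
  "e < m \<Longrightarrow> tl e = us e"
  "0 \<le> e \<Longrightarrow> e < m \<Longrightarrow> tl (e + M) = vs e"
  "0 \<le> v \<Longrightarrow> v < n \<Longrightarrow> tl (m + v) = n"
  "0 \<le> v \<Longrightarrow> v < n \<Longrightarrow> tl (m + v + M) = v"
  "0 \<le> v \<Longrightarrow> v < n \<Longrightarrow> tl (m + n + v) = v"
  "0 \<le> v \<Longrightarrow> v < n \<Longrightarrow> tl (m + n + v + M) = n + 1"
  "tl (ret) = n" "tl (ret + M) = n + 1"
  using n0 m0 unfolding tl_def M_def ret_def by simp_all

lemma rev_simps: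
  "e < M \<Longrightarrow> rev_arc e = e + M" "0 \<le> e \<Longrightarrow> rev_arc (e + M) = e"
  using M_pos by (auto simp: rev_arc_def)

lemma head_simps:
  "0 \<le> e \<Longrightarrow> e < m \<Longrightarrow> head e = vs e"
  "0 \<le> e \<Longrightarrow> e < m \<Longrightarrow> head (e + M) = us e"
  "0 \<le> v \<Longrightarrow> v < n \<Longrightarrow> head (m + v) = v"
  "0 \<le> v \<Longrightarrow> v < n \<Longrightarrow> head (m + v + M) = n"
  "0 \<le> v \<Longrightarrow> v < n \<Longrightarrow> head (m + n + v) = n + 1"
  "0 \<le> v \<Longrightarrow> v < n \<Longrightarrow> head (m + n + v + M) = v"
  "head (ret) = n + 1" "head (ret + M) = n"
proof -
  have l: "e < m \<Longrightarrow> e < M" "v < n \<Longrightarrow> m + v < M" "v < n \<Longrightarrow> m + n + v < M" "ret < M" "0 \<le> ret"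
    using n0 m0 by (auto simp: M_def ret_def)
  show "0 \<le> e \<Longrightarrow> e < m \<Longrightarrow> head e = vs e"
    "0 \<le> e \<Longrightarrow> e < m \<Longrightarrow> head (e + M) = us e"
    "0 \<le> v \<Longrightarrow> v < n \<Longrightarrow> head (m + v) = v"
    "0 \<le> v \<Longrightarrow> v < n \<Longrightarrow> head (m + v + M) = n"
    "0 \<le> v \<Longrightarrow> v < n \<Longrightarrow> head (m + n + v) = n + 1"
    "0 \<le> v \<Longrightarrow> v < n \<Longrightarrow> head (m + n + v + M) = v"
    "head (ret) = n + 1" "head (ret + M) = n"
    unfolding head_def using n0 m0 M_pos
    by (simp_all add: rev_simps tl_simps l)
qed

text \<open>In contrast to the antisymmetric case, the two arcs of an inner edge add up to twice its
  value.\<close>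

lemma sum_inner_sym_even:
  fixes h :: "int \<Rightarrow> int"
  assumes "\<And>a. a \<in> A \<Longrightarrow> h (rev_arc a) = h a"
  shows "even (\<Sum>a\<in>{a \<in> A. tl a \<in> X \<and> head a \<in> X}. h a)"
proof -
  have "(\<Sum>a\<in>{a \<in> A. tl a \<in> X \<and> head a \<in> X}. h a) = (\<Sum>a\<in>A. if tl a \<in> X \<and> head a \<in> X then h a else 0)"
    by (rule sum.inter_filter) simp
  also have "\<dots> = (\<Sum>e\<in>{0..<M}. 2 * (if tl e \<in> X \<and> head e \<in> X then h e else 0))"
    unfolding sum_arcs_pairs
  proof (rule sum.cong)
    fix e assume e: "e \<in> {0..<M}"
    then have "h (e + M) = h e" "tl (e + M) = head e" "head (e + M) = tl e"
      using assms[of e] M_pos by (auto simp: head_def rev_simps)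
    then show "(if tl e \<in> X \<and> head e \<in> X then h e else 0) +
      (if tl (e + M) \<in> X \<and> head (e + M) \<in> X then h (e + M) else 0) =
      2 * (if tl e \<in> X \<and> head e \<in> X then h e else 0)" by auto
  qed simp
  finally show ?thesis by (simp add: sum_distrib_left[symmetric])
qed

text \<open>How a T-join is exhibited: an integral edge vector \<open>h\<close> supported on
  \<open>H\<close> contributes nothing on the boundary of a closed set and an even amount inside it,
  so matching parities at the vertices force an even sum of \<open>D\<close>.\<close>

lemma even_on_closed_join:
  fixes D h :: "int \<Rightarrow> int"
  assumes h: "\<And>a. a \<in> A \<Longrightarrow> h (rev_arc a) = h a" "\<And>a. a \<in> A \<Longrightarrow> H a \<le> 0 \<Longrightarrow> h a = 0"
    and D: "\<And>v. v \<in> V \<Longrightarrow> even (D v + (\<Sum>a\<in>out_arcs v. h a))"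
  shows "even_on_closed H D"
  unfolding even_on_closed_def
proof (intro allI impI, elim conjE)
  fix Y assume Y: "Y \<subseteq> V" "closed H Y"
  have "even (\<Sum>v\<in>Y. D v + (\<Sum>a\<in>out_arcs v. h a))"
    using D Y(1) by (intro dvd_sum) auto
  moreover have "(\<Sum>v\<in>Y. \<Sum>a\<in>out_arcs v. h a) = (\<Sum>a\<in>outs Y. h a)
      + (\<Sum>a\<in>{a \<in> A. tl a \<in> Y \<and> head a \<in> Y}. h a)"
    using sum_out_arcs[OF Y(1), of h] sum_tail_split[of h Y] by simp
  moreover have "(\<Sum>a\<in>outs Y. h a) = 0"
    using Y(2) h(2) by (intro sum.neutral) (auto simp: closed_def outs_def)
  moreover have "even (\<Sum>a\<in>{a \<in> A. tl a \<in> Y \<and> head a \<in> Y}. h a)"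
    by (rule sum_inner_sym_even) (rule h(1))
  ultimately show "even (\<Sum>v\<in>Y. D v)" by (simp add: sum.distrib)
qed

section \<open>Capacities\<close>

text \<open>Residual capacities of the zero flow; \<open>\<tau>\<close> and \<open>F\<close> bound the flow on the return arc from below and
  above when a flow is regarded as a circulation.\<close>

definition base :: "(int \<Rightarrow> int) \<Rightarrow> (int \<Rightarrow> int) \<Rightarrow> (int \<Rightarrow> int) \<Rightarrow> (int \<Rightarrow> int) \<Rightarrow> int \<Rightarrow> int \<Rightarrow> int \<Rightarrow> int" where
  "base fw bw spl dem \<tau> F a =
    (if a < m then fw a else if a < m + n then spl (a - m) else if a < ret then dem (a - m - n)
     else if a < M then - \<tau>
     else if a - M < m then bw (a - M) else if a - M < ret then 0 else F)"

lemma base_simps: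
  "e < m \<Longrightarrow> base fw bw spl dem \<tau> F e = fw e"
  "0 \<le> e \<Longrightarrow> e < m \<Longrightarrow> base fw bw spl dem \<tau> F (e + M) = bw e"
  "0 \<le> v \<Longrightarrow> v < n \<Longrightarrow> base fw bw spl dem \<tau> F (m + v) = spl v"
  "0 \<le> v \<Longrightarrow> v < n \<Longrightarrow> base fw bw spl dem \<tau> F (m + v + M) = 0"
  "0 \<le> v \<Longrightarrow> v < n \<Longrightarrow> base fw bw spl dem \<tau> F (m + n + v) = dem v"
  "0 \<le> v \<Longrightarrow> v < n \<Longrightarrow> base fw bw spl dem \<tau> F (m + n + v + M) = 0"
  "base fw bw spl dem \<tau> F (ret) = - \<tau>" "base fw bw spl dem \<tau> F (ret + M) = F"
  using n0 m0 M_def ret_def by (auto simp: base_def)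

lemma sum_outs:
  fixes g :: "int \<Rightarrow> int"
  shows "(\<Sum>a\<in>outs X. g a) =
     (\<Sum>e\<in>{0..<m}. (if us e \<in> X \<and> vs e \<notin> X then g e else 0) + (if vs e \<in> X \<and> us e \<notin> X then g (e + M) else 0)) +
     (\<Sum>v\<in>{0..<n}. (if n \<in> X \<and> v \<notin> X then g (m + v) else 0) + (if v \<in> X \<and> n \<notin> X then g (m + v + M) else 0)) +
     (\<Sum>v\<in>{0..<n}. (if v \<in> X \<and> n + 1 \<notin> X then g (m + n + v) else 0) + (if n + 1 \<in> X \<and> v \<notin> X then g (m + n + v + M) else 0)) +
     (if n \<in> X \<and> n + 1 \<notin> X then g (ret) else 0) + (if n + 1 \<in> X \<and> n \<notin> X then g (ret + M) else 0)"
proof -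
  have "(\<Sum>a\<in>outs X. g a) = (\<Sum>a\<in>A. if tl a \<in> X \<and> head a \<notin> X then g a else 0)"
    unfolding outs_def by (rule sum.inter_filter) simp
  then show ?thesis
    unfolding sum_arcs by (simp add: tl_simps head_simps cong: sum.cong_simp)
qed

lemma sum_out_arcs_at:
  fixes g :: "int \<Rightarrow> int"
  shows "(\<Sum>a\<in>out_arcs v. g a) =
     (\<Sum>e\<in>{0..<m}. (if us e = v then g e else 0) + (if vs e = v then g (e + M) else 0)) +
     (\<Sum>w\<in>{0..<n}. (if v = n then g (m + w) else 0) + (if w = v then g (m + w + M) else 0)) +
     (\<Sum>w\<in>{0..<n}. (if w = v then g (m + n + w) else 0) + (if v = n + 1 then g (m + n + w + M) else 0)) +
     (if v = n then g (ret) else 0) + (if v = n + 1 then g (ret + M) else 0)"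
proof -
  have "(\<Sum>a\<in>out_arcs v. g a) = (\<Sum>a\<in>A. if tl a = v then g a else 0)"
    unfolding out_arcs_def by (rule sum.inter_filter) simp
  then show ?thesis
    unfolding sum_arcs by (simp add: tl_simps eq_commute[of v] cong: sum.cong_simp)
qed

definition cut :: "(int \<Rightarrow> int) \<Rightarrow> int set \<Rightarrow> int" where
  "cut c X = (\<Sum>e\<in>{0..<m}. if (us e \<in> X) \<noteq> (vs e \<in> X) then c e else 0)"

lemma cut_Diff_V: "cut c (X \<inter> {0..<n}) = cut c X"
  unfolding cut_def using us vs by (intro sum.cong) auto

end

section \<open>Breadth-first search in linear time\<close>

section \<open>Graph search\<close>

notation Seq (infixr ";;" 60)

abbreviation (input) incr :: "nat \<Rightarrow> com" where
  "incr x \<equiv> Assign x (Plus (Reg x) (Num 1))"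

text \<open>Registers 0 to 8 hold the input, the number of vertices of the network, its number of edges and its
  number of arcs.  Arrays 3 to 6 hold the heads and the reversals of the arcs, the previous arc with
  the same tail (or -1), and the last arc leaving each vertex (or -1).  The search starts from the vertex
  in register 20; it uses arrays 7 (positions in the queue), 8 (parent arcs) and 9 (queue).\<close>

definition search_step :: "nat \<Rightarrow> com" where
  "search_step q =
     (Assign 25 (Elem 3 (Reg 24)) ;;
      If (And (Less (Num 0) (Elem q (Reg 24))) (Equal (Elem 7 (Reg 25)) (Num 0)))
        (Update 8 (Reg 25) (Reg 24) ;; Update 9 (Reg 22) (Reg 25) ;; incr 22 ;; Update 7 (Reg 25) (Reg 22))
        Skip ;;
      Assign 24 (Elem 5 (Reg 24)))"

definition search_scan :: "nat \<Rightarrow> com" where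
  "search_scan q =
     (Assign 23 (Elem 9 (Reg 21)) ;; Assign 24 (Elem 6 (Reg 23)) ;;
      While (Less (Num (-1)) (Reg 24)) (search_step q) ;; incr 21)"

definition search :: "nat \<Rightarrow> com" where
  "search q =
     (Assign 21 (Num 0) ;;
      While (Less (Reg 21) (Reg 6)) (Update 7 (Reg 21) (Num 0) ;; incr 21) ;;
      Update 7 (Reg 20) (Num 1) ;; Update 9 (Num 0) (Reg 20) ;; Assign 21 (Num 0) ;; Assign 22 (Num 1) ;;
      While (Less (Reg 21) (Reg 22)) (search_scan q))"

lemma written_search_step [simp]:
  "written_regs (search_step q) = {22, 24, 25}" "written_arrs (search_step q) = {7, 8, 9}"
  by (auto simp: search_step_def)

lemma written_search_scan [simp]:
  "written_regs (search_scan q) = {21, 22, 23, 24, 25}" "written_arrs (search_scan q) = {7, 8, 9}"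
  by (auto simp: search_scan_def)

lemma written_search [simp]:
  "written_regs (search q) = {21, 22, 23, 24, 25}" "written_arrs (search q) = {7, 8, 9}"
  by (auto simp: search_def)

context network
begin

lemma arc_bounds [simp]:
  assumes "0 \<le> a" "a < 2 * M"
  shows "0 \<le> tl a" "tl a < n + 2" "0 \<le> head a" "head a < n + 2" "0 \<le> rev_arc a" "rev_arc a < 2 * M"
    "tl (rev_arc a) = head a" "head (rev_arc a) = tl a" "rev_arc (rev_arc a) = a"
    "rev_arc a \<noteq> a" "a \<noteq> rev_arc a"
  using tailV[of a] headV[of a] rvA[of a] rv_rv[of a] rv_ne[of a] assms by (auto simp: head_def)

definition mem :: "store \<Rightarrow> bool" where
  "mem \<sigma> \<longleftrightarrow> regs \<sigma> 0 = n \<and> regs \<sigma> 1 = m \<and> regs \<sigma> 6 = n + 2 \<and> regs \<sigma> 7 = M \<and> regs \<sigma> 8 = 2 * M \<and>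
     (\<forall>a\<in>A. arrs \<sigma> 3 a = head a \<and> arrs \<sigma> 4 a = rev_arc a \<and> arrs \<sigma> 5 a = pred_arc (tl a) a) \<and>
     (\<forall>v\<in>V. arrs \<sigma> 6 v = pred_arc v (2 * M))"

lemma mem_cong:
  "mem \<sigma> \<Longrightarrow> regs \<tau> 0 = regs \<sigma> 0 \<Longrightarrow> regs \<tau> 1 = regs \<sigma> 1 \<Longrightarrow> regs \<tau> 6 = regs \<sigma> 6 \<Longrightarrow> regs \<tau> 7 = regs \<sigma> 7 \<Longrightarrow>
   regs \<tau> 8 = regs \<sigma> 8 \<Longrightarrow> arrs \<tau> 3 = arrs \<sigma> 3 \<Longrightarrow> arrs \<tau> 4 = arrs \<sigma> 4 \<Longrightarrow> arrs \<tau> 5 = arrs \<sigma> 5 \<Longrightarrow>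
   arrs \<tau> 6 = arrs \<sigma> 6 \<Longrightarrow> mem \<tau>"
  by (simp add: mem_def)

lemma memD:
  assumes "mem \<sigma>"
  shows "regs \<sigma> 0 = n" "regs \<sigma> (Suc 0) = m" "regs \<sigma> 6 = n + 2" "regs \<sigma> 7 = M" "regs \<sigma> 8 = 2 * M"
    "\<And>a. 0 \<le> a \<Longrightarrow> a < 2 * M \<Longrightarrow> arrs \<sigma> 3 a = head a" "\<And>a. 0 \<le> a \<Longrightarrow> a < 2 * M \<Longrightarrow> arrs \<sigma> 4 a = rev_arc a"
    "\<And>a. 0 \<le> a \<Longrightarrow> a < 2 * M \<Longrightarrow> arrs \<sigma> 5 a = pred_arc (tl a) a"
    "\<And>v. 0 \<le> v \<Longrightarrow> v < n + 2 \<Longrightarrow> arrs \<sigma> 6 v = pred_arc v (2 * M)"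
  using assms by (auto simp: mem_def)

text \<open>The first \<open>h\<close> vertices of the queue are finished, and \<open>v\<close> is
  being scanned with list pointer \<open>a\<close>; lists run downwards, so its scanned arcs lie
  above \<open>a\<close>. The values 0 and \<open>2 * M\<close> for \<open>v\<close> and
  \<open>a\<close> mean that no vertex is in progress, since no arc exceeds
  \<open>2 * M\<close>.\<close>

definition scanned :: "int \<Rightarrow> int \<Rightarrow> int \<Rightarrow> (int \<Rightarrow> int) \<Rightarrow> int set" where
  "scanned h v a rk = {b \<in> A. (0 < rk (tl b) \<and> rk (tl b) \<le> h) \<or> (tl b = v \<and> a < b)}"

definition search_inv ::
  "(int \<Rightarrow> int) \<Rightarrow> int \<Rightarrow> int \<Rightarrow> int \<Rightarrow> int \<Rightarrow> int \<Rightarrow> (int \<Rightarrow> int) \<Rightarrow> (int \<Rightarrow> int) \<Rightarrow> (int \<Rightarrow> int) \<Rightarrow> bool" where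
  "search_inv r x h sp v a rk par que \<longleftrightarrow>
     0 \<le> h \<and> h \<le> sp \<and> x \<in> V \<and> rk x = 1 \<and>
     (\<forall>i. 0 \<le> i \<and> i < sp \<longrightarrow> que i \<in> V \<and> rk (que i) = i + 1) \<and>
     (\<forall>w\<in>V. 0 \<le> rk w \<and> rk w \<le> sp \<and> (0 < rk w \<longrightarrow> que (rk w - 1) = w)) \<and>
     (\<forall>w\<in>V. 0 < rk w \<and> w \<noteq> x \<longrightarrow> par w \<in> A \<and> head (par w) = w \<and> 0 < r (par w) \<and>
        0 < rk (tl (par w)) \<and> rk (tl (par w)) < rk w) \<and>
     (\<forall>b\<in>scanned h v a rk. 0 < r b \<longrightarrow> 0 < rk (head b))"

text \<open>Each queue entry has its own position as rank, so the entries are distinct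
  vertices.\<close>

lemma search_inv_sp:
  assumes "search_inv r x h sp v a rk par que"
  shows "sp \<le> n + 2"
proof -
  have q: "que i \<in> V \<and> rk (que i) = i + 1" if "0 \<le> i" "i < sp" for i
    using assms that by (simp add: search_inv_def)
  have "card {0..<sp} \<le> card V"
  proof (rule card_inj_on_le)
    show "inj_on que {0..<sp}"
    proof (rule inj_onI)
      fix i j assume ij: "i \<in> {0..<sp}" "j \<in> {0..<sp}" "que i = que j"
      have "rk (que i) = i + 1" "rk (que j) = j + 1" using q[of i] q[of j] ij(1,2) by auto
      then show "i = j" unfolding ij(3) by simp
    qed
    show "que ` {0..<sp} \<subseteq> V" using q by auto
  qed simp
  then show ?thesis using n0 by simp
qed

lemma search_inv_queue:
  assumes "search_inv r x h sp v a rk par que" "w \<in> V" "rk w = i + 1" "0 \<le> i"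
  shows "que i = w"
proof -
  have "0 < rk w \<longrightarrow> que (rk w - 1) = w" using assms(1,2) unfolding search_inv_def by blast
  then show ?thesis using assms(3,4) by simp
qed

lemma search_inv_init:
  assumes "x \<in> V" "\<And>w. w \<in> V \<Longrightarrow> rk w = 0" "que 0 = x"
  shows "search_inv r x 0 1 0 (2 * M) (rk(x := 1)) par que"
proof -
  have "0 \<le> i \<and> i < 1 \<longleftrightarrow> i = 0" for i :: int by auto
  then show ?thesis using assms by (auto simp: search_inv_def scanned_def)
qed

lemma scanned_enter:
  "v \<in> V \<Longrightarrow> scanned h v (pred_arc v (2 * M)) rk = scanned h 0 (2 * M) rk"
  using pred_arc_max[of _ v "2 * M"] by (force simp: scanned_def)

lemma search_inv_enter:
  assumes "search_inv r x h sp 0 (2 * M) rk par que" "v \<in> V"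
  shows "search_inv r x h sp v (pred_arc v (2 * M)) rk par que"
  using assms by (simp add: search_inv_def scanned_enter)

lemma scanned_next:
  assumes "a \<in> A" "tl a = v"
  shows "scanned h v (pred_arc v a) rk = insert a (scanned h v a rk)"
proof -
  have lt: "pred_arc v a < a" using pred_arc_in[of v a] assms by auto
  have "pred_arc v a < b \<longleftrightarrow> b = a \<or> a < b" if "b \<in> A" "tl b = v" for b
    using pred_arc_step[OF that, of a] lt by auto
  then show ?thesis using assms unfolding scanned_def by blast
qed

lemma search_inv_skip:
  assumes "search_inv r x h sp v a rk par que" "a \<in> A" "tl a = v" "\<not> (0 < r a \<and> rk (head a) = 0)"
  shows "search_inv r x h sp v (pred_arc v a) rk par que"
proof -
  have "0 \<le> rk (head a)" using assms(1) headV[OF assms(2)] by (simp add: search_inv_def)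
  then have "0 < rk (head a)" if "0 < r a" using that assms(4) by linarith
  then show ?thesis using assms by (auto simp: search_inv_def scanned_next[OF assms(2,3)])
qed

text \<open>A newly reached vertex receives a rank beyond \<open>h\<close>, so its arcs do not yet
  count as scanned.\<close>

lemma scanned_visit:
  assumes "h < sp" "rk w = 0"
  shows "scanned h v a (rk(w := sp + 1)) = scanned h v a rk"
  using assms by (auto simp: scanned_def)

lemma search_inv_visit:
  assumes inv: "search_inv r x h sp v a rk par que" and a: "a \<in> A" "tl a = v" "0 < r a" "rk (head a) = 0"
    and v: "rk v = h + 1" "h < sp"
  shows "search_inv r x h (sp + 1) v (pred_arc v a) (rk(head a := sp + 1)) (par(head a := a)) (que(sp := head a))"
proof -
  let ?w = "head a"
  have w: "?w \<in> V" using a by simp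
  have c1: "0 \<le> h" "x \<in> V" "rk x = 1"
    and c2: "\<And>i. 0 \<le> i \<Longrightarrow> i < sp \<Longrightarrow> que i \<in> V \<and> rk (que i) = i + 1"
    and c3: "\<And>w. w \<in> V \<Longrightarrow> 0 \<le> rk w \<and> rk w \<le> sp \<and> (0 < rk w \<longrightarrow> que (rk w - 1) = w)"
    and c4: "\<And>w. w \<in> V \<Longrightarrow> 0 < rk w \<Longrightarrow> w \<noteq> x \<Longrightarrow> par w \<in> A \<and> head (par w) = w \<and> 0 < r (par w) \<and>
        0 < rk (tl (par w)) \<and> rk (tl (par w)) < rk w"
    and c5: "\<And>b. b \<in> scanned h v a rk \<Longrightarrow> 0 < r b \<Longrightarrow> 0 < rk (head b)"
    using inv by (auto simp: search_inv_def)
  have xw: "x \<noteq> ?w" "v \<noteq> ?w" using a c1 v by auto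
  have qw: "que i \<noteq> ?w" if "0 \<le> i" "i < sp" for i using c2[OF that] a that by auto
  show ?thesis
    unfolding search_inv_def scanned_next[OF a(1,2)] scanned_visit[of h sp rk ?w, OF v(2) a(4)]
  proof (intro conjI ballI allI impI)
    fix i assume "0 \<le> i \<and> i < sp + 1"
    then show "(que(sp := ?w)) i \<in> V" "(rk(?w := sp + 1)) ((que(sp := ?w)) i) = i + 1"
      using c2[of i] qw[of i] w by auto
  next
    fix u assume "u \<in> V"
    then show "0 \<le> (rk(?w := sp + 1)) u" "(rk(?w := sp + 1)) u \<le> sp + 1"
      using c3[of u] v c1 by auto
  next
    fix u assume "u \<in> V" "0 < (rk(?w := sp + 1)) u"
    then show "(que(sp := ?w)) ((rk(?w := sp + 1)) u - 1) = u"
      using c3[of u] by auto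
  next
    fix u assume u: "u \<in> V" "0 < (rk(?w := sp + 1)) u \<and> u \<noteq> x"
    show "(par(?w := a)) u \<in> A" "head ((par(?w := a)) u) = u" "0 < r ((par(?w := a)) u)"
      using u a c4[of u] by auto
    have "0 < (rk(?w := sp + 1)) (tl ((par(?w := a)) u)) \<and>
       (rk(?w := sp + 1)) (tl ((par(?w := a)) u)) < (rk(?w := sp + 1)) u"
    proof (cases "u = ?w")
      case True
      then show ?thesis using xw v c1 a by auto
    next
      case False
      then show ?thesis using u c4[of u] a(4) by auto
    qed
    then show "0 < (rk(?w := sp + 1)) (tl ((par(?w := a)) u))"
      "(rk(?w := sp + 1)) (tl ((par(?w := a)) u)) < (rk(?w := sp + 1)) u" by auto
  next
    fix b assume "b \<in> insert a (scanned h v a rk)" "0 < r b"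
    then show "0 < (rk(?w := sp + 1)) (head b)" using c5[of b] v c1 by auto
  qed (use c1 v xw in auto)
qed

text \<open>The vertex in progress is the only one of rank \<open>h + 1\<close>; exhausting its list
  amounts to advancing the head of the queue.\<close>

lemma scanned_exit:
  assumes "search_inv r x h sp v a rk par que" "v = que h" "h < sp"
  shows "scanned h v (-1) rk = scanned (h + 1) 0 (2 * M) rk"
proof -
  have v: "rk v = h + 1" "0 \<le> h" using assms by (auto simp: search_inv_def)
  have w: "w = v" if "w \<in> V" "rk w = h + 1" for w
    using search_inv_queue[OF assms(1) that v(2)] assms(2) by simp
  have "0 < rk (tl b) \<and> rk (tl b) \<le> h \<or> tl b = v \<and> -1 < b \<longleftrightarrow>
      0 < rk (tl b) \<and> rk (tl b) \<le> h + 1 \<or> tl b = 0 \<and> 2 * M < b" if b: "b \<in> A" for b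
  proof (cases "rk (tl b) = h + 1")
    case True
    then show ?thesis using w[OF tailV[OF b] True] v b by simp
  next
    case False
    then have "tl b \<noteq> v" using v by auto
    then show ?thesis using False b by auto
  qed
  then show ?thesis unfolding scanned_def by blast
qed

lemma search_inv_exit:
  assumes "search_inv r x h sp v (-1) rk par que" "v = que h" "h < sp"
  shows "search_inv r x (h + 1) sp 0 (2 * M) rk par que"
  using assms(1,3) unfolding search_inv_def scanned_exit[OF assms] by simp

lemma search_inv_final:
  assumes inv: "search_inv r x sp sp 0 (2 * M) rk par que"
  shows "search_tree r x rk par"
proof -
  have "closed r {v \<in> V. 0 < rk v}"
    unfolding closed_def
  proof
    fix b assume b: "b \<in> outs {v \<in> V. 0 < rk v}"
    then have bA: "b \<in> A" and t: "0 < rk (tl b)" and h: "\<not> 0 < rk (head b)"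
      using headV by (auto simp: outs_def)
    have "rk (tl b) \<le> sp" using inv tailV[OF bA] by (simp add: search_inv_def)
    then have "b \<in> scanned sp 0 (2 * M) rk" using bA t by (simp add: scanned_def)
    then show "r b \<le> 0" using inv h by (force simp: search_inv_def)
  qed
  moreover have "0 \<le> rk w \<and> rk w \<le> int (card V)" if "w \<in> V" for w
  proof -
    have "0 \<le> rk w \<and> rk w \<le> sp" using inv that unfolding search_inv_def by blast
    then show ?thesis using search_inv_sp[OF inv] card_V by linarith
  qed
  ultimately show ?thesis using inv unfolding search_tree_def search_inv_def by auto
qed

text \<open>The potential of the amortized analysis: over the whole search every arc is paid for
  once.\<close>

definition unscanned :: "int \<Rightarrow> int \<Rightarrow> int \<Rightarrow> (int \<Rightarrow> int) \<Rightarrow> int" where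
  "unscanned h v a rk = int (card (A - scanned h v a rk))"

lemma unscanned_next:
  assumes "a \<in> A" "tl a = v" "rk v = h + 1"
  shows "unscanned h v (pred_arc v a) rk = unscanned h v a rk - 1"
proof -
  have "A - scanned h v (pred_arc v a) rk = (A - scanned h v a rk) - {a}"
    unfolding scanned_next[OF assms(1,2)] by auto
  moreover have "a \<in> A - scanned h v a rk" using assms by (simp add: scanned_def)
  ultimately show ?thesis
    unfolding unscanned_def using card.remove[of "A - scanned h v a rk" a] by simp
qed

lemma unscanned_ge: "0 \<le> unscanned h v a rk"
  by (simp add: unscanned_def)

lemma unscanned_init: "unscanned 0 0 (2 * M) rk = 2 * M"
proof -
  have "scanned 0 0 (2 * M) rk = {}" by (auto simp: scanned_def)
  then show ?thesis using card_A by (simp add: unscanned_def)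
qed

definition search_cost :: int where
  "search_cost = 40 * (2 * M + n + 2) + 40"

lemma wp_search_step:
  assumes mem: "mem \<sigma>" and q: "q \<notin> {3, 4, 5, 6, 7, 8, 9}"
    and inv: "search_inv (arrs \<sigma> q) x (regs \<sigma> 21) (regs \<sigma> 22) (regs \<sigma> 23) (regs \<sigma> 24) (arrs \<sigma> 7) (arrs \<sigma> 8) (arrs \<sigma> 9)"
    and a: "regs \<sigma> 24 \<in> A" "tl (regs \<sigma> 24) = regs \<sigma> 23"
    and v: "arrs \<sigma> 7 (regs \<sigma> 23) = regs \<sigma> 21 + 1" "regs \<sigma> 21 < regs \<sigma> 22"
    and post: "\<And>\<tau> k'. agree (search_step q) \<sigma> \<tau> \<Longrightarrow>
       search_inv (arrs \<sigma> q) x (regs \<sigma> 21) (regs \<tau> 22) (regs \<sigma> 23) (regs \<tau> 24) (arrs \<tau> 7) (arrs \<tau> 8) (arrs \<tau> 9) \<Longrightarrow>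
       arrs \<tau> 7 (regs \<sigma> 23) = regs \<sigma> 21 + 1 \<Longrightarrow> regs \<sigma> 21 < regs \<tau> 22 \<Longrightarrow>
       regs \<tau> 24 = pred_arc (regs \<sigma> 23) (regs \<sigma> 24) \<Longrightarrow>
       unscanned (regs \<sigma> 21) (regs \<sigma> 23) (regs \<tau> 24) (arrs \<tau> 7) =
         unscanned (regs \<sigma> 21) (regs \<sigma> 23) (regs \<sigma> 24) (arrs \<sigma> 7) - 1 \<Longrightarrow>
       k - 29 \<le> k' \<Longrightarrow> Q \<tau> k'"
  shows "wp (search_step q) Q \<sigma> k"
proof -
  note m = memD[OF mem]
  have q': "q \<noteq> 3" "q \<noteq> 4" "q \<noteq> 5" "q \<noteq> 6" "q \<noteq> 7" "q \<noteq> 8" "q \<noteq> 9" using q by auto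
  have vw: "regs \<sigma> 23 \<noteq> head (regs \<sigma> 24)" if "arrs \<sigma> 7 (head (regs \<sigma> 24)) = 0"
    using that v inv by (auto simp: search_inv_def)
  note un = unscanned_next[of "regs \<sigma> 24" "regs \<sigma> 23" "arrs \<sigma> 7" "regs \<sigma> 21", OF a v(1)]
  have un': "unscanned (regs \<sigma> 21) (regs \<sigma> 23) b ((arrs \<sigma> 7)(head (regs \<sigma> 24) := regs \<sigma> 22 + 1))
      = unscanned (regs \<sigma> 21) (regs \<sigma> 23) b (arrs \<sigma> 7)"
    if "arrs \<sigma> 7 (head (regs \<sigma> 24)) = 0" for b
    using scanned_visit[OF v(2), of "arrs \<sigma> 7" "head (regs \<sigma> 24)"] that by (simp add: unscanned_def)
  have "wp (search_step q) (\<lambda>\<tau> k'. 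
       search_inv (arrs \<sigma> q) x (regs \<sigma> 21) (regs \<tau> 22) (regs \<sigma> 23) (regs \<tau> 24) (arrs \<tau> 7) (arrs \<tau> 8) (arrs \<tau> 9) \<and>
       arrs \<tau> 7 (regs \<sigma> 23) = regs \<sigma> 21 + 1 \<and> regs \<sigma> 21 < regs \<tau> 22 \<and>
       regs \<tau> 24 = pred_arc (regs \<sigma> 23) (regs \<sigma> 24) \<and>
       unscanned (regs \<sigma> 21) (regs \<sigma> 23) (regs \<tau> 24) (arrs \<tau> 7) =
         unscanned (regs \<sigma> 21) (regs \<sigma> 23) (regs \<sigma> 24) (arrs \<sigma> 7) - 1 \<and>
       k - 29 \<le> k') \<sigma> k"
    unfolding search_step_def
    using a v q' search_inv_skip[OF inv a] search_inv_visit[OF inv a _ _ v] vw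
    by (auto simp: m un un')
  then show ?thesis by (rule wp_agree) (use post in auto)
qed

text \<open>The credit is bounded relative to the potential, so the outer loop pays only a constant
  for each vertex taken from the queue.\<close>

lemma wp_search_scan:
  assumes mem: "mem \<sigma>" and q: "q \<notin> {3, 4, 5, 6, 7, 8, 9}"
    and inv: "search_inv (arrs \<sigma> q) x (regs \<sigma> 21) (regs \<sigma> 22) 0 (2 * M) (arrs \<sigma> 7) (arrs \<sigma> 8) (arrs \<sigma> 9)"
    and h: "regs \<sigma> 21 < regs \<sigma> 22"
    and k: "40 * unscanned (regs \<sigma> 21) 0 (2 * M) (arrs \<sigma> 7) + 20 \<le> k"
    and post: "\<And>\<tau> k'. agree (search_scan q) \<sigma> \<tau> \<Longrightarrow>
       search_inv (arrs \<sigma> q) x (regs \<tau> 21) (regs \<tau> 22) 0 (2 * M) (arrs \<tau> 7) (arrs \<tau> 8) (arrs \<tau> 9) \<Longrightarrow>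
       regs \<tau> 21 = regs \<sigma> 21 + 1 \<Longrightarrow>
       k - 40 * unscanned (regs \<sigma> 21) 0 (2 * M) (arrs \<sigma> 7) - 16 \<le> k' - 40 * unscanned (regs \<tau> 21) 0 (2 * M) (arrs \<tau> 7) \<Longrightarrow>
       Q \<tau> k'"
  shows "wp (search_scan q) Q \<sigma> k"
proof -
  note m = memD[OF mem]
  define h v where "h = regs \<sigma> 21" and "v = arrs \<sigma> 9 (regs \<sigma> 21)"
  have v: "v \<in> V" "arrs \<sigma> 7 v = h + 1" using inv h by (auto simp: search_inv_def h_def v_def)
  define k0 where "k0 = k - 40 * unscanned h 0 (2 * M) (arrs \<sigma> 7) - 6"
  let ?I = "\<lambda>\<tau> k'. search_inv (arrs \<sigma> q) x h (regs \<tau> 22) v (regs \<tau> 24) (arrs \<tau> 7) (arrs \<tau> 8) (arrs \<tau> 9) \<and>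
     arrs \<tau> 7 v = h + 1 \<and> h < regs \<tau> 22 \<and> (regs \<tau> 24 = -1 \<or> regs \<tau> 24 \<in> A \<and> tl (regs \<tau> 24) = v) \<and>
     arrs \<tau> 9 h = v \<and>
     k0 + 40 * unscanned h v (regs \<tau> 24) (arrs \<tau> 7) \<le> k'"
  have "wp (search_scan q) (\<lambda>\<tau> k'.
       search_inv (arrs \<sigma> q) x (regs \<tau> 21) (regs \<tau> 22) 0 (2 * M) (arrs \<tau> 7) (arrs \<tau> 8) (arrs \<tau> 9) \<and>
       regs \<tau> 21 = regs \<sigma> 21 + 1 \<and>
       k - 40 * unscanned (regs \<sigma> 21) 0 (2 * M) (arrs \<sigma> 7) - 16 \<le> k' - 40 * unscanned (regs \<tau> 21) 0 (2 * M) (arrs \<tau> 7)) \<sigma> k"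
    unfolding search_scan_def wp_Seq wp_Assign
    apply (rule wp_While[where I = ?I])
  proof goal_cases
    case 1
    have "arrs \<sigma> 6 v = pred_arc v (2 * M)" "arrs \<sigma> 9 h = v" using v m by (simp_all add: h_def v_def)
    then show ?case
      using search_inv_enter[OF inv v(1)] v h pred_arc_in[of v "2 * M"] scanned_enter[OF v(1)]
      by (auto simp: h_def[symmetric] k0_def unscanned_def)
  next
    case (2 \<sigma>' k')
    then show ?case using k unscanned_ge[of h v "regs \<sigma>' 24" "arrs \<sigma>' 7"] by (auto simp: k0_def h_def)
  next
    case (3 \<sigma>' k')
    have ag: "arrs \<sigma>' a = arrs \<sigma> a" if "a \<notin> {7, 8, 9}" for a using agree_arrs[OF 3(2), of a] that by simp
    have rg: "regs \<sigma>' b = ((regs \<sigma>)(23 := v, 24 := arrs \<sigma> 6 v)) b" if "b \<notin> {22, 24, 25}" for b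
      using agree_regs[OF 3(2), of b] that by (simp add: v_def)
    have mem': "mem \<sigma>'" by (rule mem_cong[OF mem]) (simp_all add: ag rg)
    have qq: "arrs \<sigma>' q = arrs \<sigma> q" using q by (intro ag) auto
    have r': "regs \<sigma>' 21 = h" "regs \<sigma>' 23 = v" by (simp_all add: rg h_def)
    have a': "regs \<sigma>' 24 \<in> A" "tl (regs \<sigma>' 24) = v" using 3(1,3) by auto
    show ?case
    proof (rule wp_search_step[OF mem' q, where x = x], goal_cases)
      case (6 \<tau> k'')
      have "arrs \<tau> 9 h = v"
        using search_inv_queue[OF 6(2), of v h] 6(3) v(1) inv unfolding r' search_inv_def
        by (simp add: h_def)
      then show ?case using 6 3(1) pred_arc_in[of v "regs \<sigma>' 24"] unfolding r' qq by auto
    qed (use 3(1) a' in \<open>simp_all add: r' qq\<close>)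
  next
    case (4 \<sigma>' k')
    have rg: "regs \<sigma>' 21 = h" using agree_regs[OF 4(2), of 21] by (simp add: h_def)
    have a': "regs \<sigma>' 24 = -1" using 4(1,3) by auto
    have inv': "search_inv (arrs \<sigma> q) x h (regs \<sigma>' 22) v (-1) (arrs \<sigma>' 7) (arrs \<sigma>' 8) (arrs \<sigma>' 9)"
      using 4(1) a' by simp
    have vq: "v = arrs \<sigma>' 9 h" "h < regs \<sigma>' 22" using 4(1) by auto
    show ?case
      using search_inv_exit[OF inv' vq] scanned_exit[OF inv' vq] 4(1) a'
      by (simp add: rg unscanned_def k0_def h_def[symmetric])
  qed
  then show ?thesis by (rule wp_agree) (use post in auto)
qed

lemma wp_search:
  assumes mem: "mem \<sigma>" and x: "regs \<sigma> 20 \<in> V" and q: "q \<notin> {3, 4, 5, 6, 7, 8, 9}"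
  shows "wp (search q) (\<lambda>\<tau> k. search_tree (arrs \<sigma> q) (regs \<sigma> 20) (arrs \<tau> 7) (arrs \<tau> 8) \<and> 0 \<le> k) \<sigma> search_cost"
proof -
  note m = memD[OF mem]
  let ?I1 = "\<lambda>\<tau> k. 0 \<le> regs \<tau> 21 \<and> regs \<tau> 21 \<le> n + 2 \<and> (\<forall>v. 0 \<le> v \<and> v < regs \<tau> 21 \<longrightarrow> arrs \<tau> 7 v = 0) \<and>
    12 * (n + 2 - regs \<tau> 21) + 80 * M + 20 * (n + 2) + 30 \<le> k"
  let ?I2 = "\<lambda>\<tau> k. search_inv (arrs \<sigma> q) (regs \<sigma> 20) (regs \<tau> 21) (regs \<tau> 22) 0 (2 * M) (arrs \<tau> 7) (arrs \<tau> 8) (arrs \<tau> 9) \<and>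
    40 * unscanned (regs \<tau> 21) 0 (2 * M) (arrs \<tau> 7) + 20 * (n + 2 - regs \<tau> 21) + 5 \<le> k"
  show ?thesis
    unfolding search_def wp_Seq wp_Assign
    apply (rule wp_While[where I = ?I1])
  proof goal_cases
    case 1 then show ?case using n0 by (simp add: search_cost_def)
  next
    case (2 \<sigma>' k') then show ?case using n0 M_pos by simp
  next
    case (3 \<sigma>' k')
    have "regs \<sigma>' 6 = n + 2" using agree_regs[OF 3(2), of 6] m by simp
    then show ?case using 3 by (auto simp: m)
  next
    case (4 \<sigma>1 k1)
    have r4: "regs \<sigma>1 b = regs \<sigma> b" if "b \<noteq> 21" for b using agree_regs[OF 4(2), of b] that by simp
    have a4: "arrs \<sigma>1 b = arrs \<sigma> b" if "b \<noteq> 7" for b using agree_arrs[OF 4(2), of b] that by simp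
    have q4: "arrs \<sigma>1 q = arrs \<sigma> q" using q by (intro a4) auto
    have "regs \<sigma>1 21 = n + 2" using 4(1,3) r4 m by auto
    then have z: "\<And>w. w \<in> V \<Longrightarrow> arrs \<sigma>1 7 w = 0" and k1: "80 * M + 20 * (n + 2) + 30 \<le> k1"
      using 4(1) by auto
    show ?case
      unfolding wp_Update wp_Assign
      apply (rule wp_While[where I = ?I2])
    proof goal_cases
      case 1
      show ?case
        using search_inv_init[OF x, where rk = "arrs \<sigma>1 7" and que = "(arrs \<sigma>1 9)(0 := regs \<sigma> 20)" and r = "arrs \<sigma> q" and par = "arrs \<sigma>1 8"] z k1
        by (simp add: r4 unscanned_init)
    next
      case (2 \<sigma>' k')
      then show ?case
        using search_inv_sp[of "arrs \<sigma> q" "regs \<sigma> 20"] unscanned_ge[of "regs \<sigma>' 21" 0 "2 * M" "arrs \<sigma>' 7"] by fastforce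
    next
      case (3 \<sigma>' k')
      have ag: "arrs \<sigma>' a = arrs \<sigma> a" if "a \<notin> {7, 8, 9}" for a
        using agree_arrs[OF 3(2), of a] that a4[of a] by simp
      have rg: "regs \<sigma>' b = regs \<sigma> b" if "b \<notin> {21, 22, 23, 24, 25}" for b
        using agree_regs[OF 3(2), of b] that r4[of b] by simp
      have mem': "mem \<sigma>'" by (rule mem_cong[OF mem]) (simp_all add: ag rg)
      have qq: "arrs \<sigma>' q = arrs \<sigma> q" using q by (intro ag) auto
      have lt: "regs \<sigma>' 21 < regs \<sigma>' 22" using 3 by simp
      have "regs \<sigma>' 22 \<le> n + 2" using 3(1) search_inv_sp by blast
      with lt have lt': "regs \<sigma>' 21 < n + 2" by simp
      show ?case
      proof (rule wp_search_scan[OF mem' q, where x = "regs \<sigma> 20"], goal_cases)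
        case (4 \<tau> k'')
        then show ?case using 3(1) unfolding qq by auto
      qed (use 3(1) lt lt' in \<open>simp_all add: qq\<close>)
    next
      case (4 \<sigma>' k')
      then have "regs \<sigma>' 21 = regs \<sigma>' 22" by (auto simp: search_inv_def)
      moreover have "regs \<sigma>' 22 \<le> n + 2" using 4(1) search_inv_sp by blast
      ultimately show ?case using 4(1) search_inv_final unscanned_ge[of "regs \<sigma>' 21" 0 "2 * M" "arrs \<sigma>' 7"]
        by auto
    qed
  qed
qed

end

section \<open>Push-relabel in rounds: O(n^3 + n m) time\<close>

section \<open>Maximum flows\<close>

lemma sum_change:
  fixes f f' :: "'a \<Rightarrow> int"
  assumes "finite S" "v \<in> S" "\<And>w. w \<in> S \<Longrightarrow> w \<noteq> v \<Longrightarrow> f' w = f w"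
  shows "sum f' S = sum f S + (f' v - f v)"
proof -
  have "sum f' (S - {v}) = sum f (S - {v})" using assms by (intro sum.cong) auto
  then show ?thesis using assms(1,2) by (simp add: sum.remove[of S v])
qed

text \<open>Push-relabel in rounds over all vertices.  Array \<open>q\<close> holds the residual capacities, arrays 10 to 12
  the excesses, the labels and the current arcs.\<close>

definition push_arc :: "nat \<Rightarrow> com" where
  "push_arc q =
     (Update q (Reg 31) (Minus (Elem q (Reg 31)) (Reg 33)) ;; Assign 35 (Elem 4 (Reg 31)) ;;
      Update q (Reg 35) (Plus (Elem q (Reg 35)) (Reg 33)) ;;
      Update 10 (Reg 30) (Minus (Elem 10 (Reg 30)) (Reg 33)) ;;
      Update 10 (Reg 32) (Plus (Elem 10 (Reg 32)) (Reg 33)))"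

definition saturate_step :: "nat \<Rightarrow> com" where
  "saturate_step q =
     (Assign 32 (Elem 3 (Reg 31)) ;; Assign 33 (Elem q (Reg 31)) ;; push_arc q ;;
      Assign 31 (Elem 5 (Reg 31)))"

definition flow_init :: "nat \<Rightarrow> com" where
  "flow_init q =
     (Assign 30 (Num 0) ;;
      While (Less (Reg 30) (Reg 6))
        (Update 10 (Reg 30) (Num 0) ;; Update 11 (Reg 30) (Num 0) ;;
         Update 12 (Reg 30) (Elem 6 (Reg 30)) ;; incr 30) ;;
      Update 11 (Reg 0) (Reg 6) ;; Assign 30 (Reg 0) ;; Assign 31 (Elem 6 (Reg 0)) ;;
      While (Less (Num (-1)) (Reg 31)) (saturate_step q))"

text \<open>A relabeling raises the label by one and restarts the list. No minimum over the
  neighbours is computed, and each list is still scanned at most \<open>2 * (n + 2) + 1\<close>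
  times.\<close>

definition discharge_step :: "nat \<Rightarrow> com" where
  "discharge_step q =
     (Assign 31 (Elem 12 (Reg 30)) ;;
      If (Less (Reg 31) (Num 0))
        (Update 11 (Reg 30) (Plus (Elem 11 (Reg 30)) (Num 1)) ;; Update 12 (Reg 30) (Elem 6 (Reg 30)))
        (Assign 32 (Elem 3 (Reg 31)) ;;
         If (And (Less (Num 0) (Elem q (Reg 31)))
                 (Equal (Elem 11 (Reg 30)) (Plus (Elem 11 (Reg 32)) (Num 1))))
           (If (Less (Elem 10 (Reg 30)) (Elem q (Reg 31)))
              (Assign 33 (Elem 10 (Reg 30)) ;; push_arc q)
              (Assign 33 (Elem q (Reg 31)) ;; push_arc q ;; Update 12 (Reg 30) (Elem 5 (Reg 31))))
           (Update 12 (Reg 30) (Elem 5 (Reg 31)))))"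

text \<open>Register 34 records whether some vertex of the round was active; a round without one
  ends the computation.\<close>

definition discharge :: "nat \<Rightarrow> com" where
  "discharge q =
     (If (Less (Num 0) (Elem 10 (Reg 30)))
        (Assign 34 (Num 1) ;; While (Less (Num 0) (Elem 10 (Reg 30))) (discharge_step q))
        Skip ;;
      incr 30)"

definition flow_round :: "nat \<Rightarrow> com" where
  "flow_round q =
     (Assign 34 (Num 0) ;; Assign 30 (Num 0) ;; While (Less (Reg 30) (Reg 0)) (discharge q))"

definition maxflow :: "nat \<Rightarrow> com" where
  "maxflow q = (flow_init q ;; Assign 34 (Num 1) ;; While (Equal (Reg 34) (Num 1)) (flow_round q))"

lemma written_push_arc [simp]:
  "written_regs (push_arc q) = {35}" "written_arrs (push_arc q) = {q, 10}"
  by (auto simp: push_arc_def)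

lemma written_saturate_step [simp]:
  "written_regs (saturate_step q) = {31, 32, 33, 35}" "written_arrs (saturate_step q) = {q, 10}"
  by (auto simp: saturate_step_def)

lemma written_flow_init [simp]:
  "written_regs (flow_init q) = {30, 31, 32, 33, 35}" "written_arrs (flow_init q) = {q, 10, 11, 12}"
  by (auto simp: flow_init_def)

lemma written_discharge_step [simp]:
  "written_regs (discharge_step q) = {31, 32, 33, 35}"
  "written_arrs (discharge_step q) = {q, 10, 11, 12}"
  by (auto simp: discharge_step_def)

lemma written_discharge [simp]:
  "written_regs (discharge q) = {30, 31, 32, 33, 34, 35}"
  "written_arrs (discharge q) = {q, 10, 11, 12}"
  by (auto simp: discharge_def)

lemma written_flow_round [simp]:
  "written_regs (flow_round q) = {30, 31, 32, 33, 34, 35}"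
  "written_arrs (flow_round q) = {q, 10, 11, 12}"
  by (auto simp: flow_round_def)

lemma written_maxflow [simp]:
  "written_regs (maxflow q) = {30, 31, 32, 33, 34, 35}"
  "written_arrs (maxflow q) = {q, 10, 11, 12}"
  by (auto simp: maxflow_def)

context network
begin

text \<open>Ensures that a push out of the source updates two different entries of the excess
  array.\<close>

lemma source_no_loop: "0 \<le> a \<Longrightarrow> a < 2 * M \<Longrightarrow> tl a = n \<Longrightarrow> head a \<noteq> n"
  using us[of a] us[of "a - M"] vs[of a] vs[of "a - M"] n0 m0
  by (auto simp: tl_def head_def rev_arc_def M_def ret_def split: if_splits)

text \<open>The current-arc rule: an arc above the pointer was passed as inadmissible and remains so
  until its tail is relabeled.\<close>

definition cur_ok :: "(int \<Rightarrow> int) \<Rightarrow> (int \<Rightarrow> int) \<Rightarrow> (int \<Rightarrow> int) \<Rightarrow> int \<Rightarrow> bool" where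
  "cur_ok r d cur v \<longleftrightarrow> (cur v = -1 \<or> cur v \<in> A \<and> tl (cur v) = v) \<and>
     (\<forall>b\<in>A. tl b = v \<and> cur v < b \<and> 0 < r b \<longrightarrow> d v \<le> d (head b))"

definition preflow ::
  "(int \<Rightarrow> int) \<Rightarrow> (int \<Rightarrow> int) \<Rightarrow> (int \<Rightarrow> int) \<Rightarrow> (int \<Rightarrow> int) \<Rightarrow> (int \<Rightarrow> int) \<Rightarrow> bool" where
  "preflow r0 r E d cur \<longleftrightarrow>
     residual r0 r \<and> (\<forall>v\<in>V. E v = excess r0 r v) \<and> (\<forall>v\<in>V. v \<noteq> n \<longrightarrow> 0 \<le> E v) \<and>
     valid_labels r d \<and> d n = n + 2 \<and> d (n + 1) = 0 \<and>
     (\<forall>v\<in>{0..<n}. 0 \<le> d v \<and> d v \<le> 2 * (n + 2)) \<and> (\<forall>v\<in>{0..<n}. cur_ok r d cur v)"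

text \<open>The number of relabelings that \<open>active_label_bound\<close> still permits; the
  network has \<open>n + 2\<close> vertices.\<close>

definition budget :: "(int \<Rightarrow> int) \<Rightarrow> int" where
  "budget d = (\<Sum>v\<in>{0..<n}. 2 * (n + 2) - d v)"

text \<open>Bounds the discharge steps to come, nonsaturating pushes apart: each remaining
  relabeling pays for itself and for one pass through the list, and the rest of the current list is
  paid separately.\<close>

definition work :: "(int \<Rightarrow> int) \<Rightarrow> (int \<Rightarrow> int) \<Rightarrow> int" where
  "work d cur = (\<Sum>v\<in>{0..<n}. (2 * (n + 2) - d v) * (int (card (out_arcs v)) + 1) + int (card (arcs_upto v (cur v))))"

text \<open>Within a round that started with budget \<open>B0\<close> and active labels below \<open>\<phi>\<close>, active labels exceed \<open>\<phi>\<close> at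
  most by the number of relabelings; without relabelings, vertices that have been processed can
  become active again only below the maximal label.\<close>

definition in_round :: "int \<Rightarrow> int \<Rightarrow> int \<Rightarrow> (int \<Rightarrow> int) \<Rightarrow> (int \<Rightarrow> int) \<Rightarrow> bool" where
  "in_round \<phi> B0 v E d \<longleftrightarrow> budget d \<le> B0 \<and>
     (\<forall>w\<in>{0..<n}. 0 < E w \<longrightarrow> d w + 1 \<le> \<phi> + (B0 - budget d)) \<and>
     (budget d = B0 \<longrightarrow> (\<forall>w\<in>{0..<n}. 0 < E w \<and> w < v \<longrightarrow> d w + 2 \<le> \<phi>))"

lemma preflow_work_nonneg:
  assumes "preflow r0 r E d cur"
  shows "0 \<le> work d cur" "0 \<le> budget d"
  using assms unfolding work_def budget_def preflow_def by (auto intro!: sum_nonneg)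

lemma preflow_advance:
  assumes p: "preflow r0 r E d cur" and v: "v \<in> {0..<n}" and a: "a = cur v" "a \<noteq> -1"
    and na: "0 < r a \<longrightarrow> d v \<le> d (head a)"
  shows "preflow r0 r E d (cur(v := pred_arc v a))" and "work d (cur(v := pred_arc v a)) = work d cur - 1"
proof -
  have c: "cur_ok r d cur w" if "w \<in> {0..<n}" for w using p that by (simp add: preflow_def)
  have aA: "a \<in> A" "tl a = v" using c[OF v] a by (auto simp: cur_ok_def)
  have "cur_ok r d (cur(v := pred_arc v a)) w" if w: "w \<in> {0..<n}" for w
  proof (cases "w = v")
    case False then show ?thesis using c[OF w] by (simp add: cur_ok_def)
  next
    case True
    have "d v \<le> d (head b)" if b: "b \<in> A" "tl b = v" "pred_arc v a < b" "0 < r b" for b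
    proof (cases "b = a")
      case True then show ?thesis using na b by simp
    next
      case False
      then have "a < b" using pred_arc_step[OF b(1,2,3)] by simp
      then show ?thesis using c[OF v] b a by (simp add: cur_ok_def)
    qed
    then show ?thesis using True pred_arc_in[of v a] by (auto simp: cur_ok_def)
  qed
  then show "preflow r0 r E d (cur(v := pred_arc v a))" using p unfolding preflow_def by blast
  show "work d (cur(v := pred_arc v a)) = work d cur - 1"
    unfolding work_def using v card_arcs_upto_next[OF aA] a
    by (subst sum_change[where v = v]) auto
qed

lemma budget_relabel:
  "v \<in> {0..<n} \<Longrightarrow> budget (d(v := d v + 1)) = budget d - 1"
  unfolding budget_def by (subst sum_change[where v = v]) auto

text \<open>An exhausted list means that no residual arc leads to a smaller label, which is what
  raising the label by one requires; as \<open>v\<close> is active, the label also stays within the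
  budget.\<close>

lemma preflow_relabel:
  assumes p: "preflow r0 r E d cur" and v: "v \<in> {0..<n}" "0 < E v" and c1: "cur v = -1"
    and r0: "\<forall>a\<in>A. 0 \<le> r0 a"
  shows "preflow r0 r E (d(v := d v + 1)) (cur(v := pred_arc v (2 * M)))"
    and "work (d(v := d v + 1)) (cur(v := pred_arc v (2 * M))) = work d cur - 1"
proof -
  let ?d = "d(v := d v + 1)" and ?cur = "cur(v := pred_arc v (2 * M))"
  have p': "residual r0 r" "\<forall>v\<in>V. E v = excess r0 r v" "\<forall>v\<in>V. v \<noteq> n \<longrightarrow> 0 \<le> E v"
    "valid_labels r d" "d n = n + 2" "\<forall>v\<in>{0..<n}. 0 \<le> d v \<and> d v \<le> 2 * (n + 2)"
    and c: "\<forall>v\<in>{0..<n}. cur_ok r d cur v"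
    using p by (auto simp: preflow_def)
  have "d v < 2 * int (card V)"
    by (rule active_label_bound[OF p'(1,4) r0, of n]) (use p' v n0 in auto)
  then have dv: "d v < 2 * (n + 2)" using card_V by simp
  have val: "valid_labels r ?d"
    unfolding valid_labels_def
  proof (intro ballI impI)
    fix b assume b: "b \<in> A" "0 < r b"
    have l: "d (tl b) \<le> d (head b) + 1" using p'(4) b by (simp add: valid_labels_def)
    have l': "d v \<le> d (head b)" if "tl b = v"
    proof -
      have "cur_ok r d cur v" using c v by blast
      then show ?thesis using that b c1 unfolding cur_ok_def by auto
    qed
    then show "?d (tl b) \<le> ?d (head b) + 1" using l by auto
  qed
  have "cur_ok r ?d ?cur w" if w: "w \<in> {0..<n}" for w
  proof (cases "w = v")
    case True
    have "\<not> pred_arc v (2 * M) < b" if "b \<in> A" "tl b = v" for b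
      using pred_arc_max[of b v "2 * M"] that by auto
    then show ?thesis using True pred_arc_in[of v "2 * M"] unfolding cur_ok_def by (metis fun_upd_same)
  next
    case False
    have "cur_ok r d cur w" using c w by blast
    then show ?thesis using False unfolding cur_ok_def by fastforce
  qed
  then show "preflow r0 r E ?d ?cur" using p dv v val n0 by (auto simp: preflow_def)
  \<comment> \<open>The relabeling releases the degree plus one: the degree refills the list, and
    one unit is left over.\<close>
  have "arcs_upto v (pred_arc v (2 * M)) = out_arcs v" by (rule arcs_upto_first)
  then show "work ?d ?cur = work d cur - 1"
    unfolding work_def using v c1
    by (subst sum_change[where v = v and f = "\<lambda>v. (2 * (n + 2) - d v) * (int (card (out_arcs v)) + 1)
      + int (card (arcs_upto v (cur v)))"]) (auto simp: algebra_simps)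
qed

text \<open>Only the reversed arc can become residual, and it leads one label upwards, so neither
  labels nor list pointers are invalidated.\<close>

lemma preflow_push:
  assumes p: "preflow r0 r E d cur" and v: "v \<in> {0..<n}" and a: "a \<in> A" "tl a = v" "0 < r a"
    and adm: "d v = d (head a) + 1" and \<delta>: "0 \<le> \<delta>" "\<delta> \<le> r a" "\<delta> \<le> E v"
  shows "preflow r0 (push a \<delta> r) (E(v := E v - \<delta>, head a := E (head a) + \<delta>)) d cur"
proof -
  have vw: "v \<noteq> head a" using adm by auto
  have p': "residual r0 r" "\<And>v. v \<in> V \<Longrightarrow> E v = excess r0 r v" "\<And>v. v \<in> V \<Longrightarrow> v \<noteq> n \<Longrightarrow> 0 \<le> E v"
    "valid_labels r d" "d n = n + 2" "d (n + 1) = 0" "\<forall>v\<in>{0..<n}. 0 \<le> d v \<and> d v \<le> 2 * (n + 2)"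
    and c: "\<And>v. v \<in> {0..<n} \<Longrightarrow> cur_ok r d cur v"
    using p by (auto simp: preflow_def)
  let ?E = "E(v := E v - \<delta>, head a := E (head a) + \<delta>)" and ?r = "push a \<delta> r"
  have pos: "0 < r b \<or> b = rev_arc a" if "b \<in> A" "0 < ?r b" for b
    using that a \<delta> by (auto simp: push_apply split: if_splits)
  have "residual r0 ?r" by (rule residual_push) (use p' a \<delta> in auto)
  moreover have "?E u = excess r0 ?r u" if "u \<in> V" for u
    using p'(2)[OF that] p'(2)[of v] p'(2)[of "head a"] v a vw that
    by (auto simp: excess_push)
  moreover have "0 \<le> ?E u" if "u \<in> V" "u \<noteq> n" for u
    using p'(3)[OF that] \<delta> by auto
  moreover have "valid_labels ?r d"
    unfolding valid_labels_def
  proof (intro ballI impI)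
    fix b assume b: "b \<in> A" "0 < ?r b"
    then show "d (tl b) \<le> d (head b) + 1"
      using pos[OF b] p'(4) a adm by (auto simp: valid_labels_def)
  qed
  moreover have "cur_ok ?r d cur u" if u: "u \<in> {0..<n}" for u
    unfolding cur_ok_def
  proof (intro conjI ballI impI)
    show "cur u = -1 \<or> cur u \<in> A \<and> tl (cur u) = u" using c[OF u] by (simp add: cur_ok_def)
    fix b assume b: "b \<in> A" "tl b = u \<and> cur u < b \<and> 0 < ?r b"
    from pos[OF b(1)] b(2) have "0 < r b \<or> b = rev_arc a" by blast
    then show "d u \<le> d (head b)"
    proof
      assume "0 < r b" then show ?thesis using c[OF u] b by (simp add: cur_ok_def)
    next
      assume "b = rev_arc a" then show ?thesis using b a adm by auto
    qed
  qed
  ultimately show ?thesis using p' by (simp add: preflow_def)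
qed

text \<open>The receiver lies one label below an active vertex. Hence a vertex already processed in
  this round may become active again without violating the stricter bound.\<close>

lemma in_round_push:
  assumes "in_round \<phi> B0 v E d" "v \<in> {0..<n}" "0 < E v" "d v = d w + 1" "0 \<le> \<delta>"
  shows "in_round \<phi> B0 v (E(v := E v - \<delta>, w := E w + \<delta>)) d"
proof -
  have "d v + 1 \<le> \<phi> + (B0 - budget d)" using assms(1,2,3) unfolding in_round_def by blast
  then have w: "d w + 2 \<le> \<phi> + (B0 - budget d)" using assms(4) by simp
  have 1: "budget d \<le> B0" "\<And>u. u \<in> {0..<n} \<Longrightarrow> 0 < E u \<Longrightarrow> d u + 1 \<le> \<phi> + (B0 - budget d)"
    "\<And>u. budget d = B0 \<Longrightarrow> u \<in> {0..<n} \<Longrightarrow> 0 < E u \<Longrightarrow> u < v \<Longrightarrow> d u + 2 \<le> \<phi>"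
    using assms(1) by (auto simp: in_round_def)
  show ?thesis
    unfolding in_round_def
  proof (intro conjI ballI impI)
    fix u assume u: "u \<in> {0..<n}" "0 < (E(v := E v - \<delta>, w := E w + \<delta>)) u"
    show "d u + 1 \<le> \<phi> + (B0 - budget d)"
      using 1(2)[OF u(1)] u(2) w assms(3,5) by (auto split: if_splits)
  next
    fix u assume u: "budget d = B0" "u \<in> {0..<n}" "0 < (E(v := E v - \<delta>, w := E w + \<delta>)) u \<and> u < v"
    show "d u + 2 \<le> \<phi>"
      using 1(3)[OF u(1,2)] u w by (auto split: if_splits)
  qed (rule 1(1))
qed

text \<open>Each unit taken from the budget raises the general bound by one, which covers the new
  label; the stricter clause becomes vacuous.\<close>

lemma in_round_relabel:
  assumes "in_round \<phi> B0 v E d" "v \<in> {0..<n}"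
  shows "in_round \<phi> B0 v E (d(v := d v + 1))"
  using assms by (force simp: in_round_def budget_relabel)

lemma wp_push_arc:
  assumes mem: "mem \<sigma>" and q: "q \<notin> {3, 4, 5, 6, 10, 11, 12}" and a: "regs \<sigma> 31 \<in> A"
    and w: "regs \<sigma> 32 = head (regs \<sigma> 31)" "regs \<sigma> 30 \<noteq> head (regs \<sigma> 31)"
  shows "wp (push_arc q) (\<lambda>\<tau> k'. (arrs \<tau> q = push (regs \<sigma> 31) (regs \<sigma> 33) (arrs \<sigma> q) \<and>
       arrs \<tau> 10 = (arrs \<sigma> 10)(regs \<sigma> 30 := arrs \<sigma> 10 (regs \<sigma> 30) - regs \<sigma> 33,
         head (regs \<sigma> 31) := arrs \<sigma> 10 (head (regs \<sigma> 31)) + regs \<sigma> 33)) \<and> 0 \<le> k') \<sigma> 29"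
  using q a w by (auto simp: push_arc_def push_def memD[OF mem])

text \<open>The \<open>of_bool\<close> term accounts for the nonsaturating push, which saves no work
  but ends the activity of the vertex and thereby the inner loop.\<close>

lemma wp_discharge_step:
  assumes mem: "mem \<sigma>" and q: "q \<notin> {3, 4, 5, 6, 10, 11, 12}" and v: "regs \<sigma> 30 \<in> {0..<n}"
    and p: "preflow r0 (arrs \<sigma> q) (arrs \<sigma> 10) (arrs \<sigma> 11) (arrs \<sigma> 12)" and r0: "\<forall>a\<in>A. 0 \<le> r0 a"
    and ir: "in_round \<phi> B0 (regs \<sigma> 30) (arrs \<sigma> 10) (arrs \<sigma> 11)" and ex: "0 < arrs \<sigma> 10 (regs \<sigma> 30)"
  shows "wp (discharge_step q) (\<lambda>\<tau> k'.
      (preflow r0 (arrs \<tau> q) (arrs \<tau> 10) (arrs \<tau> 11) (arrs \<tau> 12) \<and>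
       in_round \<phi> B0 (regs \<sigma> 30) (arrs \<tau> 10) (arrs \<tau> 11) \<and>
       budget (arrs \<tau> 11) \<le> budget (arrs \<sigma> 11) \<and>
       work (arrs \<tau> 11) (arrs \<tau> 12) + of_bool (0 < arrs \<tau> 10 (regs \<sigma> 30)) \<le> work (arrs \<sigma> 11) (arrs \<sigma> 12)) \<and>
      0 \<le> k') \<sigma> 70"
proof -
  note m = memD[OF mem]
  have q': "q \<noteq> 3" "q \<noteq> 4" "q \<noteq> 5" "q \<noteq> 6" "q \<noteq> 10" "q \<noteq> 11" "q \<noteq> 12" using q by auto
  define v where "v = regs \<sigma> 30"
  define a where "a = arrs \<sigma> 12 v"
  have v': "v \<in> {0..<n}" "0 < arrs \<sigma> 10 v" using v ex by (auto simp: v_def)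
  then have v'': "0 \<le> v" "v < n" "v < n + 2" by auto
  have co: "cur_ok (arrs \<sigma> q) (arrs \<sigma> 11) (arrs \<sigma> 12) v" using p v' by (simp add: preflow_def)
  note rel = preflow_relabel[OF p v' _ r0] in_round_relabel[OF ir[folded v_def] v'(1)] budget_relabel[OF v'(1)]
  show ?thesis
  proof (cases "a = -1")
    case True
    then show ?thesis
      using rel v'' q' by (auto simp: discharge_step_def v_def[symmetric] a_def m)
  next
    case False
    then have aA: "a \<in> A" "tl a = v" using co by (auto simp: cur_ok_def a_def)
    then have a0: "0 \<le> a" "a < 2 * M" by auto
    let ?adm = "0 < arrs \<sigma> q a \<and> arrs \<sigma> 11 v = arrs \<sigma> 11 (head a) + 1"
    show ?thesis
    proof (cases ?adm)
      case na: False
      have "0 < arrs \<sigma> q a \<longrightarrow> arrs \<sigma> 11 v \<le> arrs \<sigma> 11 (head a) + 1"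
        using p aA by (auto simp: preflow_def valid_labels_def)
      then have na': "0 < arrs \<sigma> q a \<longrightarrow> arrs \<sigma> 11 v \<le> arrs \<sigma> 11 (head a)" using na by auto
      show ?thesis
        using preflow_advance[OF p v'(1) a_def False na'] na v'' a0 q' aA ir v'(2)
        by (auto simp: discharge_step_def v_def[symmetric] a_def[symmetric] m)
    next
      case adm: True
      have vw: "v \<noteq> head a" using adm by auto
      define \<delta> where "\<delta> = (if arrs \<sigma> 10 v < arrs \<sigma> q a then arrs \<sigma> 10 v else arrs \<sigma> q a)"
      have \<delta>: "0 \<le> \<delta>" "\<delta> \<le> arrs \<sigma> q a" "\<delta> \<le> arrs \<sigma> 10 v" using adm v' by (auto simp: \<delta>_def)
      let ?r = "push a \<delta> (arrs \<sigma> q)"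
      let ?E = "(arrs \<sigma> 10)(v := arrs \<sigma> 10 v - \<delta>, head a := arrs \<sigma> 10 (head a) + \<delta>)"
      have P: "preflow r0 ?r ?E (arrs \<sigma> 11) (arrs \<sigma> 12)"
        by (rule preflow_push[OF p v'(1) aA _ _ \<delta>]) (use adm in auto)
      have R: "in_round \<phi> B0 v ?E (arrs \<sigma> 11)"
        by (rule in_round_push) (use ir v' adm \<delta> in \<open>auto simp: v_def\<close>)
      show ?thesis
      proof (cases "arrs \<sigma> 10 v < arrs \<sigma> q a")
        case True
        then have d: "\<delta> = arrs \<sigma> 10 v" by (simp add: \<delta>_def)
        have E0: "?E v = 0" using d vw by simp
        show ?thesis
          unfolding discharge_step_def
          using True adm a0 False v''
          apply (simp add: v_def[symmetric] a_def[symmetric] m)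
          apply (rule wp_spec[OF wp_push_arc])
               apply (use a0 vw q in \<open>auto simp: m d v_def intro: mem_cong[OF mem]\<close>)[5]
          subgoal for \<tau> k'
            using P R E0 agree_arrs[of "push_arc q" _ \<tau> 11] agree_arrs[of "push_arc q" _ \<tau> 12] q'
            by (simp add: v_def[symmetric] d m)
          done
      next
        case nl: False
        then have d: "\<delta> = arrs \<sigma> q a" by (simp add: \<delta>_def)
        have r0': "?r a = 0" using a0 d by (simp add: push_apply)
        note adv = preflow_advance[OF P v'(1) a_def False]
        show ?thesis
          unfolding discharge_step_def
          using nl adm a0 False v''
          apply (simp add: v_def[symmetric] a_def[symmetric] m)
          apply (rule wp_spec[OF wp_push_arc])
              apply (use a0 vw q in \<open>auto simp: m d v_def intro: mem_cong[OF mem]\<close>)[5]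
          subgoal for \<tau> k'
            using adv r0' R agree_arrs[of "push_arc q" _ \<tau> 11] agree_arrs[of "push_arc q" _ \<tau> 12]
              agree_arrs[of "push_arc q" _ \<tau> 5] agree_regs[of "push_arc q" _ \<tau> 30]
              agree_regs[of "push_arc q" _ \<tau> 31] q' a0 aA
            by (simp add: v_def[symmetric] a_def[symmetric] d m)
          done
      qed
    qed
  qed
qed

lemma wp_discharge:
  assumes mem: "mem \<sigma>" and q: "q \<notin> {3, 4, 5, 6, 10, 11, 12}" and v: "regs \<sigma> 30 \<in> {0..<n}"
    and p: "preflow r0 (arrs \<sigma> q) (arrs \<sigma> 10) (arrs \<sigma> 11) (arrs \<sigma> 12)" and r0: "\<forall>a\<in>A. 0 \<le> r0 a"
    and ir: "in_round \<phi> B0 (regs \<sigma> 30) (arrs \<sigma> 10) (arrs \<sigma> 11)"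
    and k: "80 * work (arrs \<sigma> 11) (arrs \<sigma> 12) + 100 \<le> k"
  shows "wp (discharge q) (\<lambda>\<tau> k'.
      preflow r0 (arrs \<tau> q) (arrs \<tau> 10) (arrs \<tau> 11) (arrs \<tau> 12) \<and>
      in_round \<phi> B0 (regs \<sigma> 30 + 1) (arrs \<tau> 10) (arrs \<tau> 11) \<and>
      budget (arrs \<tau> 11) \<le> budget (arrs \<sigma> 11) \<and> regs \<tau> 30 = regs \<sigma> 30 + 1 \<and>
      (if 0 < arrs \<sigma> 10 (regs \<sigma> 30) then regs \<tau> 34 = 1 \<and> 1 \<le> \<phi> + (B0 - budget (arrs \<tau> 11))
       else regs \<tau> 34 = regs \<sigma> 34 \<and> arrs \<tau> = arrs \<sigma>) \<and>
      k - 80 * work (arrs \<sigma> 11) (arrs \<sigma> 12) + 80 * work (arrs \<tau> 11) (arrs \<tau> 12) - 100 \<le> k') \<sigma> k"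
proof (cases "0 < arrs \<sigma> 10 (regs \<sigma> 30)")
  case False
  have "in_round \<phi> B0 (regs \<sigma> 30 + 1) (arrs \<sigma> 10) (arrs \<sigma> 11)"
    unfolding in_round_def
  proof (intro conjI ballI impI)
    fix w assume "budget (arrs \<sigma> 11) = B0" "w \<in> {0..<n}" "0 < arrs \<sigma> 10 w \<and> w < regs \<sigma> 30 + 1"
    moreover from this False have "w < regs \<sigma> 30" by (cases "w = regs \<sigma> 30") auto
    ultimately show "arrs \<sigma> 11 w + 2 \<le> \<phi>" using ir unfolding in_round_def by blast
  qed (use ir in \<open>auto simp: in_round_def\<close>)
  then show ?thesis using False p by (simp add: discharge_def)
next
  case True
  define v where "v = regs \<sigma> 30"
  define W where "W = work (arrs \<sigma> 11) (arrs \<sigma> 12)"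
  let ?I = "\<lambda>\<tau> k'. preflow r0 (arrs \<tau> q) (arrs \<tau> 10) (arrs \<tau> 11) (arrs \<tau> 12) \<and>
      in_round \<phi> B0 v (arrs \<tau> 10) (arrs \<tau> 11) \<and>
      budget (arrs \<tau> 11) \<le> budget (arrs \<sigma> 11) \<and>
      k - 80 * W - 87 + 80 * (work (arrs \<tau> 11) (arrs \<tau> 12) + of_bool (0 < arrs \<tau> 10 v)) \<le> k'"
  \<comment> \<open>Labels are nonnegative, so an active vertex keeps the bound positive; this makes
    the bound for the next round nonnegative.\<close>
  have lab: "1 \<le> \<phi> + (B0 - budget (arrs \<sigma> 11))"
  proof -
    have "0 \<le> arrs \<sigma> 11 (regs \<sigma> 30)" using p v unfolding preflow_def by blast
    moreover have "arrs \<sigma> 11 (regs \<sigma> 30) + 1 \<le> \<phi> + (B0 - budget (arrs \<sigma> 11))"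
      using ir v True unfolding in_round_def by blast
    ultimately show ?thesis by simp
  qed
  show ?thesis
    unfolding discharge_def wp_Seq wp_If
  proof (intro conjI impI, goal_cases)
    case 1
    show ?case
      unfolding wp_Assign
      apply (rule wp_While[where I = ?I])
    proof goal_cases
      case 1
      then show ?case using p ir True by (simp add: v_def W_def)
    next
      case (2 \<sigma>' k')
      then show ?case using k preflow_work_nonneg(1)[of r0 "arrs \<sigma>' q" "arrs \<sigma>' 10" "arrs \<sigma>' 11" "arrs \<sigma>' 12"]
        by (cases "0 < arrs \<sigma>' 10 v") (auto simp: W_def)
    next
      case (3 \<sigma>' k')
      have r30: "regs \<sigma>' 30 = v" using agree_regs[OF 3(2), of 30] by (simp add: v_def)
      have mem': "mem \<sigma>'"
        by (rule mem_cong[OF mem]) (use q in \<open>simp_all add: agree_regs[OF 3(2)] agree_arrs[OF 3(2)]\<close>)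
      have act: "0 < arrs \<sigma>' 10 v" using 3(3) r30 by simp
      show ?case
        apply (rule wp_spec[OF wp_discharge_step[OF mem' q, where ?r0.0 = r0 and \<phi> = \<phi> and ?B0.0 = B0]])
             apply (use 3(1) r30 v act r0 in \<open>auto simp: v_def\<close>)[5]
        using 3(1) act by (auto simp: r30)
    next
      case (4 \<sigma>' k')
      have r30: "regs \<sigma>' 30 = v" "regs \<sigma>' 34 = 1"
        using agree_regs[OF 4(2), of 30] agree_regs[OF 4(2), of 34] by (simp_all add: v_def)
      have z: "\<not> 0 < arrs \<sigma>' 10 v" using 4(3) r30 by simp
      have I: "in_round \<phi> B0 v (arrs \<sigma>' 10) (arrs \<sigma>' 11)" using 4(1) by blast
      have "in_round \<phi> B0 (v + 1) (arrs \<sigma>' 10) (arrs \<sigma>' 11)"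
        unfolding in_round_def
      proof (intro conjI ballI impI)
        fix w assume "budget (arrs \<sigma>' 11) = B0" "w \<in> {0..<n}" "0 < arrs \<sigma>' 10 w \<and> w < v + 1"
        moreover from this z have "w < v" by (cases "w = v") auto
        ultimately show "arrs \<sigma>' 11 w + 2 \<le> \<phi>" using I unfolding in_round_def by blast
      qed (use I in \<open>auto simp: in_round_def\<close>)
      then show ?case using 4(1) r30 z True lab by (auto simp: v_def W_def)
    qed
  qed (use True in simp)
qed

definition label_bound :: "int \<Rightarrow> (int \<Rightarrow> int) \<Rightarrow> (int \<Rightarrow> int) \<Rightarrow> bool" where
  "label_bound \<phi> E d \<longleftrightarrow> 0 \<le> \<phi> \<and> (\<forall>w\<in>{0..<n}. 0 < E w \<longrightarrow> d w + 1 \<le> \<phi>)"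

text \<open>Without relabelings the largest active label drops, so \<phi> decreases by one. With r
  relabelings \<phi> grows by at most r while twice the budget drops by 2r. In both cases the sum
  decreases, which bounds the number of rounds.\<close>

lemma wp_flow_round:
  assumes mem: "mem \<sigma>" and q: "q \<notin> {3, 4, 5, 6, 10, 11, 12}"
    and p: "preflow r0 (arrs \<sigma> q) (arrs \<sigma> 10) (arrs \<sigma> 11) (arrs \<sigma> 12)" and r0: "\<forall>a\<in>A. 0 \<le> r0 a"
    and lb: "label_bound \<phi> (arrs \<sigma> 10) (arrs \<sigma> 11)"
    and k: "80 * work (arrs \<sigma> 11) (arrs \<sigma> 12) + 110 * n + 30 \<le> k"
  shows "wp (flow_round q) (\<lambda>\<tau> k'.
      preflow r0 (arrs \<tau> q) (arrs \<tau> 10) (arrs \<tau> 11) (arrs \<tau> 12) \<and>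
      (regs \<tau> 34 = 0 \<and> (\<forall>w\<in>{0..<n}. arrs \<tau> 10 w \<le> 0) \<or>
       regs \<tau> 34 = 1 \<and> (\<exists>\<phi>'. label_bound \<phi>' (arrs \<tau> 10) (arrs \<tau> 11) \<and>
           \<phi>' + 2 * budget (arrs \<tau> 11) \<le> \<phi> + 2 * budget (arrs \<sigma> 11) - 1)) \<and>
      k - 80 * work (arrs \<sigma> 11) (arrs \<sigma> 12) + 80 * work (arrs \<tau> 11) (arrs \<tau> 12) - 110 * n - 30 \<le> k') \<sigma> k"
proof -
  note m = memD[OF mem]
  define B0 W where "B0 = budget (arrs \<sigma> 11)" and "W = work (arrs \<sigma> 11) (arrs \<sigma> 12)"
  let ?I = "\<lambda>\<tau> k'. preflow r0 (arrs \<tau> q) (arrs \<tau> 10) (arrs \<tau> 11) (arrs \<tau> 12) \<and>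
      0 \<le> regs \<tau> 30 \<and> regs \<tau> 30 \<le> n \<and>
      in_round \<phi> B0 (regs \<tau> 30) (arrs \<tau> 10) (arrs \<tau> 11) \<and>
      (regs \<tau> 34 = 0 \<and> (\<forall>w\<in>{0..<regs \<tau> 30}. arrs \<tau> 10 w \<le> 0) \<or>
       regs \<tau> 34 = 1 \<and> 1 \<le> \<phi> + (B0 - budget (arrs \<tau> 11))) \<and>
      k - 80 * W + 80 * work (arrs \<tau> 11) (arrs \<tau> 12) + 110 * (n - regs \<tau> 30) - 110 * n - 10 \<le> k'"
  show ?thesis
    unfolding flow_round_def wp_Seq wp_Assign
    apply (rule wp_While[where I = ?I])
  proof goal_cases
    case 1
    then show ?case using p lb n0 by (auto simp: in_round_def label_bound_def B0_def W_def)
  next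
    case (2 \<sigma>' k')
    then show ?case using k preflow_work_nonneg(1)[of r0 "arrs \<sigma>' q" "arrs \<sigma>' 10" "arrs \<sigma>' 11" "arrs \<sigma>' 12"]
      by (auto simp: W_def)
  next
    case (3 \<sigma>' k')
    have mem': "mem \<sigma>'"
      by (rule mem_cong[OF mem]) (use q in \<open>simp_all add: agree_regs[OF 3(2)] agree_arrs[OF 3(2)]\<close>)
    have lt: "regs \<sigma>' 30 < n" using 3(3) memD(1)[OF mem'] by simp
    have k': "80 * work (arrs \<sigma>' 11) (arrs \<sigma>' 12) + 100 \<le> k' - 1 - int (bcost (Less (Reg 30) (Reg 0)))"
      using 3(1) lt k by (simp add: W_def)
    show ?case
      apply (rule wp_agree[OF wp_discharge[OF mem' q _ _ r0, where \<phi> = \<phi> and ?B0.0 = B0]])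
           apply (use 3(1) lt k' in auto)[4]
      subgoal premises prems for \<tau> k''
      proof -
        have e: "{0..<regs \<sigma>' 30 + 1} = insert (regs \<sigma>' 30) {0..<regs \<sigma>' 30}" using 3(1) by auto
        show ?thesis
        proof (cases "0 < arrs \<sigma>' 10 (regs \<sigma>' 30)")
          case True
          then show ?thesis using prems(1) 3(1) lt by auto
        next
          case False
          then show ?thesis using prems(1) 3(1) lt e by auto
        qed
      qed
      done
  next
    case (4 \<sigma>' k')
    have r0': "regs \<sigma>' 0 = n" using agree_regs[OF 4(2), of 0] m by simp
    then have r30: "regs \<sigma>' 30 = n" using 4(1,3) by simp
    have ir: "in_round \<phi> B0 n (arrs \<sigma>' 10) (arrs \<sigma>' 11)" using 4(1) r30 by simp
    have "\<exists>\<phi>'. label_bound \<phi>' (arrs \<sigma>' 10) (arrs \<sigma>' 11) \<and> \<phi>' + 2 * budget (arrs \<sigma>' 11) \<le> \<phi> + 2 * B0 - 1"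
      if c: "1 \<le> \<phi> + (B0 - budget (arrs \<sigma>' 11))"
    proof (cases "budget (arrs \<sigma>' 11) = B0")
      case True
      then have "\<forall>w\<in>{0..<n}. 0 < arrs \<sigma>' 10 w \<longrightarrow> arrs \<sigma>' 11 w + 1 \<le> \<phi> - 1"
        using ir by (force simp: in_round_def)
      then show ?thesis using True c by (intro exI[of _ "\<phi> - 1"]) (auto simp: label_bound_def)
    next
      case False
      then have "budget (arrs \<sigma>' 11) < B0" using ir by (simp add: in_round_def)
      then show ?thesis using c ir
        by (intro exI[of _ "\<phi> + (B0 - budget (arrs \<sigma>' 11))"]) (auto simp: label_bound_def in_round_def)
    qed
    then show ?case using 4(1) r30 by (auto simp: B0_def W_def)
  qed
qed

text \<open>The state while the arcs out of the source are saturated one after the other, from the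
  top of its list down to the pointer \<open>a\<close>.\<close>

definition saturating :: "(int \<Rightarrow> int) \<Rightarrow> (int \<Rightarrow> int) \<Rightarrow> (int \<Rightarrow> int) \<Rightarrow> int \<Rightarrow> bool" where
  "saturating r0 r E a \<longleftrightarrow>
     residual r0 r \<and> (\<forall>v\<in>V. E v = excess r0 r v) \<and> (\<forall>v\<in>V. v \<noteq> n \<longrightarrow> 0 \<le> E v) \<and>
     (\<forall>b\<in>A. tl b = n \<and> a < b \<longrightarrow> r b = 0) \<and> (a = -1 \<or> a \<in> A \<and> tl a = n)"

lemma saturating_start:
  assumes "\<forall>a\<in>A. 0 \<le> r0 a" "\<And>v. v \<in> V \<Longrightarrow> E v = 0"
  shows "saturating r0 r0 E (pred_arc n (2 * M))"
proof -
  have "\<not> pred_arc n (2 * M) < b" if "b \<in> A" "tl b = n" for b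
    using pred_arc_max[of b n "2 * M"] that by auto
  moreover have "residual r0 r0" using assms(1) by (simp add: residual_def)
  moreover have "\<forall>v\<in>V. E v = excess r0 r0 v" "\<forall>v\<in>V. v \<noteq> n \<longrightarrow> 0 \<le> E v"
    using assms(2) by (simp_all add: excess_def)
  ultimately show ?thesis using pred_arc_in[of n "2 * M"] unfolding saturating_def by blast
qed

lemma saturating_step:
  assumes s: "saturating r0 r E a" and a: "a \<noteq> -1"
  shows "saturating r0 (push a (r a) r) (E(n := E n - r a, head a := E (head a) + r a)) (pred_arc n a)"
proof -
  have aA: "a \<in> A" "tl a = n" using s a by (auto simp: saturating_def)
  have nh: "head a \<noteq> n" using source_no_loop aA by auto
  have res: "residual r0 r" and E: "\<And>v. v \<in> V \<Longrightarrow> E v = excess r0 r v" "\<And>v. v \<in> V \<Longrightarrow> v \<noteq> n \<Longrightarrow> 0 \<le> E v"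
    and z: "\<And>b. b \<in> A \<Longrightarrow> tl b = n \<Longrightarrow> a < b \<Longrightarrow> r b = 0"
    using s unfolding saturating_def by blast+
  have ra: "0 \<le> r a" using res aA by (auto simp: residual_def)
  let ?r = "push a (r a) r"
  have "?r b = 0" if b: "b \<in> A" "tl b = n" "pred_arc n a < b" for b
  proof -
    have "b \<noteq> rev_arc a" using b nh aA by auto
    moreover have "b = a \<or> a < b" using pred_arc_step[OF b] by blast
    ultimately show ?thesis using z[OF b(1,2)] aA b by (auto simp: push_apply)
  qed
  moreover have "residual r0 ?r" using residual_push[OF res aA(1) ra] by simp
  moreover have "(E(n := E n - r a, head a := E (head a) + r a)) u = excess r0 ?r u" if "u \<in> V" for u
    using E(1)[OF that] E(1)[of n] E(1)[of "head a"] aA n0 nh by (auto simp: excess_push)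
  moreover have "0 \<le> (E(n := E n - r a, head a := E (head a) + r a)) u" if "u \<in> V" "u \<noteq> n" for u
    using E(2)[OF that] ra that by auto
  ultimately show ?thesis using pred_arc_in[of n a] by (simp add: saturating_def) blast
qed

lemma saturating_preflow:
  assumes s: "saturating r0 r E (-1)" and d: "\<And>v. v \<in> V \<Longrightarrow> d v = (if v = n then n + 2 else 0)"
    and cur: "\<And>v. v \<in> V \<Longrightarrow> cur v = pred_arc v (2 * M)"
  shows "preflow r0 r E d cur"
proof -
  have "cur_ok r d cur v" if "v \<in> {0..<n}" for v
  proof -
    have v: "v \<in> V" using that by auto
    have "\<not> pred_arc v (2 * M) < b" if "b \<in> A" "tl b = v" for b
      using pred_arc_max[of b v "2 * M"] that by auto
    then show ?thesis using pred_arc_in[of v "2 * M"] unfolding cur_ok_def cur[OF v] by blast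
  qed
  moreover have "valid_labels r d"
    unfolding valid_labels_def
  proof (intro ballI impI)
    fix b assume b: "b \<in> A" "0 < r b"
    then have "tl b \<noteq> n" using s by (auto simp: saturating_def)
    then show "d (tl b) \<le> d (head b) + 1" using d[OF tailV[OF b(1)]] d[OF headV[OF b(1)]] n0 by auto
  qed
  moreover have "d n = n + 2" "d (n + 1) = 0" "\<forall>v\<in>{0..<n}. 0 \<le> d v \<and> d v \<le> 2 * (n + 2)"
    using d n0 by auto
  ultimately show ?thesis using s unfolding preflow_def saturating_def by blast
qed

lemma wp_flow_init:
  assumes mem: "mem \<sigma>" and q: "q \<notin> {3, 4, 5, 6, 10, 11, 12}" and r0: "\<forall>a\<in>A. 0 \<le> arrs \<sigma> q a"
  shows "wp (flow_init q) (\<lambda>\<tau> k'. (preflow (arrs \<sigma> q) (arrs \<tau> q) (arrs \<tau> 10) (arrs \<tau> 11) (arrs \<tau> 12) \<and>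
      (\<forall>v\<in>{0..<n}. arrs \<tau> 11 v = 0)) \<and> 0 \<le> k') \<sigma> (20 * (n + 2) + 90 * M + 30)"
proof -
  note m = memD[OF mem]
  let ?I1 = "\<lambda>\<tau> k. 0 \<le> regs \<tau> 30 \<and> regs \<tau> 30 \<le> n + 2 \<and>
    (\<forall>v. 0 \<le> v \<and> v < regs \<tau> 30 \<longrightarrow> arrs \<tau> 10 v = 0 \<and> arrs \<tau> 11 v = 0 \<and> arrs \<tau> 12 v = pred_arc v (2 * M)) \<and>
    20 * (n + 2 - regs \<tau> 30) + 90 * M + 28 \<le> k"
  let ?I2 = "\<lambda>\<tau> k. saturating (arrs \<sigma> q) (arrs \<tau> q) (arrs \<tau> 10) (regs \<tau> 31) \<and>
    45 * int (card (arcs_upto n (regs \<tau> 31))) + 8 \<le> k"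
  have q': "q \<noteq> 3" "q \<noteq> 4" "q \<noteq> 5" "q \<noteq> 6" "q \<noteq> 10" "q \<noteq> 11" "q \<noteq> 12" using q by auto
  show ?thesis
    unfolding flow_init_def wp_Seq wp_Assign
    apply (rule wp_While[where I = ?I1])
  proof goal_cases
    case 1 then show ?case using n0 by simp
  next
    case (2 \<sigma>' k') then show ?case using n0 M_pos by simp
  next
    case (3 \<sigma>' k')
    have "regs \<sigma>' 6 = n + 2" using agree_regs[OF 3(2), of 6] m by simp
    moreover have "arrs \<sigma>' 6 = arrs \<sigma> 6" using agree_arrs[OF 3(2), of 6] by simp
    ultimately show ?case using 3 by (auto simp: m)
  next
    case (4 \<sigma>1 k1)
    have r4: "regs \<sigma>1 b = regs \<sigma> b" if "b \<noteq> 30" for b using agree_regs[OF 4(2), of b] that by simp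
    have a4: "arrs \<sigma>1 b = arrs \<sigma> b" if "b \<notin> {10, 11, 12}" for b
      using agree_arrs[OF 4(2), of b] that by simp
    have q4: "arrs \<sigma>1 q = arrs \<sigma> q" using q by (intro a4) auto
    have m4: "regs \<sigma>1 0 = n" "regs \<sigma>1 6 = n + 2" "arrs \<sigma>1 6 n = pred_arc n (2 * M)"
      using r4 a4 m n0 by auto
    have "regs \<sigma>1 30 = n + 2" using 4(1,3) m4 by auto
    then have z: "\<And>w. w \<in> V \<Longrightarrow> arrs \<sigma>1 10 w = 0" "\<And>w. w \<in> V \<Longrightarrow> arrs \<sigma>1 11 w = 0"
       "\<And>w. w \<in> V \<Longrightarrow> arrs \<sigma>1 12 w = pred_arc w (2 * M)" and k1: "90 * M + 28 \<le> k1"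
      using 4(1) by auto
    show ?case
      unfolding wp_Update wp_Assign
      apply (rule wp_While[where I = ?I2])
    proof goal_cases
      case 1
      have "card (out_arcs n) \<le> card A" by (rule card_mono) (auto simp: out_arcs_def)
      then have "int (card (out_arcs n)) \<le> 2 * M" using card_A by linarith
      then show ?case
        using saturating_start[OF r0 z(1)] k1 q' by (simp add: m4 q4 arcs_upto_first)
    next
      case (2 \<sigma>' k') then show ?case by simp
    next
      case (3 \<sigma>' k')
      have ag: "arrs \<sigma>' a = arrs \<sigma> a" if "a \<notin> {q, 10, 11, 12}" for a
        using agree_arrs[OF 3(2), of a] that a4[of a] by simp
      have rg: "regs \<sigma>' b = regs \<sigma> b" if "b \<notin> {30, 31, 32, 33, 35}" for b
        using agree_regs[OF 3(2), of b] that r4[of b] by simp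
      have mem': "mem \<sigma>'" by (rule mem_cong[OF mem]) (use q' in \<open>simp_all add: ag rg\<close>)
      have r30: "regs \<sigma>' 30 = n" using agree_regs[OF 3(2), of 30] m4 by simp
      define a where "a = regs \<sigma>' 31"
      have s: "saturating (arrs \<sigma> q) (arrs \<sigma>' q) (arrs \<sigma>' 10) a" and an: "a \<noteq> -1"
        using 3(1,3) by (auto simp: a_def)
      then have aA: "a \<in> A" "tl a = n" by (auto simp: saturating_def)
      then have a0: "0 \<le> a" "a < 2 * M" "n \<noteq> head a" using source_no_loop[of a] by auto
      note m' = memD[OF mem']
      show ?case
        unfolding saturate_step_def wp_Seq wp_Assign
        apply (rule wp_spec[OF wp_push_arc[OF _ q]])
        subgoal by (rule mem_cong[OF mem']) simp_all
        subgoal using a0 by (simp add: a_def[symmetric])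
        subgoal using a0 by (simp add: m' a_def[symmetric])
        subgoal using a0 by (simp add: r30 a_def[symmetric])
        subgoal for \<tau> k''
          using saturating_step[OF s an] 3(1) a0 aA card_arcs_upto_next[OF aA] q'
            agree_arrs[of "push_arc q" _ \<tau> 5] agree_regs[of "push_arc q" _ \<tau> 31]
          by (simp add: m' a_def[symmetric] r30)
        done
    next
      case (4 \<sigma>' k')
      have a': "regs \<sigma>' 31 = -1" using 4(1,3) by (auto simp: saturating_def)
      have "preflow (arrs \<sigma> q) (arrs \<sigma>' q) (arrs \<sigma>' 10) (arrs \<sigma>' 11) (arrs \<sigma>' 12)"
        by (rule saturating_preflow)
          (use 4(1) a' agree_arrs[OF 4(2), of 11] agree_arrs[OF 4(2), of 12] q' z in \<open>auto simp: m4\<close>)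
      then show ?case
        using 4(1) agree_arrs[OF 4(2), of 11] q' z(2) m4 by auto
    qed
  qed
qed

text \<open>The last product is the number of rounds times the linear overhead of a round; the
  product before it pays for the initial \<open>work\<close>.\<close>

definition flow_cost :: int where
  "flow_cost = 90 * M + 20 * (n + 2) + 80 + 80 * (2 * (n + 2) * (2 * M + n) + 2 * M)
     + (110 * n + 40) * (4 * n * (n + 2) + 2)"

text \<open>Once no graph vertex is active, the preflow is a flow, and the label gap exhibits a
  minimum cut. That cut serves as certificate, so no separate max-flow min-cut theorem is
  invoked.\<close>

lemma wp_maxflow:
  assumes mem: "mem \<sigma>" and q: "q \<notin> {3, 4, 5, 6, 10, 11, 12}" and r0: "\<forall>a\<in>A. 0 \<le> arrs \<sigma> q a"
  shows "wp (maxflow q) (\<lambda>\<tau> k'. (residual (arrs \<sigma> q) (arrs \<tau> q) \<and>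
      (\<forall>v\<in>{0..<n}. excess (arrs \<sigma> q) (arrs \<tau> q) v = 0) \<and>
      arrs \<tau> 10 (n + 1) = excess (arrs \<sigma> q) (arrs \<tau> q) (n + 1) \<and>
      (\<exists>X. X \<subseteq> V \<and> n \<in> X \<and> n + 1 \<notin> X \<and> closed (arrs \<tau> q) X)) \<and> 0 \<le> k') \<sigma> flow_cost"
proof -
  note m = memD[OF mem]
  let ?I = "\<lambda>\<tau> k. preflow (arrs \<sigma> q) (arrs \<tau> q) (arrs \<tau> 10) (arrs \<tau> 11) (arrs \<tau> 12) \<and>
    (regs \<tau> 34 = 0 \<and> (\<forall>w\<in>{0..<n}. arrs \<tau> 10 w \<le> 0) \<and> 4 \<le> k \<or>
     regs \<tau> 34 = 1 \<and> (\<exists>\<phi>. label_bound \<phi> (arrs \<tau> 10) (arrs \<tau> 11) \<and>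
       80 * work (arrs \<tau> 11) (arrs \<tau> 12) + (110 * n + 40) * (\<phi> + 2 * budget (arrs \<tau> 11) + 1) \<le> k))"
  show ?thesis
    unfolding maxflow_def wp_Seq
    apply (rule wp_spec[OF wp_flow_init[OF mem q r0]])
    unfolding wp_Assign
    apply (rule wp_While[where I = ?I])
  proof goal_cases
    case (1 \<sigma>1 k1)
    then have p: "preflow (arrs \<sigma> q) (arrs \<sigma>1 q) (arrs \<sigma>1 10) (arrs \<sigma>1 11) (arrs \<sigma>1 12)"
      and d: "\<And>v. v \<in> {0..<n} \<Longrightarrow> arrs \<sigma>1 11 v = 0" by auto
    have B: "budget (arrs \<sigma>1 11) = 2 * n * (n + 2)" unfolding budget_def using d n0 by simp
    have deg: "(\<Sum>v\<in>{0..<n}. int (card (out_arcs v))) \<le> 2 * M"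
    proof -
      have "(\<Sum>v\<in>{0..<n}. int (card (out_arcs v))) = (\<Sum>a\<in>{a \<in> A. tl a \<in> {0..<n}}. 1)"
        using sum_out_arcs[of "{0..<n}" "\<lambda>_. 1 :: int"] by simp
      also have "\<dots> = int (card {a \<in> A. tl a \<in> {0..<n}})" by simp
      also have "\<dots> \<le> int (card A)" unfolding of_nat_le_iff by (rule card_mono) auto
      finally show ?thesis using card_A by simp
    qed
    have le: "card (arcs_upto v a) \<le> card (out_arcs v)" for v a
      by (rule card_mono) (auto simp: arcs_upto_def out_arcs_def intro: finite_subset[OF _ finA])
    have "work (arrs \<sigma>1 11) (arrs \<sigma>1 12) \<le> (\<Sum>v\<in>{0..<n}. 2 * (n + 2) * (int (card (out_arcs v)) + 1) + int (card (out_arcs v)))"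
      unfolding work_def using d
      by (intro sum_mono) (simp add: le)
    also have "\<dots> = (2 * (n + 2) + 1) * (\<Sum>v\<in>{0..<n}. int (card (out_arcs v))) + 2 * (n + 2) * n"
      using n0 by (simp add: sum.distrib sum_distrib_left[symmetric] distrib_right distrib_left)
    also have "\<dots> \<le> (2 * (n + 2) + 1) * (2 * M) + 2 * (n + 2) * n"
      using deg n0 by (intro add_right_mono mult_left_mono) auto
    also have "\<dots> = 2 * (n + 2) * (2 * M + n) + 2 * M" by (simp add: algebra_simps)
    finally have W: "work (arrs \<sigma>1 11) (arrs \<sigma>1 12) \<le> 2 * (n + 2) * (2 * M + n) + 2 * M" .
    have lb: "label_bound 1 (arrs \<sigma>1 10) (arrs \<sigma>1 11)" using d by (auto simp: label_bound_def)
    have "4 * n * (n + 2) + 2 = 1 + 2 * budget (arrs \<sigma>1 11) + 1" by (simp add: B)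
    then have e: "(110 * n + 40) * (4 * n * (n + 2) + 2) = (110 * n + 40) * (1 + 2 * budget (arrs \<sigma>1 11) + 1)"
      by (simp only:)
    have k: "80 * work (arrs \<sigma>1 11) (arrs \<sigma>1 12) + (110 * n + 40) * (1 + 2 * budget (arrs \<sigma>1 11) + 1) \<le> k1 - 2"
      
    proof -
      define Y Z where "Y = (110 * n + 40) * (1 + 2 * budget (arrs \<sigma>1 11) + 1)"
        and "Z = 2 * (n + 2) * (2 * M + n) + 2 * M"
      have "flow_cost = 90 * M + 20 * (n + 2) + 80 + 80 * Z + Y"
        by (simp only: flow_cost_def e Y_def Z_def)
      then show ?thesis using 1(3) W unfolding Y_def[symmetric] Z_def[symmetric] by linarith
    qed
    show ?case using p lb k by auto
  next
    case (2 \<sigma>1 k1 \<sigma>' k')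
    from 2(4) show ?case
    proof (elim conjE disjE exE)
      fix \<phi> assume a: "preflow (arrs \<sigma> q) (arrs \<sigma>' q) (arrs \<sigma>' 10) (arrs \<sigma>' 11) (arrs \<sigma>' 12)"
        "label_bound \<phi> (arrs \<sigma>' 10) (arrs \<sigma>' 11)"
        "80 * work (arrs \<sigma>' 11) (arrs \<sigma>' 12) + (110 * n + 40) * (\<phi> + 2 * budget (arrs \<sigma>' 11) + 1) \<le> k'"
      have "0 \<le> (110 * n + 40) * (\<phi> + 2 * budget (arrs \<sigma>' 11) + 1)"
        using preflow_work_nonneg[OF a(1)] a(2) n0 by (auto simp: label_bound_def)
      then show "0 \<le> k'" using a(3) preflow_work_nonneg[OF a(1)] by simp
    qed (use 2(6) in auto)
  next
    case (3 \<sigma>1 k1 \<sigma>' k')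
    have c: "regs \<sigma>' 34 = 1" using 3(6) by simp
    obtain \<phi> where a: "preflow (arrs \<sigma> q) (arrs \<sigma>' q) (arrs \<sigma>' 10) (arrs \<sigma>' 11) (arrs \<sigma>' 12)"
        "label_bound \<phi> (arrs \<sigma>' 10) (arrs \<sigma>' 11)"
        "80 * work (arrs \<sigma>' 11) (arrs \<sigma>' 12) + (110 * n + 40) * (\<phi> + 2 * budget (arrs \<sigma>' 11) + 1) \<le> k'"
      using 3(4) c by auto
    have mem': "mem \<sigma>'"
      by (rule mem_cong[OF mem])
        (use q in \<open>simp_all add: agree_regs[OF 3(2)] agree_arrs[OF 3(2)] agree_regs[OF 3(5)] agree_arrs[OF 3(5)]\<close>)
    have pos: "0 \<le> \<phi> + 2 * budget (arrs \<sigma>' 11)"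
      using preflow_work_nonneg[OF a(1)] a(2) by (simp add: label_bound_def)
    have exp: "(110 * n + 40) * (\<phi> + 2 * budget (arrs \<sigma>' 11) + 1) =
       (110 * n + 40) * (\<phi> + 2 * budget (arrs \<sigma>' 11)) + (110 * n + 40)"
      by (simp add: algebra_simps)
    have pos': "0 \<le> (110 * n + 40) * (\<phi> + 2 * budget (arrs \<sigma>' 11))"
      using pos n0 by (intro mult_nonneg_nonneg) auto
    have k': "80 * work (arrs \<sigma>' 11) (arrs \<sigma>' 12) + 110 * n + 30 \<le> k' - 1 - int (bcost (Equal (Reg 34) (Num 1)))"
      using a(3) exp pos' by simp
    show ?case
      apply (rule wp_agree[OF wp_flow_round[OF mem' q a(1) r0 a(2) k']])
      subgoal premises prems for \<tau> k''
      proof -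
        have wn: "0 \<le> work (arrs \<tau> 11) (arrs \<tau> 12)" using prems(1) preflow_work_nonneg by blast
        have kk: "80 * work (arrs \<tau> 11) (arrs \<tau> 12) + (110 * n + 40) * (\<phi> + 2 * budget (arrs \<sigma>' 11)) + 6 \<le> k''"
          using prems(1) a(3) exp by simp
        consider "regs \<tau> 34 = 0" "\<forall>w\<in>{0..<n}. arrs \<tau> 10 w \<le> 0"
          | \<phi>' where "regs \<tau> 34 = 1" "label_bound \<phi>' (arrs \<tau> 10) (arrs \<tau> 11)"
           "\<phi>' + 2 * budget (arrs \<tau> 11) \<le> \<phi> + 2 * budget (arrs \<sigma>' 11) - 1"
          using prems(1) by blast
        then show ?thesis
        proof cases
          case 1
          then show ?thesis using prems(1) kk wn pos' by auto
        next
          case (2 \<phi>')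
          have "(110 * n + 40) * (\<phi>' + 2 * budget (arrs \<tau> 11) + 1) \<le> (110 * n + 40) * (\<phi> + 2 * budget (arrs \<sigma>' 11))"
            using 2(3) n0 by (intro mult_left_mono) auto
          then show ?thesis using prems(1) kk 2 by auto
        qed
      qed
      done
  next
    case (4 \<sigma>1 k1 \<sigma>' k')
    have "regs \<sigma>' 34 = 0" "\<forall>w\<in>{0..<n}. arrs \<sigma>' 10 w \<le> 0" "4 \<le> k'" using 4(4,6) by auto
    moreover have p: "preflow (arrs \<sigma> q) (arrs \<sigma>' q) (arrs \<sigma>' 10) (arrs \<sigma>' 11) (arrs \<sigma>' 12)" using 4(4) by blast
    moreover have "excess (arrs \<sigma> q) (arrs \<sigma>' q) v = 0" if v: "v \<in> {0..<n}" for v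
    proof -
      have "v \<in> V" "v \<noteq> n" using v by auto
      then have "0 \<le> arrs \<sigma>' 10 v" "arrs \<sigma>' 10 v = excess (arrs \<sigma> q) (arrs \<sigma>' q) v"
        using p unfolding preflow_def by blast+
      then show ?thesis using calculation(2) v by fastforce
    qed
    moreover obtain X where "X \<subseteq> V" "n \<in> X" "n + 1 \<notin> X" "closed (arrs \<sigma>' q) X"
      using labels_min_cut[of "arrs \<sigma>' q" "arrs \<sigma>' 11" n "n + 1"] p n0 card_V by (auto simp: preflow_def)
    moreover have "arrs \<sigma>' 10 (n + 1) = excess (arrs \<sigma> q) (arrs \<sigma>' q) (n + 1)"
      using p n0 by (auto simp: preflow_def)
    ultimately show ?case by (auto simp: preflow_def)
  qed
qed

end

section \<open>Counting loops and the memory layout of the network\<close>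

section \<open>Setting up networks\<close>

definition for_loop :: "nat \<Rightarrow> nat \<Rightarrow> com \<Rightarrow> com" where
  "for_loop x y C = (Assign x (Num 0) ;; While (Less (Reg x) (Reg y)) (C ;; incr x))"

lemma written_for_loop [simp]:
  "written_regs (for_loop x y C) = insert x (written_regs C)"
  "written_arrs (for_loop x y C) = written_arrs C"
  by (auto simp: for_loop_def)

text \<open>The invariant receives the index as an argument and must ignore the counter register, so
  bookkeeping cannot disturb it. Guard and increment cost 8 units per iteration; initialization and
  the failing guard cost 6.\<close>

lemma wp_for:
  assumes xy: "x \<noteq> y" "x \<notin> written_regs C" "y \<notin> written_regs C" and N: "0 \<le> regs \<sigma> y" and T: "0 \<le> T"
    and indep: "\<And>i \<tau> z. I i \<tau> \<Longrightarrow> I i (\<tau>\<lparr>regs := (regs \<tau>)(x := z)\<rparr>)"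
    and init: "I 0 \<sigma>"
    and step: "\<And>i \<tau>. I i \<tau> \<Longrightarrow> 0 \<le> i \<Longrightarrow> i < regs \<sigma> y \<Longrightarrow> regs \<tau> x = i \<Longrightarrow> agree (for_loop x y C) \<sigma> \<tau> \<Longrightarrow>
       wp C (\<lambda>\<tau>' k. I (i + 1) \<tau>' \<and> 0 \<le> k) \<tau> T"
    and exit: "\<And>\<tau> k'. I (regs \<sigma> y) \<tau> \<Longrightarrow> agree (for_loop x y C) \<sigma> \<tau> \<Longrightarrow>
       k - (regs \<sigma> y * (T + 8) + 6) \<le> k' \<Longrightarrow> Q \<tau> k'"
  shows "wp (for_loop x y C) Q \<sigma> k"
proof (rule wp_spec[where P = "\<lambda>\<tau>. I (regs \<sigma> y) \<tau>" and T = "regs \<sigma> y * (T + 8) + 6"])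
  let ?J = "\<lambda>\<tau> k'. 0 \<le> regs \<tau> x \<and> regs \<tau> x \<le> regs \<sigma> y \<and> I (regs \<tau> x) \<tau> \<and>
    (regs \<sigma> y - regs \<tau> x) * (T + 8) + 4 \<le> k'"
  show "wp (for_loop x y C) (\<lambda>\<tau> k'. I (regs \<sigma> y) \<tau> \<and> 0 \<le> k') \<sigma> (regs \<sigma> y * (T + 8) + 6)"
    unfolding for_loop_def wp_Seq wp_Assign
    apply (rule wp_While[where I = ?J])
  proof goal_cases
    case 1
    then show ?case using N indep[OF init] by simp
  next
    case (2 \<tau> k')
    have "0 \<le> (regs \<sigma> y - regs \<tau> x) * (T + 8)" using 2 T by simp
    then show ?case using 2 by linarith
  next
    case (3 \<tau> k')
    have y: "regs \<tau> y = regs \<sigma> y" using agree_regs[OF 3(2), of y] xy by simp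
    have ag: "agree (for_loop x y C) \<sigma> \<tau>" using 3(2) by (auto simp: agree_def)
    have lt: "regs \<tau> x < regs \<sigma> y" using 3(3) y by simp
    have m: "(regs \<sigma> y - regs \<tau> x) * (T + 8) = (regs \<sigma> y - (regs \<tau> x + 1)) * (T + 8) + T + 8"
      by (simp add: algebra_simps)
    show ?case unfolding wp_Seq
    proof (rule wp_spec[OF step[of "regs \<tau> x" \<tau>]])
      fix \<tau>' k'' assume a: "I (regs \<tau> x + 1) \<tau>'" "agree C \<tau> \<tau>'"
      and k2: "k' - 1 - int (bcost (Less (Reg x) (Reg y))) - T \<le> k''"
      have "regs \<tau>' x = regs \<tau> x" using agree_regs[OF a(2)] xy by blast
      then show "wp (incr x) ?J \<tau>' k''"
        using indep[OF a(1)] lt 3(1) k2 m by simp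
    qed (use 3(1) lt ag in auto)
  next
    case (4 \<tau> k')
    have y: "regs \<tau> y = regs \<sigma> y" using agree_regs[OF 4(2), of y] xy by simp
    then have "regs \<tau> x = regs \<sigma> y" using 4 by auto
    then show ?case using 4(1) by simp
  qed
qed (rule exit)

definition set_heads :: com where
  "set_heads =
     (for_loop 50 1
        (Update 3 (Reg 50) (Elem 1 (Reg 50)) ;; Update 3 (Plus (Reg 50) (Reg 7)) (Elem 0 (Reg 50))) ;;
      for_loop 50 0
        (Update 3 (Plus (Reg 1) (Reg 50)) (Reg 50) ;;
         Update 3 (Plus (Plus (Reg 1) (Reg 50)) (Reg 7)) (Reg 0) ;;
         Update 3 (Plus (Plus (Reg 1) (Reg 0)) (Reg 50)) (Plus (Reg 0) (Num 1)) ;;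
         Update 3 (Plus (Plus (Plus (Reg 1) (Reg 0)) (Reg 50)) (Reg 7)) (Reg 50)) ;;
      Update 3 (Plus (Plus (Reg 1) (Reg 0)) (Reg 0)) (Plus (Reg 0) (Num 1)) ;;
      Update 3 (Plus (Plus (Plus (Reg 1) (Reg 0)) (Reg 0)) (Reg 7)) (Reg 0))"

definition set_reversals :: com where
  "set_reversals = for_loop 50 7
     (Update 4 (Reg 50) (Plus (Reg 50) (Reg 7)) ;; Update 4 (Plus (Reg 50) (Reg 7)) (Reg 50))"

text \<open>Inserting the arcs in increasing order at the front of their lists produces the downward
  links of \<open>pred_arc\<close>.\<close>

definition set_arc_lists :: com where
  "set_arc_lists =
     (for_loop 50 6 (Update 6 (Reg 50) (Num (-1))) ;;
      for_loop 50 8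
        (Assign 51 (Elem 3 (Elem 4 (Reg 50))) ;; Update 5 (Reg 50) (Elem 6 (Reg 51)) ;;
         Update 6 (Reg 51) (Reg 50)))"

definition init_network :: com where
  "init_network =
     (Assign 6 (Plus (Reg 0) (Num 2)) ;; Assign 7 (Plus (Plus (Plus (Reg 1) (Reg 0)) (Reg 0)) (Num 1)) ;;
      Assign 8 (Plus (Reg 7) (Reg 7)) ;; set_heads ;; set_reversals ;; set_arc_lists)"

lemma written_set_heads [simp]:
  "written_regs set_heads = {50}" "written_arrs set_heads = {3}"
  by (auto simp: set_heads_def)

lemma written_set_reversals [simp]:
  "written_regs set_reversals = {50}" "written_arrs set_reversals = {4}"
  by (auto simp: set_reversals_def)

lemma written_set_arc_lists [simp]:
  "written_regs set_arc_lists = {50, 51}" "written_arrs set_arc_lists = {5, 6}"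
  by (auto simp: set_arc_lists_def)

lemma written_init_network [simp]:
  "written_regs init_network = {6, 7, 8, 50, 51}" "written_arrs init_network = {3, 4, 5, 6}"
  by (auto simp: init_network_def)

text \<open>Arrays 13 and 14 hold forward and backward capacities, 15 and 16 supplies and demands.\<close>

definition load :: "nat \<Rightarrow> com" where
  "load q =
     (for_loop 50 1
        (Update q (Reg 50) (Elem 13 (Reg 50)) ;; Update q (Plus (Reg 50) (Reg 7)) (Elem 14 (Reg 50))) ;;
      for_loop 50 0
        (Update q (Plus (Reg 1) (Reg 50)) (Elem 15 (Reg 50)) ;;
         Update q (Plus (Plus (Reg 1) (Reg 50)) (Reg 7)) (Num 0) ;;
         Update q (Plus (Plus (Reg 1) (Reg 0)) (Reg 50)) (Elem 16 (Reg 50)) ;;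
         Update q (Plus (Plus (Plus (Reg 1) (Reg 0)) (Reg 50)) (Reg 7)) (Num 0)) ;;
      Update q (Plus (Plus (Reg 1) (Reg 0)) (Reg 0)) (Num 0) ;;
      Update q (Plus (Plus (Plus (Reg 1) (Reg 0)) (Reg 0)) (Reg 7)) (Num 0))"

lemma written_load [simp]:
  "written_regs (load q) = {50}" "written_arrs (load q) = {q}"
  by (auto simp: load_def)

text \<open>Register 9 holds a number that exceeds the total capacity.\<close>

definition cut_flow :: "nat \<Rightarrow> nat \<Rightarrow> nat \<Rightarrow> nat \<Rightarrow> nat \<Rightarrow> com" where
  "cut_flow q x x' y y' =
     (for_loop 50 0 (Update 15 (Reg 50) (Num 0) ;; Update 16 (Reg 50) (Num 0)) ;;
      Update 15 (Reg x) (Reg 9) ;; Update 15 (Reg x') (Reg 9) ;;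
      Update 16 (Reg y) (Reg 9) ;; Update 16 (Reg y') (Reg 9) ;;
      load q ;; maxflow q)"

lemma written_cut_flow [simp]:
  "written_regs (cut_flow q x x' y y') = {30, 31, 32, 33, 34, 35, 50}"
  "written_arrs (cut_flow q x x' y y') = {q, 10, 11, 12, 15, 16}"
  by (auto simp: cut_flow_def)

context network
begin

lemma pred_arc_Suc:
  assumes "i \<in> A"
  shows "pred_arc v (i + 1) = (if tl i = v then i else pred_arc v i)"
proof -
  have "{b \<in> A. tl b = v \<and> b < i + 1} = (if tl i = v then insert i {b \<in> A. tl b = v \<and> b < i} else {b \<in> A. tl b = v \<and> b < i})"
    using assms by (auto simp: order_less_le)
  moreover have "Max (insert (-1) (insert i {b \<in> A. tl b = v \<and> b < i})) = i"
    using assms by (intro Max_eqI) (auto intro: finite_subset[OF _ finA])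
  ultimately show ?thesis unfolding pred_arc_def by simp
qed

lemma pred_arc_0: "pred_arc v 0 = -1"
  using pred_arc_in[of v 0] by auto

lemma edge_cases:
  assumes "0 \<le> a" "a < 2 * M"
  obtains e where "a = e" "0 \<le> e" "e < m" | e where "a = e + M" "0 \<le> e" "e < m"
    | v where "a = m + v" "0 \<le> v" "v < n" | v where "a = m + v + M" "0 \<le> v" "v < n"
    | v where "a = m + n + v" "0 \<le> v" "v < n" | v where "a = m + n + v + M" "0 \<le> v" "v < n"
    | "a = ret" | "a = ret + M"
proof -
  have "\<exists>e. (a = e \<or> a = e + M) \<and> 0 \<le> e \<and> e \<le> ret"
    using assms by (cases "a < M") (auto simp: M_def intro: exI[of _ a] exI[of _ "a - M"])
  then obtain e where e: "a = e \<or> a = e + M" "0 \<le> e" "e \<le> ret" by blast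
  show ?thesis
  proof (cases "e < m")
    case True then show ?thesis using e that(1)[of e] that(2)[of e] by blast
  next
    case F1: False
    show ?thesis
    proof (cases "e < m + n")
      case True
      then show ?thesis using e F1 that(3)[of "e - m"] that(4)[of "e - m"] by auto
    next
      case F2: False
      show ?thesis
      proof (cases "e = ret")
        case True then show ?thesis using e that(7,8) by blast
      next
        case False
        then have "e - m - n < n" using e F2 by (auto simp: ret_def)
        then show ?thesis using e F2 that(5)[of "e - m - n"] that(6)[of "e - m - n"] by auto
      qed
    qed
  qed
qed

lemma edge_bounds:
  "e < m \<Longrightarrow> e < M" "v < n \<Longrightarrow> m + v < M" "v < n \<Longrightarrow> m + n + v < M"
  "ret < M" "0 \<le> ret" "m + n + n = ret" "m \<le> ret"
  using n0 m0 by (auto simp: M_def ret_def)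

text \<open>Shared by \<open>set_heads\<close> and \<open>load\<close>: both fill an array over all
  arcs in the same three blocks.\<close>

lemma wp_fill:
  assumes r: "regs \<sigma> 0 = n" "regs \<sigma> 1 = m" "regs \<sigma> 7 = M"
    and C1: "written_regs C1 = {}" "written_arrs C1 = {q}" and C2: "written_regs C2 = {}" "written_arrs C2 = {q}"
    and s1: "\<And>e \<tau>. 0 \<le> e \<Longrightarrow> e < m \<Longrightarrow> regs \<tau> 50 = e \<Longrightarrow> regs \<tau> 7 = M \<Longrightarrow> agree (for_loop 50 1 C1) \<sigma> \<tau> \<Longrightarrow>
       wp C1 (\<lambda>\<tau>' k. arrs \<tau>' q = (arrs \<tau> q)(e := g e, e + M := g (e + M)) \<and> 0 \<le> k) \<tau> 40"
    and s2: "\<And>v \<tau> \<tau>1. 0 \<le> v \<Longrightarrow> v < n \<Longrightarrow> regs \<tau> 50 = v \<Longrightarrow> agree (for_loop 50 1 C1) \<sigma> \<tau>1 \<Longrightarrow>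
       agree (for_loop 50 0 C2) \<tau>1 \<tau> \<Longrightarrow>
       wp C2 (\<lambda>\<tau>' k. arrs \<tau>' q = (arrs \<tau> q)(m + v := g (m + v), m + v + M := g (m + v + M),
          m + n + v := g (m + n + v), m + n + v + M := g (m + n + v + M)) \<and> 0 \<le> k) \<tau> 40"
    and s3: "\<And>\<tau>. agree (for_loop 50 1 C1 ;; for_loop 50 0 C2) \<sigma> \<tau> \<Longrightarrow>
       wp C3 (\<lambda>\<tau>' k'. arrs \<tau>' q = (arrs \<tau> q)(ret := g ret, ret + M := g (ret + M)) \<and> 0 \<le> k') \<tau> 40"
  shows "wp (for_loop 50 1 C1 ;; for_loop 50 0 C2 ;; C3) (\<lambda>\<tau> k. (\<forall>a\<in>A. arrs \<tau> q a = g a) \<and> 0 \<le> k) \<sigma>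
    (48 * (m + n) + 60)"
  unfolding wp_Seq
proof (rule wp_for[where T = 40 and I = "\<lambda>i \<tau>. \<forall>e. 0 \<le> e \<and> e < i \<longrightarrow> arrs \<tau> q e = g e \<and> arrs \<tau> q (e + M) = g (e + M)"], goal_cases)
  case (8 i \<tau>)
  have "regs \<tau> 7 = M" using agree_regs[OF 8(5), of 7] r C1 by simp
  with 8 r edge_bounds(1) show ?case
    by (intro wp_agree[OF s1[of i \<tau>]]) auto
next
  case (9 \<tau>1 k1)
  have r1: "regs \<tau>1 0 = n" using agree_regs[OF 9(2), of 0] r C1 by simp
  show ?case
  proof (rule wp_for[where T = 40 and I = "\<lambda>i \<tau>. (\<forall>e. 0 \<le> e \<and> e < m \<longrightarrow> arrs \<tau> q e = g e \<and> arrs \<tau> q (e + M) = g (e + M)) \<and>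
      (\<forall>v. 0 \<le> v \<and> v < i \<longrightarrow> arrs \<tau> q (m + v) = g (m + v) \<and> arrs \<tau> q (m + v + M) = g (m + v + M) \<and>
        arrs \<tau> q (m + n + v) = g (m + n + v) \<and> arrs \<tau> q (m + n + v + M) = g (m + n + v + M))"], goal_cases)
    case (8 i \<tau>)
    have i: "0 \<le> i" "i < n" using 8 r1 by auto
    have "i < M" "m + i < M" "m + n + i < M" using i edge_bounds m0 by auto
    then show ?case
      using 8 i m0 n0 M_pos edge_bounds(1)
      apply (intro wp_agree[OF s2[of i \<tau> \<tau>1, OF i 8(4) 9(2) 8(5)]])
      apply clarsimp
      done
  next
    case (9 \<tau> k2)
    have ag: "agree (for_loop 50 1 C1 ;; for_loop 50 0 C2) \<sigma> \<tau>"
      using 9(2) \<open>agree (for_loop 50 1 C1) \<sigma> \<tau>1\<close> by (auto simp: agree_def)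
    show ?case
    proof (rule wp_spec[OF s3[OF ag]])
      fix \<tau>' k' assume a: "arrs \<tau>' q = (arrs \<tau> q)(ret := g ret, ret + M := g (ret + M))" "k2 - 40 \<le> k'"
      have "arrs \<tau>' q b = g b" if "b \<in> A" for b
      proof -
        have b: "0 \<le> b" "b < 2 * M" using that by auto
        then show ?thesis
          by (cases b rule: edge_cases) (use 9(1) r1 a(1) in auto)
      qed
      moreover have "0 \<le> k'" using a(2) 9(3) \<open>48 * (m + n) + 60 - (regs \<sigma> 1 * (40 + 8) + 6) \<le> k1\<close> r r1 by simp
      ultimately show "(\<forall>a\<in>A. arrs \<tau>' q a = g a) \<and> 0 \<le> k'" by blast
    qed
  qed (use 9(1) r r1 C2 n0 in auto)
qed (use r C1 m0 in auto)

lemma wp_set_heads: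
  assumes r: "regs \<sigma> 0 = n" "regs \<sigma> 1 = m" "regs \<sigma> 7 = M"
    and a0: "\<And>e. 0 \<le> e \<Longrightarrow> e < m \<Longrightarrow> arrs \<sigma> 0 e = us e" and a1: "\<And>e. 0 \<le> e \<Longrightarrow> e < m \<Longrightarrow> arrs \<sigma> 1 e = vs e"
  shows "wp set_heads (\<lambda>\<tau> k. (\<forall>a\<in>A. arrs \<tau> 3 a = head a) \<and> 0 \<le> k) \<sigma> (48 * (m + n) + 60)"
  unfolding set_heads_def
proof (rule wp_fill[OF r], goal_cases)
  case (5 e \<tau>)
  then show ?case using a0[of e] a1[of e] agree_arrs[OF 5(5), of 0] agree_arrs[OF 5(5), of 1]
    by (simp add: head_simps)
next
  case (6 v \<tau> \<tau>1)
  have "regs \<tau> 0 = n" "regs \<tau> 1 = m" "regs \<tau> 7 = M"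
    using r agree_regs[OF 6(5)] agree_regs[OF 6(4)] by auto
  then show ?case using 6 by (simp add: head_simps)
next
  case (7 \<tau>)
  have "regs \<tau> 0 = n" "regs \<tau> 1 = m" "regs \<tau> 7 = M"
    using r agree_regs[OF 7(1)] by auto
  then show ?case by (simp add: head_simps edge_bounds)
qed auto

definition init_cost :: int where
  "init_cost = 200 * (M + n + 2)"

lemma wp_init_network:
  assumes r: "regs \<sigma> 0 = n" "regs \<sigma> 1 = m"
    and a0: "\<And>e. 0 \<le> e \<Longrightarrow> e < m \<Longrightarrow> arrs \<sigma> 0 e = us e" and a1: "\<And>e. 0 \<le> e \<Longrightarrow> e < m \<Longrightarrow> arrs \<sigma> 1 e = vs e"
  shows "wp init_network (\<lambda>\<tau> k. mem \<tau> \<and> 0 \<le> k) \<sigma> init_cost"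
proof -
  define \<sigma>0 where "\<sigma>0 = \<sigma>\<lparr>regs := (regs \<sigma>)(6 := n + 2, 7 := M, 8 := 2 * M)\<rparr>"
  have start: "wp init_network Q \<sigma> k \<longleftrightarrow> wp (set_heads ;; set_reversals ;; set_arc_lists) Q \<sigma>0 (k - 16)" for Q k
    unfolding init_network_def using r by (simp add: \<sigma>0_def M_def ret_def algebra_simps)
  have r: "regs \<sigma>0 0 = n" "regs \<sigma>0 (Suc 0) = m" "regs \<sigma>0 6 = n + 2" "regs \<sigma>0 7 = M" "regs \<sigma>0 8 = 2 * M"
    "arrs \<sigma>0 = arrs \<sigma>" using r by (auto simp: \<sigma>0_def)
  have mM: "m + n \<le> M" using n0 m0 by (auto simp: M_def ret_def)
  show ?thesis
    unfolding start wp_Seq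
    apply (rule wp_spec[OF wp_set_heads])
         apply (use a0 a1 in \<open>simp_all add: r\<close>)[5]
    subgoal premises p1 for \<tau>1 k1
      unfolding set_reversals_def
      apply (rule wp_for[where T = 20 and I = "\<lambda>i \<tau>. \<forall>e. 0 \<le> e \<and> e < i \<longrightarrow> arrs \<tau> 4 e = e + M \<and> arrs \<tau> 4 (e + M) = e"])
              apply (use M_pos in \<open>simp_all add: r agree_regs[OF p1(2)]\<close>)[7]
      subgoal premises prems for i \<tau>
        using prems by (auto simp: r agree_regs[OF p1(2)] agree_regs[OF prems(5)])
      subgoal premises p2 for \<tau>2 k2
      proof -
        have r2: "regs \<tau>2 0 = n" "regs \<tau>2 (Suc 0) = m" "regs \<tau>2 6 = n + 2" "regs \<tau>2 7 = M" "regs \<tau>2 8 = 2 * M"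
          by (simp_all add: r agree_regs[OF p1(2)] agree_regs[OF p2(2)])
        have h2: "\<And>a. a \<in> A \<Longrightarrow> arrs \<tau>2 3 a = head a" using p1(1) agree_arrs[OF p2(2), of 3] by simp
        have v2: "arrs \<tau>2 4 a = rev_arc a" if "a \<in> A" for a
        proof -
          have "regs \<tau>1 7 = M" by (simp add: r agree_regs[OF p1(2)])
          then have *: "\<forall>e. 0 \<le> e \<and> e < M \<longrightarrow> arrs \<tau>2 4 e = e + M \<and> arrs \<tau>2 4 (e + M) = e" using p2(1) by simp
          then show ?thesis using that *[rule_format, of a] *[rule_format, of "a - M"]
            by (cases "a < M") (auto simp: rev_arc_def)
        qed
        have k2: "50 * M + 100 * (n + 2) \<le> k2"
          using p1(3) p2(3) mM M_pos n0 by (simp add: init_cost_def r agree_regs[OF p1(2)])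
        show ?thesis
          unfolding set_arc_lists_def wp_Seq
          apply (rule wp_for[where T = 10 and I = "\<lambda>i \<tau>. \<forall>v. 0 \<le> v \<and> v < i \<longrightarrow> arrs \<tau> 6 v = -1"])
                  apply (use n0 in \<open>simp_all add: r2\<close>)[7]
          subgoal by auto
          subgoal premises p3 for \<tau>3 k3
            apply (rule wp_for[where T = 15 and I = "\<lambda>i \<tau>. (\<forall>v\<in>V. arrs \<tau> 6 v = pred_arc v i) \<and>
                (\<forall>a. 0 \<le> a \<and> a < i \<longrightarrow> arrs \<tau> 5 a = pred_arc (tl a) a)"])
                    apply (use p3(1) M_pos r2 in \<open>simp_all add: pred_arc_0 agree_regs[OF p3(2)]\<close>)[7]
            subgoal premises p4 for i \<tau>
            proof -
              have i: "i \<in> A" using p4 r2 agree_regs[OF p3(2), of 8] by simp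
              have "arrs \<tau> 4 i = rev_arc i" "arrs \<tau> 3 (rev_arc i) = tl i"
                using v2[OF i] h2[of "rev_arc i"] i agree_arrs[OF p3(2)] agree_arrs[OF p4(5)] by auto
              moreover have "0 \<le> tl i" "tl i < n + 2" using i by auto
              ultimately show ?thesis
                using p4(1,4) pred_arc_Suc[OF i] by auto
            qed
            subgoal premises p4 for \<tau> k4
              using p4 p3(3) k2 r2 h2 v2 M_pos n0
              by (auto simp: mem_def agree_regs[OF p4(2)] agree_arrs[OF p4(2)] agree_regs[OF p3(2)] agree_arrs[OF p3(2)])
            done
          done
      qed
      done
    done
qed

lemma wp_load:
  assumes r: "regs \<sigma> 0 = n" "regs \<sigma> 1 = m" "regs \<sigma> 7 = M" and q: "q \<notin> {13, 14, 15, 16}"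
  shows "wp (load q) (\<lambda>\<tau> k. (\<forall>a\<in>A. arrs \<tau> q a = base (arrs \<sigma> 13) (arrs \<sigma> 14) (arrs \<sigma> 15) (arrs \<sigma> 16) 0 0 a) \<and> 0 \<le> k)
    \<sigma> (48 * (m + n) + 60)"
  unfolding load_def
proof (rule wp_fill[OF r], goal_cases)
  case (5 e \<tau>)
  then show ?case
    using q agree_arrs[OF 5(5), of 13] agree_arrs[OF 5(5), of 14] by (simp add: base_simps)
next
  case (6 v \<tau> \<tau>1)
  have "regs \<tau> 0 = n" "regs \<tau> 1 = m" "regs \<tau> 7 = M" "arrs \<tau> 15 = arrs \<sigma> 15" "arrs \<tau> 16 = arrs \<sigma> 16"
    using r q agree_regs[OF 6(5)] agree_regs[OF 6(4)] agree_arrs[OF 6(5)] agree_arrs[OF 6(4)] by auto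
  then show ?case using 6 q by (simp add: base_simps)
next
  case (7 \<tau>)
  have "regs \<tau> 0 = n" "regs \<tau> 1 = m" "regs \<tau> 7 = M"
    using r agree_regs[OF 7(1)] by auto
  then show ?case by (simp add: base_simps edge_bounds)
qed auto

section \<open>Minimum cuts certified by circulations\<close>

section \<open>Minimum cuts\<close>

text \<open>\<open>I\<close> is the stand-in for infinity on the arcs at the terminals; it will
  exceed the total capacity.\<close>

definition term_base :: "(int \<Rightarrow> int) \<Rightarrow> int \<Rightarrow> int set \<Rightarrow> int set \<Rightarrow> int \<Rightarrow> int \<Rightarrow> int \<Rightarrow> int" where
  "term_base c I S T \<tau> F = base c c (\<lambda>v. if v \<in> S then I else 0) (\<lambda>v. if v \<in> T then I else 0) \<tau> F"

definition separates :: "int set \<Rightarrow> int set \<Rightarrow> int set \<Rightarrow> bool" where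
  "separates S T X \<longleftrightarrow> S \<subseteq> X \<and> T \<inter> X = {}"

text \<open>A flow closed up by the return arc, whose value may vary between \<tau> and
  \<open>F\<close>. Thanks to the lower bound, residual paths may pass through the return arc and
  lower the value, but never below \<tau>.\<close>

definition circulation :: "(int \<Rightarrow> int) \<Rightarrow> int \<Rightarrow> int set \<Rightarrow> int set \<Rightarrow> int \<Rightarrow> int \<Rightarrow> (int \<Rightarrow> int) \<Rightarrow> bool" where
  "circulation c I S T \<tau> F r \<longleftrightarrow> residual (term_base c I S T \<tau> F) r \<and>
     (\<forall>v\<in>V. excess (term_base c I S T \<tau> F) r v = 0)"

lemma residual_cong:
  assumes "\<And>a. a \<in> A \<Longrightarrow> r0 a = r0' a"
  shows "residual r0 r = residual r0' r"
proof -
  have "r0 a + r0 (rev_arc a) = r0' a + r0' (rev_arc a)" if "a \<in> A" for a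
    using assms[OF that] assms[OF rvA[OF that]] by simp
  then show ?thesis unfolding residual_def by auto
qed

lemma excess_cong:
  assumes "\<And>a. a \<in> A \<Longrightarrow> r0 a = r0' a"
  shows "excess r0 r v = excess r0' r v"
  unfolding excess_def using assms by (intro sum.cong) (auto simp: out_arcs_def)

lemma outs_term_base:
  "(\<Sum>a\<in>outs X. term_base c I S T \<tau> F a) = cut c X +
     (if n \<in> X then \<Sum>v\<in>{0..<n}. if v \<in> S \<and> v \<notin> X then I else 0 else 0) +
     (if n + 1 \<notin> X then \<Sum>v\<in>{0..<n}. if v \<in> T \<and> v \<in> X then I else 0 else 0) +
     (if n \<in> X \<and> n + 1 \<notin> X then - \<tau> else 0) + (if n + 1 \<in> X \<and> n \<notin> X then F else 0)"
proof -
  have 1: "(\<Sum>e\<in>{0..<m}. (if us e \<in> X \<and> vs e \<notin> X then c e else 0) + (if vs e \<in> X \<and> us e \<notin> X then c e else 0)) = cut c X"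
    unfolding cut_def by (intro sum.cong) auto
  have 2: "(\<Sum>v\<in>{0..<n}. if n \<in> X \<and> v \<notin> X then if v \<in> S then I else 0 else 0) =
      (if n \<in> X then \<Sum>v\<in>{0..<n}. if v \<in> S \<and> v \<notin> X then I else 0 else 0)"
    by (auto intro!: sum.cong sum.neutral)
  have 3: "(\<Sum>v\<in>{0..<n}. if v \<in> X \<and> n + 1 \<notin> X then if v \<in> T then I else 0 else 0) =
      (if n + 1 \<notin> X then \<Sum>v\<in>{0..<n}. if v \<in> T \<and> v \<in> X then I else 0 else 0)"
    by (auto intro!: sum.cong sum.neutral)
  show ?thesis
    unfolding sum_outs term_base_def 1[symmetric] 2[symmetric] 3[symmetric]
    by (simp add: base_simps cong: sum.cong_simp if_cong)
qed

lemma terminal_sum: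
  fixes I :: int
  assumes "0 < I" "S \<subseteq> {0..<n}"
  shows "0 \<le> (\<Sum>v\<in>{0..<n}. if v \<in> S \<and> P v then I else 0)"
    "(\<Sum>v\<in>{0..<n}. if v \<in> S \<and> P v then I else 0) < I \<Longrightarrow> \<forall>v\<in>S. \<not> P v"
    "\<forall>v\<in>S. \<not> P v \<Longrightarrow> (\<Sum>v\<in>{0..<n}. if v \<in> S \<and> P v then I else 0) = 0"
proof -
  show "0 \<le> (\<Sum>v\<in>{0..<n}. if v \<in> S \<and> P v then I else 0)" using assms by (auto intro!: sum_nonneg)
  show "\<forall>v\<in>S. \<not> P v" if lt: "(\<Sum>v\<in>{0..<n}. if v \<in> S \<and> P v then I else 0) < I"
  proof (rule ballI, rule notI)
    fix v assume v: "v \<in> S" "P v"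
    have "(if v \<in> S \<and> P v then I else 0) \<le> (\<Sum>v\<in>{0..<n}. if v \<in> S \<and> P v then I else 0)"
      by (rule member_le_sum) (use v assms in auto)
    then show False using v lt by simp
  qed
  show "(\<Sum>v\<in>{0..<n}. if v \<in> S \<and> P v then I else 0) = 0" if "\<forall>v\<in>S. \<not> P v"
    using that by (auto intro!: sum.neutral)
qed

lemma cut_nonneg: "(\<And>e. 0 \<le> e \<Longrightarrow> e < m \<Longrightarrow> 0 \<le> c e) \<Longrightarrow> 0 \<le> cut c X"
  unfolding cut_def by (auto intro!: sum_nonneg)

lemma cut_le_sum: "(\<And>e. 0 \<le> e \<Longrightarrow> e < m \<Longrightarrow> 0 \<le> c e) \<Longrightarrow> cut c X \<le> (\<Sum>e\<in>{0..<m}. c e)"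
  unfolding cut_def by (auto intro!: sum_mono)

lemma excess_total: "residual r0 r \<Longrightarrow> (\<Sum>v\<in>V. excess r0 r v) = 0"
proof -
  assume "residual r0 r"
  moreover have "outs V = {}" using headV by (auto simp: outs_def)
  ultimately show ?thesis by (simp add: excess_cut)
qed

lemma excess_source:
  assumes "residual r0 r" "\<And>v. v \<in> {0..<n} \<Longrightarrow> excess r0 r v = 0"
  shows "excess r0 r n = - excess r0 r (n + 1)"
proof -
  have "V = insert n (insert (n + 1) {0..<n})" using n0 by auto
  then show ?thesis using excess_total[OF assms(1)] assms(2) by simp
qed

lemma flow_value_le:
  assumes "residual r0 r" "\<And>v. v \<in> {0..<n} \<Longrightarrow> excess r0 r v = 0"
    and Y: "Y \<subseteq> V" "n \<in> Y" "n + 1 \<notin> Y"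
  shows "excess r0 r (n + 1) \<le> (\<Sum>a\<in>outs Y. r0 a)"
    and "closed r Y \<Longrightarrow> excess r0 r (n + 1) = (\<Sum>a\<in>outs Y. r0 a)"
proof -
  have sub: "Y - {n} \<subseteq> {0..<n}"
  proof
    fix x assume "x \<in> Y - {n}"
    then have "x \<in> V" "x \<noteq> n" "x \<noteq> n + 1" using Y by auto
    then show "x \<in> {0..<n}" by auto
  qed
  have "(\<Sum>v\<in>Y. excess r0 r v) = excess r0 r n + (\<Sum>v\<in>Y - {n}. excess r0 r v)"
    using Y by (intro sum.remove) (auto intro: finite_subset)
  also have "(\<Sum>v\<in>Y - {n}. excess r0 r v) = 0"
    using assms(2) sub by (intro sum.neutral) blast
  finally have s: "(\<Sum>v\<in>Y. excess r0 r v) = - excess r0 r (n + 1)"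
    using excess_source[OF assms(1,2)] by simp
  show "excess r0 r (n + 1) \<le> (\<Sum>a\<in>outs Y. r0 a)" using cut_value_bound[OF assms(1) Y(1)] s by simp
  show "excess r0 r (n + 1) = (\<Sum>a\<in>outs Y. r0 a)" if "closed r Y"
    using closed_value[OF assms(1) that Y(1)] s by simp
qed

lemma outs_separating:
  assumes I: "0 < I" and S: "S \<subseteq> {0..<n}" "T \<subseteq> {0..<n}" and Y: "separates S T Y"
  shows "(\<Sum>a\<in>outs (insert n (Y \<inter> {0..<n})). term_base c I S T \<tau> F a) = cut c Y - \<tau>"
proof -
  define Y' where "Y' = insert n (Y \<inter> {0..<n})"
  have "\<forall>v\<in>S. \<not> v \<notin> Y'" "\<forall>v\<in>T. \<not> v \<in> Y'" "n \<in> Y'" "n + 1 \<notin> Y'"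
    using S Y by (auto simp: Y'_def separates_def)
  moreover have "cut c Y' = cut c Y"
    unfolding Y'_def using cut_Diff_V[of c "insert n (Y \<inter> {0..<n})"] cut_Diff_V[of c Y]
    by (simp add: Int_insert_left Int_assoc)
  ultimately show ?thesis
    unfolding Y'_def[symmetric] outs_term_base
    using terminal_sum(3)[OF I S(1), of "\<lambda>v. v \<notin> Y'"] terminal_sum(3)[OF I S(2), of "\<lambda>v. v \<in> Y'"] by simp
qed

text \<open>A single terminal arc already costs \<open>I\<close>, so none leaves a cut whose total
  is below \<open>I\<close>.\<close>

lemma terminal_cut:
  fixes I F C :: int
  assumes I: "0 < I" and S: "S \<subseteq> {0..<n}" "T \<subseteq> {0..<n}"
    and F: "F = C + (\<Sum>v\<in>{0..<n}. if v \<in> S \<and> v \<notin> X then I else 0) + (\<Sum>v\<in>{0..<n}. if v \<in> T \<and> v \<in> X then I else 0)"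
    and C: "0 \<le> C" "F < I"
  shows "separates S T X" "C = F"
proof -
  note s = terminal_sum[OF I S(1), of "\<lambda>v. v \<notin> X"] and t = terminal_sum[OF I S(2), of "\<lambda>v. v \<in> X"]
  have "\<forall>v\<in>S. \<not> v \<notin> X" using s(1,2) t(1) F C by linarith
  moreover have "\<forall>v\<in>T. \<not> v \<in> X" using s(1) t(1,2) F C by linarith
  ultimately show "separates S T X" "C = F" using s(3) t(3) F by (auto simp: separates_def)
qed

text \<open>Turns the outcome of \<open>wp_maxflow\<close> into a minimum cut and into circulations
  for every admissible lower bound.\<close>

lemma maximum_flow_cut:
  fixes c r :: "int \<Rightarrow> int"
  assumes c: "\<And>e. 0 \<le> e \<Longrightarrow> e < m \<Longrightarrow> 0 \<le> c e" "(\<Sum>e\<in>{0..<m}. c e) < I"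
    and S: "S \<subseteq> {0..<n}" "T \<subseteq> {0..<n}" "S \<inter> T = {}"
  defines "b \<equiv> term_base c I S T 0 0" and "F \<equiv> excess (term_base c I S T 0 0) r (n + 1)"
  assumes res: "residual b r" and cons: "\<And>v. v \<in> {0..<n} \<Longrightarrow> excess b r v = 0"
    and X: "\<exists>X. X \<subseteq> V \<and> n \<in> X \<and> n + 1 \<notin> X \<and> closed r X"
  shows "\<exists>X. separates S T X \<and> cut c X = F"
    and "separates S T Y \<Longrightarrow> F \<le> cut c Y"
    and "0 \<le> F" and "0 \<le> \<tau> \<Longrightarrow> \<tau> \<le> F \<Longrightarrow> circulation c I S T \<tau> F (r(ret := F - \<tau>))"
proof -
  have I: "0 < I" using c(2) sum_nonneg[of "{0..<m}" c] c(1) by fastforce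
  have le: "F \<le> cut c Y" if Y: "separates S T Y" for Y
  proof -
    let ?Y = "insert n (Y \<inter> {0..<n})"
    have "F \<le> (\<Sum>a\<in>outs ?Y. b a)"
      unfolding F_def b_def[symmetric] by (rule flow_value_le(1)[OF res cons]) (use n0 in auto)
    also have "\<dots> = cut c Y"
      using outs_separating[OF I S(1,2) Y, of c 0 0] by (simp add: b_def)
    finally show ?thesis .
  qed
  then show "separates S T Y \<Longrightarrow> F \<le> cut c Y" .
  obtain X where X: "X \<subseteq> V" "n \<in> X" "n + 1 \<notin> X" "closed r X" using X by blast
  have FX: "F = (\<Sum>a\<in>outs X. b a)"
    unfolding F_def b_def[symmetric] by (rule flow_value_le(2)[OF res cons X(1,2,3,4)])
  then have FX': "F = cut c X + (\<Sum>v\<in>{0..<n}. if v \<in> S \<and> v \<notin> X then I else 0) + (\<Sum>v\<in>{0..<n}. if v \<in> T \<and> v \<in> X then I else 0)"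
    using X unfolding b_def outs_term_base by simp
  \<comment> \<open>\<open>S\<close> itself is a separating set, and its cut is at most the total
    capacity.\<close>
  have "F < I" using le[of S] cut_le_sum[of c S, OF c(1)] c(2) S(3) by (force simp: separates_def)
  have "separates S T X"
    by (rule terminal_cut(1)[OF I S(1,2) FX' _ \<open>F < I\<close>]) (use cut_nonneg[of c X, OF c(1)] in simp)
  moreover have "cut c X = F"
    by (rule terminal_cut(2)[OF I S(1,2) FX' _ \<open>F < I\<close>]) (use cut_nonneg[of c X, OF c(1)] in simp)
  ultimately show "\<exists>X. separates S T X \<and> cut c X = F" by blast
  then show F0: "0 \<le> F" using cut_nonneg[of c, OF c(1)] by metis
  assume \<tau>: "0 \<le> \<tau>" "\<tau> \<le> F"
  have retA: "ret \<in> A" "ret + M \<in> A" and rvr: "rev_arc ret = ret + M"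
    using edge_bounds M_pos by (auto simp: rev_arc_def)
  have bz: "b ret = 0" "b (ret + M) = 0" by (simp_all add: b_def term_base_def base_simps)
  have r0: "r ret = 0" "r (ret + M) = 0"
  proof -
    note bz
    moreover have "0 \<le> r ret \<and> r ret + r (ret + M) = b ret + b (ret + M)" "0 \<le> r (ret + M)"
      using res retA rvr unfolding residual_def by metis+
    ultimately show "r ret = 0" "r (ret + M) = 0" by auto
  qed
  \<comment> \<open>Only the two return arcs differ from the loaded network: the flow of value
    \<open>F\<close> is sent back through \<open>ret + M\<close>, which it fills, and the slack
    \<open>F - \<tau>\<close> appears on \<open>ret\<close>.\<close>
  let ?b = "term_base c I S T \<tau> F" and ?r = "r(ret := F - \<tau>)"
  have b: "?b a = b a - (if a = ret then \<tau> else 0) + (if a = ret + M then F else 0)" if "a \<in> A" for a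
  proof (cases "a < M")
    case True
    then show ?thesis using that M_pos n0 m0 by (auto simp: b_def term_base_def base_def M_def ret_def)
  next
    case False
    then have "a \<noteq> ret" using edge_bounds by auto
    moreover have "a - M < ret \<or> a = ret + M" using that False by (auto simp: M_def)
    moreover have "m + n \<le> ret" using edge_bounds n0 by auto
    ultimately show ?thesis using False edge_bounds(4,5,7) m0
      by (auto simp: b_def term_base_def base_def ret_def[symmetric])
  qed
  have "residual ?b ?r"
    unfolding residual_def
  proof
    fix a assume a: "a \<in> A"
    have "rev_arc a = ret \<longleftrightarrow> a = ret + M" "rev_arc a = ret + M \<longleftrightarrow> a = ret"
      using rv_eq_iff[OF a retA(1)] rv_eq_iff[OF a retA(2)] rvr rv_rv[OF retA(1)] by auto
    then show "0 \<le> ?r a \<and> ?r a + ?r (rev_arc a) = ?b a + ?b (rev_arc a)"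
      using res a b[OF a] b[OF rvA[OF a]] r0 bz \<tau> M_pos rvr unfolding residual_def by auto
  qed
  moreover have "excess ?b ?r v = 0" if v: "v \<in> V" for v
  proof -
    have "excess ?b ?r v = (\<Sum>a\<in>out_arcs v. (r a - b a) + (if a = ret then F else 0) - (if a = ret + M then F else 0))"
      unfolding excess_def using b r0 M_pos by (intro sum.cong) (auto simp: out_arcs_def)
    also have "\<dots> = excess b r v + (if v = n then F else 0) - (if v = n + 1 then F else 0)"
    proof -
      have "ret \<in> out_arcs v \<longleftrightarrow> v = n" "ret + M \<in> out_arcs v \<longleftrightarrow> v = n + 1"
        using retA by (auto simp: out_arcs_def tl_simps)
      then show ?thesis by (simp add: sum.distrib sum_subtractf excess_def)
    qed
    also have "\<dots> = 0"
    proof (cases "v \<in> {0..<n}")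
      case True then show ?thesis using cons[OF True] by auto
    next
      case False
      then have "v = n \<or> v = n + 1" using v by auto
      then show ?thesis using excess_source[OF res cons] by (auto simp: F_def b_def)
    qed
    finally show ?thesis .
  qed
  ultimately show "circulation c I S T \<tau> F ?r" by (simp add: circulation_def)
qed

text \<open>The lower bound makes the circulation a certificate: what comes back on the return arc
  has to cross every separating cut.\<close>

lemma circulation_cut:
  assumes circ: "circulation c I S T \<tau> F r" and S: "0 < I" "S \<subseteq> {0..<n}" "T \<subseteq> {0..<n}" and Y: "separates S T Y"
  shows "\<tau> \<le> cut c Y"
proof -
  let ?Y = "insert n (Y \<inter> {0..<n})" and ?b = "term_base c I S T \<tau> F"
  have "- (\<Sum>a\<in>outs ?Y. ?b a) \<le> (\<Sum>v\<in>?Y. excess ?b r v)"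
    by (rule cut_value_bound) (use circ n0 in \<open>auto simp: circulation_def\<close>)
  also have "\<dots> = 0" using circ n0 by (intro sum.neutral) (auto simp: circulation_def)
  finally have "0 \<le> (\<Sum>a\<in>outs ?Y. ?b a)" by simp
  also have "\<dots> = cut c Y - \<tau>" by (rule outs_separating[OF S Y])
  finally show ?thesis by simp
qed

text \<open>Nothing leaves \<open>X\<close> on balance, so the capacities leaving a closed
  \<open>X\<close> sum to 0. The edge \<open>e\<close> contributes a positive amount, which only the
  return arc with capacity \<open>- \<tau>\<close> can compensate; hence the source lies in
  \<open>X\<close> and the sink does not.\<close>

lemma circulation_tight_cut:
  assumes circ: "circulation c I S T \<tau> F r" and S: "S \<subseteq> {0..<n}" "T \<subseteq> {0..<n}"
    and c: "\<And>e. 0 \<le> e \<Longrightarrow> e < m \<Longrightarrow> 0 \<le> c e" and I: "0 \<le> \<tau>" "\<tau> < I" "0 \<le> F"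
    and X: "closed r X" "X \<subseteq> V" and e: "0 \<le> e" "e < m" "(us e \<in> X) \<noteq> (vs e \<in> X)" "0 < c e"
  shows "separates S T X \<and> cut c X = \<tau>"
proof -
  let ?b = "term_base c I S T \<tau> F"
  have I0: "0 < I" using I by simp
  have "(\<Sum>v\<in>X. excess ?b r v) = 0" using circ X(2) by (intro sum.neutral) (auto simp: circulation_def)
  then have s: "(\<Sum>a\<in>outs X. ?b a) = 0"
    using closed_value[of ?b r X] X circ by (simp add: circulation_def)
  have "c e \<le> cut c X"
  proof -
    have "(if (us e \<in> X) \<noteq> (vs e \<in> X) then c e else 0) \<le> cut c X"
      unfolding cut_def by (rule member_le_sum) (use e c in auto)
    then show ?thesis using e by simp
  qed
  then have pos: "0 < cut c X" using e by simp
  note t = terminal_sum(1,2,3)[OF I0 S(1), of "\<lambda>v. v \<notin> X"] terminal_sum(1,2,3)[OF I0 S(2), of "\<lambda>v. v \<in> X"]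
  have nX: "n \<in> X \<and> n + 1 \<notin> X"
    using s pos t(1,4) I unfolding outs_term_base by (auto split: if_splits)
  then have eq: "cut c X + (\<Sum>v\<in>{0..<n}. if v \<in> S \<and> v \<notin> X then I else 0)
     + (\<Sum>v\<in>{0..<n}. if v \<in> T \<and> v \<in> X then I else 0) = \<tau>"
    using s unfolding outs_term_base by simp
  show ?thesis using terminal_cut[OF I0 S eq[symmetric] _ I(2)] pos by simp
qed

definition cut_flow_cost :: int where
  "cut_flow_cost = flow_cost + 100 * (M + n) + 100"

text \<open>The circulation is provided for every lower bound \<open>t\<close>, because the common
  minimum over both kinds of cuts is known only after both flows.\<close>

lemma wp_cut_flow:
  assumes mem: "mem \<sigma>" and q: "q \<notin> {3, 4, 5, 6, 10, 11, 12, 13, 14, 15, 16}"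
    and x: "{x, x', y, y'} \<inter> {50} = {}"
    and S: "S = {regs \<sigma> x, regs \<sigma> x'}" "T = {regs \<sigma> y, regs \<sigma> y'}"
    and ST: "S \<subseteq> {0..<n}" "T \<subseteq> {0..<n}" "S \<inter> T = {}"
    and c: "\<And>e. 0 \<le> e \<Longrightarrow> e < m \<Longrightarrow> 0 \<le> c e" "(\<Sum>e\<in>{0..<m}. c e) < regs \<sigma> 9"
      "\<And>e. 0 \<le> e \<Longrightarrow> e < m \<Longrightarrow> arrs \<sigma> 13 e = c e \<and> arrs \<sigma> 14 e = c e"
  shows "wp (cut_flow q x x' y y') (\<lambda>\<tau> k. (0 \<le> arrs \<tau> 10 (n + 1) \<and>
      (\<exists>X. separates S T X \<and> cut c X = arrs \<tau> 10 (n + 1)) \<and>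
      (\<forall>Y. separates S T Y \<longrightarrow> arrs \<tau> 10 (n + 1) \<le> cut c Y) \<and>
      (\<forall>t. 0 \<le> t \<and> t \<le> arrs \<tau> 10 (n + 1) \<longrightarrow>
         circulation c (regs \<sigma> 9) S T t (arrs \<tau> 10 (n + 1)) ((arrs \<tau> q)(ret := arrs \<tau> 10 (n + 1) - t)))) \<and> 0 \<le> k)
    \<sigma> cut_flow_cost"
proof -
  define I where "I = regs \<sigma> 9"
  note m = memD[OF mem]
  have mM: "m + 2 * n \<le> M" by (auto simp: M_def ret_def)
  have I0: "0 < I" using c(2) sum_nonneg[of "{0..<m}" c] c(1) unfolding I_def by fastforce
  show ?thesis
    unfolding cut_flow_def wp_Seq
    apply (rule wp_for[where T = 10 and I = "\<lambda>i \<tau>. \<forall>v. 0 \<le> v \<and> v < i \<longrightarrow> arrs \<tau> 15 v = 0 \<and> arrs \<tau> 16 v = 0"])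
            apply (use n0 in \<open>simp_all add: m\<close>)[7]
    subgoal by auto
    subgoal premises p1 for \<tau>1 k1
      unfolding wp_Update
      apply (rule wp_spec[OF wp_load])
          apply (use q x in \<open>simp_all add: m agree_regs[OF p1(2)]\<close>)[4]
      subgoal premises p2 for \<tau>2 k2
      proof -
        have r: "regs \<tau>1 x = regs \<sigma> x" "regs \<tau>1 x' = regs \<sigma> x'" "regs \<tau>1 y = regs \<sigma> y" "regs \<tau>1 y' = regs \<sigma> y'"
          "regs \<tau>1 9 = I" using x by (auto simp: agree_regs[OF p1(2)] I_def)
        have mem2: "mem \<tau>2"
          by (rule mem_cong[OF mem])
            (use q in \<open>simp_all add: agree_regs[OF p1(2)] agree_arrs[OF p1(2)] agree_regs[OF p2(2)] agree_arrs[OF p2(2)]\<close>)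
        have b: "arrs \<tau>2 q a = term_base c I S T 0 0 a" if aA: "a \<in> A" for a
        proof -
          have z: "arrs \<tau>1 15 v = 0" "arrs \<tau>1 16 v = 0" if "0 \<le> v" "v < n" for v using p1(1) that m by auto
          have cc: "arrs \<tau>1 13 e = c e" "arrs \<tau>1 14 e = c e" if "0 \<le> e" "e < m" for e
            using c(3) that by (simp_all add: agree_arrs[OF p1(2)])
          have "0 \<le> a" "a < 2 * M" using aA by auto
          then show ?thesis
            using p2(1)[rule_format, OF aA] S
            by (cases a rule: edge_cases) (auto simp: term_base_def base_simps z cc r)
        qed
        have b0: "\<forall>a\<in>A. 0 \<le> arrs \<tau>2 q a"
        proof
          fix a assume aA: "a \<in> A"
          then have "0 \<le> a" "a < 2 * M" by auto
          then show "0 \<le> arrs \<tau>2 q a"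
            unfolding b[OF aA]
            by (cases a rule: edge_cases) (use c I0 in \<open>auto simp: term_base_def base_simps\<close>)
        qed
        have q3: "q \<notin> {3, 4, 5, 6, 10, 11, 12}" using q by auto
        have k2: "flow_cost \<le> k2"
          using p1(3) p2(3) mM n0 m0 M_pos by (simp add: cut_flow_cost_def m)
        show ?thesis
        proof (rule wp_spec[OF wp_maxflow[OF mem2 q3 b0]], elim conjE)
          fix \<tau> k assume a: "residual (arrs \<tau>2 q) (arrs \<tau> q)"
            "\<forall>v\<in>{0..<n}. excess (arrs \<tau>2 q) (arrs \<tau> q) v = 0"
            "arrs \<tau> 10 (n + 1) = excess (arrs \<tau>2 q) (arrs \<tau> q) (n + 1)"
            "\<exists>X\<subseteq>V. n \<in> X \<and> n + 1 \<notin> X \<and> closed (arrs \<tau> q) X" "k2 - flow_cost \<le> k"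
          have ex: "excess (arrs \<tau>2 q) (arrs \<tau> q) v = excess (term_base c I S T 0 0) (arrs \<tau> q) v" for v
            by (rule excess_cong) (rule b)
          have res: "residual (term_base c I S T 0 0) (arrs \<tau> q)"
            using a(1) residual_cong[of "arrs \<tau>2 q" "term_base c I S T 0 0" "arrs \<tau> q"] b by blast
          have cons: "\<And>v. v \<in> {0..<n} \<Longrightarrow> excess (term_base c I S T 0 0) (arrs \<tau> q) v = 0"
            using a(2) ex by metis
          have X: "\<exists>X. X \<subseteq> V \<and> n \<in> X \<and> n + 1 \<notin> X \<and> closed (arrs \<tau> q) X" using a(4) by blast
          note mf = maximum_flow_cut[OF c(1) c(2)[folded I_def] ST res cons X]
          show "(0 \<le> arrs \<tau> 10 (n + 1) \<and>
            (\<exists>X. separates S T X \<and> cut c X = arrs \<tau> 10 (n + 1)) \<and>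
            (\<forall>Y. separates S T Y \<longrightarrow> arrs \<tau> 10 (n + 1) \<le> cut c Y) \<and>
            (\<forall>t. 0 \<le> t \<and> t \<le> arrs \<tau> 10 (n + 1) \<longrightarrow>
               circulation c (regs \<sigma> 9) S T t (arrs \<tau> 10 (n + 1)) ((arrs \<tau> q)(ret := arrs \<tau> 10 (n + 1) - t)))) \<and> 0 \<le> k"
            unfolding a(3) ex I_def[symmetric] using mf a(5) k2 by auto
        qed
      qed
      done
    done
qed

end

section \<open>Lowering capacities without lowering the minimum cut\<close>

section \<open>Reducing the capacities\<close>

definition augment :: "nat \<Rightarrow> com" where
  "augment q = While (Not (Equal (Reg 43) (Reg 20)))
     (Assign 44 (Elem 8 (Reg 43)) ;; Update q (Reg 44) (Minus (Elem q (Reg 44)) (Num 1)) ;;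
      Assign 45 (Elem 4 (Reg 44)) ;; Update q (Reg 45) (Plus (Elem q (Reg 45)) (Num 1)) ;;
      Assign 43 (Elem 3 (Reg 45)))"

definition shift_edge :: "nat \<Rightarrow> int \<Rightarrow> com" where
  "shift_edge q k =
     (Update q (Reg 40) (Plus (Elem q (Reg 40)) (Num k)) ;;
      Update q (Plus (Reg 40) (Reg 7)) (Plus (Elem q (Plus (Reg 40) (Reg 7))) (Num k)))"

text \<open>Tries to lower the capacity of the edge in register 40 by one; register 41 tells the outcome.\<close>

definition try_reduce :: "nat \<Rightarrow> com" where
  "try_reduce q =
     (Assign 41 (Num 1) ;;
      If (And (Less (Num 0) (Elem q (Reg 40))) (Less (Num 0) (Elem q (Plus (Reg 40) (Reg 7))))) Skip
        (If (Less (Num 0) (Elem q (Reg 40))) (Assign 42 (Plus (Reg 40) (Reg 7))) (Assign 42 (Reg 40)) ;;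
         Assign 20 (Elem 3 (Elem 4 (Reg 42))) ;; search q ;; Assign 43 (Elem 3 (Reg 42)) ;;
         If (Equal (Elem 7 (Reg 43)) (Num 0)) (Assign 41 (Num 0))
           (augment q ;; Update q (Reg 42) (Plus (Elem q (Reg 42)) (Num 1)) ;;
            Assign 45 (Elem 4 (Reg 42)) ;; Update q (Reg 45) (Minus (Elem q (Reg 45)) (Num 1)))) ;;
      If (Equal (Reg 41) (Num 1)) (shift_edge q (-1)) Skip)"

text \<open>Both circulations have to admit the lowering. If the second one refuses, the first is
  repaired by shifting both residuals of the edge back, without another search.\<close>

definition reduce_edge :: com where
  "reduce_edge =
     (If (Less (Num 0) (Elem 2 (Reg 40)))
        (try_reduce 20 ;;
         If (Equal (Reg 41) (Num 1))
           (try_reduce 21 ;; If (Equal (Reg 41) (Num 1)) Skip (shift_edge 20 1)) Skip)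
        (Assign 41 (Num 0)) ;;
      If (Equal (Reg 41) (Num 1))
        (Update 2 (Reg 40) (Minus (Elem 2 (Reg 40)) (Num 1)) ;; Update 17 (Reg 40) (Num 1))
        (Update 17 (Reg 40) (Num 0)))"

lemma written_augment [simp]:
  "written_regs (augment q) = {43, 44, 45}" "written_arrs (augment q) = {q}"
  by (auto simp: augment_def)

lemma written_shift_edge [simp]:
  "written_regs (shift_edge q k) = {}" "written_arrs (shift_edge q k) = {q}"
  by (auto simp: shift_edge_def)

lemma written_try_reduce [simp]:
  "written_regs (try_reduce q) = {20, 21, 22, 23, 24, 25, 41, 42, 43, 44, 45}"
  "written_arrs (try_reduce q) = {q, 7, 8, 9}"
  by (auto simp: try_reduce_def)

lemma written_reduce_edge [simp]:
  "written_regs reduce_edge = {20, 21, 22, 23, 24, 25, 41, 42, 43, 44, 45}"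
  "written_arrs reduce_edge = {2, 7, 8, 9, 17, 20, 21}"
  by (auto simp: reduce_edge_def)

lemma wp_Seq_fun: "wp (Seq C D) Q = wp C (wp D Q)"
  by (intro ext) simp

context arc_graph
begin

text \<open>State of an augmentation that walks from \<open>y\<close> back to the root
  \<open>x\<close> and stands at \<open>w\<close>: the part from \<open>w\<close> to
  \<open>y\<close> has been pushed, and the tree arcs still ahead have lost nothing. The last clause
  protects an arc that enters the root and hence lies on no tree path.\<close>

definition augmenting ::
  "('a \<Rightarrow> int) \<Rightarrow> ('a \<Rightarrow> int) \<Rightarrow> 'v \<Rightarrow> 'v \<Rightarrow> ('v \<Rightarrow> int) \<Rightarrow> ('v \<Rightarrow> 'a) \<Rightarrow> 'a \<Rightarrow> 'v \<Rightarrow> ('a \<Rightarrow> int) \<Rightarrow> bool" where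
  "augmenting b r x y rk par a w r' \<longleftrightarrow>
     residual b r' \<and> w \<in> V \<and> 0 < rk w \<and>
     (\<forall>v\<in>V. excess b r' v = excess b r v + of_bool (v = y) - of_bool (v = w)) \<and>
     (\<forall>z\<in>V. 0 < rk z \<and> rk z \<le> rk w \<and> z \<noteq> x \<longrightarrow> r (par z) \<le> r' (par z)) \<and> r a \<le> r' a"

lemma augmenting_step:
  assumes st: "search_tree r x rk par" and aug: "augmenting b r x y rk par a w r'" and w: "w \<noteq> x"
    and a: "a \<in> A" "head a = x"
  shows "augmenting b r x y rk par a (tail (par w)) (push (par w) 1 r')"
    and "par w \<in> A" "rk (tail (par w)) < rk w"
proof -
  let ?p = "par w"
  have wV: "w \<in> V" "0 < rk w" using aug by (auto simp: augmenting_def)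
  then show p: "?p \<in> A" and lt: "rk (tail ?p) < rk w"
    using st w unfolding search_tree_def by blast+
  have p': "head ?p = w" "0 < r ?p" "0 < rk (tail ?p)" using st w wV unfolding search_tree_def by blast+
  have "r ?p \<le> r' ?p" using aug wV w unfolding augmenting_def by blast
  then have res: "residual b (push ?p 1 r')"
    using p p' aug by (intro residual_push) (auto simp: augmenting_def)
  have ge: "r' c \<le> push ?p 1 r' c" if "c \<in> A" "c \<noteq> ?p" for c
    using that p by (simp add: push_apply)
  have tr: "r (par z) \<le> push ?p 1 r' (par z)" if z: "z \<in> V" "0 < rk z" "rk z \<le> rk (tail ?p)" "z \<noteq> x" for z
  proof -
    have "par z \<in> A" "head (par z) = z" using st z unfolding search_tree_def by blast+
    moreover have "z \<noteq> w" using z lt by auto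
    ultimately have "par z \<in> A" "par z \<noteq> ?p" using p' by auto
    moreover have "r (par z) \<le> r' (par z)" using aug z lt unfolding augmenting_def by auto
    ultimately show ?thesis using ge[of "par z"] by linarith
  qed
  have "r a \<le> r' a" using aug by (simp add: augmenting_def)
  moreover have "a \<noteq> ?p" using a p' w by auto
  ultimately have ra: "r a \<le> push ?p 1 r' a" using ge[OF a(1)] by linarith
  have ex: "excess b (push ?p 1 r') v = excess b r v + of_bool (v = y) - of_bool (v = tail ?p)" if "v \<in> V" for v
  proof -
    have "excess b r' v = excess b r v + of_bool (v = y) - of_bool (v = w)"
      using aug that unfolding augmenting_def by blast
    then show ?thesis using p' p by (simp add: excess_push)
  qed
  show "augmenting b r x y rk par a (tail ?p) (push ?p 1 r')"
    unfolding augmenting_def using res p p' tr ra ex by auto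
qed

end

context network
begin

lemma wp_augment:
  assumes mem: "mem \<sigma>" and q: "q \<notin> {3, 4, 5, 6, 7, 8, 9}"
    and st: "search_tree r x (arrs \<sigma> 7) (arrs \<sigma> 8)" and x: "regs \<sigma> 20 = x"
    and aug: "augmenting b r x y (arrs \<sigma> 7) (arrs \<sigma> 8) a (regs \<sigma> 43) (arrs \<sigma> q)"
    and a: "a \<in> A" "head a = x"
  shows "wp (augment q) (\<lambda>\<tau> k. augmenting b r x y (arrs \<sigma> 7) (arrs \<sigma> 8) a x (arrs \<tau> q) \<and> 0 \<le> k) \<sigma> (30 * (n + 2) + 10)"
proof -
  have rk: "arrs \<sigma> 7 v \<le> n + 2" if "v \<in> V" for v
    using st that card_V unfolding search_tree_def by auto
  have q': "q \<noteq> 3" "q \<noteq> 4" "q \<noteq> 7" "q \<noteq> 8" using q by auto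
  let ?I = "\<lambda>\<tau> k. augmenting b r x y (arrs \<sigma> 7) (arrs \<sigma> 8) a (regs \<tau> 43) (arrs \<tau> q) \<and>
    30 * arrs \<sigma> 7 (regs \<tau> 43) + 10 \<le> k"
  show ?thesis
    unfolding augment_def
  proof (rule wp_While[where I = ?I], goal_cases)
    case 1
    have "arrs \<sigma> 7 (regs \<sigma> 43) \<le> n + 2" using aug by (intro rk) (auto simp: augmenting_def)
    then show ?case using aug by simp
  next
    case (2 \<tau> k) then show ?case by (auto simp: augmenting_def)
  next
    case (3 \<tau> k)
    have mem': "mem \<tau>" by (rule mem_cong[OF mem]) (use q' q in \<open>simp_all add: agree_regs[OF 3(2)] agree_arrs[OF 3(2)]\<close>)
    have e: "arrs \<tau> 8 = arrs \<sigma> 8" "regs \<tau> 20 = x" using q' x by (simp_all add: agree_regs[OF 3(2)] agree_arrs[OF 3(2)])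
    define w p where "w = regs \<tau> 43" and "p = arrs \<sigma> 8 w"
    have wx: "w \<noteq> x" using 3(3) e by (simp add: w_def)
    have au: "augmenting b r x y (arrs \<sigma> 7) (arrs \<sigma> 8) a w (arrs \<tau> q)" using 3(1) by (simp add: w_def)
    note s = augmenting_step[OF st au wx a, folded p_def]
    have p0: "0 \<le> p" "p < 2 * M" using s(2) by auto
    have "push p 1 (arrs \<tau> q) = (arrs \<tau> q)(p := arrs \<tau> q p - 1, rev_arc p := arrs \<tau> q (rev_arc p) + 1)"
      by (simp add: push_def)
    then show ?case using 3(1) s(1,3) q' p0 by (simp add: memD[OF mem'] e w_def[symmetric] p_def[symmetric])
  next
    case (4 \<tau> k)
    have "regs \<tau> 20 = x" using x by (simp add: agree_regs[OF 4(2)])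
    then show ?case using 4 by (auto simp: augmenting_def)
  qed
qed

lemma wp_shift_edge:
  assumes "mem \<sigma>" "regs \<sigma> 40 = e"
  shows "wp (shift_edge q \<delta>) Q \<sigma> k \<longleftrightarrow>
    Q (\<sigma>\<lparr>arrs := (arrs \<sigma>)(q := (arrs \<sigma> q)(e := arrs \<sigma> q e + \<delta>, e + M := arrs \<sigma> q (e + M) + \<delta>))\<rparr>) (k - 16)"
  using assms(2) M_pos by (simp add: shift_edge_def memD[OF assms(1)])

lemma term_base_shift:
  assumes "0 \<le> e" "e < m" "a \<in> A"
  shows "term_base (c(e := c e + \<delta>)) I S T \<tau> F a = term_base c I S T \<tau> F a + (if a = e \<or> a = e + M then \<delta> else 0)"
  using assms M_pos edge_bounds by (auto simp: term_base_def base_def)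

text \<open>Changing a capacity by \<delta> changes both residuals of the edge alike, so the flow
  itself stays the same.\<close>

lemma circulation_shift:
  assumes circ: "circulation c I S T \<tau> F r" and e: "0 \<le> e" "e < m" and r: "0 \<le> r e + \<delta>" "0 \<le> r (e + M) + \<delta>"
  shows "circulation (c(e := c e + \<delta>)) I S T \<tau> F (r(e := r e + \<delta>, e + M := r (e + M) + \<delta>))"
proof -
  let ?b = "term_base (c(e := c e + \<delta>)) I S T \<tau> F" and ?r = "r(e := r e + \<delta>, e + M := r (e + M) + \<delta>)"
  let ?f = "\<lambda>a. if a = e \<or> a = e + M then \<delta> else 0"
  have eA: "e \<in> A" "rev_arc e = e + M" using e edge_bounds by (auto simp: rev_arc_def)
  have b: "?b a = term_base c I S T \<tau> F a + ?f a" if "a \<in> A" for a by (rule term_base_shift[OF e that])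
  have r': "?r a = r a + ?f a" for a using M_pos by auto
  have f: "?f (rev_arc a) = ?f a" if "a \<in> A" for a
    using rv_eq_iff[OF that eA(1)] rv_rv[OF eA(1)] eA(2) rv_rv[OF that] by metis
  have "residual ?b ?r"
    unfolding residual_def
  proof
    fix a assume a: "a \<in> A"
    have "0 \<le> r a" "r a + r (rev_arc a) = term_base c I S T \<tau> F a + term_base c I S T \<tau> F (rev_arc a)"
      using circ a unfolding circulation_def residual_def by blast+
    then show "0 \<le> ?r a \<and> ?r a + ?r (rev_arc a) = ?b a + ?b (rev_arc a)"
      unfolding b[OF a] b[OF rvA[OF a]] r' f[OF a] using r by auto
  qed
  moreover have "excess ?b ?r v = excess (term_base c I S T \<tau> F) r v" for v
    unfolding excess_def by (rule sum.cong) (auto simp: b r' out_arcs_def simp del: fun_upd_apply)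
  ultimately show ?thesis using circ by (simp add: circulation_def)
qed

definition reduce_cost :: int where
  "reduce_cost = search_cost + 30 * (n + 2) + 150"

text \<open>Lowering requires slack in both directions of the edge. If one direction is saturated, a
  unit of its flow is rerouted along a residual path from its tail to its head. If there is no such
  path, the reached set is closed and crossed by the edge, hence a tight cut.\<close>

lemma wp_try_reduce:
  assumes mem: "mem \<sigma>" and q: "q \<notin> {3, 4, 5, 6, 7, 8, 9}"
    and e: "regs \<sigma> 40 = e" "0 \<le> e" "e < m" "0 < c e"
    and circ: "circulation c I S T \<tau> F (arrs \<sigma> q)"
    and S: "S \<subseteq> {0..<n}" "T \<subseteq> {0..<n}"
    and c: "\<And>e. 0 \<le> e \<Longrightarrow> e < m \<Longrightarrow> 0 \<le> c e" and I: "0 \<le> \<tau>" "\<tau> < I" "0 \<le> F"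
  shows "wp (try_reduce q) (\<lambda>\<tau>' k.
     (regs \<tau>' 41 = 1 \<and> circulation (c(e := c e - 1)) I S T \<tau> F (arrs \<tau>' q) \<or>
      regs \<tau>' 41 = 0 \<and> circulation c I S T \<tau> F (arrs \<tau>' q) \<and>
        (\<exists>X. separates S T X \<and> cut c X = \<tau> \<and> (us e \<in> X) \<noteq> (vs e \<in> X))) \<and> 0 \<le> k) \<sigma> reduce_cost"
proof -
  note m = memD[OF mem]
  have q': "q \<noteq> 3" "q \<noteq> 4" "q \<noteq> 5" "q \<noteq> 6" "q \<noteq> 7" "q \<noteq> 8" "q \<noteq> 9" using q by auto
  define r where "r = arrs \<sigma> q"
  define b where "b = term_base c I S T \<tau> F"
  have eA: "e \<in> A" "rev_arc e = e + M" "e + M \<in> A" "rev_arc (e + M) = e"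
    using e edge_bounds by (auto simp: rev_arc_def)
  have be: "b e = c e" "b (e + M) = c e" using e by (simp_all add: b_def term_base_def base_simps)
  have res: "residual b r" and ex: "\<And>v. v \<in> V \<Longrightarrow> excess b r v = 0"
    using circ by (auto simp: circulation_def b_def r_def)
  have re: "0 \<le> r e" "0 \<le> r (e + M)" "r e + r (e + M) = 2 * c e"
  proof -
    have "0 \<le> r e \<and> r e + r (rev_arc e) = b e + b (rev_arc e)" "0 \<le> r (e + M)"
      using res eA(1,3) unfolding residual_def by blast+
    then show "0 \<le> r e" "0 \<le> r (e + M)" "r e + r (e + M) = 2 * c e" using eA be by auto
  qed
  have sc: "0 \<le> search_cost" using M_pos n0 by (simp add: search_cost_def)
  show ?thesis
  proof (cases "0 < r e \<and> 0 < r (e + M)")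
    case True
    then show ?thesis
      using circulation_shift[OF circ e(2,3), of "-1"] sc n0 M_pos
      by (auto simp: try_reduce_def shift_edge_def e m r_def reduce_cost_def)
  next
    case False
    \<comment> \<open>\<open>a\<close> is the saturated direction. Both residuals sum to
      \<open>2 * c e\<close>, so the opposite one is at least 2 and can give up two units: one for
      the cancelled flow and one for the lowered capacity.\<close>
    define a where "a = (if 0 < r e then e + M else e)"
    have a: "a \<in> A" "r a = 0" "2 \<le> r (rev_arc a)" "a = e \<or> a = e + M"
      using eA re e False by (auto simp: a_def)
    have a0: "0 \<le> a" "a < 2 * M" using a by auto
    define \<sigma>1 where "\<sigma>1 = \<sigma>\<lparr>regs := (regs \<sigma>)(41 := 1, 42 := a, 20 := tl a)\<rparr>"
    have m1: "mem \<sigma>1" by (rule mem_cong[OF mem]) (simp_all add: \<sigma>1_def)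
    have start: "wp (try_reduce q) Q \<sigma> k \<longleftrightarrow>
       wp (search q) (wp (Assign 43 (Elem 3 (Reg 42)) ;;
         If (Equal (Elem 7 (Reg 43)) (Num 0)) (Assign 41 (Num 0))
           (augment q ;; Update q (Reg 42) (Plus (Elem q (Reg 42)) (Num 1)) ;;
            Assign 45 (Elem 4 (Reg 42)) ;; Update q (Reg 45) (Minus (Elem q (Reg 45)) (Num 1))))
         (wp (If (Equal (Reg 41) (Num 1)) (shift_edge q (-1)) Skip) Q)) \<sigma>1 (k - (if 0 < r e then 27 else 25))" for Q k
      unfolding try_reduce_def using False a0 edge_bounds e
      by (auto simp: e m r_def[symmetric] a_def \<sigma>1_def fun_upd_twist split: if_splits)
    show ?thesis
      unfolding start
    proof (rule wp_spec[OF wp_search[OF m1 _ q]], goal_cases)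
      case 1
      then show ?case using a0 by (simp add: \<sigma>1_def)
    next
      case (2 \<sigma>2 k2)
      have r1: "regs \<sigma>1 20 = tl a" "arrs \<sigma>1 q = r" by (simp_all add: \<sigma>1_def r_def)
      note st = 2(1)[unfolded r1]
      have r2: "regs \<sigma>2 20 = tl a" "regs \<sigma>2 40 = e" "regs \<sigma>2 41 = 1" "regs \<sigma>2 42 = a" "arrs \<sigma>2 q = r"
        using agree_regs[OF 2(2)] agree_arrs[OF 2(2), of q] q' e by (auto simp: \<sigma>1_def r_def)
      have m2: "mem \<sigma>2" by (rule mem_cong[OF m1]) (simp_all add: agree_regs[OF 2(2)] agree_arrs[OF 2(2)])
      have k2: "30 * (n + 2) + 100 \<le> k2" using 2(3) by (simp add: reduce_cost_def split: if_splits)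
      show ?case
      proof (cases "arrs \<sigma>2 7 (head a) = 0")
        case True
        let ?X = "{v \<in> V. 0 < arrs \<sigma>2 7 v}"
        have cl: "closed r ?X" "tl a \<in> ?X" using st by (auto simp: search_tree_def)
        have "head a \<notin> ?X" using True by auto
        then have cr: "(us e \<in> ?X) \<noteq> (vs e \<in> ?X)"
          using a(4) cl(2) e by (auto simp: tl_simps head_simps)
        have "separates S T ?X \<and> cut c ?X = \<tau>"
          by (rule circulation_tight_cut[OF circ S c I cl(1)[unfolded r_def] _ e(2,3) cr e(4)]) auto
        then show ?thesis
          using True r2 a0 circ cr k2 n0 by (auto simp: memD[OF m2] r_def)
      next
        case False
        let ?y = "head a"
        have rk: "0 < arrs \<sigma>2 7 ?y" using st False headV[OF a(1)] unfolding search_tree_def by force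
        have aug0: "augmenting b r (tl a) ?y (arrs \<sigma>2 7) (arrs \<sigma>2 8) (rev_arc a) ?y r"
          using res rk headV[OF a(1)] by (auto simp: augmenting_def)
        define \<sigma>3 where "\<sigma>3 = \<sigma>2\<lparr>regs := (regs \<sigma>2)(43 := ?y)\<rparr>"
        have m3: "mem \<sigma>3" by (rule mem_cong[OF m2]) (simp_all add: \<sigma>3_def)
        have r3: "regs \<sigma>3 20 = tl a" "regs \<sigma>3 43 = ?y" "arrs \<sigma>3 = arrs \<sigma>2" "regs \<sigma>3 42 = a"
          "regs \<sigma>3 40 = e" "regs \<sigma>3 41 = 1" using r2 by (simp_all add: \<sigma>3_def)
        have "wp (augment q ;; Update q (Reg 42) (Plus (Elem q (Reg 42)) (Num 1)) ;;
            Assign 45 (Elem 4 (Reg 42)) ;; Update q (Reg 45) (Minus (Elem q (Reg 45)) (Num 1)) ;;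
            If (Equal (Reg 41) (Num 1)) (shift_edge q (-1)) Skip)
          (\<lambda>\<tau>' k. (regs \<tau>' 41 = 1 \<and> circulation (c(e := c e - 1)) I S T \<tau> F (arrs \<tau>' q)) \<and> 0 \<le> k) \<sigma>3 (k2 - 8)"
          unfolding wp_Seq
        proof (rule wp_spec[OF wp_augment[OF m3 q, where r = r and x = "tl a" and b = b and y = ?y and a = "rev_arc a"]], goal_cases)
          case (6 \<sigma>4 k4)
          have r4: "regs \<sigma>4 42 = a" "regs \<sigma>4 40 = e" "regs \<sigma>4 41 = 1" using agree_regs[OF 6(2)] r3 by auto
          have m4: "mem \<sigma>4" by (rule mem_cong[OF m3]) (use q' in \<open>simp_all add: agree_regs[OF 6(2)] agree_arrs[OF 6(2)]\<close>)
          let ?r = "arrs \<sigma>4 q" and ?r' = "push (rev_arc a) 1 (arrs \<sigma>4 q)"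
          have R: "residual b ?r" "r (rev_arc a) \<le> ?r (rev_arc a)"
            and X: "\<And>v. v \<in> V \<Longrightarrow> excess b ?r v = of_bool (v = ?y) - of_bool (v = tl a)"
            using 6(1) ex unfolding augmenting_def r3 by auto
          have r'a: "?r' a = ?r a + 1" "?r' (rev_arc a) = ?r (rev_arc a) - 1"
            using a0 by (simp_all add: push_apply)
          have ra0: "0 \<le> ?r a" using R(1) a(1) by (simp add: residual_def)
          have C: "circulation c I S T \<tau> F ?r'"
            unfolding circulation_def b_def[symmetric]
          proof
            show "residual b ?r'" by (rule residual_push[OF R(1)]) (use a R(2) in auto)
            show "\<forall>v\<in>V. excess b ?r' v = 0" using X a0 by (auto simp: excess_push)
          qed
          have pos: "0 \<le> ?r' e + (-1)" "0 \<le> ?r' (e + M) + (-1)"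
            using a(3,4) R(2) r'a ra0 eA by auto
          have up: "(arrs \<sigma>4 q)(a := ?r a + 1, rev_arc a := ?r (rev_arc a) - 1) = ?r'"
            using a0 by (simp add: push_def fun_upd_twist)
          define \<sigma>5 where "\<sigma>5 = \<sigma>4\<lparr>regs := (regs \<sigma>4)(45 := rev_arc a), arrs := (arrs \<sigma>4)(q := ?r')\<rparr>"
          have m5: "mem \<sigma>5" by (rule mem_cong[OF m4]) (use q' in \<open>simp_all add: \<sigma>5_def\<close>)
          have r5: "regs \<sigma>5 40 = e" "regs \<sigma>5 41 = 1" "arrs \<sigma>5 q = ?r'" by (simp_all add: \<sigma>5_def r4)
          have s5: "wp (Update q (Reg 42) (Plus (Elem q (Reg 42)) (Num 1)) ;;
            Assign 45 (Elem 4 (Reg 42)) ;; Update q (Reg 45) (Minus (Elem q (Reg 45)) (Num 1)) ;;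
            If (Equal (Reg 41) (Num 1)) (shift_edge q (-1)) Skip) Q \<sigma>4 k \<longleftrightarrow> wp (shift_edge q (-1)) Q \<sigma>5 (k - 19)" for Q k
            using a0 q' up by (simp add: r4 memD[OF m4] \<sigma>5_def)
          have "wp (shift_edge q (-1)) (\<lambda>\<tau>' k. (regs \<tau>' 41 = 1 \<and> circulation (c(e := c e - 1)) I S T \<tau> F (arrs \<tau>' q)) \<and> 0 \<le> k) \<sigma>5 (k4 - 19)"
            using 6(3) k2 circulation_shift[OF C e(2,3) pos]
            by (simp add: wp_shift_edge[OF m5 r5(1)] r5(2) r5(3)[symmetric])
          then show ?case by (simp only: s5[unfolded wp_Seq_fun] wp_Seq_fun)
        qed (use a0 r3 st aug0 r2 in auto)
        then have "wp (augment q ;; Update q (Reg 42) (Plus (Elem q (Reg 42)) (Num 1)) ;;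
            Assign 45 (Elem 4 (Reg 42)) ;; Update q (Reg 45) (Minus (Elem q (Reg 45)) (Num 1)) ;;
            If (Equal (Reg 41) (Num 1)) (shift_edge q (-1)) Skip)
          (\<lambda>\<tau>' k. (regs \<tau>' 41 = 1 \<and> circulation (c(e := c e - 1)) I S T \<tau> F (arrs \<tau>' q) \<or>
            regs \<tau>' 41 = 0 \<and> circulation c I S T \<tau> F (arrs \<tau>' q) \<and>
            (\<exists>X. separates S T X \<and> cut c X = \<tau> \<and> (us e \<in> X) = (vs e \<notin> X))) \<and> 0 \<le> k) \<sigma>3 (k2 - 8)"
          by (rule wp_agree) simp
        then show ?thesis
          using False r2 r3 a0 by (simp add: memD[OF m2] \<sigma>3_def[symmetric] wp_Seq_fun)
      qed
    qed
  qed
qed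

end

section \<open>Correcting parities by a greedy T-join\<close>

text \<open>Array 18 receives the degrees with respect to the capacities.\<close>

definition set_degrees :: com where
  "set_degrees =
     (for_loop 50 6 (Update 18 (Reg 50) (Num 0)) ;;
      for_loop 50 1
        (Assign 46 (Elem 3 (Plus (Reg 50) (Reg 7))) ;;
         Update 18 (Reg 46) (Plus (Elem 18 (Reg 46)) (Elem 2 (Reg 50))) ;;
         Assign 46 (Elem 3 (Reg 50)) ;;
         Update 18 (Reg 46) (Plus (Elem 18 (Reg 46)) (Elem 2 (Reg 50)))))"

definition mark_edge :: "aexp \<Rightarrow> com" where
  "mark_edge p = (Update 22 p (Num 1) ;; Update 22 (Plus p (Reg 7)) (Num 1))"

text \<open>The edges that may receive an additional unit of capacity.  Two paths through the source and the sink
  join the terminals of each pair.\<close>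

definition mark_edges :: com where
  "mark_edges =
     (for_loop 50 8 (Update 22 (Reg 50) (Num 0)) ;;
      for_loop 50 1
        (Update 22 (Reg 50) (Elem 17 (Reg 50)) ;; Update 22 (Plus (Reg 50) (Reg 7)) (Elem 17 (Reg 50))) ;;
      mark_edge (Plus (Reg 1) (Reg 2)) ;; mark_edge (Plus (Reg 1) (Reg 3)) ;;
      mark_edge (Plus (Plus (Reg 1) (Reg 0)) (Reg 4)) ;; mark_edge (Plus (Plus (Reg 1) (Reg 0)) (Reg 5)))"

text \<open>The edge is deleted before the search, which thus finds the component of its tail
  without the edge. Parity is tested by comparing a number with twice its half; artificial edges
  take part in the pairing but carry no capacity.\<close>

definition join_edge :: com where
  "join_edge =
     (If (Equal (Elem 22 (Reg 40)) (Num 0)) Skip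
        (Update 22 (Reg 40) (Num 0) ;; Update 22 (Plus (Reg 40) (Reg 7)) (Num 0) ;;
         Assign 20 (Elem 3 (Plus (Reg 40) (Reg 7))) ;; search 22 ;; Assign 46 (Num 0) ;;
         for_loop 47 6
           (If (Less (Num 0) (Elem 7 (Reg 47))) (Assign 46 (Plus (Reg 46) (Elem 18 (Reg 47)))) Skip) ;;
         If (Equal (Reg 46) (Plus (Half (Reg 46)) (Half (Reg 46)))) Skip
           (Update 18 (Reg 20) (Plus (Elem 18 (Reg 20)) (Num 1)) ;; Assign 48 (Elem 3 (Reg 40)) ;;
            Update 18 (Reg 48) (Plus (Elem 18 (Reg 48)) (Num 1)) ;;
            If (Less (Reg 40) (Reg 1)) (Update 2 (Reg 40) (Plus (Elem 2 (Reg 40)) (Num 1))) Skip)))"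

lemma written_set_degrees [simp]:
  "written_regs set_degrees = {46, 50}" "written_arrs set_degrees = {18}"
  by (auto simp: set_degrees_def)

lemma written_mark_edge [simp]:
  "written_regs (mark_edge p) = {}" "written_arrs (mark_edge p) = {22}"
  by (auto simp: mark_edge_def)

lemma written_mark_edges [simp]:
  "written_regs mark_edges = {50}" "written_arrs mark_edges = {22}"
  by (auto simp: mark_edges_def)

lemma written_join_edge [simp]:
  "written_regs join_edge = {20, 21, 22, 23, 24, 25, 46, 47, 48}"
  "written_arrs join_edge = {2, 7, 8, 9, 18, 22}"
  by (auto simp: join_edge_def)

lemma half_even: "s = s div 2 + s div 2 \<longleftrightarrow> even (s :: int)"
  by presburger

context network
begin

definition crosses :: "int \<Rightarrow> int set \<Rightarrow> bool" where
  "crosses e X \<longleftrightarrow> (us e \<in> X) \<noteq> (vs e \<in> X)"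

lemma cut_decrease:
  assumes "0 \<le> e" "e < m"
  shows "cut (c(e := c e - 1)) X = cut c X - of_bool (crosses e X)"
  unfolding cut_def using assms by (subst sum_change[where v = e and f = "\<lambda>e. if (us e \<in> X) \<noteq> (vs e \<in> X) then c e else 0"])
    (auto simp: crosses_def)

text \<open>When \<open>P\<close> means separation of both pairs, either alternative forces a biflow
  of value \<tau> to use the whole capacity of \<open>e\<close>, so its parity need not be corrected
  there.\<close>

definition tight :: "(int \<Rightarrow> int) \<Rightarrow> (int set \<Rightarrow> bool) \<Rightarrow> int \<Rightarrow> int \<Rightarrow> bool" where
  "tight c P \<tau> e \<longleftrightarrow> c e = 0 \<or> (\<exists>X. P X \<and> cut c X = \<tau> \<and> crosses e X)"

text \<open>State of the reduction: circulations for both kinds of cuts are kept in arrays 20 and 21.\<close>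

definition reducing :: "int \<Rightarrow> int set \<Rightarrow> int set \<Rightarrow> int set \<Rightarrow> int set \<Rightarrow> int \<Rightarrow> (int \<Rightarrow> int) \<Rightarrow> (int \<Rightarrow> int) \<Rightarrow> (int \<Rightarrow> int) \<Rightarrow> bool" where
  "reducing I S T S' T' \<tau> c r r' \<longleftrightarrow> (\<forall>e. 0 \<le> e \<and> e < m \<longrightarrow> 0 \<le> c e) \<and>
     (\<exists>F. 0 \<le> F \<and> circulation c I S T \<tau> F r) \<and> (\<exists>F. 0 \<le> F \<and> circulation c I S' T' \<tau> F r')"

lemma wp_reduce_edge:
  assumes mem: "mem \<sigma>" and e: "regs \<sigma> 40 = e" "0 \<le> e" "e < m"
    and red: "reducing I S T S' T' \<tau> (arrs \<sigma> 2) (arrs \<sigma> 20) (arrs \<sigma> 21)"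
    and S: "S \<subseteq> {0..<n}" "T \<subseteq> {0..<n}" "S' \<subseteq> {0..<n}" "T' \<subseteq> {0..<n}" and I: "0 \<le> \<tau>" "\<tau> < I"
  defines "P \<equiv> \<lambda>X. separates S T X \<or> separates S' T' X"
  shows "wp reduce_edge (\<lambda>\<tau>' k.
     (reducing I S T S' T' \<tau> (arrs \<tau>' 2) (arrs \<tau>' 20) (arrs \<tau>' 21) \<and>
      (arrs \<tau>' 2 = (arrs \<sigma> 2)(e := arrs \<sigma> 2 e - 1) \<and> arrs \<tau>' 17 = (arrs \<sigma> 17)(e := 1) \<or>
       arrs \<tau>' 2 = arrs \<sigma> 2 \<and> arrs \<tau>' 17 = (arrs \<sigma> 17)(e := 0) \<and> tight (arrs \<sigma> 2) P \<tau> e)) \<and> 0 \<le> k) \<sigma>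
     (2 * reduce_cost + 100)"
proof -
  note m = memD[OF mem]
  define c where "c = arrs \<sigma> 2"
  obtain F F' where c0: "\<And>e. 0 \<le> e \<Longrightarrow> e < m \<Longrightarrow> 0 \<le> c e"
    and F: "0 \<le> F" "circulation c I S T \<tau> F (arrs \<sigma> 20)" and F': "0 \<le> F'" "circulation c I S' T' \<tau> F' (arrs \<sigma> 21)"
    using red by (auto simp: reducing_def c_def)
  have rc: "0 \<le> reduce_cost" using M_pos n0 by (simp add: reduce_cost_def search_cost_def)
  have c1: "0 \<le> (c(e := c e - 1)) x" if "0 < c e" "0 \<le> x" "x < m" for x using c0 that by auto
  show ?thesis
  proof (cases "0 < c e")
    case False
    then have "c e = 0" using c0[of e] e by auto
    then show ?thesis using red rc e by (auto simp: reduce_edge_def c_def tight_def)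
  next
    case True
    show ?thesis
      unfolding reduce_edge_def wp_Seq wp_If
    proof (intro conjI impI, goal_cases)
      case 1
      show ?case
      proof (rule wp_spec[OF wp_try_reduce[OF mem _ e True F(2) S(1,2) c0 I F(1)]], simp, simp, simp, goal_cases)
        case (1 \<sigma>1 k1)
        have m1: "mem \<sigma>1" by (rule mem_cong[OF mem]) (simp_all add: agree_regs[OF 1(2)] agree_arrs[OF 1(2)])
        have a1: "regs \<sigma>1 40 = e" "arrs \<sigma>1 21 = arrs \<sigma> 21" "arrs \<sigma>1 2 = c" "arrs \<sigma>1 17 = arrs \<sigma> 17"
          using e by (simp_all add: agree_regs[OF 1(2)] agree_arrs[OF 1(2)] c_def)
        from 1(1) show ?case
        proof (elim disjE conjE)
          assume z: "regs \<sigma>1 41 = 0" "circulation c I S T \<tau> F (arrs \<sigma>1 20)"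
            "\<exists>X. separates S T X \<and> cut c X = \<tau> \<and> (us e \<in> X) \<noteq> (vs e \<in> X)"
          have "tight c P \<tau> e" using z(3) unfolding tight_def P_def crosses_def by auto
          moreover have "reducing I S T S' T' \<tau> c (arrs \<sigma>1 20) (arrs \<sigma>1 21)"
            unfolding reducing_def a1 using z(2) c0 F(1) F' by blast
          ultimately show ?thesis using z(1) a1 1(3) rc by (simp add: c_def[symmetric])
        next
          assume z: "regs \<sigma>1 41 = 1" "circulation (c(e := c e - 1)) I S T \<tau> F (arrs \<sigma>1 20)"
          show ?thesis
          proof (intro conjI impI, goal_cases)
            case 1
            show ?case
          proof (rule wp_spec[OF wp_try_reduce[OF m1 _ a1(1) e(2,3) True F'(2)[folded a1(2)] S(3,4) c0 I F'(1)]], simp, simp, simp, goal_cases)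
            case (1 \<sigma>2 k2)
            have m2: "mem \<sigma>2" by (rule mem_cong[OF m1]) (simp_all add: agree_regs[OF 1(2)] agree_arrs[OF 1(2)])
            have a2: "regs \<sigma>2 40 = e" "arrs \<sigma>2 20 = arrs \<sigma>1 20" "arrs \<sigma>2 2 = c" "arrs \<sigma>2 17 = arrs \<sigma> 17"
              using a1 by (simp_all add: agree_regs[OF 1(2)] agree_arrs[OF 1(2)])
            have k2: "60 \<le> k2" using 1(3) \<open>2 * reduce_cost + 100 - 1 - int (bcost (Less (Num 0) (Elem 2 (Reg 40)))) - reduce_cost \<le> k1\<close> by simp
            from 1(1) show ?case
            proof (elim disjE conjE)
              assume y: "regs \<sigma>2 41 = 1" "circulation (c(e := c e - 1)) I S' T' \<tau> F' (arrs \<sigma>2 21)"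
              have "reducing I S T S' T' \<tau> (c(e := c e - 1)) (arrs \<sigma>2 20) (arrs \<sigma>2 21)"
                unfolding reducing_def a2 using z(2) y(2) c1[OF True] F(1) F'(1) by blast
              then show ?thesis using y(1) a2 k2 by (simp add: c_def[symmetric])
            next
              assume y: "regs \<sigma>2 41 = 0" "circulation c I S' T' \<tau> F' (arrs \<sigma>2 21)"
                "\<exists>X. separates S' T' X \<and> cut c X = \<tau> \<and> (us e \<in> X) \<noteq> (vs e \<in> X)"
              have t: "tight c P \<tau> e" using y(3) unfolding tight_def P_def crosses_def by auto
              let ?r = "arrs \<sigma>1 20"
              have eA: "e \<in> A" "e + M \<in> A" using e edge_bounds by auto
              then have r0: "0 \<le> ?r e" "0 \<le> ?r (e + M)"
                using z(2) unfolding circulation_def residual_def by blast+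
              then have C: "circulation c I S T \<tau> F (?r(e := ?r e + 1, e + M := ?r (e + M) + 1))"
                using circulation_shift[OF z(2) e(2,3), of 1] by simp
              have "reducing I S T S' T' \<tau> c (?r(e := ?r e + 1, e + M := ?r (e + M) + 1)) (arrs \<sigma>2 21)"
                unfolding reducing_def using C y(2) c0 F(1) F'(1) by blast
              then show ?thesis using y(1) t a2 k2 by (simp add: wp_shift_edge[OF m2 a2(1)] c_def[symmetric])
            qed
          qed
          qed (use z(1) in simp)
        qed
      qed
    qed (use True e in \<open>simp add: c_def\<close>)
  qed
qed

lemma wp_reduce_loop:
  assumes mem: "mem \<sigma>"
    and red: "reducing I S T S' T' \<tau> (arrs \<sigma> 2) (arrs \<sigma> 20) (arrs \<sigma> 21)"
    and S: "S \<subseteq> {0..<n}" "T \<subseteq> {0..<n}" "S' \<subseteq> {0..<n}" "T' \<subseteq> {0..<n}" and I: "0 \<le> \<tau>" "\<tau> < I"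
  defines "P \<equiv> \<lambda>X. separates S T X \<or> separates S' T' X"
  shows "wp (for_loop 40 1 reduce_edge) (\<lambda>\<tau>' k.
     (reducing I S T S' T' \<tau> (arrs \<tau>' 2) (arrs \<tau>' 20) (arrs \<tau>' 21) \<and>
      (\<forall>e. 0 \<le> e \<and> e < m \<longrightarrow> arrs \<tau>' 17 e = 1 \<and> arrs \<tau>' 2 e = arrs \<sigma> 2 e - 1 \<or>
         arrs \<tau>' 17 e = 0 \<and> arrs \<tau>' 2 e = arrs \<sigma> 2 e \<and> tight (arrs \<tau>' 2) P \<tau> e)) \<and> 0 \<le> k) \<sigma>
     (m * (2 * reduce_cost + 108) + 6)"
proof (rule wp_for[where T = "2 * reduce_cost + 100" and I = "\<lambda>i \<tau>'.
      reducing I S T S' T' \<tau> (arrs \<tau>' 2) (arrs \<tau>' 20) (arrs \<tau>' 21) \<and>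
      (\<forall>e. 0 \<le> e \<and> e < i \<longrightarrow> arrs \<tau>' 17 e = 1 \<and> arrs \<tau>' 2 e = arrs \<sigma> 2 e - 1 \<or>
         arrs \<tau>' 17 e = 0 \<and> arrs \<tau>' 2 e = arrs \<sigma> 2 e \<and> tight (arrs \<tau>' 2) P \<tau> e) \<and>
      (\<forall>e. i \<le> e \<and> e < m \<longrightarrow> arrs \<tau>' 2 e = arrs \<sigma> 2 e)"], goal_cases)
  case (8 i \<tau>1)
  have i: "0 \<le> i" "i < m" using 8 by (simp_all add: memD[OF mem])
  have m1: "mem \<tau>1" by (rule mem_cong[OF mem]) (simp_all add: agree_regs[OF 8(5)] agree_arrs[OF 8(5)])
  have red1: "reducing I S T S' T' \<tau> (arrs \<tau>1 2) (arrs \<tau>1 20) (arrs \<tau>1 21)" using 8(1) by blast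
  have I0: "0 < I" using I by simp
  show ?case
  proof (rule wp_agree[OF wp_reduce_edge[OF m1 8(4) i red1 S I]], goal_cases)
    case (1 \<tau>2 k)
    from 1(1) consider
      "arrs \<tau>2 2 = (arrs \<tau>1 2)(i := arrs \<tau>1 2 i - 1)" "arrs \<tau>2 17 = (arrs \<tau>1 17)(i := 1)"
      | "arrs \<tau>2 2 = arrs \<tau>1 2" "arrs \<tau>2 17 = (arrs \<tau>1 17)(i := 0)" "tight (arrs \<tau>1 2) P \<tau> i"
      unfolding P_def by blast
    then show ?case
    proof cases
      case a: 1
      \<comment> \<open>A cut of capacity \<tau> cannot be lowered further, since the circulations
        certify that it still has at least \<tau>. So an edge once found tight remains tight during
        all later reductions.\<close>
      have "tight (arrs \<tau>2 2) P \<tau> e" if e: "e \<noteq> i" "tight (arrs \<tau>1 2) P \<tau> e" for e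
      proof (cases "arrs \<tau>1 2 e = 0")
        case True then show ?thesis using e a by (simp add: tight_def)
      next
        case False
        then obtain X where X: "P X" "cut (arrs \<tau>1 2) X = \<tau>" "crosses e X" using e by (auto simp: tight_def)
        have "\<tau> \<le> cut (arrs \<tau>2 2) X"
          using X(1) 1(1) circulation_cut[OF _ I0 S(1,2)] circulation_cut[OF _ I0 S(3,4)]
          unfolding P_def reducing_def by blast
        then have "cut (arrs \<tau>2 2) X = \<tau>" using X(2) cut_decrease[OF i, of "arrs \<tau>1 2" X] a(1)
          by (auto simp: of_bool_def split: if_splits)
        then show ?thesis using X by (auto simp: tight_def)
      qed
      then show ?thesis using 1(1) 8(1) a i by auto
    next
      case a: 2
      then show ?thesis using 1(1) 8(1) i by auto
    qed
  qed
next
  case (9 \<tau>1 k)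
  have "regs \<sigma> 1 = m" using memD(2)[OF mem] by simp
  then show ?case using 9 by (simp add: algebra_simps)
qed (use red m0 M_pos n0 in \<open>auto simp: reduce_cost_def search_cost_def memD[OF mem]\<close>)

definition degree :: "(int \<Rightarrow> int) \<Rightarrow> int \<Rightarrow> int" where
  "degree c v = (\<Sum>e\<in>{0..<m}. (if us e = v then c e else 0) + (if vs e = v then c e else 0))"

lemma sum_Suc_int:
  fixes f :: "int \<Rightarrow> int"
  shows "0 \<le> i \<Longrightarrow> sum f {0..<i + 1} = sum f {0..<i} + f i"
proof -
  assume "0 \<le> i"
  then have "{0..<i + 1} = insert i {0..<i}" by auto
  then show ?thesis by simp
qed

lemma wp_set_degrees:
  assumes mem: "mem \<sigma>"
  shows "wp set_degrees (\<lambda>\<tau> k. (\<forall>v\<in>V. arrs \<tau> 18 v = degree (arrs \<sigma> 2) v) \<and> 0 \<le> k) \<sigma> (20 * (n + 2) + 60 * m + 20)"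
proof -
  note m = memD[OF mem]
  let ?d = "\<lambda>i v. \<Sum>e\<in>{0..<i}. (if us e = v then arrs \<sigma> 2 e else 0) + (if vs e = v then arrs \<sigma> 2 e else 0)"
  show ?thesis
    unfolding set_degrees_def wp_Seq
  proof (rule wp_for[where T = 10 and I = "\<lambda>i \<tau>. \<forall>v. 0 \<le> v \<and> v < i \<longrightarrow> arrs \<tau> 18 v = 0"], goal_cases)
    case (9 \<tau>1 k1)
    have m1: "mem \<tau>1" by (rule mem_cong[OF mem]) (simp_all add: agree_regs[OF 9(2)] agree_arrs[OF 9(2)])
    show ?case
    proof (rule wp_for[where T = 40 and I = "\<lambda>i \<tau>. \<forall>v\<in>V. arrs \<tau> 18 v = ?d i v"], goal_cases)
      case (8 i \<tau>)
      have m2: "mem \<tau>" by (rule mem_cong[OF m1]) (simp_all add: agree_regs[OF 8(5)] agree_arrs[OF 8(5)])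
      have i: "0 \<le> i" "i < m" using 8 by (simp_all add: memD[OF m1])
      have c: "arrs \<tau> 2 = arrs \<sigma> 2" by (simp add: agree_arrs[OF 8(5)] agree_arrs[OF 9(2)])
      have "head (i + M) = us i" "head i = vs i" "i < 2 * M" "i + M < 2 * M" "us i \<in> V" "vs i \<in> V"
        using i us[OF i] vs[OF i] edge_bounds by (auto simp: head_simps)
      then show ?case
        using 8(1,4) i M_pos by (simp add: memD[OF m2] c sum_Suc_int)
    next
      case (9 \<tau> k2)
      then show ?case using \<open>20 * (n + 2) + 60 * m + 20 - (regs \<sigma> 6 * (10 + 8) + 6) \<le> k1\<close> m0 n0
        by (simp add: memD[OF m1] degree_def m)
    qed (use 9(1) m0 in \<open>auto simp: memD[OF m1] m\<close>)
  qed (use n0 in \<open>auto simp: m\<close>)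
qed

definition marks :: "(int \<Rightarrow> int) \<Rightarrow> int set \<Rightarrow> int \<Rightarrow> int" where
  "marks red X a = (if edge_of a < m then red (edge_of a) else if edge_of a \<in> X then 1 else 0)"

lemma wp_mark_edges:
  assumes mem: "mem \<sigma>" and s: "regs \<sigma> 2 \<in> {0..<n}" "regs \<sigma> 3 \<in> {0..<n}" "regs \<sigma> 4 \<in> {0..<n}" "regs \<sigma> 5 \<in> {0..<n}"
  shows "wp mark_edges (\<lambda>\<tau> k. (\<forall>a\<in>A. arrs \<tau> 22 a =
      marks (arrs \<sigma> 17) {m + regs \<sigma> 2, m + regs \<sigma> 3, m + n + regs \<sigma> 4, m + n + regs \<sigma> 5} a) \<and> 0 \<le> k) \<sigma>
    (40 * M + 40 * m + 150)"
proof -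
  note m = memD[OF mem]
  show ?thesis
    unfolding mark_edges_def wp_Seq
  proof (rule wp_for[where T = 10 and I = "\<lambda>i \<tau>. \<forall>v. 0 \<le> v \<and> v < i \<longrightarrow> arrs \<tau> 22 v = 0"], goal_cases)
    case (9 \<tau>1 k1)
    have m1: "mem \<tau>1" by (rule mem_cong[OF mem]) (simp_all add: agree_regs[OF 9(2)] agree_arrs[OF 9(2)])
    have z: "arrs \<tau>1 22 a = 0" if "a \<in> A" for a using 9(1) that by (simp add: m)
    show ?case
    proof (rule wp_for[where T = 20 and I = "\<lambda>i \<tau>. \<forall>a\<in>A. arrs \<tau> 22 a = (if edge_of a < i then arrs \<sigma> 17 (edge_of a) else 0)"], goal_cases)
      case 7
      have "0 \<le> edge_of a" if "a \<in> A" for a using that by (auto simp: edge_of_def)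
      then show ?case using z by force
    next
      case (8 i \<tau>)
      have m2: "mem \<tau>" by (rule mem_cong[OF m1]) (simp_all add: agree_regs[OF 8(5)] agree_arrs[OF 8(5)])
      have i: "0 \<le> i" "i < m" "i < M" using 8 edge_bounds(1) by (simp_all add: memD[OF m1])
      have c: "arrs \<tau> 17 = arrs \<sigma> 17" by (simp add: agree_arrs[OF 8(5)] agree_arrs[OF 9(2)])
      have "edge_of a < i + 1 \<longleftrightarrow> edge_of a < i \<or> a = i \<or> a = i + M" "edge_of i = i" "edge_of (i + M) = i" if "a \<in> A" for a
        using that i by (auto simp: edge_of_def)
      then show ?case
        using 8(1,4) i M_pos by (auto simp: memD[OF m2] c)
    next
      case (9 \<tau> k2)
      have m2: "mem \<tau>" by (rule mem_cong[OF m1]) (simp_all add: agree_regs[OF 9(2)] agree_arrs[OF 9(2)])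
      have r: "regs \<tau> x = regs \<sigma> x" if "x \<in> {2, 3, 4, 5}" for x
        using that agree_regs[OF 9(2), of x] agree_regs[OF \<open>agree (for_loop 50 8 (Update 22 (Reg 50) (Num 0))) \<sigma> \<tau>1\<close>, of x] by auto
      have k: "60 \<le> k2" using 9(3) \<open>40 * M + 40 * m + 150 - (regs \<sigma> 8 * (10 + 8) + 6) \<le> k1\<close> m0 M_pos
        by (simp add: memD[OF m1] m)
      define x1 x2 x3 x4 where x: "x1 = m + regs \<sigma> 2" "x2 = m + regs \<sigma> 3" "x3 = m + n + regs \<sigma> 4" "x4 = m + n + regs \<sigma> 5"
      have b: "m \<le> x1" "x1 < M" "m \<le> x2" "x2 < M" "m \<le> x3" "x3 < M" "m \<le> x4" "x4 < M"
        using s m0 n0 edge_bounds by (auto simp: x)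
      let ?h = "(arrs \<tau> 22)(x1 := 1, x1 + M := 1, x2 := 1, x2 + M := 1, x3 := 1, x3 + M := 1, x4 := 1, x4 + M := 1)"
      have "?h a = marks (arrs \<sigma> 17) {x1, x2, x3, x4} a" if aA: "a \<in> A" for a
      proof -
        have h: "arrs \<tau> 22 a = (if edge_of a < m then arrs \<sigma> 17 (edge_of a) else 0)"
          using 9(1) aA by (simp add: memD[OF m1])
        have e: "edge_of a = x \<longleftrightarrow> a = x \<or> a = x + M" if "m \<le> x" "x < M" for x
          using aA that m0 by (auto simp: edge_of_def)
        note e = e[OF b(1,2)] e[OF b(3,4)] e[OF b(5,6)] e[OF b(7,8)]
        show ?thesis
        proof (cases "edge_of a < m")
          case True
          then have "edge_of a \<notin> {x1, x2, x3, x4}" using b by auto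
          then show ?thesis using True h e by (simp add: marks_def)
        next
          case False
          show ?thesis
          proof (cases "edge_of a \<in> {x1, x2, x3, x4}")
            case True
            then have "?h a = 1" unfolding insert_iff e by (elim disjE) simp_all
            then show ?thesis using True False by (simp add: marks_def)
          next
            case nx: False
            then have "?h a = arrs \<tau> 22 a" unfolding insert_iff e by simp
            then show ?thesis using nx False h by (simp add: marks_def)
          qed
        qed
      qed
      then show ?case
        using k by (simp add: mark_edge_def memD[OF m2] r x[symmetric])
    qed (use m0 in \<open>auto simp: memD[OF m1] m\<close>)
  qed (use M_pos in \<open>auto simp: m\<close>)
qed

lemma edge_of_bounds: "a \<in> A \<Longrightarrow> 0 \<le> edge_of a \<and> edge_of a < M"
  by (auto simp: edge_of_def)

lemma edge_of_eq: "a \<in> A \<Longrightarrow> 0 \<le> e \<Longrightarrow> e < M \<Longrightarrow> edge_of a = e \<longleftrightarrow> a = e \<or> a = e + M"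
  by (auto simp: edge_of_def)

lemma edge_of_rev: "a \<in> A \<Longrightarrow> edge_of (rev_arc a) = edge_of a"
  by (auto simp: edge_of_def rev_arc_def)

text \<open>\<open>y\<close> is the edge vector built so far: the capacities together with the
  artificial edges taken. \<open>D\<close> is its degree vector, and the edges below
  \<open>i\<close> are decided. The parity condition says that the undecided edges can still repair
  \<open>D\<close>.\<close>

definition joining :: "(int \<Rightarrow> int) \<Rightarrow> (int \<Rightarrow> int) \<Rightarrow> (int \<Rightarrow> int) \<Rightarrow> int \<Rightarrow> (int \<Rightarrow> int) \<Rightarrow> (int \<Rightarrow> int) \<Rightarrow> (int \<Rightarrow> int) \<Rightarrow> bool" where
  "joining g c0 y i c D H \<longleftrightarrow>
     (\<forall>a\<in>A. H a = (if edge_of a < i then 0 else g (edge_of a))) \<and> even_on_closed H D \<and>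
     (\<forall>v\<in>V. D v = (\<Sum>a\<in>out_arcs v. y (edge_of a))) \<and>
     (\<forall>e. 0 \<le> e \<and> e < m \<longrightarrow> y e = c e \<and> (c e = c0 e \<or> g e \<noteq> 0 \<and> c e = c0 e + 1) \<and> (i \<le> e \<longrightarrow> c e = c0 e)) \<and>
     (\<forall>e. m \<le> e \<and> e < M \<longrightarrow> g e = 0 \<longrightarrow> y e = 0)"

lemma joining_skip:
  assumes j: "joining g c0 y i c D H" and i: "0 \<le> i" "i < M" "H i = 0"
  shows "joining g c0 y (i + 1) c D H"
proof -
  have iA: "i \<in> A" "edge_of i = i" using i by (auto simp: edge_of_def)
  then have "g i = 0" using j i(3) unfolding joining_def by force
  then have "(if edge_of a < i + 1 then 0 else g (edge_of a)) = (if edge_of a < i then 0 else g (edge_of a))" for a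
    by (cases "edge_of a = i") auto
  moreover have "i \<le> e" if "i + 1 \<le> e" for e using that by simp
  ultimately show ?thesis using j unfolding joining_def by auto
qed

lemma joining_step:
  assumes j: "joining g c0 y i c D H" and i: "0 \<le> i" "i < M" "H i \<noteq> 0"
    and st: "search_tree (H(i := 0, i + M := 0)) (tl i) rk par"
    and D': "\<And>v. v \<in> V \<Longrightarrow> D' v = D v + (if odd (\<Sum>v\<in>{v \<in> V. 0 < rk v}. D v) then of_bool (v = tl i) + of_bool (v = head i) else 0)"
    and c': "\<And>e. 0 \<le> e \<Longrightarrow> e < m \<Longrightarrow> c' e = c e + (if odd (\<Sum>v\<in>{v \<in> V. 0 < rk v}. D v) \<and> e = i then 1 else 0)"
  shows "\<exists>y. joining g c0 y (i + 1) c' D' (H(i := 0, i + M := 0))"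
proof -
  define p where "p = (if odd (\<Sum>v\<in>{v \<in> V. 0 < rk v}. D v) then 1 else 0 :: int)"
  define y' where "y' = y(i := y i + p)"
  have H: "\<And>a. a \<in> A \<Longrightarrow> H a = (if edge_of a < i then 0 else g (edge_of a))"
    and ev: "even_on_closed H D" and D: "\<And>v. v \<in> V \<Longrightarrow> D v = (\<Sum>a\<in>out_arcs v. y (edge_of a))"
    and y: "\<And>e. 0 \<le> e \<Longrightarrow> e < m \<Longrightarrow> y e = c e \<and> (c e = c0 e \<or> g e \<noteq> 0 \<and> c e = c0 e + 1) \<and> (i \<le> e \<longrightarrow> c e = c0 e)"
    "\<And>e. m \<le> e \<Longrightarrow> e < M \<Longrightarrow> g e = 0 \<Longrightarrow> y e = 0"
    using j unfolding joining_def by blast+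
  have iA: "i \<in> A" "edge_of i = i" "rev_arc i = i + M" "i + M \<in> A" using i by (auto simp: edge_of_def rev_arc_def)
  have gi: "g i \<noteq> 0" using H[OF iA(1)] iA(2) i(3) by simp
  let ?H = "H(i := 0, i + M := 0)" and ?X = "{v \<in> V. 0 < rk v}"
  have "even_on_closed ?H D'"
  proof (rule even_on_closed_drop[OF _ iA(1) ev, where X = ?X])
    show "\<forall>a\<in>A. H (rev_arc a) = H a" using H rvA edge_of_rev by simp
    show "?H = H(i := 0, rev_arc i := 0)" using iA by simp
    show "?X \<subseteq> V" by auto
    show "tl i \<in> ?X" "closed ?H ?X" using st by (auto simp: search_tree_def)
    show "?X \<subseteq> Y" if "tl i \<in> Y" "closed ?H Y" for Y by (rule search_tree_minimal[OF st that])
  qed (rule D')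
  moreover have "?H a = (if edge_of a < i + 1 then 0 else g (edge_of a))" if "a \<in> A" for a
    using H[OF that] edge_of_eq[OF that i(1,2)] by (cases "edge_of a = i") auto
  moreover have "D' v = (\<Sum>a\<in>out_arcs v. y' (edge_of a))" if v: "v \<in> V" for v
  proof -
    have "(\<Sum>a\<in>out_arcs v. y' (edge_of a)) =
      (\<Sum>a\<in>out_arcs v. y (edge_of a) + (if a = i then p else 0) + (if a = i + M then p else 0))"
    proof (rule sum.cong)
      fix a assume "a \<in> out_arcs v"
      then have "a \<in> A" by (simp add: out_arcs_def)
      from edge_of_eq[OF this i(1,2)] show "y' (edge_of a) = y (edge_of a) + (if a = i then p else 0) + (if a = i + M then p else 0)"
        using iA(2) M_pos by (auto simp: y'_def)
    qed simp
    also have "\<dots> = D v + (if i \<in> out_arcs v then p else 0) + (if i + M \<in> out_arcs v then p else 0)"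
      by (simp add: sum.distrib D[OF v])
    also have "\<dots> = D' v"
    proof -
      have "i \<in> out_arcs v \<longleftrightarrow> v = tl i" "i + M \<in> out_arcs v \<longleftrightarrow> v = head i"
        using iA by (auto simp: out_arcs_def head_def)
      then show ?thesis using D'[OF v] by (simp add: p_def)
    qed
    finally show ?thesis by simp
  qed
  moreover have "y' e = c' e \<and> (c' e = c0 e \<or> g e \<noteq> 0 \<and> c' e = c0 e + 1) \<and> (i + 1 \<le> e \<longrightarrow> c' e = c0 e)"
    if "0 \<le> e" "e < m" for e
    using y(1)[OF that] c'[OF that] gi by (cases "e = i") (auto simp: y'_def p_def)
  moreover have "y' e = 0" if "m \<le> e" "e < M" "g e = 0" for e
    using y(2)[OF that] that gi by (auto simp: y'_def)
  ultimately show ?thesis unfolding joining_def by blast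
qed

definition join_cost :: int where
  "join_cost = search_cost + 20 * (n + 2) + 150"

lemma wp_join_edge:
  assumes mem: "mem \<sigma>" and i: "regs \<sigma> 40 = i" "0 \<le> i" "i < M"
    and j: "joining g c0 y i (arrs \<sigma> 2) (arrs \<sigma> 18) (arrs \<sigma> 22)"
  shows "wp join_edge (\<lambda>\<tau> k. (\<exists>y. joining g c0 y (i + 1) (arrs \<tau> 2) (arrs \<tau> 18) (arrs \<tau> 22)) \<and> 0 \<le> k) \<sigma> join_cost"
proof -
  note m = memD[OF mem]
  have cost: "0 \<le> search_cost" using M_pos n0 by (simp add: search_cost_def)
  have i2: "i < 2 * M" "i + M < 2 * M" using i by auto
  have hd: "head (i + M) = tl i" using i by (simp add: head_def rev_arc_def)
  show ?thesis
  proof (cases "arrs \<sigma> 22 i = 0")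
    case True
    have "joining g c0 y (i + 1) (arrs \<sigma> 2) (arrs \<sigma> 18) (arrs \<sigma> 22)"
      by (rule joining_skip[OF j i(2,3) True])
    then show ?thesis using True cost n0 i by (auto simp: join_edge_def join_cost_def)
  next
    case False
    let ?H = "(arrs \<sigma> 22)(i := 0, i + M := 0)"
    define \<sigma>1 where "\<sigma>1 = \<sigma>\<lparr>arrs := (arrs \<sigma>)(22 := ?H), regs := (regs \<sigma>)(20 := tl i)\<rparr>"
    have m1: "mem \<sigma>1" by (rule mem_cong[OF mem]) (simp_all add: \<sigma>1_def)
    have start: "wp join_edge Q \<sigma> k \<longleftrightarrow> wp (search 22 ;; Assign 46 (Num 0) ;;
         for_loop 47 6
           (If (Less (Num 0) (Elem 7 (Reg 47))) (Assign 46 (Plus (Reg 46) (Elem 18 (Reg 47)))) Skip) ;;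
         If (Equal (Reg 46) (Plus (Half (Reg 46)) (Half (Reg 46)))) Skip
           (Update 18 (Reg 20) (Plus (Elem 18 (Reg 20)) (Num 1)) ;; Assign 48 (Elem 3 (Reg 40)) ;;
            Update 18 (Reg 48) (Plus (Elem 18 (Reg 48)) (Num 1)) ;;
            If (Less (Reg 40) (Reg 1)) (Update 2 (Reg 40) (Plus (Elem 2 (Reg 40)) (Num 1))) Skip)) Q \<sigma>1 (k - 18)" for Q k
      unfolding join_edge_def using False i i2 by (simp add: m \<sigma>1_def hd)
    show ?thesis
      unfolding start wp_Seq
    proof (rule wp_spec[OF wp_search[OF m1]], goal_cases)
      case 1
      have "tl i \<in> V" using i i2 by auto
      then show ?case by (simp add: \<sigma>1_def)
    next
      case 2 then show ?case by simp
    next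
      case (3 \<sigma>2 k2)
      have s1: "regs \<sigma>1 20 = tl i" "arrs \<sigma>1 22 = ?H" by (simp_all add: \<sigma>1_def)
      note st = 3(1)[unfolded s1]
      have m2: "mem \<sigma>2" by (rule mem_cong[OF m1]) (simp_all add: agree_regs[OF 3(2)] agree_arrs[OF 3(2)])
      have r2: "regs \<sigma>2 20 = tl i" "regs \<sigma>2 40 = i" "arrs \<sigma>2 22 = ?H" "arrs \<sigma>2 18 = arrs \<sigma> 18" "arrs \<sigma>2 2 = arrs \<sigma> 2"
        using i by (simp_all add: agree_regs[OF 3(2)] agree_arrs[OF 3(2)] \<sigma>1_def)
      have k2: "20 * (n + 2) + 100 \<le> k2" using 3(3) by (simp add: join_cost_def)
      define rk where "rk = arrs \<sigma>2 7"
      let ?s = "\<lambda>i. \<Sum>v\<in>{0..<i}. if 0 < rk v then arrs \<sigma> 18 v else 0"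
      have s: "?s (n + 2) = (\<Sum>v\<in>{v \<in> V. 0 < rk v}. arrs \<sigma> 18 v)" by (rule sum.inter_filter[symmetric]) simp
      show ?case
        unfolding wp_Assign
      proof (rule wp_for[where T = 12 and I = "\<lambda>i \<tau>. regs \<tau> 46 = ?s i"], goal_cases)
        case (8 v \<tau>)
        have a: "arrs \<tau> 7 = rk" "arrs \<tau> 18 = arrs \<sigma> 18"
          using r2 by (simp_all add: agree_arrs[OF 8(5)] rk_def)
        show ?case using 8(1,2,4) by (simp add: a sum_Suc_int)
      next
        case (9 \<tau> k3)
        have m3: "mem \<tau>" by (rule mem_cong[OF m2]) (simp_all add: agree_regs[OF 9(2)] agree_arrs[OF 9(2)])
        have r3: "regs \<tau> 20 = tl i" "regs \<tau> 40 = i" "arrs \<tau> 22 = ?H" "arrs \<tau> 18 = arrs \<sigma> 18" "arrs \<tau> 2 = arrs \<sigma> 2"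
          using r2 by (simp_all add: agree_regs[OF 9(2)] agree_arrs[OF 9(2)])
        have sm: "regs \<tau> 46 = (\<Sum>v\<in>{v \<in> V. 0 < rk v}. arrs \<sigma> 18 v)" using 9(1) s by (simp add: memD[OF m2])
        have k3: "60 \<le> k3" using 9(3) k2 n0 by (simp add: memD[OF m2])
        note js = joining_step[OF j i(2,3) False st, folded rk_def, folded sm]
        show ?case
        proof (cases "even (regs \<tau> 46)")
          case True
          have "\<exists>y. joining g c0 y (i + 1) (arrs \<sigma> 2) (arrs \<sigma> 18) ?H" by (rule js) (use True in auto)
          then show ?thesis using True k3 by (simp add: half_even[symmetric] r3)
        next
          case odd: False
          let ?D = "(arrs \<sigma> 18)(tl i := arrs \<sigma> 18 (tl i) + 1)"
          let ?D' = "?D(head i := ?D (head i) + 1)"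
          let ?c = "if i < m then (arrs \<sigma> 2)(i := arrs \<sigma> 2 i + 1) else arrs \<sigma> 2"
          have "\<exists>y. joining g c0 y (i + 1) ?c ?D' ?H" by (rule js) (use odd in auto)
          moreover have "regs \<tau> 46 \<noteq> regs \<tau> 46 div 2 + regs \<tau> 46 div 2" using odd half_even by blast
          ultimately show ?thesis using k3 i i2 by (simp add: r3 memD[OF m3] split: if_splits)
        qed
      qed (use n0 in \<open>auto simp: memD[OF m2]\<close>)
    qed
  qed
qed

lemma wp_join_loop:
  assumes mem: "mem \<sigma>" and j: "joining g c0 y 0 (arrs \<sigma> 2) (arrs \<sigma> 18) (arrs \<sigma> 22)"
  shows "wp (for_loop 40 7 join_edge) (\<lambda>\<tau> k. (\<exists>y D H. joining g c0 y M (arrs \<tau> 2) D H) \<and> 0 \<le> k) \<sigma> (M * (join_cost + 8) + 6)"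
proof (rule wp_for[where T = join_cost and I = "\<lambda>i \<tau>. \<exists>y. joining g c0 y i (arrs \<tau> 2) (arrs \<tau> 18) (arrs \<tau> 22)"], goal_cases)
  case (8 i \<tau>)
  have m1: "mem \<tau>" by (rule mem_cong[OF mem]) (simp_all add: agree_regs[OF 8(5)] agree_arrs[OF 8(5)])
  have i: "0 \<le> i" "i < M" using 8 by (simp_all add: memD[OF mem])
  show ?case using 8(1) wp_join_edge[OF m1 8(4) i] by blast
next
  case (9 \<tau> k)
  have "regs \<sigma> 7 = M" by (simp add: memD[OF mem])
  then show ?case using 9 by auto
qed (use j M_pos n0 in \<open>auto simp: memD[OF mem] join_cost_def search_cost_def\<close>)

text \<open>The Euler condition known from integral two-commodity flows: once each pair is joined by
  as many demand edges as its parity requires, all degrees are even.\<close>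

definition parity_ok :: "(int \<Rightarrow> int) \<Rightarrow> int \<Rightarrow> int \<Rightarrow> int \<Rightarrow> int \<Rightarrow> bool" where
  "parity_ok c s1 t1 s2 t2 \<longleftrightarrow> (\<forall>v\<in>{0..<n} - {s1, t1, s2, t2}. even (degree c v)) \<and>
     even (degree c s1 + degree c t1) \<and> even (degree c s2 + degree c t2)"

lemma sum_two:
  fixes f :: "int \<Rightarrow> int"
  assumes "a \<in> {0..<n}" "b \<in> {0..<n}" "a \<noteq> b" "\<And>v. v \<in> {0..<n} \<Longrightarrow> v \<noteq> a \<Longrightarrow> v \<noteq> b \<Longrightarrow> f v = 0"
  shows "sum f {0..<n} = f a + f b"
proof -
  have "sum f {0..<n} = sum f {a, b}" by (rule sum.mono_neutral_right) (use assms in auto)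
  then show ?thesis using assms(3) by simp
qed

lemma sum_out_edges:
  assumes v: "v \<in> V" and y: "\<And>e. 0 \<le> e \<Longrightarrow> e < m \<Longrightarrow> y e = c e" "y ret = 0"
  shows "(\<Sum>a\<in>out_arcs v. y (edge_of a)) =
    (if v = n then \<Sum>w\<in>{0..<n}. y (m + w) else if v = n + 1 then \<Sum>w\<in>{0..<n}. y (m + n + w)
     else degree c v + y (m + v) + y (m + n + v))"
proof -
  have e: "edge_of e = e" if "e < M" for e using that by (simp add: edge_of_def)
  have e': "edge_of (e + M) = e" if "0 \<le> e" for e using that M_pos by (simp add: edge_of_def)
  have d: "(\<Sum>e\<in>{0..<m}. (if us e = v then y (edge_of e) else 0) + (if vs e = v then y (edge_of (e + M)) else 0)) = degree c v"
    unfolding degree_def by (rule sum.cong) (use y e e' edge_bounds(1) in auto)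
  have w1: "(\<Sum>w\<in>{0..<n}. (if v = n then y (edge_of (m + w)) else 0) + (if w = v then y (edge_of (m + w + M)) else 0)) =
     (if v = n then \<Sum>w\<in>{0..<n}. y (m + w) else 0) + (if v \<in> {0..<n} then y (m + v) else 0)"
  proof -
    have "(\<Sum>w\<in>{0..<n}. (if v = n then y (edge_of (m + w)) else 0) + (if w = v then y (edge_of (m + w + M)) else 0)) =
      (\<Sum>w\<in>{0..<n}. (if v = n then y (m + w) else 0) + (if w = v then y (m + w) else 0))"
      using e e' edge_bounds(2) m0 by (intro sum.cong) auto
    then show ?thesis by (simp add: sum.distrib)
  qed
  have w2: "(\<Sum>w\<in>{0..<n}. (if w = v then y (edge_of (m + n + w)) else 0) + (if v = n + 1 then y (edge_of (m + n + w + M)) else 0)) =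
     (if v = n + 1 then \<Sum>w\<in>{0..<n}. y (m + n + w) else 0) + (if v \<in> {0..<n} then y (m + n + v) else 0)"
  proof -
    have "(\<Sum>w\<in>{0..<n}. (if w = v then y (edge_of (m + n + w)) else 0) + (if v = n + 1 then y (edge_of (m + n + w + M)) else 0)) =
      (\<Sum>w\<in>{0..<n}. (if w = v then y (m + n + w) else 0) + (if v = n + 1 then y (m + n + w) else 0))"
      using e e' edge_bounds(3) m0 n0 by (intro sum.cong) auto
    then show ?thesis by (simp add: sum.distrib)
  qed
  have r: "edge_of ret = ret" "edge_of (ret + M) = ret" using e e' edge_bounds by auto
  have dn: "degree c n = 0" "degree c (n + 1) = 0" 
  proof -
    have "degree c v = 0" if "\<not> v < n" for v
      unfolding degree_def
    proof (rule sum.neutral, rule ballI)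
      fix e assume "e \<in> {0..<m}"
      then have "us e < n" "vs e < n" using us[of e] vs[of e] by auto
      then show "(if us e = v then c e else 0) + (if vs e = v then c e else 0) = 0" using that by auto
    qed
    then show "degree c n = 0" "degree c (n + 1) = 0" by auto
  qed
  show ?thesis
    unfolding sum_out_arcs_at d w1 w2 r using v y(2) dn by auto
qed

text \<open>With all edges decided every singleton is closed, so all degrees of \<open>y\<close> are
  even. At the source and at the sink only the two artificial edges of one pair count; these have
  equal parity, so removing them changes the parity of both terminals of the pair or of
  neither.\<close>

lemma joining_final:
  assumes j: "joining g c0 y M c D H"
    and g: "\<And>e. m \<le> e \<Longrightarrow> e < M \<Longrightarrow> e \<notin> {m + s1, m + t1, m + n + s2, m + n + t2} \<Longrightarrow> g e = 0"
    and s: "s1 \<in> {0..<n}" "t1 \<in> {0..<n}" "s2 \<in> {0..<n}" "t2 \<in> {0..<n}" "distinct [s1, t1, s2, t2]"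
  shows "parity_ok c s1 t1 s2 t2"
proof -
  have H: "\<And>a. a \<in> A \<Longrightarrow> H a = 0" using j edge_of_bounds unfolding joining_def by auto
  have ev: "even_on_closed H D" and D: "\<And>v. v \<in> V \<Longrightarrow> D v = (\<Sum>a\<in>out_arcs v. y (edge_of a))"
    and y: "\<And>e. 0 \<le> e \<Longrightarrow> e < m \<Longrightarrow> y e = c e" "\<And>e. m \<le> e \<Longrightarrow> e < M \<Longrightarrow> g e = 0 \<Longrightarrow> y e = 0"
    using j unfolding joining_def by blast+
  have "even (D v)" if v: "v \<in> V" for v
  proof -
    have "closed H {v}" unfolding closed_def outs_def using H by auto
    then have "even (\<Sum>v\<in>{v}. D v)" using ev v unfolding even_on_closed_def by blast
    then show ?thesis by simp
  qed
  then have E: "even (\<Sum>a\<in>out_arcs v. y (edge_of a))" if "v \<in> V" for v using D that by metis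
  have yr: "y ret = 0"
  proof (rule y(2)[OF _ _ g])
    show "ret \<notin> {m + s1, m + t1, m + n + s2, m + n + t2}" using s n0 by (simp add: ret_def)
  qed (use edge_bounds in simp_all)
  note O = sum_out_edges[of _ y c, OF _ y(1) yr]
  have y1: "y (m + v) = 0" if "v \<in> {0..<n}" "v \<noteq> s1" "v \<noteq> t1" for v
  proof (rule y(2)[OF _ _ g])
    show "m + v \<notin> {m + s1, m + t1, m + n + s2, m + n + t2}" using that s by simp
  qed (use that edge_bounds(2) in simp_all)
  have y2: "y (m + n + v) = 0" if "v \<in> {0..<n}" "v \<noteq> s2" "v \<noteq> t2" for v
  proof (rule y(2)[OF _ _ g])
    show "m + n + v \<notin> {m + s1, m + t1, m + n + s2, m + n + t2}" using that s by simp
  qed (use that edge_bounds(3) n0 in simp_all)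
  have S: "even (y (m + s1) + y (m + t1))"
    using E[of n] O[of n] sum_two[of s1 t1 "\<lambda>v. y (m + v)"] y1 s n0 by auto
  have T: "even (y (m + n + s2) + y (m + n + t2))"
    using E[of "n + 1"] O[of "n + 1"] sum_two[of s2 t2 "\<lambda>v. y (m + n + v)"] y2 s n0 by auto
  have d: "even (degree c v + y (m + v) + y (m + n + v))" if "v \<in> {0..<n}" for v
    using E[of v] O[of v] that by auto
  have "even (degree c v)" if "v \<in> {0..<n} - {s1, t1, s2, t2}" for v
    using d[of v] y1[of v] y2[of v] that by auto
  moreover have "even (degree c s1 + degree c t1)"
    using d[OF s(1)] d[OF s(2)] y2[of s1] y2[of t1] S s by auto
  moreover have "even (degree c s2 + degree c t2)"
    using d[OF s(3)] d[OF s(4)] y1[of s2] y1[of t2] T s by auto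
  ultimately show ?thesis unfolding parity_ok_def by blast
qed

end

section \<open>Single flows of prescribed parity and the split of the value\<close>

section \<open>Two flows with prescribed demands\<close>

text \<open>A flow with the parity of the capacities on every edge is twice an integral flow plus \<open>c mod 2\<close>.\<close>

definition demand_flow :: "nat \<Rightarrow> nat \<Rightarrow> nat \<Rightarrow> com" where
  "demand_flow q x y =
     (for_loop 50 1
        (Update 13 (Reg 50) (Half (Elem 2 (Reg 50))) ;;
         Update 14 (Reg 50) (Minus (Elem 2 (Reg 50)) (Elem 13 (Reg 50)))) ;;
      for_loop 50 0 (Update 19 (Reg 50) (Num 0)) ;;
      for_loop 50 1
        (Assign 47 (Minus (Elem 14 (Reg 50)) (Elem 13 (Reg 50))) ;;
         Assign 46 (Elem 3 (Plus (Reg 50) (Reg 7))) ;;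
         Update 19 (Reg 46) (Minus (Elem 19 (Reg 46)) (Reg 47)) ;;
         Assign 46 (Elem 3 (Reg 50)) ;;
         Update 19 (Reg 46) (Plus (Elem 19 (Reg 46)) (Reg 47))) ;;
      Update 19 (Reg 2) (Plus (Elem 19 (Reg 2)) (Reg 54)) ;;
      Update 19 (Reg 3) (Minus (Elem 19 (Reg 3)) (Reg 54)) ;;
      Update 19 (Reg x) (Plus (Elem 19 (Reg x)) (Reg 55)) ;;
      Update 19 (Reg y) (Minus (Elem 19 (Reg y)) (Reg 55)) ;;
      for_loop 50 0
        (Assign 46 (Half (Elem 19 (Reg 50))) ;;
         If (Less (Num 0) (Reg 46))
           (Update 15 (Reg 50) (Reg 46) ;; Update 16 (Reg 50) (Num 0))
           (Update 15 (Reg 50) (Num 0) ;; Update 16 (Reg 50) (Minus (Num 0) (Reg 46)))) ;;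
      load q ;; maxflow q)"

lemma written_demand_flow [simp]:
  "written_regs (demand_flow q x y) = {30, 31, 32, 33, 34, 35, 46, 47, 50}"
  "written_arrs (demand_flow q x y) = {q, 10, 11, 12, 13, 14, 15, 16, 19}"
  by (auto simp: demand_flow_def)

context network
begin

definition divergence :: "(int \<Rightarrow> int) \<Rightarrow> int \<Rightarrow> int" where
  "divergence f v = (\<Sum>e\<in>{0..<m}. (if us e = v then f e else 0) - (if vs e = v then f e else 0))"

lemma sum_endpoints:
  fixes X :: "int set"
  shows "(\<Sum>v\<in>{0..<n} \<inter> X. \<Sum>e\<in>{0..<m}. (if us e = v then f e else 0) + (if vs e = v then g e else (0::int))) =
    (\<Sum>e\<in>{0..<m}. (if us e \<in> X then f e else 0) + (if vs e \<in> X then g e else 0))"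
proof -
  have "(\<Sum>v\<in>{0..<n} \<inter> X. (if us e = v then f e else 0) + (if vs e = v then g e else 0)) =
    (if us e \<in> X then f e else 0) + (if vs e \<in> X then g e else 0)" if "e \<in> {0..<m}" for e
    using that us[of e] vs[of e] by (simp add: sum.distrib)
  then show ?thesis by (subst sum.swap) simp
qed

lemma endpoints_outside:
  assumes "v < 0 \<or> n \<le> v"
  shows "(\<Sum>e\<in>{0..<m}. (if us e = v then f e else 0) + (if vs e = v then g e else (0::int))) = 0"
proof (rule sum.neutral, rule ballI)
  fix e assume "e \<in> {0..<m}"
  then have "us e \<noteq> v" "vs e \<noteq> v" using us[of e] vs[of e] assms by auto
  then show "(if us e = v then f e else 0) + (if vs e = v then g e else 0) = 0" by simp
qed

lemma divergence_alt: "divergence f v = (\<Sum>e\<in>{0..<m}. (if us e = v then f e else 0) + (if vs e = v then - f e else 0))"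
  unfolding divergence_def by (rule sum.cong) auto

lemma sum_divergence:
  "(\<Sum>v\<in>{0..<n} \<inter> X. divergence f v) = (\<Sum>e\<in>{0..<m}. (if us e \<in> X then f e else 0) + (if vs e \<in> X then - f e else 0))"
  unfolding divergence_alt by (rule sum_endpoints)

lemma cut_parity: "even (cut c X + (\<Sum>v\<in>{0..<n} \<inter> X. degree c v))"
proof -
  have "cut c X + (\<Sum>v\<in>{0..<n} \<inter> X. degree c v) = (\<Sum>e\<in>{0..<m}. (if (us e \<in> X) \<noteq> (vs e \<in> X) then c e else 0)
     + ((if us e \<in> X then c e else 0) + (if vs e \<in> X then c e else 0)))"
    unfolding cut_def degree_def sum_endpoints by (simp add: sum.distrib)
  also have "even \<dots>" by (rule dvd_sum) auto
  finally show ?thesis .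
qed

lemma cut_complement: "cut c (- X) = cut c X"
  unfolding cut_def by (rule sum.cong) auto

text \<open>An edge crosses the symmetric difference exactly if it crosses one of the two sets but
  not the other.\<close>

lemma cut_symdiff:
  assumes "\<And>e. 0 \<le> e \<Longrightarrow> e < m \<Longrightarrow> 0 \<le> c e"
  shows "cut c {v. (v \<in> X) \<noteq> (v \<in> Y)} \<le> cut c X + cut c Y"
  unfolding cut_def sum.distrib[symmetric] by (rule sum_mono) (use assms in auto)

text \<open>The supply-demand theorem with the parity built in. As \<open>c\<close> is
  \<open>fw + bw\<close>, the flow \<open>c - 2 * r\<close> is twice the computed flow
  \<open>fw - r\<close> plus \<open>bw - fw\<close>. The cut condition on \<open>dd\<close> ensures
  that no cut of the auxiliary network lies below the total supply.\<close>

lemma demand_flow_exists: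
  fixes c b r :: "int \<Rightarrow> int"
  assumes c: "\<And>e. 0 \<le> e \<Longrightarrow> e < m \<Longrightarrow> fw e + bw e = c e \<and> 0 \<le> fw e \<and> 0 \<le> bw e"
    and b: "\<And>v. v \<in> {0..<n} \<Longrightarrow> 2 * b v = dd v - divergence (\<lambda>e. bw e - fw e) v"
    and dd: "(\<Sum>v\<in>{0..<n}. dd v) = 0" "\<And>X. (\<Sum>v\<in>{0..<n} \<inter> X. dd v) \<le> cut c X"
    and spl: "\<And>v. v \<in> {0..<n} \<Longrightarrow> spl v = max (b v) 0" and dem: "\<And>v. v \<in> {0..<n} \<Longrightarrow> dem v = max (- b v) 0"
  defines "r0 \<equiv> base fw bw spl dem 0 0"
  assumes res: "residual r0 r" and cons: "\<And>v. v \<in> {0..<n} \<Longrightarrow> excess r0 r v = 0"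
    and X: "\<exists>X. X \<subseteq> V \<and> n \<in> X \<and> n + 1 \<notin> X \<and> closed r X"
  shows "0 \<le> e \<Longrightarrow> e < m \<Longrightarrow> 0 \<le> r e \<and> r e \<le> c e"
    and "v \<in> {0..<n} \<Longrightarrow> divergence (\<lambda>e. c e - 2 * r e) v = dd v"
proof -
  define F where "F = excess r0 r (n + 1)"
  define f0 where "f0 = (\<lambda>e. bw e - fw e)"
  have bs: "spl v - dem v = b v" "0 \<le> spl v" "0 \<le> dem v" if "v \<in> {0..<n}" for v
    using spl[OF that] dem[OF that] by auto
  note bs3 = base_simps[where fw = fw and bw = bw and spl = spl and dem = dem and \<tau> = 0 and F = 0, folded r0_def]
  have rr: "0 \<le> r a" "r a + r (rev_arc a) = r0 a + r0 (rev_arc a)" if "a \<in> A" for a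
    using res that unfolding residual_def by blast+
  have pair: "0 \<le> r e \<and> 0 \<le> r (e + M) \<and> r e + r (e + M) = r0 e + r0 (e + M)" if "0 \<le> e" "e < M" for e
    using rr[of e] rr[of "e + M"] that rev_simps by auto
  have fb: "0 \<le> r e \<and> 0 \<le> r (e + M) \<and> r e + r (e + M) = c e" if "0 \<le> e" "e < m" for e
    using pair[of e] that edge_bounds(1) c[OF that] by (simp add: bs3)
  then show "0 \<le> e \<Longrightarrow> e < m \<Longrightarrow> 0 \<le> r e \<and> r e \<le> c e" by force
  have sv: "0 \<le> r (m + v) \<and> 0 \<le> r (m + v + M) \<and> r (m + v) + r (m + v + M) = spl v" if "0 \<le> v" "v < n" for v
    using pair[of "m + v"] that edge_bounds(2) m0 by (simp add: bs3)
  have dv: "0 \<le> r (m + n + v) \<and> 0 \<le> r (m + n + v + M) \<and> r (m + n + v) + r (m + n + v + M) = dem v" if "0 \<le> v" "v < n" for v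
    using pair[of "m + n + v"] that edge_bounds(3) m0 n0 by (simp add: bs3)
  have rt: "r ret = 0 \<and> r (ret + M) = 0"
    using pair[of ret] edge_bounds(4,5) by (simp add: bs3)
  have sb: "(\<Sum>v\<in>{0..<n}. b v) = 0"
  proof -
    have "2 * (\<Sum>v\<in>{0..<n}. b v) = (\<Sum>v\<in>{0..<n}. dd v - divergence f0 v)"
      unfolding sum_distrib_left f0_def using b by (intro sum.cong) auto
    also have "\<dots> = - (\<Sum>v\<in>{0..<n} \<inter> UNIV. divergence f0 v)" using dd(1) by (simp add: sum_subtractf)
    also have "\<dots> = 0" unfolding sum_divergence by (simp add: sum.distrib[symmetric])
    finally show ?thesis by simp
  qed
  then have sd: "(\<Sum>v\<in>{0..<n}. spl v) = (\<Sum>v\<in>{0..<n}. dem v)"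
  proof -
    have "(\<Sum>v\<in>{0..<n}. spl v - dem v) = (\<Sum>v\<in>{0..<n}. b v)" by (rule sum.cong) (use bs(1) in auto)
    then show ?thesis using sb by (simp add: sum_subtractf)
  qed
  obtain X where X: "X \<subseteq> V" "n \<in> X" "n + 1 \<notin> X" "closed r X" using X by blast
  have "F = (\<Sum>a\<in>outs X. r0 a)" unfolding F_def by (rule flow_value_le(2)[OF res cons X(1,2,3,4)])
  also have "\<dots> = (\<Sum>e\<in>{0..<m}. (if us e \<in> X \<and> vs e \<notin> X then fw e else 0) + (if vs e \<in> X \<and> us e \<notin> X then bw e else 0))
     + (\<Sum>v\<in>{0..<n}. if v \<notin> X then spl v else 0) + (\<Sum>v\<in>{0..<n}. if v \<in> X then dem v else 0)"
    unfolding sum_outs using X by (simp add: bs3 cong: sum.cong_simp if_cong)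
  finally have FX: "F = \<dots>" .
  \<comment> \<open>Twice the halved capacity leaving \<open>X\<close> plus the divergence of
    \<open>bw - fw\<close> over \<open>X\<close> is the undirected cut; so the condition on
    \<open>dd\<close> carries over to the halved problem.\<close>
  have "(\<Sum>v\<in>{0..<n}. spl v) \<le> F"
  proof -
    have "2 * (\<Sum>e\<in>{0..<m}. (if us e \<in> X \<and> vs e \<notin> X then fw e else 0) + (if vs e \<in> X \<and> us e \<notin> X then bw e else 0))
        + (\<Sum>v\<in>{0..<n} \<inter> X. divergence f0 v) = cut c X"
      unfolding sum_divergence cut_def sum_distrib_left sum.distrib[symmetric]
    proof (rule sum.cong)
      fix e assume "e \<in> {0..<m}"
      then have "bw e = c e - fw e" using c[of e] by auto
      then show "2 * ((if us e \<in> X \<and> vs e \<notin> X then fw e else 0) + (if vs e \<in> X \<and> us e \<notin> X then bw e else 0)) +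
          ((if us e \<in> X then f0 e else 0) + (if vs e \<in> X then - f0 e else 0)) =
          (if (us e \<in> X) \<noteq> (vs e \<in> X) then c e else 0)"
        by (auto simp: f0_def)
    qed simp
    moreover have "(\<Sum>v\<in>{0..<n} \<inter> X. divergence f0 v) = (\<Sum>v\<in>{0..<n} \<inter> X. dd v) - 2 * (\<Sum>v\<in>{0..<n} \<inter> X. b v)"
      unfolding sum_distrib_left sum_subtractf[symmetric] using b by (intro sum.cong) (auto simp: f0_def)
    moreover have "(\<Sum>v\<in>{0..<n} \<inter> X. b v) = (\<Sum>v\<in>{0..<n}. if v \<in> X then spl v else 0) - (\<Sum>v\<in>{0..<n}. if v \<in> X then dem v else 0)"
      unfolding sum_subtractf[symmetric] sum.inter_restrict[OF finite_atLeastLessThan_int]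
      using bs(1) by (intro sum.cong) auto
    moreover have "(\<Sum>v\<in>{0..<n}. spl v) = (\<Sum>v\<in>{0..<n}. if v \<in> X then spl v else 0) + (\<Sum>v\<in>{0..<n}. if v \<notin> X then spl v else 0)"
      unfolding sum.distrib[symmetric] by (intro sum.cong) auto
    ultimately show ?thesis using FX dd(2)[of X] by linarith
  qed
  moreover have xs: "- F = (\<Sum>v\<in>{0..<n}. r (m + v) - spl v)"
    using excess_source[OF res cons] rt unfolding F_def excess_def sum_out_arcs_at[where v = n]
    by (simp add: bs3 endpoints_outside cong: sum.cong_simp)
  moreover have xt: "F = (\<Sum>v\<in>{0..<n}. r (m + n + v + M))"
    unfolding F_def excess_def sum_out_arcs_at[where v = "n + 1"]
    using rt by (simp add: bs3 endpoints_outside cong: sum.cong_simp)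
  ultimately have s1: "(\<Sum>v\<in>{0..<n}. r (m + v)) \<le> 0" and s2: "(\<Sum>v\<in>{0..<n}. r (m + n + v)) \<le> 0"
  proof -
    show "(\<Sum>v\<in>{0..<n}. r (m + v)) \<le> 0" using xs \<open>(\<Sum>v\<in>{0..<n}. spl v) \<le> F\<close> by (simp add: sum_subtractf)
    have "(\<Sum>v\<in>{0..<n}. r (m + n + v)) + (\<Sum>v\<in>{0..<n}. r (m + n + v + M)) = (\<Sum>v\<in>{0..<n}. dem v)"
      unfolding sum.distrib[symmetric] using dv by (intro sum.cong) auto
    then show "(\<Sum>v\<in>{0..<n}. r (m + n + v)) \<le> 0" using xt sd \<open>(\<Sum>v\<in>{0..<n}. spl v) \<le> F\<close> by linarith
  qed
  \<comment> \<open>Nonnegative residuals with sum at most 0: every supply arc is saturated, and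
    below likewise every demand arc.\<close>
  have z1: "r (m + v) = 0" if "v \<in> {0..<n}" for v
    using sum_nonneg_0[of "{0..<n}" "\<lambda>v. r (m + v)" v] sum_nonneg[of "{0..<n}" "\<lambda>v. r (m + v)"] s1 sv that by force
  have z2: "r (m + n + v) = 0" if "v \<in> {0..<n}" for v
    using sum_nonneg_0[of "{0..<n}" "\<lambda>v. r (m + n + v)" v] sum_nonneg[of "{0..<n}" "\<lambda>v. r (m + n + v)"] s2 dv that by force
  show "divergence (\<lambda>e. c e - 2 * r e) v = dd v" if v: "v \<in> {0..<n}"
  proof -
    have vn: "0 \<le> v" "v < n" "v \<noteq> n" "v \<noteq> n + 1" using v by auto
    have "0 = excess r0 r v" using cons[OF v] by simp
    also have "\<dots> = (\<Sum>e\<in>{0..<m}. (if us e = v then r e - fw e else 0) + (if vs e = v then r (e + M) - bw e else 0))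
       + r (m + v + M) + (r (m + n + v) - dem v)"
      unfolding excess_def sum_out_arcs_at[where v = v] using vn
      by (simp add: bs3 cong: sum.cong_simp if_cong)
    also have "r (m + v + M) = spl v" using sv[OF vn(1,2)] z1[OF v] by simp
    also have "r (m + n + v) - dem v = - dem v" using z2[OF v] by simp
    finally have 1: "(\<Sum>e\<in>{0..<m}. (if us e = v then r e - fw e else 0) + (if vs e = v then r (e + M) - bw e else 0)) = - b v"
      using bs(1)[OF v] by simp
    have "divergence (\<lambda>e. c e - 2 * r e) v = divergence f0 v -
       2 * (\<Sum>e\<in>{0..<m}. (if us e = v then r e - fw e else 0) + (if vs e = v then r (e + M) - bw e else 0))"
      unfolding divergence_def sum_distrib_left sum_subtractf[symmetric]
    proof (rule sum.cong)
      fix e assume "e \<in> {0..<m}"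
      then have "fw e + bw e = c e" "r (e + M) = c e - r e" using c[of e] fb[of e] by auto
      then show "(if us e = v then c e - 2 * r e else 0) - (if vs e = v then c e - 2 * r e else 0) =
         (if us e = v then f0 e else 0) - (if vs e = v then f0 e else 0) -
         2 * ((if us e = v then r e - fw e else 0) + (if vs e = v then r (e + M) - bw e else 0))"
        by (auto simp: f0_def)
    qed simp
    then show ?thesis using 1 b[OF v] by (simp add: f0_def)
  qed
qed

definition demand :: "int \<Rightarrow> int \<Rightarrow> int \<Rightarrow> int \<Rightarrow> int \<Rightarrow> int \<Rightarrow> int \<Rightarrow> int" where
  "demand d1 s t d2 x y v = d1 * (of_bool (v = s) - of_bool (v = t)) + d2 * (of_bool (v = x) - of_bool (v = y))"

lemma sum_demand:
  assumes "s \<in> {0..<n}" "t \<in> {0..<n}" "x \<in> {0..<n}" "y \<in> {0..<n}"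
  shows "(\<Sum>v\<in>{0..<n} \<inter> X. demand d1 s t d2 x y v) =
    d1 * (of_bool (s \<in> X) - of_bool (t \<in> X)) + d2 * (of_bool (x \<in> X) - of_bool (y \<in> X))"
proof -
  have o: "(\<Sum>v\<in>{0..<n} \<inter> X. of_bool (v = z)) = (of_bool (z \<in> X) :: int)" if "z \<in> {0..<n}" for z
  proof -
    have "(\<Sum>v\<in>{0..<n} \<inter> X. of_bool (v = z) :: int) = (\<Sum>v\<in>{0..<n} \<inter> X. if v = z then 1 else 0)"
      by (rule sum.cong) auto
    then show ?thesis using that by simp
  qed
  show ?thesis
    unfolding demand_def by (simp only: sum.distrib sum_distrib_left[symmetric] sum_subtractf o[OF assms(1)] o[OF assms(2)] o[OF assms(3)] o[OF assms(4)])
qed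

lemma demand_cut:
  assumes v: "s \<in> {0..<n}" "t \<in> {0..<n}" "x \<in> {0..<n}" "y \<in> {0..<n}" and d: "0 \<le> d1" "0 \<le> d2"
    and c1: "\<And>X. s \<in> X \<Longrightarrow> t \<notin> X \<Longrightarrow> d1 \<le> cut c X" and c2: "\<And>X. (x \<in> X) \<noteq> (y \<in> X) \<Longrightarrow> d2 \<le> cut c X"
    and c12: "\<And>X. s \<in> X \<Longrightarrow> t \<notin> X \<Longrightarrow> (x \<in> X) \<noteq> (y \<in> X) \<Longrightarrow> d1 + d2 \<le> cut c X"
    and c0: "\<And>e. 0 \<le> e \<Longrightarrow> e < m \<Longrightarrow> 0 \<le> c e"
  shows "(\<Sum>v\<in>{0..<n} \<inter> X. demand d1 s t d2 x y v) \<le> cut c X"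
  unfolding sum_demand[OF v] using c1[of X] c2[of X] c12[of X] cut_nonneg[of c X, OF c0] d
  by (cases "s \<in> X"; cases "t \<in> X"; cases "x \<in> X"; cases "y \<in> X") auto

text \<open>How the value is split between the two commodities: the first one gets as much as a minimum cut
  admits, up to parity.\<close>

lemma split_value:
  assumes c0: "\<And>e. 0 \<le> e \<Longrightarrow> e < m \<Longrightarrow> 0 \<le> c e" and par: "parity_ok c s1 t1 s2 t2"
    and v: "s1 \<in> {0..<n}" "t1 \<in> {0..<n}" "s2 \<in> {0..<n}" "t2 \<in> {0..<n}" "distinct [s1, t1, s2, t2]"
    and tau: "1 \<le> \<tau>" "\<And>X. s1 \<in> X \<Longrightarrow> t1 \<notin> X \<Longrightarrow> (s2 \<in> X) \<noteq> (t2 \<in> X) \<Longrightarrow> \<tau> \<le> cut c X"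
      "s1 \<in> X0" "t1 \<notin> X0" "(s2 \<in> X0) \<noteq> (t2 \<in> X0)" "cut c X0 = \<tau>"
    and lam: "\<And>X. s1 \<in> X \<Longrightarrow> t1 \<notin> X \<Longrightarrow> l \<le> cut c X" "s1 \<in> Y" "t1 \<notin> Y" "cut c Y = l" "0 \<le> l"
    and d1: "d1 = (if l < \<tau> then l else if even (\<tau> - degree c s1) then \<tau> else \<tau> - 1)" and d2: "d2 = \<tau> - d1"
  shows "0 \<le> d1" "0 \<le> d2" "even (d1 - degree c s1)" "even (d2 - degree c s2)"
    "\<And>X. s1 \<in> X \<Longrightarrow> t1 \<notin> X \<Longrightarrow> d1 \<le> cut c X" "\<And>X. (s2 \<in> X) \<noteq> (t2 \<in> X) \<Longrightarrow> d2 \<le> cut c X"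
proof -
  have deg: "even ((\<Sum>v\<in>{0..<n} \<inter> X. degree c v) + of_bool (s1 \<in> X) * degree c s1 + of_bool (t1 \<in> X) * degree c t1
      + of_bool (s2 \<in> X) * degree c s2 + of_bool (t2 \<in> X) * degree c t2)" for X
  proof -
    let ?T = "{s1, t1, s2, t2}"
    have "(\<Sum>v\<in>{0..<n} \<inter> X. degree c v) = (\<Sum>v\<in>({0..<n} \<inter> X) - ?T. degree c v) + (\<Sum>v\<in>({0..<n} \<inter> X) \<inter> ?T. degree c v)"
      by (subst sum.Int_Diff[of _ _ ?T]) auto
    moreover have "even (\<Sum>v\<in>({0..<n} \<inter> X) - ?T. degree c v)"
      by (rule dvd_sum) (use par in \<open>auto simp: parity_ok_def\<close>)
    moreover have "(\<Sum>v\<in>({0..<n} \<inter> X) \<inter> ?T. degree c v) = (\<Sum>v\<in>?T. of_bool (v \<in> X) * degree c v)"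
      by (rule sum.mono_neutral_cong_left) (use v in auto)
    moreover have "(\<Sum>v\<in>?T. of_bool (v \<in> X) * degree c v) = of_bool (s1 \<in> X) * degree c s1 + of_bool (t1 \<in> X) * degree c t1
      + of_bool (s2 \<in> X) * degree c s2 + of_bool (t2 \<in> X) * degree c t2" (is "_ = ?z") using v(5) by simp
    ultimately have "(\<Sum>v\<in>{0..<n} \<inter> X. degree c v) + ?z = (\<Sum>v\<in>({0..<n} \<inter> X) - ?T. degree c v) + 2 * ?z"
      by (simp only: mult_2 add.assoc)
    moreover have "even ((\<Sum>v\<in>({0..<n} \<inter> X) - ?T. degree c v) + 2 * ?z)"
      using \<open>even (\<Sum>v\<in>({0..<n} \<inter> X) - ?T. degree c v)\<close> by (simp only: even_add dvd_triv_left)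
    ultimately show ?thesis by (simp only: add.assoc)
  qed
  \<comment> \<open>The parity of a cut is determined by the terminals on one side, since all other
    degrees are even.\<close>
  have cp: "even (cut c X + of_bool (s1 \<in> X) * degree c s1 + of_bool (t1 \<in> X) * degree c t1
      + of_bool (s2 \<in> X) * degree c s2 + of_bool (t2 \<in> X) * degree c t2)" for X
    using cut_parity[of c X] deg[of X] by presburger
  have p1: "even (degree c s1 + degree c t1)" "even (degree c s2 + degree c t2)" using par by (auto simp: parity_ok_def)
  have pt: "even (\<tau> + degree c s1 + degree c s2)"
    using cp[of X0] tau(3-6) p1 by (cases "s2 \<in> X0") auto
  have YX: "\<tau> \<le> cut c Y" if "(s2 \<in> Y) \<noteq> (t2 \<in> Y)" using tau(2)[of Y] lam that by auto
  have pl: "even (l + degree c s1)" if "l < \<tau>"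
  proof -
    \<comment> \<open>A minimum cut of the first pair that is cheaper than \<tau> cannot separate
      the second pair as well.\<close>
    have "(s2 \<in> Y) = (t2 \<in> Y)" using YX lam that by auto
    then show ?thesis using cp[of Y] lam(2-4) p1 by (cases "s2 \<in> Y") auto
  qed
  show "0 \<le> d1" "0 \<le> d2" using d1 d2 tau(1) lam by auto
  show e1: "even (d1 - degree c s1)" using d1 pl pt by auto
  then show "even (d2 - degree c s2)" using d2 pt by auto
  show "d1 \<le> cut c X" if "s1 \<in> X" "t1 \<notin> X" for X using lam(1)[OF that] d1 by (auto split: if_splits)
  show "d2 \<le> cut c X" if X: "(s2 \<in> X) \<noteq> (t2 \<in> X)" for X
  proof (cases "(s1 \<in> X) = (t1 \<in> X)")
    case False
    then have "\<tau> \<le> cut c X"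
      using tau(2)[of X] tau(2)[of "- X"] X by (cases "s1 \<in> X") (auto simp: cut_complement)
    then show ?thesis using d2 \<open>0 \<le> d1\<close> by simp
  next
    case same: True
    show ?thesis
    proof (cases "l < \<tau>")
      case True
      have "(s2 \<in> Y) = (t2 \<in> Y)" using YX lam True by auto
      \<comment> \<open>\<open>X\<close> separates only the second pair and \<open>Y\<close> only
        the first, so their symmetric difference separates both. This gives \<tau> at most
        \<open>cut c X + l\<close>, that is, \<open>d2\<close> at most
        \<open>cut c X\<close>.\<close>
      then have Z: "(s2 \<in> {v. (v \<in> X) \<noteq> (v \<in> Y)}) \<noteq> (t2 \<in> {v. (v \<in> X) \<noteq> (v \<in> Y)})" using X by auto
      let ?Z = "{v. (v \<in> X) \<noteq> (v \<in> Y)}"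
      have "\<tau> \<le> cut c ?Z"
      proof (cases "s1 \<in> ?Z")
        case True
        then show ?thesis using tau(2)[of ?Z] Z same lam(2,3) by auto
      next
        case False
        have "\<tau> \<le> cut c (- ?Z)" by (rule tau(2)) (use False Z same lam(2,3) in auto)
        then show ?thesis by (simp only: cut_complement)
      qed
      then show ?thesis using cut_symdiff[of c X Y, OF c0] True d1 d2 lam(4) by simp
    next
      case False
      show ?thesis
      proof (cases "even (\<tau> - degree c s1)")
        case True
        then show ?thesis using False d1 d2 cut_nonneg[of c X, OF c0] by simp
      next
        \<comment> \<open>Here \<open>d2\<close> is 1. The vertices \<open>s2\<close> and
          \<open>t2\<close> have odd degree and are separated by \<open>X\<close>, so the cut is odd
          and therefore not 0.\<close>
        case odd: False
        then have "odd (degree c s2)" using pt by auto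
        then have "odd (degree c t2)" using p1 by auto
        have "odd (cut c X)" using cp[of X] X same p1 \<open>odd (degree c s2)\<close> \<open>odd (degree c t2)\<close>
          by (cases "s2 \<in> X"; cases "s1 \<in> X") auto
        then have "cut c X \<noteq> 0" by auto
        then have "1 \<le> cut c X" using cut_nonneg[of c X, OF c0] by simp
        then show ?thesis using False odd d1 d2 by simp
      qed
    qed
  qed
qed

definition demand_cost :: int where
  "demand_cost = flow_cost + 300 * (M + n) + 300"

lemma divergence_degree: "(\<And>e. 0 \<le> e \<Longrightarrow> e < m \<Longrightarrow> even (f e + c e)) \<Longrightarrow> even (divergence f v + degree c v)"
  unfolding divergence_def degree_def sum.distrib[symmetric] by (rule dvd_sum) auto

lemma wp_demand_flow:
  assumes mem: "mem \<sigma>" and q: "q \<notin> {2, 3, 4, 5, 6, 10, 11, 12, 13, 14, 15, 16, 19}"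
    and xy: "{x, y} \<inter> {46, 47, 50} = {}"
    and c: "\<And>e. 0 \<le> e \<Longrightarrow> e < m \<Longrightarrow> 0 \<le> arrs \<sigma> 2 e"
    and dd: "dd = demand (regs \<sigma> 54) (regs \<sigma> 2) (regs \<sigma> 3) (regs \<sigma> 55) (regs \<sigma> x) (regs \<sigma> y)"
    and v: "regs \<sigma> 2 \<in> {0..<n}" "regs \<sigma> 3 \<in> {0..<n}" "regs \<sigma> x \<in> {0..<n}" "regs \<sigma> y \<in> {0..<n}"
      "distinct [regs \<sigma> 2, regs \<sigma> 3, regs \<sigma> x, regs \<sigma> y]"
    and cut: "\<And>X. (\<Sum>v\<in>{0..<n} \<inter> X. dd v) \<le> cut (arrs \<sigma> 2) X"
    and ev: "\<And>v. v \<in> {0..<n} \<Longrightarrow> even (dd v + degree (arrs \<sigma> 2) v)"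
  shows "wp (demand_flow q x y) (\<lambda>\<tau> k.
     ((\<forall>e. 0 \<le> e \<and> e < m \<longrightarrow> 0 \<le> arrs \<tau> q e \<and> arrs \<tau> q e \<le> arrs \<sigma> 2 e) \<and>
      (\<forall>v\<in>{0..<n}. divergence (\<lambda>e. arrs \<sigma> 2 e - 2 * arrs \<tau> q e) v = dd v)) \<and> 0 \<le> k) \<sigma> demand_cost"
proof -
  note m = memD[OF mem]
  define c where "c = arrs \<sigma> 2"
  define fw bw where "fw = (\<lambda>e. c e div 2)" and "bw = (\<lambda>e. c e - c e div 2)"
  define f0 where "f0 = (\<lambda>e. bw e - fw e)"
  \<comment> \<open>\<open>f0\<close> is the capacity modulo 2. Its divergence has the parity of the
    degree, which is that of the demand, so the halving is exact.\<close>
  define b where "b = (\<lambda>v. (dd v - divergence f0 v) div 2)"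
  have mM: "m + 2 * n \<le> M" "0 \<le> M" using M_pos by (auto simp: M_def ret_def)
  have q': "q \<noteq> 2" "q \<noteq> 3" "q \<noteq> 4" "q \<noteq> 5" "q \<noteq> 6" "q \<noteq> 19" using q by auto
  have b2: "2 * b v = dd v - divergence f0 v" if "v \<in> {0..<n}" for v
  proof -
    have "f0 e + c e = 2 * (c e - c e div 2)" for e by (simp add: f0_def fw_def bw_def)
    then have "even (divergence f0 v + degree c v)" by (intro divergence_degree) simp
    then have "even (dd v - divergence f0 v)" using ev[OF that] unfolding c_def[symmetric] by auto
    then show ?thesis by (simp add: b_def)
  qed
  show ?thesis
    unfolding demand_flow_def wp_Seq
  proof (rule wp_for[where T = 20 and I = "\<lambda>i \<tau>. \<forall>e. 0 \<le> e \<and> e < i \<longrightarrow> arrs \<tau> 13 e = fw e \<and> arrs \<tau> 14 e = bw e"], goal_cases)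
    case (8 i \<tau>)
    have "arrs \<tau> 2 = c" by (simp add: agree_arrs[OF 8(5)] c_def)
    then show ?case using 8(1,4) by (auto simp: fw_def bw_def)
  next
    case (9 \<tau>1 k1)
    have r1: "regs \<tau>1 z = regs \<sigma> z" if "z \<noteq> 50" for z using that by (simp add: agree_regs[OF 9(2)])
    have a1: "arrs \<tau>1 z = arrs \<sigma> z" if "z \<notin> {13, 14}" for z using that by (simp add: agree_arrs[OF 9(2)])
    have fb1: "\<And>e. 0 \<le> e \<Longrightarrow> e < m \<Longrightarrow> arrs \<tau>1 13 e = fw e \<and> arrs \<tau>1 14 e = bw e" using 9(1) by (simp add: m)
    have k1: "demand_cost - 28 * m - 6 \<le> k1" using 9(3) by (simp add: m)
    show ?case
    proof (rule wp_for[where T = 10 and I = "\<lambda>i \<tau>. \<forall>v. 0 \<le> v \<and> v < i \<longrightarrow> arrs \<tau> 19 v = 0"], goal_cases)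
      case (9 \<tau>2 k2)
      have r2: "regs \<tau>2 z = regs \<sigma> z" if "z \<noteq> 50" for z using that by (simp add: agree_regs[OF 9(2)] r1)
      have a2: "arrs \<tau>2 z = arrs \<tau>1 z" if "z \<noteq> 19" for z using that by (simp add: agree_arrs[OF 9(2)])
      have z2: "\<And>v. 0 \<le> v \<Longrightarrow> v < n \<Longrightarrow> arrs \<tau>2 19 v = 0" using 9(1) by (simp add: r1 m)
      have k2: "demand_cost - 28 * m - 18 * n - 12 \<le> k2" using 9(3) k1 by (simp add: r1 m)
      show ?case
      proof (rule wp_for[where T = 50 and I = "\<lambda>i \<tau>. \<forall>v. 0 \<le> v \<and> v < n \<longrightarrow> arrs \<tau> 19 v =
           - (\<Sum>e\<in>{0..<i}. (if us e = v then f0 e else 0) - (if vs e = v then f0 e else 0))"], goal_cases)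
        case (8 i \<tau>)
        have i: "0 \<le> i" "i < m" using 8 by (simp_all add: r2 m)
        have rt: "regs \<tau> 7 = M" by (simp add: agree_regs[OF 8(5)] r2 m)
        have at: "arrs \<tau> 3 = arrs \<sigma> 3" "arrs \<tau> 13 i = fw i" "arrs \<tau> 14 i = bw i"
          using fb1[OF i] by (simp_all add: agree_arrs[OF 8(5)] a1 a2)
        have "arrs \<sigma> 3 (i + M) = us i" "arrs \<sigma> 3 i = vs i"
          using i edge_bounds(1)[of i] by (simp_all add: m head_simps)
        then show ?case
          using 8(1,4) i us[OF i] vs[OF i] by (simp add: rt at sum_Suc_int f0_def)
      next
        case (9 \<tau>3 k3)
        have r3: "regs \<tau>3 z = regs \<sigma> z" if "z \<notin> {46, 47, 50}" for z using that by (simp add: agree_regs[OF 9(2)] r2)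
        have a3: "arrs \<tau>3 z = arrs \<tau>1 z" if "z \<noteq> 19" for z using that by (simp add: agree_arrs[OF 9(2)] a2)
        have d3: "\<And>v. 0 \<le> v \<Longrightarrow> v < n \<Longrightarrow> arrs \<tau>3 19 v = - divergence f0 v"
          using 9(1) by (simp add: r2 m divergence_def)
        have k3: "demand_cost - 86 * m - 18 * n - 18 \<le> k3" using 9(3) k2 by (simp add: r2 m)
        define s t u w where "s = regs \<sigma> 2" and "t = regs \<sigma> 3" and "u = regs \<sigma> x" and "w = regs \<sigma> y"
        define d1 d2 where "d1 = regs \<sigma> 54" and "d2 = regs \<sigma> 55"
        have rs: "regs \<tau>3 2 = s" "regs \<tau>3 3 = t" "regs \<tau>3 x = u" "regs \<tau>3 y = w" "regs \<tau>3 54 = d1" "regs \<tau>3 55 = d2"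
          using xy by (auto simp: r3 s_def t_def u_def w_def d1_def d2_def)
        have dist: "s \<noteq> t" "s \<noteq> u" "s \<noteq> w" "t \<noteq> u" "t \<noteq> w" "u \<noteq> w" using v(5) by (auto simp: s_def t_def u_def w_def)
        let ?h = "arrs \<tau>3 19"
        let ?B = "?h(s := ?h s + d1, t := ?h t - d1, u := ?h u + d2, w := ?h w - d2)"
        have B: "?B v = 2 * b v" if "v \<in> {0..<n}" for v
          using b2[OF that] d3[of v] that dist
          unfolding dd demand_def s_def[symmetric] t_def[symmetric] u_def[symmetric] w_def[symmetric] d1_def[symmetric] d2_def[symmetric]
          by auto
        define \<tau>4 where "\<tau>4 = \<tau>3\<lparr>arrs := (arrs \<tau>3)(19 := ?B)\<rparr>"
        have st4: "wp (Update 19 (Reg 2) (Plus (Elem 19 (Reg 2)) (Reg 54)))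
           (wp (Update 19 (Reg 3) (Minus (Elem 19 (Reg 3)) (Reg 54)))
           (wp (Update 19 (Reg x) (Plus (Elem 19 (Reg x)) (Reg 55)))
           (wp (Update 19 (Reg y) (Minus (Elem 19 (Reg y)) (Reg 55))) Q))) \<tau>3 k3 \<longleftrightarrow> Q \<tau>4 (k3 - 24)" for Q
          using dist by (simp add: rs \<tau>4_def)
        show ?case
          unfolding wp_Seq_fun st4
        proof (rule wp_for[where T = 25 and I = "\<lambda>i \<tau>. \<forall>v. 0 \<le> v \<and> v < i \<longrightarrow> arrs \<tau> 15 v = max (b v) 0 \<and> arrs \<tau> 16 v = max (- b v) 0"], goal_cases)
          case (8 i \<tau>)
          have i: "i \<in> {0..<n}" using 8 by (simp add: \<tau>4_def r3 m)
          have "arrs \<tau> 19 i = 2 * b i" using B[OF i] by (simp add: agree_arrs[OF 8(5)] \<tau>4_def)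
          then show ?case using 8(1,4) by (auto simp: max_def)
        next
          case (9 \<tau>5 k5)
          have r5: "regs \<tau>5 z = regs \<sigma> z" if "z \<notin> {46, 47, 50}" for z using that by (simp add: agree_regs[OF 9(2)] \<tau>4_def r3)
          have a5: "arrs \<tau>5 z = arrs \<tau>1 z" if "z \<notin> {15, 16, 19}" for z
            using that by (simp add: agree_arrs[OF 9(2)] \<tau>4_def a3)
          have sd: "\<And>v. v \<in> {0..<n} \<Longrightarrow> arrs \<tau>5 15 v = max (b v) 0" "\<And>v. v \<in> {0..<n} \<Longrightarrow> arrs \<tau>5 16 v = max (- b v) 0"
            using 9(1) by (simp_all add: \<tau>4_def r3 m)
          have k5: "demand_cost - 86 * m - 51 * n - 48 \<le> k5" using 9(3) k3 by (simp add: \<tau>4_def r3 m)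
          have ql: "q \<notin> {13, 14, 15, 16}" using q by auto
          have m5: "mem \<tau>5" by (rule mem_cong[OF mem]) (simp_all add: r5 a5 a1)
          show ?case
          proof (rule wp_spec[OF wp_load[OF _ _ _ ql]], goal_cases)
            case (4 \<tau>6 k6)
            have m6: "mem \<tau>6" by (rule mem_cong[OF m5]) (use q' in \<open>simp_all add: agree_regs[OF 4(2)] agree_arrs[OF 4(2)]\<close>)
            have fb: "arrs \<tau>5 13 e = fw e \<and> arrs \<tau>5 14 e = bw e" if "0 \<le> e" "e < m" for e using fb1[OF that] by (simp add: a5)
            let ?b = "base fw bw (arrs \<tau>5 15) (arrs \<tau>5 16) 0 0"
            have base: "arrs \<tau>6 q a = ?b a" if aA: "a \<in> A" for a
            proof -
              have "0 \<le> a" "a < 2 * M" using aA by auto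
              then show ?thesis using 4(1)[rule_format, OF aA] fb
                by (cases a rule: edge_cases) (auto simp: base_simps)
            qed
            have c0: "fw e + bw e = c e \<and> 0 \<le> fw e \<and> 0 \<le> bw e" if "0 \<le> e" "e < m" for e
              using assms(4)[OF that] by (auto simp: fw_def bw_def c_def)
            have b0: "\<forall>a\<in>A. 0 \<le> arrs \<tau>6 q a"
            proof
              fix a assume aA: "a \<in> A"
              then have "0 \<le> a" "a < 2 * M" by auto
              then show "0 \<le> arrs \<tau>6 q a"
                unfolding base[OF aA] by (cases a rule: edge_cases) (use c0 sd in \<open>auto simp: base_simps\<close>)
            qed
            have q3: "q \<notin> {3, 4, 5, 6, 10, 11, 12}" using q by auto
            have k6: "flow_cost \<le> k6" using 4(3) k5 mM n0 m0 by (simp add: demand_cost_def)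
            show ?case
            proof (rule wp_spec[OF wp_maxflow[OF m6 q3 b0]], elim conjE)
              fix \<tau> k assume a: "residual (arrs \<tau>6 q) (arrs \<tau> q)"
                "\<forall>v\<in>{0..<n}. excess (arrs \<tau>6 q) (arrs \<tau> q) v = 0"
                "\<exists>X\<subseteq>V. n \<in> X \<and> n + 1 \<notin> X \<and> closed (arrs \<tau> q) X" "k6 - flow_cost \<le> k"
              have ex: "excess (arrs \<tau>6 q) (arrs \<tau> q) v = excess ?b (arrs \<tau> q) v" for v
                by (rule excess_cong) (rule base)
              have res: "residual ?b (arrs \<tau> q)"
                using a(1) residual_cong[of "arrs \<tau>6 q" ?b "arrs \<tau> q"] base by blast
              have cons: "\<And>v. v \<in> {0..<n} \<Longrightarrow> excess ?b (arrs \<tau> q) v = 0"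
                using a(2) ex by metis
              have X: "\<exists>X. X \<subseteq> V \<and> n \<in> X \<and> n + 1 \<notin> X \<and> closed (arrs \<tau> q) X" using a(3) by blast
              have d0: "(\<Sum>v\<in>{0..<n}. dd v) = 0"
                using sum_demand[OF v(1-4), where X = UNIV] by (simp add: dd)
              note de = demand_flow_exists[where c = c and b = b, OF c0 b2[unfolded f0_def] d0 cut[folded c_def] sd res cons X]
              show "((\<forall>e. 0 \<le> e \<and> e < m \<longrightarrow> 0 \<le> arrs \<tau> q e \<and> arrs \<tau> q e \<le> arrs \<sigma> 2 e) \<and>
                (\<forall>v\<in>{0..<n}. divergence (\<lambda>e. arrs \<sigma> 2 e - 2 * arrs \<tau> q e) v = dd v)) \<and> 0 \<le> k"
                unfolding c_def[symmetric] using de a(4) k6 by auto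
            qed
          qed (simp_all add: r5 m)
        qed (use n0 in \<open>auto simp: \<tau>4_def r3 m\<close>)
      qed (use m0 z2 in \<open>auto simp: r2 m\<close>)
    qed (use n0 in \<open>auto simp: r1 m\<close>)
  qed (use m0 in \<open>auto simp: m\<close>)
qed

end

section \<open>Path decomposition of an integral flow\<close>

section \<open>Decomposition into paths\<close>

definition encode :: "(nat list \<times> nat) list \<Rightarrow> nat list" where
  "encode L = concat (map (\<lambda>(Q, w). w # length Q # Q) L)"

definition listed :: "(int \<Rightarrow> int) \<Rightarrow> int \<Rightarrow> nat list \<Rightarrow> bool" where
  "listed f p xs \<longleftrightarrow> p = int (length xs) \<and> (\<forall>i<length xs. f (int i) = int (xs ! i))"

lemma encode_append: "encode (L @ L') = encode L @ encode L'"
  by (simp add: encode_def)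

lemma encode_single: "encode [(Q, w)] = [w, length Q] @ Q"
  by (simp add: encode_def)

lemma listed_snoc: "listed f p xs \<Longrightarrow> z = int y \<Longrightarrow> listed (f(p := z)) (p + 1) (xs @ [y])"
  by (auto simp: listed_def nth_append less_Suc_eq)

text \<open>In array 24, the entry of an arc is the flow against its direction, so that a search tree rooted at the
  sink of a commodity yields the paths from its source in order.\<close>

definition extract_path :: "nat \<Rightarrow> com" where
  "extract_path s =
     (Assign 63 (Reg s) ;; Assign 62 (Elem 24 (Elem 8 (Reg 63))) ;; Assign 65 (Num 0) ;;
      While (Not (Equal (Reg 63) (Reg 20)))
        (Assign 64 (Elem 8 (Reg 63)) ;;
         If (Less (Elem 24 (Reg 64)) (Reg 62)) (Assign 62 (Elem 24 (Reg 64))) Skip ;;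
         incr 65 ;; Assign 63 (Elem 3 (Elem 4 (Reg 64)))) ;;
      Update 0 (Reg 60) (Reg 62) ;; incr 60 ;; Update 0 (Reg 60) (Reg 65) ;; incr 60 ;;
      Assign 63 (Reg s) ;;
      While (Not (Equal (Reg 63) (Reg 20)))
        (Assign 64 (Elem 8 (Reg 63)) ;;
         Update 24 (Reg 64) (Minus (Elem 24 (Reg 64)) (Reg 62)) ;;
         If (Less (Reg 64) (Reg 7)) (Update 0 (Reg 60) (Reg 64))
           (Update 0 (Reg 60) (Minus (Reg 64) (Reg 7))) ;;
         incr 60 ;; Assign 63 (Elem 3 (Elem 4 (Reg 64)))) ;;
      incr 61)"

definition decompose :: "nat \<Rightarrow> nat \<Rightarrow> com" where
  "decompose s t =
     (Assign 20 (Reg t) ;; search 24 ;;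
      While (Less (Num 0) (Elem 7 (Reg s))) (extract_path s ;; search 24))"

definition set_path_arcs :: "aexp \<Rightarrow> com" where
  "set_path_arcs p =
     (for_loop 50 8 (Update 24 (Reg 50) (Num 0)) ;;
      for_loop 50 1
        (Assign 46 p ;;
         If (Less (Num 0) (Reg 46)) (Update 24 (Plus (Reg 50) (Reg 7)) (Reg 46))
           (Update 24 (Reg 50) (Minus (Num 0) (Reg 46)))))"

lemma written_extract_path [simp]:
  "written_regs (extract_path s) = {60, 61, 62, 63, 64, 65}" "written_arrs (extract_path s) = {0, 24}"
  by (auto simp: extract_path_def)

lemma written_decompose [simp]:
  "written_regs (decompose s t) = {20, 21, 22, 23, 24, 25, 60, 61, 62, 63, 64, 65}"
  "written_arrs (decompose s t) = {0, 7, 8, 9, 24}"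
  by (auto simp: decompose_def)

lemma written_set_path_arcs [simp]:
  "written_regs (set_path_arcs p) = {46, 50}" "written_arrs (set_path_arcs p) = {24}"
  by (auto simp: set_path_arcs_def)

context arc_graph
begin

text \<open>Listed from \<open>v\<close> towards the root, against the direction of the arcs; this
  is the order in which the edges of a path from the source are output.\<close>

fun tree_path :: "'v \<Rightarrow> ('v \<Rightarrow> 'a) \<Rightarrow> 'v \<Rightarrow> 'a list \<Rightarrow> bool" where
  "tree_path x par v [] \<longleftrightarrow> v = x"
| "tree_path x par v (a # as) \<longleftrightarrow> v \<noteq> x \<and> a = par v \<and> tree_path x par (tail a) as"

lemma search_tree_parent:
  assumes "search_tree r x rk par" "v \<in> V" "0 < rk v" "v \<noteq> x"
  shows "par v \<in> A" "head (par v) = v" "0 < r (par v)" "0 < rk (tail (par v))" "rk (tail (par v)) < rk v"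
  using assms unfolding search_tree_def by blast+

lemma tree_path_exists:
  assumes st: "search_tree r x rk par" and v: "v \<in> V" "0 < rk v"
  shows "\<exists>as. tree_path x par v as"
  using v
proof (induction "nat (rk v)" arbitrary: v rule: less_induct)
  case less
  show ?case
  proof (cases "v = x")
    case True then show ?thesis by (intro exI[of _ "[]"]) simp
  next
    case False
    note p = search_tree_parent[OF st less.prems False]
    obtain as where "tree_path x par (tail (par v)) as"
      using less.hyps[of "tail (par v)"] p by auto
    then show ?thesis using False by (intro exI[of _ "par v # as"]) simp
  qed
qed

lemma tree_path_props:
  assumes st: "search_tree r x rk par" and v: "v \<in> V" "0 < rk v" and p: "tree_path x par v as"
  shows "\<forall>a\<in>set as. a \<in> A \<and> 0 < r a \<and> rk (head a) \<le> rk v \<and> rk (tail a) < rk v"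
    and "distinct as" and "distinct (v # map tail as)" and "last (v # map tail as) = x"
    and "\<forall>i<length as. head (as ! i) = (v # map tail as) ! i"
    and "int (length as) \<le> rk v"
proof -
  have "(\<forall>a\<in>set as. a \<in> A \<and> 0 < r a \<and> rk (head a) \<le> rk v \<and> rk (tail a) < rk v) \<and> distinct as \<and>
    distinct (v # map tail as) \<and> last (v # map tail as) = x \<and>
    (\<forall>i<length as. head (as ! i) = (v # map tail as) ! i) \<and> int (length as) \<le> rk v"
    using v p
  proof (induction as arbitrary: v)
    case Nil
    then show ?case by simp
  next
    case (Cons a as)
    then have vx: "v \<noteq> x" and a: "a = par v" and tp: "tree_path x par (tail a) as" by auto
    note q = search_tree_parent[OF st Cons.prems(1,2) vx, folded a]
    note IH = Cons.IH[OF tailV[OF q(1)] q(4) tp]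
    have "a \<notin> set as" using IH q by fastforce
    moreover have "v \<notin> set (map tail as)" using IH q(5) by fastforce
    moreover have "v \<noteq> tail a" using q by auto
    moreover have "head ((a # as) ! i) = (v # map tail (a # as)) ! i" if "i < length (a # as)" for i
      using IH q(2) that by (cases i) auto
    ultimately show ?case using IH q by auto
  qed
  then show "\<forall>a\<in>set as. a \<in> A \<and> 0 < r a \<and> rk (head a) \<le> rk v \<and> rk (tail a) < rk v"
    "distinct as" "distinct (v # map tail as)" "last (v # map tail as) = x"
    "\<forall>i<length as. head (as ! i) = (v # map tail as) ! i" "int (length as) \<le> rk v" by blast+
qed

text \<open>As \<open>P\<close> records flow against the arcs, this is outflow minus inflow.\<close>

definition net_out :: "('a \<Rightarrow> int) \<Rightarrow> 'v \<Rightarrow> int" where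
  "net_out P v = (\<Sum>a\<in>out_arcs v. P (rv a) - P a)"

definition drop_path :: "'a list \<Rightarrow> int \<Rightarrow> ('a \<Rightarrow> int) \<Rightarrow> 'a \<Rightarrow> int" where
  "drop_path as \<delta> P a = P a - (if a \<in> set as then \<delta> else 0)"

lemma drop_path_Nil: "drop_path [] \<delta> P = P"
  by (auto simp: drop_path_def)

lemma drop_path_snoc:
  "a \<notin> set as \<Longrightarrow> drop_path (as @ [a]) \<delta> P = (drop_path as \<delta> P)(a := drop_path as \<delta> P a - \<delta>)"
  by (auto simp: drop_path_def)

lemma drop_path_Cons:
  "a \<notin> set as \<Longrightarrow> drop_path (a # as) \<delta> P = drop_path as \<delta> (P(a := P a - \<delta>))"
  by (auto simp: drop_path_def)

lemma net_out_upd: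
  assumes a: "a \<in> A"
  shows "net_out (P(a := P a - \<delta>)) u = net_out P u + (if u = tail a then \<delta> else 0) - (if u = head a then \<delta> else 0)"
proof -
  have "net_out (P(a := P a - \<delta>)) u = (\<Sum>b\<in>out_arcs u. (P (rv b) - P b) + (if b = a then \<delta> else 0) - (if b = rv a then \<delta> else 0))"
    unfolding net_out_def
  proof (rule sum.cong)
    fix b assume "b \<in> out_arcs u"
    then have b: "b \<in> A" by (simp add: out_arcs_def)
    show "(P(a := P a - \<delta>)) (rv b) - (P(a := P a - \<delta>)) b = P (rv b) - P b + (if b = a then \<delta> else 0) - (if b = rv a then \<delta> else 0)"
      using rv_eq_iff[OF b a] a b by auto
  qed simp
  also have "\<dots> = net_out P u + (if a \<in> out_arcs u then \<delta> else 0) - (if rv a \<in> out_arcs u then \<delta> else 0)"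
    by (simp add: net_out_def sum.distrib sum_subtractf)
  finally show ?thesis using a by (auto simp: out_arcs_def head_def)
qed

text \<open>The changes at consecutive arcs cancel at inner vertices, so only the two ends
  remain.\<close>

lemma net_out_drop_path:
  assumes st: "search_tree r x rk par" and v: "v \<in> V" "0 < rk v" and p: "tree_path x par v as"
  shows "net_out (drop_path as \<delta> P) u = net_out P u - (if u = v then \<delta> else 0) + (if u = x then \<delta> else 0)"
  using v p
proof (induction as arbitrary: v P)
  case Nil
  then show ?case by (simp add: drop_path_Nil)
next
  case (Cons a as)
  then have vx: "v \<noteq> x" and a: "a = par v" and tp: "tree_path x par (tail a) as" by auto
  note q = search_tree_parent[OF st Cons.prems(1,2) vx, folded a]
  have na: "a \<notin> set as" using tree_path_props(2)[OF st Cons.prems(1,2,3)] by simp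
  have "net_out (drop_path (a # as) \<delta> P) u = net_out (drop_path as \<delta> (P(a := P a - \<delta>))) u"
    by (simp only: drop_path_Cons[OF na])
  also have "\<dots> = net_out (P(a := P a - \<delta>)) u - (if u = tail a then \<delta> else 0) + (if u = x then \<delta> else 0)"
    by (rule Cons.IH[OF tailV[OF q(1)] q(4) tp])
  also have "\<dots> = net_out P u - (if u = v then \<delta> else 0) + (if u = x then \<delta> else 0)"
    unfolding net_out_upd[OF q(1)] q(2) by simp
  finally show ?case .
qed

lemma net_out_cut:
  assumes "X \<subseteq> V"
  shows "(\<Sum>v\<in>X. net_out P v) = (\<Sum>a\<in>outs X. P (rv a) - P a)"
  unfolding net_out_def using assms by (intro sum_cut_antisym) auto

end

definition total :: "(nat list \<times> nat) list \<Rightarrow> int" where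
  "total L = sum_list (map (\<lambda>(Q, w). int w) L)"

definition load_of :: "(nat list \<times> nat) list \<Rightarrow> int \<Rightarrow> int" where
  "load_of L e = sum_list (map (\<lambda>(Q, w). if nat e \<in> set Q then int w else 0) L)"

context network
begin

definition edge_path :: "int \<Rightarrow> nat list \<Rightarrow> int \<Rightarrow> bool" where
  "edge_path s Q t \<longleftrightarrow> (\<exists>ws. length ws = length Q + 1 \<and> distinct ws \<and> set ws \<subseteq> {0..<n} \<and> hd ws = s \<and> last ws = t \<and>
     (\<forall>i<length Q. int (Q ! i) < m \<and> {us (int (Q ! i)), vs (int (Q ! i))} = {ws ! i, ws ! Suc i}))"

text \<open>Every listed path retains a bottleneck edge without remaining flow in either direction,
  whereas a new path uses only edges that still carry flow. This is how the distinctness demanded of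
  the output is obtained without comparing paths.\<close>

definition decomposed ::
  "(int \<Rightarrow> int) \<Rightarrow> int \<Rightarrow> int \<Rightarrow> int \<Rightarrow> (int \<Rightarrow> int) \<Rightarrow> (nat list \<times> nat) list \<Rightarrow> bool" where
  "decomposed P0 d s t P L \<longleftrightarrow>
     (\<forall>a\<in>A. 0 \<le> P a \<and> (m \<le> edge_of a \<longrightarrow> P a = 0)) \<and> (\<forall>e. 0 \<le> e \<and> e < m \<longrightarrow> P e = 0 \<or> P (e + M) = 0) \<and>
     (\<forall>v\<in>V. net_out P v = (d - total L) * (of_bool (v = s) - of_bool (v = t))) \<and>
     (\<forall>e. 0 \<le> e \<and> e < m \<longrightarrow> P e + P (e + M) + load_of L e = P0 e + P0 (e + M)) \<and>
     (\<forall>Q\<in>fst ` set L. edge_path s Q t \<and> (\<exists>e\<in>set Q. P (int e) = 0 \<and> P (int e + M) = 0)) \<and> distinct (map fst L)"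

lemma edge_of_ends: "a \<in> A \<Longrightarrow> edge_of a < m \<Longrightarrow> {us (edge_of a), vs (edge_of a)} = {head a, tl a}"
  using head_simps(1,2)[of "edge_of a"] tl_simps(1,2)[of "edge_of a"] edge_of_bounds[of a]
  by (cases "a < M") (auto simp: edge_of_def)

text \<open>The bottleneck arc drops to 0, so fewer arcs carry flow afterwards; this bounds the
  number of extracted paths by the number of arcs.\<close>

lemma decomposed_step:
  assumes dec: "decomposed P0 d s t P L" and st: "search_tree P t rk par"
    and s: "s \<in> {0..<n}" "0 < rk s" "s \<noteq> t" and p: "tree_path t par s as"
    and \<delta>: "0 < \<delta>" "\<forall>a\<in>set as. \<delta> \<le> P a" "\<exists>a\<in>set as. P a = \<delta>"
  shows "decomposed P0 d s t (drop_path as \<delta> P) (L @ [(map (nat \<circ> edge_of) as, nat \<delta>)])"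
    and "card {a \<in> A. 0 < drop_path as \<delta> P a} < card {a \<in> A. 0 < P a}"
proof -
  let ?P = "drop_path as \<delta> P" and ?Q = "map (nat \<circ> edge_of) as"
  have sV: "s \<in> V" using s by auto
  note tp = tree_path_props[OF st sV s(2) p]
  have P: "\<And>a. a \<in> A \<Longrightarrow> 0 \<le> P a" "\<And>a. a \<in> A \<Longrightarrow> m \<le> edge_of a \<Longrightarrow> P a = 0"
    "\<And>e. 0 \<le> e \<Longrightarrow> e < m \<Longrightarrow> P e = 0 \<or> P (e + M) = 0"
    and no: "\<And>v. v \<in> V \<Longrightarrow> net_out P v = (d - total L) * (of_bool (v = s) - of_bool (v = t))"
    and ld: "\<And>e. 0 \<le> e \<Longrightarrow> e < m \<Longrightarrow> P e + P (e + M) + load_of L e = P0 e + P0 (e + M)"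
    and Ls: "\<And>Q. Q \<in> fst ` set L \<Longrightarrow> edge_path s Q t \<and> (\<exists>e\<in>set Q. P (int e) = 0 \<and> P (int e + M) = 0)"
      "distinct (map fst L)"
    using dec unfolding decomposed_def by blast+
  have asA: "a \<in> A" "0 < P a" if "a \<in> set as" for a using tp(1) that by auto
  have em: "edge_of a < m" if "a \<in> set as" for a using P(2)[of a] asA[OF that] by force
  have e0: "0 \<le> edge_of a" if "a \<in> set as" for a using edge_of_bounds asA[OF that] by blast
  have pos: "0 \<le> ?P a \<and> ?P a \<le> P a" if "a \<in> A" for a using P(1)[OF that] \<delta>(1,2) by (auto simp: drop_path_def)
  have eA: "e \<in> A" "e + M \<in> A" if "0 \<le> e" "e < m" for e using that edge_bounds(1) M_pos by auto
  have inQ: "nat e \<in> set ?Q \<longleftrightarrow> e \<in> set as \<or> e + M \<in> set as" if e: "0 \<le> e" "e < m" for e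
  proof -
    have "nat e \<in> set ?Q \<longleftrightarrow> (\<exists>a\<in>set as. edge_of a = e)" using e e0 by (force simp: nat_eq_iff)
    also have "\<dots> \<longleftrightarrow> (\<exists>a\<in>set as. a = e \<or> a = e + M)"
      using edge_of_eq[OF asA(1) e(1), of _] e edge_bounds(1) by auto
    finally show ?thesis by auto
  qed
  have one: "\<not> (e \<in> set as \<and> e + M \<in> set as)" if "0 \<le> e" "e < m" for e
    using P(3)[OF that] asA(2) by force
  have ep: "edge_path s ?Q t"
    unfolding edge_path_def
  proof (intro exI conjI allI impI)
    let ?w = "s # map tl as"
    show "length ?w = length ?Q + 1" "distinct ?w" "hd ?w = s" "last ?w = t" using tp by simp_all
    have "tl a \<in> {0..<n}" if a: "a \<in> set as" for a
    proof -
      have "tl a \<in> {us (edge_of a), vs (edge_of a)}" using edge_of_ends[OF asA(1)[OF a] em[OF a]] by auto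
      then show ?thesis using us[OF e0[OF a] em[OF a]] vs[OF e0[OF a] em[OF a]] by auto
    qed
    then show "set ?w \<subseteq> {0..<n}" using s by auto
    fix i assume i: "i < length ?Q"
    then have a: "as ! i \<in> set as" by simp
    have "head (as ! i) = ?w ! i" "tl (as ! i) = ?w ! Suc i" using tp(5) i by auto
    note ht = this
    have Qi: "int (?Q ! i) = edge_of (as ! i)" using i e0[OF a] by simp
    show "int (?Q ! i) < m" unfolding Qi by (rule em[OF a])
    show "{us (int (?Q ! i)), vs (int (?Q ! i))} = {?w ! i, ?w ! Suc i}"
      unfolding Qi edge_of_ends[OF asA(1)[OF a] em[OF a]] ht by (rule refl)
  qed
  obtain a where a: "a \<in> set as" "P a = \<delta>" using \<delta>(3) by blast
  have Pz: "?P (edge_of a) = 0 \<and> ?P (edge_of a + M) = 0"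
  proof -
    let ?e = "edge_of a"
    have b: "0 \<le> ?e" "?e < m" using e0[OF a(1)] em[OF a(1)] by auto
    have ae: "a = ?e \<or> a = ?e + M" using edge_of_eq[OF asA(1)[OF a(1)], of ?e] b edge_bounds(1) by auto
    have "?P a = 0" using a by (simp add: drop_path_def)
    moreover have "?P ?e = 0 \<or> ?P (?e + M) = 0 \<Longrightarrow> ?thesis"
      using P(3)[OF b] pos[OF eA(1)[OF b]] pos[OF eA(2)[OF b]] ae a asA(2)[OF a(1)] \<open>?P a = 0\<close> by auto
    ultimately show ?thesis using ae by metis
  qed
  have new: "?Q \<notin> fst ` set L"
  proof
    assume "?Q \<in> fst ` set L"
    then obtain e where e: "e \<in> set ?Q" "P (int e) = 0" "P (int e + M) = 0" using Ls by blast
    then obtain b where b: "b \<in> set as" "int e = edge_of b" using e0 by auto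
    have "b = edge_of b \<or> b = edge_of b + M" by (auto simp: edge_of_def)
    then show False using asA(2)[OF b(1)] e b by auto
  qed
  have nat\<delta>: "int (nat \<delta>) = \<delta>" using \<delta> by simp
  show "decomposed P0 d s t ?P (L @ [(?Q, nat \<delta>)])"
    unfolding decomposed_def
  proof (intro conjI ballI allI impI)
    fix b assume b: "b \<in> A"
    show "0 \<le> ?P b" using pos[OF b] by simp
    show "?P b = 0" if "m \<le> edge_of b" using pos[OF b] P(2)[OF b that] by simp
  next
    fix e assume e: "0 \<le> e \<and> e < m"
    then show "?P e = 0 \<or> ?P (e + M) = 0" using P(3)[of e] pos[OF eA(1)[of e]] pos[OF eA(2)[of e]] by auto
  next
    fix v assume v: "v \<in> V"
    show "net_out ?P v = (d - total (L @ [(?Q, nat \<delta>)])) * (of_bool (v = s) - of_bool (v = t))"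
      using net_out_drop_path[OF st sV s(2) p, of \<delta> P v] no[OF v] s(3) nat\<delta>
      by (auto simp: total_def algebra_simps)
  next
    fix e assume e: "0 \<le> e \<and> e < m"
    have "?P e + ?P (e + M) = P e + P (e + M) - (if nat e \<in> set ?Q then \<delta> else 0)"
      using inQ[of e] one[of e] e by (auto simp: drop_path_def)
    then show "?P e + ?P (e + M) + load_of (L @ [(?Q, nat \<delta>)]) e = P0 e + P0 (e + M)"
      using ld[of e] e nat\<delta> by (simp add: load_of_def)
  next
    fix Q assume "Q \<in> fst ` set (L @ [(?Q, nat \<delta>)])"
    then consider "Q \<in> fst ` set L" | "Q = ?Q" by auto
    then have "edge_path s Q t \<and> (\<exists>e\<in>set Q. ?P (int e) = 0 \<and> ?P (int e + M) = 0)"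
    proof cases
      case 1
      then obtain e where e: "e \<in> set Q" "P (int e) = 0" "P (int e + M) = 0" "edge_path s Q t" using Ls by blast
      have "int e < m" using e(1,4) unfolding edge_path_def in_set_conv_nth by blast
      then have "?P (int e) = 0" "?P (int e + M) = 0"
        using e pos[OF eA(1)[of "int e"]] pos[OF eA(2)[of "int e"]] by auto
      then show ?thesis using e by blast
    next
      case 2
      have "nat (edge_of a) \<in> set ?Q" "int (nat (edge_of a)) = edge_of a" using a e0 by auto
      then show ?thesis using Pz ep 2 by metis
    qed
    then show "edge_path s Q t" "\<exists>e\<in>set Q. ?P (int e) = 0 \<and> ?P (int e + M) = 0" by auto
  next
    show "distinct (map fst (L @ [(?Q, nat \<delta>)]))" using Ls(2) new by auto
  qed
  have "{a \<in> A. 0 < ?P a} \<subset> {a \<in> A. 0 < P a}"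
  proof
    show "{a \<in> A. 0 < ?P a} \<subseteq> {a \<in> A. 0 < P a}" using pos by force
    have "?P a = 0" using a by (simp add: drop_path_def)
    then have "a \<notin> {a \<in> A. 0 < ?P a}" by simp
    moreover have "a \<in> {a \<in> A. 0 < P a}" using asA[OF a(1)] by blast
    ultimately show "{a \<in> A. 0 < ?P a} \<noteq> {a \<in> A. 0 < P a}" by blast
  qed
  then show "card {a \<in> A. 0 < ?P a} < card {a \<in> A. 0 < P a}"
    by (intro psubset_card_mono) (auto intro: finite_subset[OF _ finA])
qed

text \<open>The reached set contains all vertices from which remaining flow leads to
  \<open>t\<close>. No flow enters it, yet \<open>t\<close> would have to absorb
  \<open>d - total L\<close> without help from \<open>s\<close>. Whatever flow is left in
  \<open>P\<close> is discarded.\<close>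

lemma decomposed_final:
  assumes dec: "decomposed P0 d s t P L" and st: "search_tree P t rk par" and s: "s \<in> V" "\<not> 0 < rk s"
  shows "d \<le> total L"
proof -
  let ?X = "{v \<in> V. 0 < rk v}"
  have t: "t \<in> ?X" "closed P ?X" using st by (auto simp: search_tree_def)
  have "0 \<le> (\<Sum>a\<in>outs ?X. P (rev_arc a) - P a)"
  proof (rule sum_nonneg)
    fix a assume a: "a \<in> outs ?X"
    then have "a \<in> A" by (simp add: outs_def)
    then have "0 \<le> P (rev_arc a)" using dec rvA unfolding decomposed_def by blast
    moreover have "P a \<le> 0" using t(2) a by (simp add: closed_def)
    ultimately show "0 \<le> P (rev_arc a) - P a" by simp
  qed
  also have "\<dots> = (\<Sum>v\<in>?X. net_out P v)" by (rule net_out_cut[symmetric]) auto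
  also have "\<dots> = (\<Sum>v\<in>?X. if v = t then - (d - total L) else 0)"
  proof (rule sum.cong)
    fix v assume v: "v \<in> ?X"
    then have "v \<noteq> s" using s by auto
    moreover have "net_out P v = (d - total L) * (of_bool (v = s) - of_bool (v = t))"
      using dec v unfolding decomposed_def by blast
    ultimately show "net_out P v = (if v = t then - (d - total L) else 0)" by auto
  qed simp
  also have "\<dots> = - (d - total L)"
  proof -
    have "finite ?X" by (rule finite_subset[of _ V]) auto
    then show ?thesis unfolding sum.delta[OF \<open>finite ?X\<close>] using t(1) by simp
  qed
  finally show ?thesis by simp
qed

definition path_arcs :: "(int \<Rightarrow> int) \<Rightarrow> int \<Rightarrow> int" where
  "path_arcs f a = (if m \<le> edge_of a then 0 else if a < M then max (- f a) 0 else max (f (a - M)) 0)"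

lemma path_arcs_simps:
  "0 \<le> e \<Longrightarrow> e < m \<Longrightarrow> path_arcs f e = max (- f e) 0" "0 \<le> e \<Longrightarrow> e < m \<Longrightarrow> path_arcs f (e + M) = max (f e) 0"
  "m \<le> e \<Longrightarrow> e < M \<Longrightarrow> path_arcs f e = 0" "m \<le> e \<Longrightarrow> path_arcs f (e + M) = 0"
  using edge_bounds(1) m0 by (auto simp: path_arcs_def edge_of_def)

lemma net_out_path_arcs:
  assumes P: "\<And>a. a \<in> A \<Longrightarrow> P a = path_arcs f a" and v: "v \<in> V"
  shows "net_out P v = divergence f v"
proof -
  define h where "h a = path_arcs f (rev_arc a) - path_arcs f a" for a
  have "net_out P v = (\<Sum>a\<in>out_arcs v. h a)"
    unfolding net_out_def h_def using P rvA by (intro sum.cong) (auto simp: out_arcs_def)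
  moreover have h: "h e = f e" "h (e + M) = - f e" if "0 \<le> e" "e < m" for e
    using that edge_bounds(1) by (auto simp: h_def rev_simps path_arcs_simps)
  moreover have z: "h e = 0" "h (e + M) = 0" if "m \<le> e" "e < M" for e
    using that m0 by (auto simp: h_def rev_simps path_arcs_simps)
  moreover have "h (m + w) = 0" "h (m + w + M) = 0" "h (m + n + w) = 0" "h (m + n + w + M) = 0"
    if "0 \<le> w" "w < n" for w
    using that edge_bounds(2,3) n0 by (auto intro!: z)
  moreover have "h ret = 0" "h (ret + M) = 0" using edge_bounds(4,7) by (auto intro!: z)
  ultimately show ?thesis
    unfolding divergence_alt sum_out_arcs_at by (simp cong: sum.cong_simp if_cong)
qed

lemma decomposed_init:
  assumes P: "\<And>a. a \<in> A \<Longrightarrow> P a = path_arcs f a"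
    and f: "\<And>v. v \<in> {0..<n} \<Longrightarrow> divergence f v = d * (of_bool (v = s) - of_bool (v = t))"
    and s: "s \<in> {0..<n}" "t \<in> {0..<n}"
  shows "decomposed P d s t P []"
proof -
  have "divergence f v = 0" if "n \<le> v" for v
    unfolding divergence_alt by (rule endpoints_outside) (use that in simp)
  then have "net_out P v = d * (of_bool (v = s) - of_bool (v = t))" if "v \<in> V" for v
    using net_out_path_arcs[OF P that] f[of v] s that by (cases "v < n") auto
  moreover have "P e = path_arcs f e" "P (e + M) = path_arcs f (e + M)" if "0 \<le> e" "e < m" for e
    using P[of e] P[of "e + M"] that edge_bounds(1)[of e] M_pos by auto
  ultimately show ?thesis
    using P by (auto simp: decomposed_def total_def load_of_def path_arcs_simps) (auto simp: path_arcs_def)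
qed

lemma wp_set_path_arcs:
  assumes mem: "mem \<sigma>"
    and p: "\<And>\<tau> e. 0 \<le> e \<Longrightarrow> e < m \<Longrightarrow> regs \<tau> 50 = e \<Longrightarrow> (\<And>z. z \<noteq> 24 \<Longrightarrow> arrs \<tau> z = arrs \<sigma> z) \<Longrightarrow> aval \<tau> p = f e"
    and c: "acost p \<le> 10"
  shows "wp (set_path_arcs p) (\<lambda>\<tau> k. (\<forall>a\<in>A. arrs \<tau> 24 a = path_arcs f a) \<and> 0 \<le> k) \<sigma> (40 * M + 50 * m + 50)"
proof -
  note m = memD[OF mem]
  show ?thesis
    unfolding set_path_arcs_def wp_Seq
  proof (rule wp_for[where T = 10 and I = "\<lambda>i \<tau>. \<forall>v. 0 \<le> v \<and> v < i \<longrightarrow> arrs \<tau> 24 v = 0"], goal_cases)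
    case (9 \<tau>1 k1)
    have m1: "mem \<tau>1" by (rule mem_cong[OF mem]) (simp_all add: agree_regs[OF 9(2)] agree_arrs[OF 9(2)])
    have z: "arrs \<tau>1 24 a = 0" if "a \<in> A" for a using 9(1) that by (simp add: m)
    show ?case
    proof (rule wp_for[where T = 35 and I = "\<lambda>i \<tau>. \<forall>a\<in>A. arrs \<tau> 24 a = (if edge_of a < i then path_arcs f a else 0)"], goal_cases)
      case 7
      have "\<not> edge_of a < 0" if "a \<in> A" for a using edge_of_bounds[OF that] by simp
      then show ?case using z by simp
    next
      case (8 i \<tau>)
      have i: "0 \<le> i" "i < m" "i < M" using 8 edge_bounds(1) by (simp_all add: memD[OF m1])
      have r: "regs \<tau> 7 = M" by (simp add: agree_regs[OF 8(5)] memD[OF m1])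
      have pv: "aval \<tau> p = f i"
        by (rule p[OF i(1,2) 8(4)]) (simp add: agree_arrs[OF 8(5)] agree_arrs[OF 9(2)])
      have e: "edge_of a < i + 1 \<longleftrightarrow> edge_of a < i \<or> a = i \<or> a = i + M" "\<not> edge_of i < i" "\<not> edge_of (i + M) < i" if "a \<in> A" for a
        using that i by (auto simp: edge_of_def)
      have pa: "path_arcs f i = max (- f i) 0" "path_arcs f (i + M) = max (f i) 0"
        using i by (simp_all add: path_arcs_simps)
      have iA: "i \<in> A" "i + M \<in> A" using i by auto
      have zz: "arrs \<tau> 24 i = 0" "arrs \<tau> 24 (i + M) = 0" using 8(1) iA e(2,3)[OF iA(1)] by auto
      show ?case
      proof (cases "0 < f i")
        case True
        have "((arrs \<tau> 24)(i + M := f i)) a = (if edge_of a < i + 1 then path_arcs f a else 0)" if aA: "a \<in> A" for a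
          using 8(1) aA e[OF aA] pa zz True M_pos by auto
        then show ?thesis using True 8(4) c by (simp add: pv r)
      next
        case False
        have "((arrs \<tau> 24)(i := - f i)) a = (if edge_of a < i + 1 then path_arcs f a else 0)" if aA: "a \<in> A" for a
          using 8(1) aA e[OF aA] pa zz False M_pos by auto
        then show ?thesis using False 8(4) c by (simp add: pv r)
      qed
    next
      case (9 \<tau> k2)
      have "edge_of a < m \<or> path_arcs f a = 0" for a by (simp add: path_arcs_def)
      then have "arrs \<tau> 24 a = path_arcs f a" if "a \<in> A" for a using 9(1) that by (auto simp: memD[OF m1])
      moreover have "0 \<le> k2" using 9(3) \<open>40 * M + 50 * m + 50 - (regs \<sigma> 8 * (10 + 8) + 6) \<le> k1\<close> M_pos m0
        by (simp add: memD[OF m1] m)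
      ultimately show ?case by blast
    qed (use m0 in \<open>auto simp: memD[OF m1]\<close>)
  qed (use M_pos in \<open>auto simp: m\<close>)
qed

definition extract_cost :: int where
  "extract_cost = 80 * (n + 2) + 80"

text \<open>Two passes over the same tree path are needed, because the output format puts value and
  length before the edges.\<close>

lemma wp_extract_path:
  assumes mem: "mem \<sigma>" and st: "search_tree P t (arrs \<sigma> 7) (arrs \<sigma> 8)" and P: "arrs \<sigma> 24 = P"
    and s: "regs \<sigma> z = s" "s \<in> V" "0 < arrs \<sigma> 7 s" "s \<noteq> t" and t: "regs \<sigma> 20 = t" and z: "z \<notin> {20, 60, 61, 62, 63, 64, 65}"
    and out: "listed (arrs \<sigma> 0) (regs \<sigma> 60) xs"
  shows "wp (extract_path z) (\<lambda>\<tau> k. (regs \<tau> 61 = regs \<sigma> 61 + 1 \<and>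
     (\<exists>as \<delta>. tree_path t (arrs \<sigma> 8) s as \<and> 0 < \<delta> \<and> (\<forall>a\<in>set as. \<delta> \<le> P a) \<and> (\<exists>a\<in>set as. P a = \<delta>) \<and>
       arrs \<tau> 24 = drop_path as \<delta> P \<and>
       listed (arrs \<tau> 0) (regs \<tau> 60) (xs @ [nat \<delta>, length as] @ map (nat \<circ> edge_of) as))) \<and> 0 \<le> k) \<sigma> extract_cost"
proof -
  note m = memD[OF mem]
  define par where "par = arrs \<sigma> 8"
  obtain as where as: "tree_path t par s as" using tree_path_exists[OF st s(2,3)] by (auto simp: par_def)
  note st' = st[folded par_def]
  note tp = tree_path_props[OF st' s(2,3) as]
  have asA: "a \<in> A" "0 < P a" "0 \<le> a" "a < 2 * M" if "a \<in> set as" for a using tp(1) that by auto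
  have len: "int (length as) \<le> n + 2" using tp(6) st s(2) card_V unfolding search_tree_def by fastforce
  obtain a0 as0 where c: "as = a0 # as0" "a0 = par s" using as s(4) by (cases as) auto
  have sb: "0 \<le> s" "s < n + 2" using s by auto
  have tr: "arrs \<sigma> 3 (arrs \<sigma> 4 a) = tl a" if "0 \<le> a" "a < 2 * M" for a
    using that by (simp add: m)
  let ?I1 = "\<lambda>\<tau> k. \<exists>pre post. as = pre @ post \<and> tree_path t par (regs \<tau> 63) post \<and> regs \<tau> 65 = int (length pre) \<and>
      (\<forall>a\<in>set pre. regs \<tau> 62 \<le> P a) \<and> (\<exists>a\<in>set as. P a = regs \<tau> 62) \<and>
      30 * int (length post) + 40 * (n + 2) + 50 \<le> k"
  show ?thesis
    unfolding extract_path_def wp_Seq wp_Assign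
  proof (rule wp_While[where I = ?I1], goal_cases)
    case 1
    have "P a0 = P (par s)" "a0 \<in> set as" using c by auto
    then show ?case
      using as len n0 s by (intro exI[of _ "[]"] exI[of _ as]) (auto simp: P extract_cost_def par_def[symmetric])
  next
    case (2 \<tau> k) then show ?case using n0 by auto
  next
    case (3 \<tau> k)
    from 3(1) obtain pre post where I: "as = pre @ post" "tree_path t par (regs \<tau> 63) post" "regs \<tau> 65 = int (length pre)"
      "\<forall>a\<in>set pre. regs \<tau> 62 \<le> P a" "\<exists>a\<in>set as. P a = regs \<tau> 62"
      "30 * int (length post) + 40 * (n + 2) + 50 \<le> k" by blast
    have r: "regs \<tau> 20 = t" "arrs \<tau> = arrs \<sigma>"
      using t by (simp add: agree_regs[OF 3(2)], intro ext, simp add: agree_arrs[OF 3(2)])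
    have nt: "regs \<tau> 63 \<noteq> t" using 3(3) r by simp
    then obtain a post' where a: "post = a # post'" "a = par (regs \<tau> 63)" "tree_path t par (tl a) post'"
      using I(2) by (cases post) auto
    have aas: "a \<in> set as" using I(1) a by simp
    note ab = asA[OF aas]
    have p8: "arrs \<sigma> 8 (regs \<tau> 63) = a" using a(2) by (simp add: par_def)
    define w where "w = (if P a < regs \<tau> 62 then P a else regs \<tau> 62)"
    have w: "\<forall>b\<in>set (pre @ [a]). w \<le> P b" "\<exists>a\<in>set as. P a = w"
      using I(4,5) aas unfolding w_def by force+
    have E: "as = (pre @ [a]) @ post'" "regs \<tau> 65 + 1 = int (length (pre @ [a]))"
      "30 * int (length post') + 40 * (n + 2) + 50 \<le> k - 30"
      using I(1,3,6) a(1) by simp_all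
    have tla: "arrs \<sigma> 3 (arrs \<sigma> 4 a) = tl a" by (rule tr[OF ab(3,4)])
    show ?case
    proof (cases "P a < regs \<tau> 62")
      case True
      then have "w = P a" by (simp add: w_def)
      note w = w[unfolded this]
      show ?thesis
        using True by (simp add: r p8 P tla del: Suc_eq_plus1, intro exI[of _ "pre @ [a]"] exI[of _ post'] conjI)
          (use E a(3) w in simp_all)
    next
      case False
      then have "w = regs \<tau> 62" by (simp add: w_def)
      note w = w[unfolded this]
      show ?thesis
        using False by (simp add: r p8 P tla, intro exI[of _ "pre @ [a]"] exI[of _ post'] conjI)
          (use E a(3) w in simp_all)
    qed
  next
    case (4 \<tau> k)
    from 4(1) obtain pre post where I: "as = pre @ post" "tree_path t par (regs \<tau> 63) post" "regs \<tau> 65 = int (length pre)"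
      "\<forall>a\<in>set pre. regs \<tau> 62 \<le> P a" "\<exists>a\<in>set as. P a = regs \<tau> 62"
      "30 * int (length post) + 40 * (n + 2) + 50 \<le> k" by blast
    have r: "regs \<tau> 20 = t" "arrs \<tau> = arrs \<sigma>" "regs \<tau> z = s" "regs \<tau> 60 = regs \<sigma> 60" "regs \<tau> 61 = regs \<sigma> 61" "regs \<tau> 7 = M"
      using t s z m by (simp_all add: agree_regs[OF 4(2)]) (intro ext, simp add: agree_arrs[OF 4(2)])
    have "regs \<tau> 63 = t" using 4(3) r by simp
    then have pe: "post = []" using I(2) by (cases post) auto
    define \<delta> where "\<delta> = regs \<tau> 62"
    have \<delta>: "\<forall>a\<in>set as. \<delta> \<le> P a" "\<exists>a\<in>set as. P a = \<delta>" "regs \<tau> 65 = int (length as)"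
      using I pe by (auto simp: \<delta>_def)
    have d1: "0 < \<delta>" using \<delta>(2) asA(2) by blast
    then have d0: "0 < \<delta>" "\<delta> = int (nat \<delta>)" by simp_all
    have k: "40 * (n + 2) + 40 \<le> k - 5" using I(6) by auto
    let ?xs = "xs @ [nat \<delta>, length as]"
    have l2: "listed ((arrs \<sigma> 0)(regs \<sigma> 60 := \<delta>, regs \<sigma> 60 + 1 := int (length as))) (regs \<sigma> 60 + 2) ?xs"
      using listed_snoc[OF listed_snoc[OF out d0(2)] refl, of "length as"] by (simp add: add.commute)
    let ?I2 = "\<lambda>\<tau>' k. \<exists>pre post. as = pre @ post \<and> tree_path t par (regs \<tau>' 63) post \<and>
        arrs \<tau>' 24 = drop_path pre \<delta> P \<and> listed (arrs \<tau>' 0) (regs \<tau>' 60) (?xs @ map (nat \<circ> edge_of) pre) \<and>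
        40 * int (length post) + 12 \<le> k"
    show ?case
      unfolding wp_Update wp_Assign
    proof (rule wp_While[where I = ?I2], goal_cases)
      case 1
      show ?case
        using as l2 len k
        by (intro exI[of _ "[]"] exI[of _ as]) (use z in \<open>simp add: r P drop_path_Nil \<delta>_def[symmetric] \<delta>(3) add.commute\<close>)
    next
      case (2 \<tau>' k') then show ?case by auto
    next
      case (3 \<tau>' k')
      from 3(1) obtain pre post where J: "as = pre @ post" "tree_path t par (regs \<tau>' 63) post"
        "arrs \<tau>' 24 = drop_path pre \<delta> P" "listed (arrs \<tau>' 0) (regs \<tau>' 60) (?xs @ map (nat \<circ> edge_of) pre)"
        "40 * int (length post) + 12 \<le> k'" by blast
      have r': "regs \<tau>' 20 = t" "regs \<tau>' 62 = \<delta>" "regs \<tau>' 7 = M" "arrs \<tau>' 3 = arrs \<sigma> 3" "arrs \<tau>' 4 = arrs \<sigma> 4" "arrs \<tau>' 8 = par"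
        by (simp_all add: agree_regs[OF 3(2)] agree_arrs[OF 3(2)] r \<delta>_def par_def)
      have nt: "regs \<tau>' 63 \<noteq> t" using 3(3) r' by simp
      then obtain a post' where a: "post = a # post'" "par (regs \<tau>' 63) = a" "tree_path t par (tl a) post'"
        using J(2) by (cases post) auto
      have aas: "a \<in> set as" using J(1) a by simp
      note ab = asA[OF aas]
      have np: "a \<notin> set pre" using tp(2) J(1) a(1) by auto
      have eq: "(drop_path pre \<delta> P)(a := drop_path pre \<delta> P a - \<delta>) = drop_path (pre @ [a]) \<delta> P"
        by (rule drop_path_snoc[OF np, symmetric])
      have "edge_of a = int (nat (edge_of a))" using edge_of_bounds[OF ab(1)] by simp
      from listed_snoc[OF J(4) this]
      have ls: "listed ((arrs \<tau>' 0)(regs \<tau>' 60 := edge_of a)) (regs \<tau>' 60 + 1) (?xs @ map (nat \<circ> edge_of) (pre @ [a]))"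
        by simp
      have E: "as = (pre @ [a]) @ post'" "40 * int (length post') + 12 \<le> k' - 40"
        using J(1,5) a(1) by simp_all
      have tla: "arrs \<sigma> 3 (arrs \<sigma> 4 a) = tl a" by (rule tr[OF ab(3,4)])
      show ?case
      proof (cases "a < M")
        case True
        then have "edge_of a = a" by (simp add: edge_of_def)
        note ls = ls[unfolded this]
        show ?thesis
          using True by (simp add: r' a(2) J(3) tla del: map_append, intro exI[of _ "pre @ [a]"] exI[of _ post'] conjI)
            (use E a(3) ls eq in simp_all)
      next
        case False
        then have "edge_of a = a - M" by (simp add: edge_of_def)
        note ls = ls[unfolded this]
        show ?thesis
          using False by (simp add: r' a(2) J(3) tla del: map_append, intro exI[of _ "pre @ [a]"] exI[of _ post'] conjI)
            (use E a(3) ls eq in simp_all)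
      qed
    next
      case (4 \<tau>' k')
      from 4(1) obtain pre post where J: "as = pre @ post" "tree_path t par (regs \<tau>' 63) post"
        "arrs \<tau>' 24 = drop_path pre \<delta> P" "listed (arrs \<tau>' 0) (regs \<tau>' 60) (?xs @ map (nat \<circ> edge_of) pre)"
        "40 * int (length post) + 12 \<le> k'" by blast
      have r': "regs \<tau>' 20 = t" "regs \<tau>' 61 = regs \<sigma> 61" by (simp_all add: agree_regs[OF 4(2)] r)
      have "regs \<tau>' 63 = t" using 4(3) r' by simp
      then have "post = []" using J(2) by (cases post) auto
      then have "tree_path t (arrs \<sigma> 8) s as \<and> 0 < \<delta> \<and> (\<forall>a\<in>set as. \<delta> \<le> P a) \<and> (\<exists>a\<in>set as. P a = \<delta>) \<and>
         arrs \<tau>' 24 = drop_path as \<delta> P \<and>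
         listed (arrs \<tau>' 0) (regs \<tau>' 60) (xs @ [nat \<delta>, length as] @ map (nat \<circ> edge_of) as)"
        using J as \<delta> d0 by (simp add: par_def)
      then show ?case using r' J(5) by simp blast
    qed
  qed
qed

lemma wp_decompose:
  assumes mem: "mem \<sigma>" and s: "regs \<sigma> x = s" "regs \<sigma> y = t" "s \<in> {0..<n}" "t \<in> {0..<n}" "s \<noteq> t"
    and xy: "x \<in> {2, 3, 4, 5}" "y \<in> {2, 3, 4, 5}"
    and dec: "decomposed P0 d s t (arrs \<sigma> 24) []"
    and out: "listed (arrs \<sigma> 0) (regs \<sigma> 60) (encode L0)" "regs \<sigma> 61 = int (length L0)"
  shows "wp (decompose x y) (\<lambda>\<tau> k. (\<exists>L P. decomposed P0 d s t P L \<and> d \<le> total L \<and>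
     listed (arrs \<tau> 0) (regs \<tau> 60) (encode (L0 @ L)) \<and> regs \<tau> 61 = int (length (L0 @ L))) \<and> 0 \<le> k) \<sigma>
    ((2 * M + 1) * (search_cost + extract_cost + 10) + 10)"
proof -
  define C where "C = search_cost + extract_cost + 10"
  have C0: "0 \<le> search_cost" "0 \<le> extract_cost" using M_pos n0 by (auto simp: search_cost_def extract_cost_def)
  note m = memD[OF mem]
  have tV: "t \<in> V" "s \<in> V" using s by auto
  let ?pos = "\<lambda>P. int (card {a \<in> A. 0 < P a})"
  \<comment> \<open>Each round costs at most \<open>C\<close> and empties at least one arc, so the
    arcs that carry flow serve as credit.\<close>
  let ?I = "\<lambda>\<tau> k. \<exists>L. decomposed P0 d s t (arrs \<tau> 24) L \<and> search_tree (arrs \<tau> 24) t (arrs \<tau> 7) (arrs \<tau> 8) \<and>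
      listed (arrs \<tau> 0) (regs \<tau> 60) (encode (L0 @ L)) \<and> regs \<tau> 61 = int (length (L0 @ L)) \<and> regs \<tau> 20 = t \<and>
      ?pos (arrs \<tau> 24) * C + 8 \<le> k"
  define \<sigma>1 where "\<sigma>1 = \<sigma>\<lparr>regs := (regs \<sigma>)(20 := t)\<rparr>"
  have m1: "mem \<sigma>1" by (rule mem_cong[OF mem]) (simp_all add: \<sigma>1_def)
  have start: "wp (decompose x y) Q \<sigma> k \<longleftrightarrow> wp (search 24 ;; While (Less (Num 0) (Elem 7 (Reg x))) (extract_path x ;; search 24)) Q \<sigma>1 (k - 2)" for Q k
    unfolding decompose_def by (simp add: s \<sigma>1_def)
  have xn: "x \<notin> {7, 20, 21, 22, 23, 24, 25, 60, 61, 62, 63, 64, 65}" using xy by auto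
  show ?thesis
    unfolding start wp_Seq
  proof (rule wp_spec[OF wp_search[OF m1]], goal_cases)
    case 1 then show ?case using tV by (simp add: \<sigma>1_def)
  next
    case 2 then show ?case by simp
  next
    case (3 \<sigma>2 k2)
    have r1: "regs \<sigma>1 20 = t" "arrs \<sigma>1 = arrs \<sigma>" by (simp_all add: \<sigma>1_def)
    have r2: "regs \<sigma>2 20 = t" "regs \<sigma>2 60 = regs \<sigma> 60" "regs \<sigma>2 61 = regs \<sigma> 61" "regs \<sigma>2 x = s" "arrs \<sigma>2 24 = arrs \<sigma> 24" "arrs \<sigma>2 0 = arrs \<sigma> 0"
      using xn s by (auto simp: agree_regs[OF 3(2)] agree_arrs[OF 3(2)] \<sigma>1_def)
    have m2: "mem \<sigma>2" by (rule mem_cong[OF m1]) (simp_all add: agree_regs[OF 3(2)] agree_arrs[OF 3(2)])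
    show ?case
    proof (rule wp_While[where I = ?I], goal_cases)
      case 1
      have "card {a \<in> A. 0 < arrs \<sigma> 24 a} \<le> card A" by (rule card_mono) auto
      then have "?pos (arrs \<sigma> 24) \<le> 2 * M" using card_A by linarith
      then have "?pos (arrs \<sigma> 24) * C \<le> 2 * M * C" using C0 by (intro mult_right_mono) (auto simp: C_def)
      moreover have "(2 * M + 1) * C = 2 * M * C + C" by (simp add: algebra_simps)
      moreover have "search_cost + 10 \<le> C" using C0 by (simp add: C_def)
      ultimately have "?pos (arrs \<sigma> 24) * C + 8 \<le> k2"
        using 3(3)[folded C_def] by linarith
      then show ?case using 3(1) dec out by (intro exI[of _ "[]"]) (simp add: r1 r2)
    next
      case (2 \<tau> k)
      have "0 \<le> ?pos (arrs \<tau> 24) * C" using C0 by (simp add: C_def)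
      then show ?case using 2 by auto
    next
      case (3 \<tau> k)
      from 3(1) obtain L where I: "decomposed P0 d s t (arrs \<tau> 24) L" "search_tree (arrs \<tau> 24) t (arrs \<tau> 7) (arrs \<tau> 8)"
        "listed (arrs \<tau> 0) (regs \<tau> 60) (encode (L0 @ L))" "regs \<tau> 61 = int (length (L0 @ L))" "regs \<tau> 20 = t"
        "?pos (arrs \<tau> 24) * C + 8 \<le> k" by blast
      have m3: "mem \<tau>" by (rule mem_cong[OF m2]) (simp_all add: agree_regs[OF 3(2)] agree_arrs[OF 3(2)])
      have rx: "regs \<tau> x = s" using xn r2 by (simp add: agree_regs[OF 3(2)])
      have rk: "0 < arrs \<tau> 7 s" using 3(3) rx by simp
      show ?case
        unfolding wp_Seq
      proof (rule wp_spec[OF wp_extract_path[OF m3 I(2) refl rx tV(2) rk s(5) I(5) _ I(3)]], goal_cases)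
        case 1 then show ?case using xn by auto
      next
        case (2 \<tau>1 k1)
        from 2(1) obtain as \<delta> where E: "regs \<tau>1 61 = regs \<tau> 61 + 1" "tree_path t (arrs \<tau> 8) s as" "0 < \<delta>" "\<forall>a\<in>set as. \<delta> \<le> arrs \<tau> 24 a"
          "\<exists>a\<in>set as. arrs \<tau> 24 a = \<delta>" "arrs \<tau>1 24 = drop_path as \<delta> (arrs \<tau> 24)"
          "listed (arrs \<tau>1 0) (regs \<tau>1 60) (encode (L0 @ L) @ [nat \<delta>, length as] @ map (nat \<circ> edge_of) as)" by blast
        note ds = decomposed_step[OF I(1,2) s(3) rk s(5) E(2-5), folded E(6)]
        let ?L = "L @ [(map (nat \<circ> edge_of) as, nat \<delta>)]"
        have enc: "encode (L0 @ ?L) = encode (L0 @ L) @ [nat \<delta>, length as] @ map (nat \<circ> edge_of) as"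
          by (simp add: encode_append encode_single)
        have m4: "mem \<tau>1" by (rule mem_cong[OF m3]) (simp_all add: agree_regs[OF 2(2)] agree_arrs[OF 2(2)])
        have t1: "regs \<tau>1 20 = t" using I(5) by (simp add: agree_regs[OF 2(2)])
        have "?pos (arrs \<tau>1 24) + 1 \<le> ?pos (arrs \<tau> 24)" using ds(2) by simp
        then have "(?pos (arrs \<tau>1 24) + 1) * C \<le> ?pos (arrs \<tau> 24) * C" using C0 by (intro mult_right_mono) (auto simp: C_def)
        then have cr: "?pos (arrs \<tau>1 24) * C + C \<le> ?pos (arrs \<tau> 24) * C" by (simp add: algebra_simps)
        show ?case
        proof (rule wp_spec[OF wp_search[OF m4]], goal_cases)
          case 1 then show ?case using tV t1 by simp
        next
          case 2 then show ?case by simp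
        next
          case (3 \<tau>2 k3)
          have r: "regs \<tau>2 20 = t" "regs \<tau>2 60 = regs \<tau>1 60" "regs \<tau>2 61 = regs \<tau>1 61" "arrs \<tau>2 24 = arrs \<tau>1 24" "arrs \<tau>2 0 = arrs \<tau>1 0"
            using t1 by (simp_all add: agree_regs[OF 3(2)] agree_arrs[OF 3(2)])
          have "?pos (arrs \<tau>1 24) * C + 8 \<le> k3"
            using 3(3) \<open>k - 1 - int (bcost (Less (Num 0) (Elem 7 (Reg x)))) - extract_cost \<le> k1\<close> I(6) cr
            by (simp add: C_def)
          then show ?case
            using ds(1) 3(1) E(1,7) I(4) by (intro exI[of _ ?L]) (simp add: r t1 enc)
        qed
      qed
    next
      case (4 \<tau> k)
      from 4(1) obtain L where I: "decomposed P0 d s t (arrs \<tau> 24) L" "search_tree (arrs \<tau> 24) t (arrs \<tau> 7) (arrs \<tau> 8)"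
        "listed (arrs \<tau> 0) (regs \<tau> 60) (encode (L0 @ L))" "regs \<tau> 61 = int (length (L0 @ L))"
        "?pos (arrs \<tau> 24) * C + 8 \<le> k" by blast
      have "regs \<tau> x = s" using xn r2 by (simp add: agree_regs[OF 4(2)])
      then have rk: "\<not> 0 < arrs \<tau> 7 s" using 4(3) by simp
      have "d \<le> total L" by (rule decomposed_final[OF I(1,2) tV(2) rk])
      moreover have "0 \<le> ?pos (arrs \<tau> 24) * C" using C0 by (simp add: C_def)
      ultimately show ?case using I by auto
    qed
  qed
qed

end

section \<open>Bicuts, separating cuts and weak duality\<close>

section \<open>Bicuts of numbered graphs\<close>

locale graph_network = network n m us vs for n m us vs +
  fixes G :: "(nat, nat) terminal_graph"
  assumes wf: "wf_terminal_graph G" and V_G: "verts G = {..<nat n}" and E_G: "edges G = {..<nat m}"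
    and ends_G: "\<And>e. e < nat m \<Longrightarrow> ends G e = {nat (us (int e)), nat (vs (int e))}"
begin

abbreviation "s1 \<equiv> int (source1 G)"
abbreviation "t1 \<equiv> int (sink1 G)"
abbreviation "s2 \<equiv> int (source2 G)"
abbreviation "t2 \<equiv> int (sink2 G)"

lemma terminals:
  "s1 \<in> {0..<n}" "t1 \<in> {0..<n}" "s2 \<in> {0..<n}" "t2 \<in> {0..<n}" "distinct [s1, t1, s2, t2]"
  using wf unfolding wf_terminal_graph_def V_G by auto

definition bisep :: "int set \<Rightarrow> bool" where
  "bisep X \<longleftrightarrow> (s1 \<in> X) \<noteq> (t1 \<in> X) \<and> (s2 \<in> X) \<noteq> (t2 \<in> X)"

definition cut_edges :: "int set \<Rightarrow> nat set" where
  "cut_edges X = {e \<in> edges G. crosses (int e) X}"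

lemma ends_int:
  assumes "e < nat m"
  shows "{us (int e), vs (int e)} = int ` ends G e"
proof -
  have "int e < m" using assms by simp
  then show ?thesis using us[of "int e"] vs[of "int e"] by (simp add: ends_G[OF assms])
qed

lemma crosses_ends:
  assumes "e < nat m" "ends G e = {x, y}"
  shows "crosses (int e) X \<longleftrightarrow> (int x \<in> X) \<noteq> (int y \<in> X)"
  using ends_int[OF assms(1)] unfolding assms(2) crosses_def by (auto simp: doubleton_eq_iff)

lemma finite_G [simp]: "finite (edges G)" "finite (cut_edges X)" "finite (terminal_paths G)"
  using finite_terminal_paths[OF wf] by (auto simp: E_G cut_edges_def)

lemma cut_sum: "cut c X = (\<Sum>e\<in>cut_edges X. c (int e))"
proof -
  have "cut c X = (\<Sum>e\<in>int ` {..<nat m}. if crosses e X then c e else 0)"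
    unfolding cut_def crosses_def by (rule sum.cong) (auto simp: image_iff intro!: bexI[of _ "nat _"])
  also have "\<dots> = (\<Sum>e\<in>edges G. if crosses (int e) X then c (int e) else 0)"
    by (subst sum.reindex) (auto simp: inj_on_def E_G)
  also have "\<dots> = (\<Sum>e\<in>cut_edges X. c (int e))"
    unfolding cut_edges_def by (rule sum.inter_filter[symmetric]) simp
  finally show ?thesis .
qed

lemma walk_parity:
  "even ((\<Sum>i<k. of_bool ((w i \<in> X) \<noteq> (w (Suc i) \<in> X))) + of_bool (w 0 \<in> X) + (of_bool (w k \<in> X) :: int))"
  by (induction k) auto

text \<open>Each crossing changes the side, so the parity of the crossings is decided by the ends.
  Counting edges instead of positions is justified because distinct vertices make the edges
  distinct.\<close>

lemma simple_path_parity: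
  assumes "simple_path G s Q t"
  shows "distinct Q" "set Q \<subseteq> edges G"
    "even (int (card {e \<in> set Q. crosses (int e) X}) + of_bool (int s \<in> X) + of_bool (int t \<in> X))"
proof -
  obtain ws where ws: "length ws = length Q + 1" "distinct ws" "hd ws = s" "last ws = t"
    and Q: "\<And>i. i < length Q \<Longrightarrow> Q ! i \<in> edges G \<and> ends G (Q ! i) = {ws ! i, ws ! Suc i}"
    using assms unfolding simple_path_def by blast
  show d: "distinct Q"
    unfolding distinct_conv_nth
  proof (intro allI impI)
    fix i j assume ij: "i < length Q" "j < length Q" "i \<noteq> j"
    show "Q ! i \<noteq> Q ! j"
    proof
      assume "Q ! i = Q ! j"
      then have "{ws ! i, ws ! Suc i} = {ws ! j, ws ! Suc j}" using Q[OF ij(1)] Q[OF ij(2)] by simp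
      then show False using ws(1,2) ij by (auto simp: doubleton_eq_iff nth_eq_iff_index_eq)
    qed
  qed
  show "set Q \<subseteq> edges G" using Q by (auto simp: in_set_conv_nth)
  have "int (card {e \<in> set Q. crosses (int e) X}) = (\<Sum>e\<in>set Q. of_bool (crosses (int e) X))"
  proof -
    have "set Q \<inter> {e. crosses (int e) X} = {e \<in> set Q. crosses (int e) X}" by auto
    then show ?thesis by (simp add: of_bool_def sum.If_cases)
  qed
  also have "\<dots> = (\<Sum>i<length Q. of_bool (crosses (int (Q ! i)) X))"
    using sum_list_distinct_conv_sum_set[OF d, of "\<lambda>e. of_bool (crosses (int e) X) :: int"]
    by (simp add: sum_list_sum_nth atLeast0LessThan)
  also have "\<dots> = (\<Sum>i<length Q. of_bool ((int (ws ! i) \<in> X) \<noteq> (int (ws ! Suc i) \<in> X)))"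
  proof (rule sum.cong)
    fix i assume "i \<in> {..<length Q}"
    then have "Q ! i < nat m" "ends G (Q ! i) = {ws ! i, ws ! Suc i}" using Q[of i] by (auto simp: E_G)
    then show "of_bool (crosses (int (Q ! i)) X) = of_bool ((int (ws ! i) \<in> X) \<noteq> (int (ws ! Suc i) \<in> X))"
      by (simp only: crosses_ends)
  qed simp
  finally have c: "int (card {e \<in> set Q. crosses (int e) X}) = (\<Sum>i<length Q. of_bool ((int (ws ! i) \<in> X) \<noteq> (int (ws ! Suc i) \<in> X)))" .
  have "ws \<noteq> []" using ws(1) by auto
  then have "ws ! 0 = s" "ws ! length Q = t" using ws by (simp_all add: hd_conv_nth last_conv_nth)
  then show "even (int (card {e \<in> set Q. crosses (int e) X}) + of_bool (int s \<in> X) + of_bool (int t \<in> X))"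
    using walk_parity[of "\<lambda>i. int (ws ! i)" X "length Q"] c by simp
qed

lemma terminal_path_crosses:
  assumes "Q \<in> terminal_paths G" "bisep X"
  shows "1 \<le> card {e \<in> set Q. crosses (int e) X}" and "set Q \<subseteq> edges G"
proof -
  have ends: "(\<exists>s t. simple_path G s Q t \<and> (int s \<in> X) \<noteq> (int t \<in> X))"
    using assms unfolding terminal_paths_def bisep_def by blast
  then obtain s t where st: "simple_path G s Q t" "(int s \<in> X) \<noteq> (int t \<in> X)" by blast
  show "set Q \<subseteq> edges G" by (rule simple_path_parity(2)[OF st(1)])
  have "odd (card {e \<in> set Q. crosses (int e) X})"
    using simple_path_parity(3)[OF st(1), of X] st(2) by (cases "int s \<in> X") auto
  then show "1 \<le> card {e \<in> set Q. crosses (int e) X}" by (metis even_zero less_one not_le)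
qed

lemma bicut_cut_edges: "bisep X \<Longrightarrow> bicut G (cut_edges X)"
  unfolding bicut_def
proof (intro conjI ballI)
  fix Q assume "bisep X" "Q \<in> terminal_paths G"
  note t = terminal_path_crosses[OF this(2,1)]
  then have "{e \<in> set Q. crosses (int e) X} \<noteq> {}" by (metis card.empty not_one_le_zero)
  then show "set Q \<inter> cut_edges X \<noteq> {}" using t(2) by (auto simp: cut_edges_def)
qed (auto simp: cut_edges_def)

text \<open>The path is kept simple during the induction: if the next vertex is already on it, the
  path is cut back to that vertex.\<close>

lemma reachable_simple_path:
  assumes "(\<lambda>x y. \<exists>e\<in>F. ends G e = {x, y})\<^sup>*\<^sup>* x y" "x \<in> verts G" "F \<subseteq> edges G"
  shows "\<exists>Q. simple_path G x Q y \<and> set Q \<subseteq> F"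
  using assms(1)
proof (induction rule: rtranclp_induct)
  case base
  show ?case
    by (rule exI[of _ "[]"]) (use assms(2) in \<open>auto simp: simple_path_def intro!: exI[of _ "[x]"]\<close>)
next
  case (step y z)
  obtain Q ws where Q: "set Q \<subseteq> F" and ws: "length ws = length Q + 1" "distinct ws" "set ws \<subseteq> verts G" "hd ws = x" "last ws = y"
    and en: "\<And>i. i < length Q \<Longrightarrow> Q ! i \<in> edges G \<and> ends G (Q ! i) = {ws ! i, ws ! Suc i}"
    using step.IH unfolding simple_path_def by blast
  obtain e where e: "e \<in> F" "ends G e = {y, z}" using step.hyps(2) by blast
  have ne: "ws \<noteq> []" using ws(1) by auto
  show ?case
  proof (cases "z \<in> set ws")
    case True
    then obtain i where i: "i < length ws" "ws ! i = z" by (auto simp: in_set_conv_nth)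
    have "simple_path G x (take i Q) z"
      unfolding simple_path_def
    proof (intro exI[of _ "take (Suc i) ws"] conjI allI impI)
      show "last (take (Suc i) ws) = z" using i by (simp add: take_Suc_conv_app_nth)
      show "hd (take (Suc i) ws) = x" using ne ws(4) by (simp add: hd_take)
      show "length (take (Suc i) ws) = length (take i Q) + 1" using i ws(1) by simp
      show "distinct (take (Suc i) ws)" using ws(2) by simp
      show "set (take (Suc i) ws) \<subseteq> verts G" using ws(3) set_take_subset[of "Suc i" ws] by (rule order_trans[rotated])
      fix j assume "j < length (take i Q)"
      then have j: "j < length Q" "j < i" by simp_all
      show "take i Q ! j \<in> edges G" "ends G (take i Q ! j) = {take (Suc i) ws ! j, take (Suc i) ws ! Suc j}"
        using en[OF j(1)] j(2) by simp_all
    qed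
    then show ?thesis using Q set_take_subset[of i Q] by blast
  next
    case False
    have "simple_path G x (Q @ [e]) z"
      unfolding simple_path_def
    proof (intro exI[of _ "ws @ [z]"] conjI allI impI)
      have "z \<in> verts G"
      proof -
        have "e \<in> edges G" using e assms(3) by auto
        then obtain p q where "p \<in> verts G" "q \<in> verts G" "ends G e = {p, q}" using wf unfolding wf_terminal_graph_def by blast
        then show ?thesis using e(2) by (auto simp: doubleton_eq_iff)
      qed
      then show "set (ws @ [z]) \<subseteq> verts G" using ws(3) by simp
      fix i assume i: "i < length (Q @ [e])"
      have y: "ws ! length Q = y" using ws ne by (simp add: last_conv_nth)
      show "(Q @ [e]) ! i \<in> edges G" using i en e assms(3) by (auto simp: nth_append)
      show "ends G ((Q @ [e]) ! i) = {(ws @ [z]) ! i, (ws @ [z]) ! Suc i}"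
        using i en[of i] e(2) ws(1) y by (cases "i < length Q") (auto simp: nth_append less_Suc_eq)
    qed (use ws ne False in auto)
    then show ?thesis using Q e by (intro exI[of _ "Q @ [e]"]) auto
  qed
qed

text \<open>Without \<open>K\<close> neither pair is connected. Some union of components separates
  both pairs, and every edge leaving a union of components belongs to \<open>K\<close>.\<close>

lemma bicut_contains_cut:
  assumes K: "bicut G K"
  shows "\<exists>X. bisep X \<and> cut_edges X \<subseteq> K"
proof -
  define R where "R = (\<lambda>x y. \<exists>e\<in>edges G - K. ends G e = {x, y})\<^sup>*\<^sup>*"
  have sym: "R y x" if "R x y" for x y
  proof -
    have "R y x" if "(\<lambda>x y. \<exists>e\<in>edges G - K. ends G e = {x, y})\<^sup>*\<^sup>* x y" for x y
      using that
    proof (induction rule: rtranclp_induct)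
      case (step y z)
      then have "\<exists>e\<in>edges G - K. ends G e = {z, y}" by (simp add: insert_commute)
      then show ?case using step.IH unfolding R_def by (rule converse_rtranclp_into_rtranclp)
    qed (simp add: R_def)
    then show ?thesis using that unfolding R_def by blast
  qed
  have tr: "R x z" if "R x y" "R y z" for x y z using that unfolding R_def by (rule rtranclp_trans)
  have refl: "R x x" for x unfolding R_def by simp
  have V: "source1 G \<in> verts G" "source2 G \<in> verts G" using wf by (auto simp: wf_terminal_graph_def)
  have np: "\<not> (set Q \<subseteq> edges G - K)" if "Q \<in> terminal_paths G" for Q using K that by (auto simp: bicut_def)
  have n1: "\<not> R (source1 G) (sink1 G)"
    using reachable_simple_path[of "edges G - K" "source1 G" "sink1 G"] V np unfolding R_def terminal_paths_def by blast
  have n2: "\<not> R (source2 G) (sink2 G)"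
    using reachable_simple_path[of "edges G - K" "source2 G" "sink2 G"] V np unfolding R_def terminal_paths_def by blast
  have main: "cut_edges (int ` {y. \<exists>x\<in>B. R x y}) \<subseteq> K" for B
  proof
    let ?X = "{y. \<exists>x\<in>B. R x y}"
    fix e assume e: "e \<in> cut_edges (int ` ?X)"
    show "e \<in> K"
    proof (rule ccontr)
      assume nK: "e \<notin> K"
      have em: "e < nat m" "e \<in> edges G" using e by (auto simp: cut_edges_def E_G)
      obtain p q where pq: "ends G e = {p, q}" using ends_G[OF em(1)] by blast
      have "R p q" unfolding R_def using nK em pq by blast
      then have same: "p \<in> ?X \<longleftrightarrow> q \<in> ?X" using tr sym by blast
      have "crosses (int e) (int ` ?X)" using e by (simp add: cut_edges_def)
      then have "(p \<in> ?X) \<noteq> (q \<in> ?X)"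
        by (simp only: crosses_ends[OF em(1) pq] inj_image_mem_iff[OF inj_of_nat] simp_thms)
      then show False using same by blast
    qed
  qed
  have "\<exists>B. bisep (int ` {y. \<exists>x\<in>B. R x y})"
  proof -
    have b: "bisep (int ` {y. \<exists>x\<in>B. R x y}) \<longleftrightarrow> (\<exists>x\<in>B. R x (source1 G)) \<noteq> (\<exists>x\<in>B. R x (sink1 G)) \<and>
      (\<exists>x\<in>B. R x (source2 G)) \<noteq> (\<exists>x\<in>B. R x (sink2 G))" for B
      by (simp only: bisep_def inj_image_mem_iff[OF inj_of_nat] mem_Collect_eq)
    show ?thesis
    \<comment> \<open>The component of the first source suffices if it contains exactly one terminal
      of the second pair. Otherwise it contains neither, and the component of a terminal of the
      second pair that is not connected to the first sink is added.\<close>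
    proof (cases "R (source1 G) (source2 G) = R (source1 G) (sink2 G)")
      case False
      then show ?thesis unfolding b using refl n1 False by (intro exI[of _ "{source1 G}"]) simp
    next
      case True
      then have no: "\<not> R (source1 G) (source2 G)" "\<not> R (source1 G) (sink2 G)" using n2 tr sym by blast+
      show ?thesis
      proof (cases "R (source2 G) (sink1 G)")
        case True
        then have "\<not> R (sink2 G) (sink1 G)" "\<not> R (sink2 G) (source2 G)" using n2 tr sym by blast+
        then show ?thesis unfolding b using refl n1 no by (intro exI[of _ "{source1 G, sink2 G}"]) simp
      next
        case False
        then show ?thesis unfolding b using refl n1 n2 no False by (intro exI[of _ "{source1 G, source2 G}"]) simp
      qed
    qed
  qed
  then show ?thesis using main by blast
qed

text \<open>Double counting of the pairs of a path and a cut edge on it.\<close>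

lemma sum_loads:
  fixes f :: "nat list \<Rightarrow> real"
  assumes P: "P \<subseteq> terminal_paths G"
  shows "(\<Sum>e\<in>cut_edges X. \<Sum>Q\<in>{Q \<in> P. e \<in> set Q}. f Q) = (\<Sum>Q\<in>P. f Q * card {e \<in> set Q. crosses (int e) X})"
proof -
  have fP: "finite P" by (rule finite_subset[OF P]) simp
  have "(\<Sum>e\<in>cut_edges X. \<Sum>Q\<in>{Q \<in> P. e \<in> set Q}. f Q) = (\<Sum>e\<in>cut_edges X. \<Sum>Q\<in>P. if e \<in> set Q then f Q else 0)"
    by (rule sum.cong) (use fP in \<open>simp_all add: sum.inter_filter\<close>)
  also have "\<dots> = (\<Sum>Q\<in>P. \<Sum>e\<in>cut_edges X. if e \<in> set Q then f Q else 0)" by (rule sum.swap)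
  also have "\<dots> = (\<Sum>Q\<in>P. f Q * card {e \<in> set Q. crosses (int e) X})"
  proof (rule sum.cong)
    fix Q assume "Q \<in> P"
    then have "set Q \<subseteq> edges G" using P simple_path_parity(2) unfolding terminal_paths_def by blast
    then have "{e \<in> cut_edges X. e \<in> set Q} = {e \<in> set Q. crosses (int e) X}" by (auto simp: cut_edges_def)
    then show "(\<Sum>e\<in>cut_edges X. if e \<in> set Q then f Q else 0) = f Q * card {e \<in> set Q. crosses (int e) X}"
      by (simp add: sum.inter_filter[symmetric])
  qed simp
  finally show ?thesis .
qed

text \<open>Each path crosses a separating cut at least once, so the value is at most the load of
  the cut. In case of equality no slack is left, and all its edges are saturated.\<close>

lemma weak_duality:
  assumes f: "biflow G c f" and X: "bisep X"
  shows "biflow_value G f \<le> real (sum c (cut_edges X))"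
    and "biflow_value G f = real (sum c (cut_edges X)) \<Longrightarrow> e \<in> cut_edges X \<Longrightarrow>
      (\<Sum>Q\<in>{Q \<in> terminal_paths G. e \<in> set Q}. f Q) = real (c e)"
proof -
  let ?l = "\<lambda>e. \<Sum>Q\<in>{Q \<in> terminal_paths G. e \<in> set Q}. f Q"
  have f0: "\<And>Q. Q \<in> terminal_paths G \<Longrightarrow> 0 \<le> f Q" and l: "\<And>e. e \<in> cut_edges X \<Longrightarrow> ?l e \<le> real (c e)"
    using f by (auto simp: biflow_def cut_edges_def)
  have "biflow_value G f \<le> (\<Sum>Q\<in>terminal_paths G. f Q * card {e \<in> set Q. crosses (int e) X})"
    unfolding biflow_value_def
  proof (rule sum_mono)
    fix Q assume Q: "Q \<in> terminal_paths G"
    then have "f Q * 1 \<le> f Q * real (card {e \<in> set Q. crosses (int e) X})"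
      using terminal_path_crosses(1)[OF Q X] f0[OF Q] by (intro mult_left_mono) auto
    then show "f Q \<le> f Q * real (card {e \<in> set Q. crosses (int e) X})" by simp
  qed
  also have "\<dots> = (\<Sum>e\<in>cut_edges X. ?l e)" by (rule sum_loads[symmetric]) simp
  finally have v: "biflow_value G f \<le> (\<Sum>e\<in>cut_edges X. ?l e)" .
  have s: "(\<Sum>e\<in>cut_edges X. ?l e) \<le> (\<Sum>e\<in>cut_edges X. real (c e))" by (rule sum_mono) (rule l)
  then show "biflow_value G f \<le> real (sum c (cut_edges X))" using v by simp
  assume "biflow_value G f = real (sum c (cut_edges X))" and e: "e \<in> cut_edges X"
  then have "(\<Sum>e\<in>cut_edges X. real (c e) - ?l e) \<le> 0" using v by (simp add: sum_subtractf)
  moreover have "0 \<le> real (c e) - ?l e" if "e \<in> cut_edges X" for e using l[OF that] by simp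
  ultimately have "(\<Sum>e\<in>cut_edges X. real (c e) - ?l e) = 0" by (simp add: sum_nonneg order_antisym)
  then show "?l e = real (c e)"
    using sum_nonneg_eq_0_iff[of "cut_edges X" "\<lambda>e. real (c e) - ?l e"] l e by auto
qed

text \<open>The two numbers differ only by loops, which count twice in the degree and not at all in
  the cut.\<close>

lemma cut_singleton_degree: "even (cut c {v} + degree c v)"
proof -
  have "cut c {v} + degree c v = (\<Sum>e\<in>{0..<m}. (if (us e = v) \<noteq> (vs e = v) then c e else 0)
     + ((if us e = v then c e else 0) + (if vs e = v then c e else 0)))"
    unfolding cut_def degree_def by (simp add: sum.distrib)
  also have "even \<dots>" by (rule dvd_sum) auto
  finally show ?thesis .
qed

text \<open>The only consequence of the Seymour property that the algorithm needs: there are integral loads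
  that saturate all minimum cuts and have the parities of a biflow.\<close>

lemma seymour_loads:
  assumes G: "Seymour_graph G" and c0: "\<And>e. 0 \<le> e \<Longrightarrow> e < m \<Longrightarrow> 0 \<le> c e"
    and tau: "\<And>X. bisep X \<Longrightarrow> \<tau> \<le> cut c X" "bisep X0" "cut c X0 = \<tau>"
  shows "\<exists>l k1 k2. (\<forall>e. 0 \<le> e \<and> e < m \<longrightarrow> 0 \<le> l e \<and> l e \<le> c e) \<and>
     (\<forall>X e. bisep X \<and> cut c X = \<tau> \<and> 0 \<le> e \<and> e < m \<and> crosses e X \<longrightarrow> l e = c e) \<and>
     (\<forall>v. even (degree l v + k1 * (of_bool (v = s1) + of_bool (v = t1)) + k2 * (of_bool (v = s2) + of_bool (v = t2))))"
proof -
  define c' where "c' e = nat (c (int e))" for e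
  have c': "int (c' e) = c (int e)" if "e \<in> edges G" for e using that c0[of "int e"] by (simp add: c'_def E_G)
  have sc: "int (sum c' (cut_edges X)) = cut c X" for X
    unfolding cut_sum of_nat_sum by (rule sum.cong) (auto simp: cut_edges_def c')
  obtain f K where f: "integral_biflow G c' f" and K: "min_bicut G c' K" and val: "biflow_value G f = real (sum c' K)"
    using G unfolding Seymour_graph_def max_integral_biflow_def by blast
  \<comment> \<open>Separating cuts are bicuts, and every bicut contains one, so both minima
    agree.\<close>
  have "int (sum c' K) = \<tau>"
  proof (rule antisym)
    have "sum c' K \<le> sum c' (cut_edges X0)" using K bicut_cut_edges[OF tau(2)] by (simp add: min_bicut_def)
    then show "int (sum c' K) \<le> \<tau>" using sc[of X0] tau(3) by linarith
    obtain X where X: "bisep X" "cut_edges X \<subseteq> K" using K bicut_contains_cut unfolding min_bicut_def by blast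
    have "finite K" using K by (auto simp: min_bicut_def bicut_def intro: finite_subset[of _ "edges G"])
    then have "sum c' (cut_edges X) \<le> sum c' K" using X(2) by (intro sum_mono2) auto
    then show "\<tau> \<le> int (sum c' K)" using sc[of X] tau(1)[OF X(1)] by linarith
  qed
  then have val: "biflow_value G f = real_of_int \<tau>" using val by (metis of_int_of_nat_eq)
  have bf: "biflow G c' f" and fZ: "\<And>Q. Q \<in> terminal_paths G \<Longrightarrow> f Q \<in> \<int>" and f0: "\<And>Q. Q \<in> terminal_paths G \<Longrightarrow> 0 \<le> f Q"
    using f by (auto simp: integral_biflow_def biflow_def)
  \<comment> \<open>The path values are reals known to be integral; taking floors moves the sums to
    the integers, where parity makes sense.\<close>
  define F where "F Q = \<lfloor>f Q\<rfloor>" for Q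
  have F: "f Q = real_of_int (F Q)" if "Q \<in> terminal_paths G" for Q using fZ[OF that] by (auto simp: F_def Ints_def image_iff)
  define l where "l e = (\<Sum>Q\<in>{Q \<in> terminal_paths G. nat e \<in> set Q}. F Q)" for e
  have l: "real_of_int (l e) = (\<Sum>Q\<in>{Q \<in> terminal_paths G. nat e \<in> set Q}. f Q)" for e
    unfolding l_def of_int_sum by (rule sum.cong) (auto simp: F)
  define P1 where "P1 = {Q. simple_path G (source1 G) Q (sink1 G)}"
  define P2 where "P2 = terminal_paths G - P1"
  \<comment> \<open>\<open>k1\<close> and \<open>k2\<close> are the values of the two commodities: a
    path meets the cut around \<open>{v}\<close> an odd number of times exactly if \<open>v\<close>
    is one of its ends.\<close>
  define k1 where "k1 = sum F P1"
  define k2 where "k2 = sum F P2"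
  have P: "P1 \<subseteq> terminal_paths G" "P2 \<subseteq> terminal_paths G" "P1 \<union> P2 = terminal_paths G" "P1 \<inter> P2 = {}"
    by (auto simp: P1_def P2_def terminal_paths_def)
  have fin: "finite P1" "finite P2" by (rule finite_subset[OF P(1)], simp, rule finite_subset[OF P(2)], simp)
  have lc: "0 \<le> l e \<and> l e \<le> c e" if e: "0 \<le> e" "e < m" for e
  proof -
    have eE: "nat e \<in> edges G" using e by (simp add: E_G)
    have "real_of_int (l e) \<le> real (c' (nat e))" using bf eE unfolding l biflow_def by blast
    also have "\<dots> = real_of_int (c e)" using c'[OF eE] e by (metis of_int_of_nat_eq int_nat_eq)
    finally have "l e \<le> c e" by simp
    moreover have "0 \<le> real_of_int (l e)" unfolding l by (rule sum_nonneg) (simp add: f0)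
    ultimately show ?thesis by simp
  qed
  moreover have "l e = c e" if X: "bisep X" "cut c X = \<tau>" and e: "0 \<le> e" "e < m" "crosses e X" for X e
  proof -
    have eX: "nat e \<in> cut_edges X" using e by (simp add: cut_edges_def E_G)
    have "biflow_value G f = real (sum c' (cut_edges X))" using val sc[of X] X(2) by (metis of_int_of_nat_eq)
    then have "real_of_int (l e) = real (c' (nat e))" unfolding l by (rule weak_duality(2)[OF bf X(1) _ eX])
    also have "\<dots> = real_of_int (c e)" using c'[of "nat e"] eX e by (simp add: cut_edges_def)
    finally show ?thesis by simp
  qed
  moreover have "even (degree l v + k1 * (of_bool (v = s1) + of_bool (v = t1)) + k2 * (of_bool (v = s2) + of_bool (v = t2)))" for v
  proof -
    let ?n = "\<lambda>Q. int (card {e \<in> set Q. crosses (int e) {v}})"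
    let ?b1 = "of_bool (v = s1) + of_bool (v = t1) :: int" and ?b2 = "of_bool (v = s2) + of_bool (v = t2) :: int"
    have "real_of_int (cut l {v}) = (\<Sum>e\<in>cut_edges {v}. \<Sum>Q\<in>{Q \<in> terminal_paths G. e \<in> set Q}. f Q)"
      unfolding cut_sum of_int_sum by (simp add: l)
    also have "\<dots> = (\<Sum>Q\<in>terminal_paths G. f Q * card {e \<in> set Q. crosses (int e) {v}})" by (rule sum_loads) simp
    also have "\<dots> = real_of_int (\<Sum>Q\<in>terminal_paths G. F Q * ?n Q)"
      unfolding of_int_sum by (rule sum.cong) (auto simp: F)
    finally have "cut l {v} = (\<Sum>Q\<in>terminal_paths G. F Q * ?n Q)" by (simp only: of_int_eq_iff)
    also have "\<dots> = (\<Sum>Q\<in>P1. F Q * ?n Q) + (\<Sum>Q\<in>P2. F Q * ?n Q)"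
      unfolding P(3)[symmetric] by (rule sum.union_disjoint[OF fin P(4)])
    finally have cl: "cut l {v} = (\<Sum>Q\<in>P1. F Q * ?n Q) + (\<Sum>Q\<in>P2. F Q * ?n Q)" .
    have e1: "even (?n Q + ?b1)" if "Q \<in> P1" for Q
      using simple_path_parity(3)[of "source1 G" Q "sink1 G" "{v}"] that by (simp add: P1_def eq_commute add.assoc)
    have e2: "even (?n Q + ?b2)" if "Q \<in> P2" for Q
    proof -
      have "simple_path G (source2 G) Q (sink2 G)" using that by (auto simp: P1_def P2_def terminal_paths_def)
      then show ?thesis using simple_path_parity(3)[of "source2 G" Q "sink2 G" "{v}"] by (simp add: eq_commute add.assoc)
    qed
    have "even (\<Sum>Q\<in>P1. F Q * (?n Q + ?b1))" "even (\<Sum>Q\<in>P2. F Q * (?n Q + ?b2))"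
      by (rule dvd_sum, rule dvd_mult, erule e1) (rule dvd_sum, rule dvd_mult, erule e2)
    then have "even ((\<Sum>Q\<in>P1. F Q * ?n Q) + k1 * ?b1)" "even ((\<Sum>Q\<in>P2. F Q * ?n Q) + k2 * ?b2)"
      unfolding k1_def k2_def sum_distrib_right distrib_left sum.distrib by simp_all
    then have "even (((\<Sum>Q\<in>P1. F Q * ?n Q) + k1 * ?b1) + ((\<Sum>Q\<in>P2. F Q * ?n Q) + k2 * ?b2))" by (rule dvd_add)
    then have "even (cut l {v} + (k1 * ?b1 + k2 * ?b2))" unfolding cl by (simp only: ac_simps)
    moreover have "even (cut l {v} + degree l v)" by (rule cut_singleton_degree)
    ultimately show ?thesis by (simp only: even_add add.assoc)
  qed
  ultimately show ?thesis by blast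
qed

section \<open>From the listed paths to a maximum integral biflow\<close>

section \<open>Correctness of the output\<close>

lemma edge_path_simple_path:
  assumes "edge_path (int s) Q (int t)"
  shows "simple_path G s Q t"
proof -
  obtain ws where ws: "length ws = length Q + 1" "distinct ws" "set ws \<subseteq> {0..<n}" "hd ws = int s" "last ws = int t"
    and Q: "\<And>i. i < length Q \<Longrightarrow> int (Q ! i) < m \<and> {us (int (Q ! i)), vs (int (Q ! i))} = {ws ! i, ws ! Suc i}"
    using assms unfolding edge_path_def by blast
  show ?thesis
    unfolding simple_path_def
  proof (intro exI[of _ "map nat ws"] conjI allI impI)
    have ne: "ws \<noteq> []" using ws(1) by auto
    show "length (map nat ws) = length Q + 1" "hd (map nat ws) = s" "last (map nat ws) = t"
      using ws ne by (simp_all add: hd_map last_map)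
    show "set (map nat ws) \<subseteq> verts G" using ws(3) by (auto simp: V_G)
    have "0 \<le> x" if "x \<in> set ws" for x using ws(3) that by auto
    then have "inj_on nat (set ws)" by (intro inj_onI) (metis int_nat_eq)
    then show "distinct (map nat ws)" using ws(2) by (simp add: distinct_map)
    fix i assume i: "i < length Q"
    have Qi: "Q ! i < nat m" using Q[OF i] by linarith
    then show "Q ! i \<in> edges G" by (simp add: E_G)
    have "ends G (Q ! i) = nat ` {us (int (Q ! i)), vs (int (Q ! i))}" using ends_G[OF Qi] by simp
    also have "\<dots> = {map nat ws ! i, map nat ws ! Suc i}" unfolding Q[OF i, THEN conjunct2] using i ws(1) by simp
    finally show "ends G (Q ! i) = {map nat ws ! i, map nat ws ! Suc i}" .
  qed
qed

text \<open>Paths are identified by their edges alone, so the two lists of paths could overlap. The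
  cut around \<open>s1\<close> excludes this: one kind of path crosses it an odd number of times,
  the other an even number.\<close>

lemma commodities_disjoint:
  assumes "simple_path G (source1 G) Q (sink1 G)"
  shows "\<not> simple_path G (source2 G) Q (sink2 G)"
proof
  assume "simple_path G (source2 G) Q (sink2 G)"
  from simple_path_parity(3)[OF this, of "{s1}"] simple_path_parity(3)[OF assms, of "{s1}"] show False
    using terminals(5) by auto
qed

lemma sum_listed_biflow:
  assumes "finite B" "distinct (map fst L)"
  shows "(\<Sum>Q\<in>B. listed_biflow L Q) = real_of_int (sum_list (map (\<lambda>(Q, w). if Q \<in> B then int w else 0) L))"
  using assms(2)
proof (induction L)
  case Nil
  then show ?case by (simp add: listed_biflow_def)
next
  case (Cons p L)
  obtain P w where p: "p = (P, w)" by fastforce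
  have "P \<notin> fst ` set L" using Cons.prems p by auto
  then have "map_of L P = None" by (simp add: map_of_eq_None_iff)
  then have "listed_biflow (p # L) Q = listed_biflow L Q + (if P = Q then real w else 0)" for Q
    by (cases "P = Q") (auto simp: listed_biflow_def p)
  then have "(\<Sum>Q\<in>B. listed_biflow (p # L) Q) = (\<Sum>Q\<in>B. listed_biflow L Q) + (if P \<in> B then real w else 0)"
    using assms(1) by (simp add: sum.distrib)
  then show ?case using Cons p by simp
qed

text \<open>Optimality is certified by weak duality against the cut of \<open>X\<close>.\<close>

lemma listed_biflow_maximum:
  assumes L: "distinct (map fst L)" "fst ` set L \<subseteq> terminal_paths G"
    and load: "\<And>e. 0 \<le> e \<Longrightarrow> e < m \<Longrightarrow> load_of L e \<le> int (c (nat e))"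
    and X: "bisep X" "cut (\<lambda>e. int (c (nat e))) X \<le> total L"
  shows "max_integral_biflow G c (listed_biflow L)"
  unfolding max_integral_biflow_def integral_biflow_def
proof (intro conjI allI impI ballI)
  note fin = finite_G(3)
  show bf: "biflow G c (listed_biflow L)"
    unfolding biflow_def
  proof (intro conjI ballI)
    fix Q show "0 \<le> listed_biflow L Q" by (simp add: listed_biflow_def split: option.split)
  next
    fix e assume e: "e \<in> edges G"
    have "(\<Sum>Q\<in>{Q \<in> terminal_paths G. e \<in> set Q}. listed_biflow L Q) =
      real_of_int (sum_list (map (\<lambda>(Q, w). if Q \<in> {Q \<in> terminal_paths G. e \<in> set Q} then int w else 0) L))"
      by (rule sum_listed_biflow) (use fin L in auto)
    also have "map (\<lambda>(Q, w). if Q \<in> {Q \<in> terminal_paths G. e \<in> set Q} then int w else 0) L =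
       map (\<lambda>(Q, w). if nat (int e) \<in> set Q then int w else 0) L"
      using L(2) by (intro map_cong) force+
    also have "sum_list \<dots> = load_of L (int e)" by (simp only: load_of_def)
    also have "real_of_int \<dots> \<le> real_of_int (int (c e))"
      using load[of "int e"] e by (simp only: of_int_le_iff) (simp add: E_G)
    also have "\<dots> = real (c e)" by simp
    finally show "(\<Sum>Q\<in>{Q \<in> terminal_paths G. e \<in> set Q}. listed_biflow L Q) \<le> real (c e)" .
  qed
  fix Q show "listed_biflow L Q \<in> \<int>" by (simp add: listed_biflow_def split: option.split)
next
  fix g assume "biflow G c g \<and> (\<forall>Q\<in>terminal_paths G. g Q \<in> \<int>)"
  then have "biflow_value G g \<le> real (sum c (cut_edges X))" by (intro weak_duality(1) X) simp
  also have "\<dots> = real_of_int (cut (\<lambda>e. int (c (nat e))) X)" unfolding cut_sum by simp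
  also have "\<dots> \<le> real_of_int (total L)" using X(2) by simp
  also have "total L = sum_list (map (\<lambda>(Q, w). if Q \<in> terminal_paths G then int w else 0) L)"
    unfolding total_def using L(2) by (intro arg_cong[of _ _ sum_list] map_cong) force+
  also have "real_of_int \<dots> = biflow_value G (listed_biflow L)"
    unfolding biflow_value_def by (rule sum_listed_biflow[symmetric]) (use L in auto)
  finally show "biflow_value G g \<le> biflow_value G (listed_biflow L)" .
qed

end

section \<open>Assembling the phases\<close>

section \<open>The algorithm\<close>

definition copy_capacities :: com where
  "copy_capacities = for_loop 50 1
     (Update 13 (Reg 50) (Elem 2 (Reg 50)) ;; Update 14 (Reg 50) (Elem 2 (Reg 50)))"

text \<open>Starting from 1 makes the result strictly larger than the total capacity.\<close>

definition sum_capacities :: com where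
  "sum_capacities = (Assign 9 (Num 1) ;; for_loop 50 1 (Assign 9 (Plus (Reg 9) (Elem 2 (Reg 50)))))"

text \<open>A bicut separates either \<open>s\<^sub>1, s\<^sub>2\<close> from \<open>t\<^sub>1, t\<^sub>2\<close> or \<open>s\<^sub>1, t\<^sub>2\<close> from \<open>t\<^sub>1, s\<^sub>2\<close>.  The minimum
  capacity is put into register 52, and the return arcs of both flows get a lower bound equal to it.\<close>

definition prepare :: com where
  "prepare =
     (init_network ;; sum_capacities ;; copy_capacities ;;
      cut_flow 20 2 4 3 5 ;; Assign 53 (Elem 10 (Plus (Reg 0) (Num 1))) ;;
      cut_flow 21 2 5 3 4 ;; Assign 56 (Elem 10 (Plus (Reg 0) (Num 1))) ;;
      If (Less (Reg 53) (Reg 56)) (Assign 52 (Reg 53)) (Assign 52 (Reg 56)) ;;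
      Update 20 (Minus (Reg 7) (Num 1)) (Minus (Reg 53) (Reg 52)) ;;
      Update 21 (Minus (Reg 7) (Num 1)) (Minus (Reg 56) (Reg 52)))"

definition adjust :: com where
  "adjust = (for_loop 40 1 reduce_edge ;; set_degrees ;; mark_edges ;; for_loop 40 7 join_edge)"

text \<open>The repeated registers make the terminal sets singletons: this flow yields the minimum
  cut of the first pair alone, the number \<open>l\<close> of \<open>split_value\<close>.\<close>

definition split_demand :: com where
  "split_demand =
     (copy_capacities ;; set_degrees ;; cut_flow 23 2 2 3 3 ;;
      Assign 57 (Elem 10 (Plus (Reg 0) (Num 1))) ;; Assign 46 (Minus (Reg 52) (Elem 18 (Reg 2))) ;;
      If (Less (Reg 57) (Reg 52)) (Assign 54 (Reg 57))
        (If (Equal (Reg 46) (Plus (Half (Reg 46)) (Half (Reg 46))))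
           (Assign 54 (Reg 52)) (Assign 54 (Minus (Reg 52) (Num 1)))) ;;
      Assign 55 (Minus (Reg 52) (Reg 54)))"

lemma written_copy_capacities [simp]:
  "written_regs copy_capacities = {50}" "written_arrs copy_capacities = {13, 14}"
  by (auto simp: copy_capacities_def)

lemma written_sum_capacities [simp]:
  "written_regs sum_capacities = {9, 50}" "written_arrs sum_capacities = {}"
  by (auto simp: sum_capacities_def)

lemma written_adjust:
  "written_regs adjust \<inter> {0, Suc 0, 2, 3, 4, 5, 6, 7, 8, 9, 52} = {}" "written_arrs adjust \<inter> {3, 4, 5, 6} = {}"
  by (simp_all add: adjust_def)

lemma written_split_demand:
  "written_regs split_demand \<inter> {0, Suc 0, 2, 3, 4, 5, 6, 7, 8, 9, 52} = {}" "written_arrs split_demand \<inter> {2, 3, 4, 5, 6} = {}"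
  by (simp_all add: split_demand_def)

context network
begin

lemma wp_copy_capacities:
  assumes "regs \<sigma> 1 = m"
  shows "wp copy_capacities (\<lambda>\<tau> k. (\<forall>e. 0 \<le> e \<and> e < m \<longrightarrow> arrs \<tau> 13 e = arrs \<sigma> 2 e \<and> arrs \<tau> 14 e = arrs \<sigma> 2 e) \<and> 0 \<le> k) \<sigma> (20 * m + 10)"
  unfolding copy_capacities_def
proof (rule wp_for[where T = 12 and I = "\<lambda>i \<tau>. \<forall>e. 0 \<le> e \<and> e < i \<longrightarrow> arrs \<tau> 13 e = arrs \<sigma> 2 e \<and> arrs \<tau> 14 e = arrs \<sigma> 2 e"], goal_cases)
  case (8 i \<tau>)
  have "arrs \<tau> 2 = arrs \<sigma> 2" by (simp add: agree_arrs[OF 8(5)])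
  then show ?case using 8 by simp
next
  case (9 \<tau> k)
  then show ?case using assms by simp
qed (use assms m0 in auto)

lemma wp_sum_capacities:
  assumes "regs \<sigma> 1 = m"
  shows "wp sum_capacities (\<lambda>\<tau> k. regs \<tau> 9 = 1 + (\<Sum>e\<in>{0..<m}. arrs \<sigma> 2 e) \<and> 0 \<le> k) \<sigma> (20 * m + 10)"
  unfolding sum_capacities_def wp_Seq wp_Assign
proof (rule wp_for[where T = 8 and I = "\<lambda>i \<tau>. regs \<tau> 9 = 1 + (\<Sum>e\<in>{0..<i}. arrs \<sigma> 2 e) \<and> arrs \<tau> = arrs \<sigma>"], goal_cases)
  case (8 i \<tau>)
  then show ?case by (simp add: sum_Suc_int)
next
  case (9 \<tau> k)
  then show ?case using assms m0 by simp
qed (use assms m0 in auto)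

lemma degree_outside: "n \<le> v \<Longrightarrow> degree c v = 0"
  unfolding degree_def by (rule endpoints_outside) simp

lemma degree_diff: "degree (\<lambda>e. f e - g e) v = degree f v - degree g v"
  unfolding degree_def sum_subtractf[symmetric] by (rule sum.cong) auto

lemma cut_mono: "(\<And>e. 0 \<le> e \<Longrightarrow> e < m \<Longrightarrow> c e \<le> d e) \<Longrightarrow> cut c X \<le> cut d X"
  unfolding cut_def by (rule sum_mono) auto

text \<open>The witness for the T-join: \<open>l - c\<close> on the edges of the graph, extended by
  \<open>k1\<close> and \<open>k2\<close> on the artificial edges. Its degrees have the wrong
  parities to be repaired, and it lives on marked edges because unmarked ones are filled by
  \<open>l\<close>.\<close>

lemma joining_init:
  assumes H: "\<And>a. a \<in> A \<Longrightarrow> H a = marks red X a" and D: "\<And>v. v \<in> V \<Longrightarrow> D v = degree c v"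
    and s: "s1 \<in> {0..<n}" "t1 \<in> {0..<n}" "s2 \<in> {0..<n}" "t2 \<in> {0..<n}" "distinct [s1, t1, s2, t2]"
    and X: "X = {m + s1, m + t1, m + n + s2, m + n + t2}"
    and red: "\<And>e. 0 \<le> e \<Longrightarrow> e < m \<Longrightarrow> red e = 1 \<or> red e = 0 \<and> l e = c e"
    and par: "\<And>v. even (degree l v + k1 * (of_bool (v = s1) + of_bool (v = t1)) + k2 * (of_bool (v = s2) + of_bool (v = t2)))"
  defines "g \<equiv> \<lambda>e. if e < m then red e else if e \<in> X then 1 else 0"
  shows "joining g c (\<lambda>e. if e < m then c e else 0) 0 c D H"
proof -
  define h where "h e = (if e < m then l e - c e else if e \<in> {m + s1, m + t1} then k1 else if e \<in> {m + n + s2, m + n + t2} then k2 else 0)" for e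
  have g: "marks red X a = g (edge_of a)" for a by (simp add: marks_def g_def)
  have ret: "m + 2 * n = ret" "m \<le> ret" using n0 by (simp_all add: ret_def)
  have D': "D v = (\<Sum>a\<in>out_arcs v. if edge_of a < m then c (edge_of a) else 0)" if v: "v \<in> V" for v
  proof -
    have "(\<Sum>a\<in>out_arcs v. (\<lambda>e. if e < m then c e else 0) (edge_of a)) = (if v = n then 0 else if v = n + 1 then 0 else degree c v)"
      by (subst sum_out_edges[OF v, where c = c]) (use ret s n0 v in auto)
    then show ?thesis using D[OF v] degree_outside[of n c] degree_outside[of "n + 1" c] by auto
  qed
  have ev: "even_on_closed H D"
  proof (rule even_on_closed_join[where h = "\<lambda>a. h (edge_of a)"])
    fix a assume a: "a \<in> A"
    show "h (edge_of (rev_arc a)) = h (edge_of a)" by (simp add: edge_of_rev[OF a])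
    assume "H a \<le> 0"
    then have "g (edge_of a) \<le> 0" using H[OF a] g by simp
    then show "h (edge_of a) = 0"
      using red[of "edge_of a"] edge_of_bounds[OF a] s n0 by (auto simp: g_def h_def X split: if_splits)
  next
    fix v assume v: "v \<in> V"
    have h0: "h ret = 0" using s n0 by (auto simp: h_def ret_def)
    have S1: "(\<Sum>w\<in>{0..<n}. h (m + w)) = k1 + k1"
      by (subst sum_two[of s1 t1]) (use s in \<open>auto simp: h_def\<close>)
    have S2: "(\<Sum>w\<in>{0..<n}. h (m + n + w)) = k2 + k2"
      by (subst sum_two[of s2 t2]) (use s in \<open>auto simp: h_def\<close>)
    have eq: "(\<Sum>a\<in>out_arcs v. h (edge_of a)) = (if v = n then k1 + k1 else if v = n + 1 then k2 + k2
        else degree l v - degree c v + h (m + v) + h (m + n + v))"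
      by (subst sum_out_edges[OF v, where c = "\<lambda>e. l e - c e"]) (use h0 S1 S2 in \<open>auto simp: degree_diff\<close>, simp_all add: h_def)
    show "even (D v + (\<Sum>a\<in>out_arcs v. h (edge_of a)))"
    proof (cases "v < n")
      case True
      then have vn: "v \<in> {0..<n}" "v \<noteq> n" "v \<noteq> n + 1" using v by auto
      have "h (m + v) = k1 * (of_bool (v = s1) + of_bool (v = t1))" using vn s by (auto simp: h_def)
      moreover have "h (m + n + v) = k2 * (of_bool (v = s2) + of_bool (v = t2))" using vn s n0 by (auto simp: h_def)
      ultimately have "D v + (\<Sum>a\<in>out_arcs v. h (edge_of a)) = degree l v + k1 * (of_bool (v = s1) + of_bool (v = t1)) + k2 * (of_bool (v = s2) + of_bool (v = t2))"
        unfolding eq using vn D[OF v] by simp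
      then show ?thesis using par[of v] by simp
    next
      case False
      then show ?thesis unfolding eq D[OF v] using v degree_outside[of v c] by auto
    qed
  qed
  show ?thesis
    unfolding joining_def using H g D' ev edge_of_bounds by fastforce
qed

end

definition (in network) prepare_cost :: int where
  "prepare_cost = init_cost + 2 * cut_flow_cost + 40 * m + 200"

definition (in network) adjust_cost :: int where
  "adjust_cost = m * (2 * reduce_cost + 108) + 20 * (n + 2) + 100 * m + 40 * M + M * (join_cost + 8) + 200"

definition (in network) split_cost :: int where
  "split_cost = cut_flow_cost + 20 * (n + 2) + 80 * m + 100"

context graph_network
begin

definition ready :: "store \<Rightarrow> bool" where
  "ready \<sigma> \<longleftrightarrow> mem \<sigma> \<and> regs \<sigma> 2 = s1 \<and> regs \<sigma> 3 = t1 \<and> regs \<sigma> 4 = s2 \<and> regs \<sigma> 5 = t2"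

lemma readyD:
  assumes "ready \<sigma>"
  shows "mem \<sigma>" "regs \<sigma> 2 = s1" "regs \<sigma> 3 = t1" "regs \<sigma> 4 = s2" "regs \<sigma> 5 = t2"
  using assms by (auto simp: ready_def)

lemma ready_agree:
  assumes "ready \<sigma>" "agree C \<sigma> \<tau>" "written_regs C \<inter> {0, Suc 0, 2, 3, 4, 5, 6, 7, 8} = {}" "written_arrs C \<inter> {3, 4, 5, 6} = {}"
  shows "ready \<tau>"
proof -
  have "regs \<tau> i = regs \<sigma> i" if "i \<in> {0, Suc 0, 2, 3, 4, 5, 6, 7, 8}" for i
    using agree_regs[OF assms(2), of i] assms(3) that by blast
  moreover have "arrs \<tau> i = arrs \<sigma> i" if "i \<in> {3, 4, 5, 6}" for i
    using agree_arrs[OF assms(2), of i] assms(4) that by blast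
  ultimately show ?thesis using assms(1) mem_cong[of \<sigma> \<tau>] by (simp add: ready_def)
qed

lemma ready_cong:
  "ready \<sigma> \<Longrightarrow> (\<And>i. i < 9 \<Longrightarrow> regs \<tau> i = regs \<sigma> i) \<Longrightarrow> (\<And>i. i \<in> {3, 4, 5, 6} \<Longrightarrow> arrs \<tau> i = arrs \<sigma> i) \<Longrightarrow> ready \<tau>"
  using mem_cong[of \<sigma> \<tau>] by (simp add: ready_def)

abbreviation "separates_pairs X \<equiv> separates {s1, s2} {t1, t2} X \<or> separates {s1, t2} {t1, s2} X"

lemma bisep_separates: "bisep X \<longleftrightarrow> separates_pairs X \<or> separates_pairs (- X)"
  by (auto simp: bisep_def separates_def)

lemma all_bisep: "(\<And>X. separates_pairs X \<Longrightarrow> \<tau> \<le> cut c X) \<Longrightarrow> bisep X \<Longrightarrow> \<tau> \<le> cut c X"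
  using bisep_separates[of X] cut_complement[of c X] by metis

lemma wp_prepare:
  assumes r: "regs \<sigma> 0 = n" "regs \<sigma> 1 = m" "regs \<sigma> 2 = s1" "regs \<sigma> 3 = t1" "regs \<sigma> 4 = s2" "regs \<sigma> 5 = t2"
    and a: "\<And>e. 0 \<le> e \<Longrightarrow> e < m \<Longrightarrow> arrs \<sigma> 0 e = us e" "\<And>e. 0 \<le> e \<Longrightarrow> e < m \<Longrightarrow> arrs \<sigma> 1 e = vs e"
    and c0: "\<And>e. 0 \<le> e \<Longrightarrow> e < m \<Longrightarrow> 0 \<le> arrs \<sigma> 2 e"
  shows "wp prepare (\<lambda>\<tau> k. (ready \<tau> \<and> arrs \<tau> 2 = arrs \<sigma> 2 \<and> (\<Sum>e\<in>{0..<m}. arrs \<sigma> 2 e) < regs \<tau> 9 \<and>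
       0 \<le> regs \<tau> 52 \<and> regs \<tau> 52 < regs \<tau> 9 \<and>
       reducing (regs \<tau> 9) {s1, s2} {t1, t2} {s1, t2} {t1, s2} (regs \<tau> 52) (arrs \<sigma> 2) (arrs \<tau> 20) (arrs \<tau> 21) \<and>
       (\<forall>X. bisep X \<longrightarrow> regs \<tau> 52 \<le> cut (arrs \<sigma> 2) X) \<and> (\<exists>X. bisep X \<and> cut (arrs \<sigma> 2) X = regs \<tau> 52)) \<and> 0 \<le> k) \<sigma> prepare_cost"
proof -
  define c where "c = arrs \<sigma> 2"
  note tm = terminals
  show ?thesis
    unfolding prepare_def wp_Seq
  proof (rule wp_spec[OF wp_init_network], goal_cases)
    case (5 \<tau>1 k1)
    have r1: "ready \<tau>1"
      using 5(1) r by (simp add: ready_def agree_regs[OF 5(2)])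
    have c1: "arrs \<tau>1 2 = c" by (simp add: agree_arrs[OF 5(2)] c_def)
    have m1: "regs \<tau>1 1 = m" using 5(1) by (simp add: memD)
    show ?case
      unfolding wp_Seq
    proof (rule wp_spec[OF wp_sum_capacities[OF m1]], goal_cases)
      case (1 \<tau>2 k2)
      have r2: "ready \<tau>2" by (rule ready_agree[OF r1 1(2)]) simp_all
      have c2: "arrs \<tau>2 2 = c" by (simp add: agree_arrs[OF 1(2)] c1)
      have I2: "regs \<tau>2 9 = 1 + sum c {0..<m}" using 1(1) c1 by simp
      have m2: "regs \<tau>2 1 = m" using readyD(1)[OF r2] by (simp add: memD)
      note k2 = 1(3)
      show ?case
        unfolding wp_Seq
      proof (rule wp_spec[OF wp_copy_capacities[OF m2]], goal_cases)
        case (1 \<tau>3 k3)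
        have r3: "ready \<tau>3" by (rule ready_agree[OF r2 1(2)]) simp_all
        note R3 = readyD[OF r3]
        have c3: "arrs \<tau>3 2 = c" "regs \<tau>3 9 = 1 + sum c {0..<m}"
          "\<And>e. 0 \<le> e \<Longrightarrow> e < m \<Longrightarrow> arrs \<tau>3 13 e = c e \<and> arrs \<tau>3 14 e = c e"
          using 1(1) by (simp_all add: agree_arrs[OF 1(2)] agree_regs[OF 1(2)] c2 I2)
        note k3 = 1(3)
        show ?case
          unfolding wp_Seq
        proof (rule wp_spec[OF wp_cut_flow[OF R3(1), where S = "{s1, s2}" and T = "{t1, t2}" and c = c]], goal_cases)
          case (11 \<tau>4 k4)
          have r4: "ready \<tau>4" by (rule ready_agree[OF r3 11(2)]) simp_all
          have c4: "arrs \<tau>4 2 = c" "regs \<tau>4 9 = 1 + sum c {0..<m}"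
            "\<And>e. 0 \<le> e \<Longrightarrow> e < m \<Longrightarrow> arrs \<tau>4 13 e = c e \<and> arrs \<tau>4 14 e = c e"
            using c3 by (simp_all add: agree_arrs[OF 11(2)] agree_regs[OF 11(2)])
          define F where "F = arrs \<tau>4 10 (n + 1)"
          have F: "0 \<le> F" "\<exists>X. separates {s1, s2} {t1, t2} X \<and> cut c X = F" "\<And>Y. separates {s1, s2} {t1, t2} Y \<Longrightarrow> F \<le> cut c Y"
            "\<And>t. 0 \<le> t \<Longrightarrow> t \<le> F \<Longrightarrow> circulation c (regs \<tau>4 9) {s1, s2} {t1, t2} t F ((arrs \<tau>4 20)(ret := F - t))"
            using 11(1) unfolding F_def[symmetric] c3 c4 by blast+
          define \<tau>4' where "\<tau>4' = \<tau>4\<lparr>regs := (regs \<tau>4)(53 := F)\<rparr>"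
          have n4: "regs \<tau>4 0 = n" using readyD(1)[OF r4] by (simp add: memD)
          have r4': "ready \<tau>4'" by (rule ready_cong[OF r4]) (simp_all add: \<tau>4'_def)
          note R4 = readyD[OF r4']
          note k4 = 11(3)
          have start: "wp (Assign 53 (Elem 10 (Plus (Reg 0) (Num 1)))) Q \<tau>4 k4 \<longleftrightarrow> Q \<tau>4' (k4 - 5)" for Q
            by (simp add: \<tau>4'_def F_def n4)
          have a4: "arrs \<tau>4' = arrs \<tau>4" "regs \<tau>4' 9 = regs \<tau>4 9" "regs \<tau>4' 53 = F" by (simp_all add: \<tau>4'_def)
          show ?case
            unfolding wp_Seq start
          proof (rule wp_spec[OF wp_cut_flow[OF R4(1), where S = "{s1, t2}" and T = "{t1, s2}" and c = c]], goal_cases)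
            case (11 \<tau>5 k5)
            have r5: "ready \<tau>5" by (rule ready_agree[OF r4' 11(2)]) simp_all
            note m5 = memD[OF readyD(1)[OF r5]]
            have c5: "arrs \<tau>5 2 = c" "regs \<tau>5 9 = 1 + sum c {0..<m}" "regs \<tau>5 53 = F" "arrs \<tau>5 20 = arrs \<tau>4 20"
              using c4 by (simp_all add: agree_arrs[OF 11(2)] agree_regs[OF 11(2)] a4)
            define G' where "G' = arrs \<tau>5 10 (n + 1)"
            have G': "0 \<le> G'" "\<exists>X. separates {s1, t2} {t1, s2} X \<and> cut c X = G'" "\<And>Y. separates {s1, t2} {t1, s2} Y \<Longrightarrow> G' \<le> cut c Y"
              "\<And>t. 0 \<le> t \<Longrightarrow> t \<le> G' \<Longrightarrow> circulation c (regs \<tau>4 9) {s1, t2} {t1, s2} t G' ((arrs \<tau>5 21)(ret := G' - t))"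
              using 11(1) unfolding G'_def[symmetric] a4 by blast+
            define \<mu> where "\<mu> = min F G'"
            have "cut c X \<le> sum c {0..<m}" for X by (rule cut_le_sum) (use c0 in \<open>simp add: c_def\<close>)
            then have "F \<le> sum c {0..<m}" using F(2) by metis
            then have \<mu>: "0 \<le> \<mu>" "\<mu> \<le> F" "\<mu> \<le> G'" "\<mu> < 1 + sum c {0..<m}"
              using F(1) G'(1) unfolding \<mu>_def by simp_all
            have red: "reducing (1 + sum c {0..<m}) {s1, s2} {t1, t2} {s1, t2} {t1, s2} \<mu> c
                ((arrs \<tau>4 20)(ret := F - \<mu>)) ((arrs \<tau>5 21)(ret := G' - \<mu>))"
              unfolding reducing_def using F(1,4) G'(1,4) \<mu>(1-3) c4(2) c0 unfolding c_def[symmetric] by metis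
            have all: "\<mu> \<le> cut c X" if "bisep X" for X
              by (rule all_bisep[OF _ that]) (use F(3) G'(3) \<mu>(2,3) in fastforce)
            have ex: "\<exists>X. bisep X \<and> cut c X = \<mu>"
              using F(2) G'(2) unfolding \<mu>_def min_def bisep_separates by metis
            have ret: "M - 1 = ret" by (simp add: M_def)
            have k5: "80 \<le> k5"
              using 11(3) k4 k3 k2 5(3) by (simp add: prepare_cost_def)
            have r5': "ready (\<tau>5\<lparr>regs := (regs \<tau>5)(56 := G', 52 := \<mu>), arrs := (arrs \<tau>5)(20 := (arrs \<tau>5 20)(ret := F - \<mu>), 21 := (arrs \<tau>5 21)(ret := G' - \<mu>))\<rparr>)"
              by (rule ready_cong[OF r5]) auto
            have m5': "regs \<tau>5 0 = n" "regs \<tau>5 7 = M" using m5 by simp_all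
            show ?case
            proof (cases "F < G'")
              case True
              then have "\<mu> = F" by (simp add: \<mu>_def)
              then show ?thesis
                using True r5' red all ex \<mu> c5(1-3) k5
                by (simp add: m5' G'_def[symmetric] c5 ret c_def[symmetric])
            next
              case False
              then have "\<mu> = G'" by (simp add: \<mu>_def)
              then show ?thesis
                using False r5' red all ex \<mu> c5(1-3) k5
                by (simp add: m5' G'_def[symmetric] c5 ret c_def[symmetric])
            qed
          qed (use tm R4 c4 c0 in \<open>auto simp: a4 c_def[symmetric]\<close>)
        qed (use tm R3 c3 c0 in \<open>auto simp: c_def[symmetric]\<close>)
      qed
    qed
  qed (use r a in auto)
qed

lemma wp_adjust:
  assumes G: "Seymour_graph G" and r: "ready \<sigma>" and I: "0 \<le> regs \<sigma> 52" "regs \<sigma> 52 < regs \<sigma> 9"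
    and red: "reducing (regs \<sigma> 9) {s1, s2} {t1, t2} {s1, t2} {t1, s2} (regs \<sigma> 52) (arrs \<sigma> 2) (arrs \<sigma> 20) (arrs \<sigma> 21)"
    and X0: "bisep X0" "cut (arrs \<sigma> 2) X0 = regs \<sigma> 52"
  shows "wp adjust (\<lambda>\<tau> k. ((\<forall>e. 0 \<le> e \<and> e < m \<longrightarrow> 0 \<le> arrs \<tau> 2 e \<and> arrs \<tau> 2 e \<le> arrs \<sigma> 2 e) \<and>
       (\<forall>X. bisep X \<longrightarrow> regs \<sigma> 52 \<le> cut (arrs \<tau> 2) X) \<and> parity_ok (arrs \<tau> 2) s1 t1 s2 t2) \<and> 0 \<le> k) \<sigma> adjust_cost"
proof -
  note R = readyD[OF r]
  define c where "c = arrs \<sigma> 2"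
  define \<mu> where "\<mu> = regs \<sigma> 52"
  note tm = terminals
  have ST: "{s1, s2} \<subseteq> {0..<n}" "{t1, t2} \<subseteq> {0..<n}" "{s1, t2} \<subseteq> {0..<n}" "{t1, s2} \<subseteq> {0..<n}" using tm by auto
  show ?thesis
    unfolding adjust_def wp_Seq
  proof (rule wp_spec[OF wp_reduce_loop[OF R(1) red ST I]], goal_cases)
    case (1 \<tau>1 k1)
    define d where "d = arrs \<tau>1 2"
    have r1: "ready \<tau>1" by (rule ready_agree[OF r 1(2)]) simp_all
    have rd: "reducing (regs \<sigma> 9) {s1, s2} {t1, t2} {s1, t2} {t1, s2} \<mu> d (arrs \<tau>1 20) (arrs \<tau>1 21)"
      and e1: "\<And>e. 0 \<le> e \<Longrightarrow> e < m \<Longrightarrow> arrs \<tau>1 17 e = 1 \<and> d e = c e - 1 \<or> arrs \<tau>1 17 e = 0 \<and> d e = c e \<and> tight d separates_pairs \<mu> e"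
      using 1(1) unfolding d_def c_def \<mu>_def by blast+
    have d0: "\<And>e. 0 \<le> e \<Longrightarrow> e < m \<Longrightarrow> 0 \<le> d e" using rd by (simp add: reducing_def)
    have dc: "d e \<le> c e" if "0 \<le> e" "e < m" for e using e1[OF that] by auto
    have I0: "0 < regs \<sigma> 9" using I by simp
    have sep: "\<mu> \<le> cut d X" if "separates_pairs X" for X
      using that rd circulation_cut[OF _ I0 ST(1,2)] circulation_cut[OF _ I0 ST(3,4)] unfolding reducing_def by blast
    have bi: "\<mu> \<le> cut d X" if "bisep X" for X by (rule all_bisep[OF sep that])
    \<comment> \<open>Lowering only decreases cuts, but none below the minimum; so \<open>X0\<close>
      remains a minimum cut and the loads for the lowered capacities have the same value.\<close>
    have X0': "cut d X0 = \<mu>"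
      using cut_mono[of d c X0, OF dc] X0 bi[OF X0(1)] by (simp add: c_def \<mu>_def)
    obtain l l1 l2 where l: "\<And>e. 0 \<le> e \<Longrightarrow> e < m \<Longrightarrow> 0 \<le> l e \<and> l e \<le> d e"
      "\<And>X e. bisep X \<Longrightarrow> cut d X = \<mu> \<Longrightarrow> 0 \<le> e \<Longrightarrow> e < m \<Longrightarrow> crosses e X \<Longrightarrow> l e = d e"
      "\<And>v. even (degree l v + l1 * (of_bool (v = s1) + of_bool (v = t1)) + l2 * (of_bool (v = s2) + of_bool (v = t2)))"
      using seymour_loads[OF G d0 bi X0(1) X0'] by blast
    \<comment> \<open>An edge that could not be lowered is tight and therefore filled by the loads,
      so \<open>l - d\<close> is supported on the lowered edges.\<close>
    have red1: "arrs \<tau>1 17 e = 1 \<or> arrs \<tau>1 17 e = 0 \<and> l e = d e" if e: "0 \<le> e" "e < m" for e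
      using e1[OF e] l(1)[OF e] l(2)[OF _ _ e] bisep_separates unfolding tight_def by fastforce
    show ?case
      unfolding wp_Seq
    proof (rule wp_spec[OF wp_set_degrees[OF readyD(1)[OF r1]]], goal_cases)
      case (1 \<tau>2 k2)
      have r2: "ready \<tau>2" by (rule ready_agree[OF r1 1(2)]) simp_all
      have a2: "arrs \<tau>2 2 = d" "arrs \<tau>2 17 = arrs \<tau>1 17" by (simp_all add: agree_arrs[OF 1(2)] d_def)
      have D: "\<And>v. v \<in> V \<Longrightarrow> arrs \<tau>2 18 v = degree d v" using 1(1) by (simp add: d_def)
      note R2 = readyD[OF r2] and k2 = 1(3)
      show ?case
        unfolding wp_Seq
      proof (rule wp_spec[OF wp_mark_edges[OF R2(1)]], goal_cases)
        case (5 \<tau>3 k3)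
        have r3: "ready \<tau>3" by (rule ready_agree[OF r2 5(2)]) simp_all
        have a3: "arrs \<tau>3 2 = d" "arrs \<tau>3 18 = arrs \<tau>2 18" by (simp_all add: agree_arrs[OF 5(2)] a2)
        have mk: "\<And>a. a \<in> A \<Longrightarrow> arrs \<tau>3 22 a = marks (arrs \<tau>1 17) {m + s1, m + t1, m + n + s2, m + n + t2} a"
          using 5(1) by (simp add: R2 a2)
        define g where "g = (\<lambda>e. if e < m then arrs \<tau>1 17 e else if e \<in> {m + s1, m + t1, m + n + s2, m + n + t2} then 1 else 0)"
        have j: "joining g d (\<lambda>e. if e < m then d e else 0) 0 (arrs \<tau>3 2) (arrs \<tau>3 18) (arrs \<tau>3 22)"
          unfolding a3 g_def by (rule joining_init[OF mk D tm refl red1 l(3)])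
        have k3: "M * (join_cost + 8) + 6 \<le> k3"
          using 5(3) k2 1(3) \<open>adjust_cost - (m * (2 * reduce_cost + 108) + 6) \<le> k1\<close> by (simp add: adjust_cost_def)
        show ?case
        proof (rule wp_spec[OF wp_join_loop[OF readyD(1)[OF r3] j]], goal_cases)
          case (1 \<tau>4 k4)
          then obtain y D' H where jf: "joining g d y M (arrs \<tau>4 2) D' H" by blast
          have "parity_ok (arrs \<tau>4 2) s1 t1 s2 t2"
            by (rule joining_final[OF jf _ tm]) (simp add: g_def)
          \<comment> \<open>A unit is given back only to an edge that has lost one.\<close>
          moreover have bnd: "d e \<le> arrs \<tau>4 2 e \<and> arrs \<tau>4 2 e \<le> c e" if e: "0 \<le> e" "e < m" for e
          proof -
            have "arrs \<tau>4 2 e = d e \<or> g e \<noteq> 0 \<and> arrs \<tau>4 2 e = d e + 1" using jf e unfolding joining_def by blast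
            then show ?thesis using e1[OF e] dc[OF e] e by (auto simp: g_def)
          qed
          moreover have "\<mu> \<le> cut (arrs \<tau>4 2) X" if "bisep X" for X
            using bi[OF that] cut_mono[of d "arrs \<tau>4 2" X] bnd by fastforce
          moreover have "0 \<le> arrs \<tau>4 2 e" if "0 \<le> e" "e < m" for e using bnd[OF that] d0[OF that] by simp
          ultimately show ?case using 1(3) k3 by (simp add: \<mu>_def c_def)
        qed
      qed (use tm R2 in simp_all)
    qed
  qed
qed

lemma wp_split_demand:
  assumes r: "ready \<sigma>" and c0: "\<And>e. 0 \<le> e \<Longrightarrow> e < m \<Longrightarrow> 0 \<le> arrs \<sigma> 2 e" "(\<Sum>e\<in>{0..<m}. arrs \<sigma> 2 e) < regs \<sigma> 9"
    and par: "parity_ok (arrs \<sigma> 2) s1 t1 s2 t2" and mu: "1 \<le> regs \<sigma> 52" "\<And>X. bisep X \<Longrightarrow> regs \<sigma> 52 \<le> cut (arrs \<sigma> 2) X"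
      "bisep X0" "cut (arrs \<sigma> 2) X0 = regs \<sigma> 52"
  shows "wp split_demand (\<lambda>\<tau> k. (0 \<le> regs \<tau> 54 \<and> 0 \<le> regs \<tau> 55 \<and> regs \<tau> 54 + regs \<tau> 55 = regs \<sigma> 52 \<and>
      even (regs \<tau> 54 - degree (arrs \<sigma> 2) s1) \<and> even (regs \<tau> 55 - degree (arrs \<sigma> 2) s2) \<and>
      (\<forall>X. s1 \<in> X \<and> t1 \<notin> X \<longrightarrow> regs \<tau> 54 \<le> cut (arrs \<sigma> 2) X) \<and>
      (\<forall>X. (s2 \<in> X) \<noteq> (t2 \<in> X) \<longrightarrow> regs \<tau> 55 \<le> cut (arrs \<sigma> 2) X)) \<and> 0 \<le> k) \<sigma> split_cost"
proof -
  define c where "c = arrs \<sigma> 2"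
  define \<mu> where "\<mu> = regs \<sigma> 52"
  note R = readyD[OF r]
  note tm = terminals
  have m: "regs \<sigma> 1 = m" using R(1) by (simp add: memD)
  obtain X1 where X1: "s1 \<in> X1" "t1 \<notin> X1" "(s2 \<in> X1) \<noteq> (t2 \<in> X1)" "cut c X1 = \<mu>"
  proof (cases "s1 \<in> X0")
    case True
    then show ?thesis using that[of X0] mu(3,4) by (simp add: bisep_def c_def \<mu>_def)
  next
    case False
    then show ?thesis using that[of "- X0"] mu(3,4) by (simp add: bisep_def c_def \<mu>_def cut_complement)
  qed
  have tau: "\<mu> \<le> cut c X" if "s1 \<in> X" "t1 \<notin> X" "(s2 \<in> X) \<noteq> (t2 \<in> X)" for X
    using mu(2)[of X] that by (simp add: bisep_def c_def \<mu>_def)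
  show ?thesis
    unfolding split_demand_def wp_Seq
  proof (rule wp_spec[OF wp_copy_capacities[OF m]], goal_cases)
    case (1 \<tau>1 k1)
    have r1: "ready \<tau>1" by (rule ready_agree[OF r 1(2)]) simp_all
    have a1: "arrs \<tau>1 2 = c" "regs \<tau>1 9 = regs \<sigma> 9" "regs \<tau>1 52 = \<mu>"
      "\<And>e. 0 \<le> e \<Longrightarrow> e < m \<Longrightarrow> arrs \<tau>1 13 e = c e \<and> arrs \<tau>1 14 e = c e"
      using 1(1) by (simp_all add: agree_arrs[OF 1(2)] agree_regs[OF 1(2)] c_def \<mu>_def)
    show ?case
      unfolding wp_Seq
    proof (rule wp_spec[OF wp_set_degrees[OF readyD(1)[OF r1]]], goal_cases)
      case (1 \<tau>2 k2)
      have r2: "ready \<tau>2" by (rule ready_agree[OF r1 1(2)]) simp_all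
      note R2 = readyD[OF r2] and k2 = 1(3)
      have a2: "regs \<tau>2 9 = regs \<sigma> 9" "regs \<tau>2 52 = \<mu>" "arrs \<tau>2 18 s1 = degree c s1"
        "\<And>e. 0 \<le> e \<Longrightarrow> e < m \<Longrightarrow> arrs \<tau>2 13 e = c e \<and> arrs \<tau>2 14 e = c e"
        using 1(1) a1 tm by (simp_all add: agree_arrs[OF 1(2)] agree_regs[OF 1(2)])
      show ?case
        unfolding wp_Seq
      proof (rule wp_spec[OF wp_cut_flow[OF R2(1), where S = "{s1}" and T = "{t1}" and c = c]], goal_cases)
        case (11 \<tau>3 k3)
        have r3: "ready \<tau>3" by (rule ready_agree[OF r2 11(2)]) simp_all
        have n3: "regs \<tau>3 0 = n" using readyD(1)[OF r3] by (simp add: memD)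
        have a3: "regs \<tau>3 52 = \<mu>" "arrs \<tau>3 18 s1 = degree c s1" "regs \<tau>3 2 = s1"
          using a2 readyD(2)[OF r3] by (simp_all add: agree_arrs[OF 11(2)] agree_regs[OF 11(2)])
        define w where "w = arrs \<tau>3 10 (n + 1)"
        have w: "0 \<le> w" "\<And>Y. s1 \<in> Y \<Longrightarrow> t1 \<notin> Y \<Longrightarrow> w \<le> cut c Y" "\<exists>X. s1 \<in> X \<and> t1 \<notin> X \<and> cut c X = w"
          using 11(1) unfolding w_def[symmetric] separates_def by auto
        then obtain Y where Y: "s1 \<in> Y" "t1 \<notin> Y" "cut c Y = w" by blast
        define d1 where "d1 = (if w < \<mu> then w else if even (\<mu> - degree c s1) then \<mu> else \<mu> - 1)"
        note sv = split_value[of c s1 t1 s2 t2 \<mu> X1 w Y d1 "\<mu> - d1", OF c0(1)[folded c_def] par[folded c_def] tm mu(1)[folded \<mu>_def] tau X1 w(2) Y w(1) d1_def refl]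
        have k3: "60 \<le> k3"
          using 11(3) k2 \<open>split_cost - (20 * m + 10) \<le> k1\<close> by (simp add: split_cost_def)
        have he: "x = x div 2 + x div 2 \<longleftrightarrow> even x" for x :: int by (rule half_even)
        show ?case
        proof (cases "w < \<mu>")
          case True
          then have "d1 = w" by (simp add: d1_def)
          then show ?thesis using True sv k3 by (simp add: n3 a3 w_def[symmetric] c_def[symmetric] \<mu>_def[symmetric])
        next
          case False
          note F = this
          show ?thesis
          proof (cases "even (\<mu> - degree c s1)")
            case True
            then have "d1 = \<mu>" using F by (simp add: d1_def)
            then show ?thesis using True F sv k3 he[of "\<mu> - degree c s1"] by (simp add: n3 a3 w_def[symmetric] c_def[symmetric] \<mu>_def[symmetric] he)
          next
            case False
            then have "d1 = \<mu> - 1" using F by (simp add: d1_def)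
            then show ?thesis using False F sv k3 he[of "\<mu> - degree c s1"] by (simp add: n3 a3 w_def[symmetric] c_def[symmetric] \<mu>_def[symmetric] he)
          qed
        qed
      qed (use tm R2 a2 c0 in \<open>auto simp: c_def[symmetric]\<close>)
    qed
  qed
qed

end

section \<open>Routing, output and the total running time\<close>

text \<open>Both sums and differences of the two commodities are routed as single flows with integral demands;
  registers 54 and 55 hold the values of the commodities.\<close>

definition route :: com where
  "route = (demand_flow 20 4 5 ;; demand_flow 21 5 4)"

text \<open>Arrays 20 and 21 hold p and q, where the two routed flows are c - 2p and c - 2q. Half
  their sum is c - p - q, and half their difference is q - p.\<close>

definition output_paths :: com where
  "output_paths =
     (Assign 60 (Num 0) ;; Assign 61 (Num 0) ;;
      set_path_arcs (Minus (Minus (Elem 2 (Reg 50)) (Elem 20 (Reg 50))) (Elem 21 (Reg 50))) ;; decompose 2 3 ;;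
      set_path_arcs (Minus (Elem 21 (Reg 50)) (Elem 20 (Reg 50))) ;; decompose 4 5)"

text \<open>The value 0 is treated separately because the parity correction in
  \<open>split_value\<close> may subtract one from it.\<close>

definition biflow_algorithm :: com where
  "biflow_algorithm =
     (prepare ;;
      If (Less (Num 0) (Reg 52))
        (adjust ;; split_demand ;; route ;; output_paths ;; Assign 0 (Reg 61))
        (Assign 0 (Num 0)))"

lemma written_route: "written_regs route \<inter> {0, Suc 0, 2, 3, 4, 5, 6, 7, 8} = {}" "written_arrs route \<inter> {2, 3, 4, 5, 6} = {}"
  by (simp_all add: route_def)

context network
begin

lemma divergence_half_sum:
  assumes "\<And>e. 0 \<le> e \<Longrightarrow> e < m \<Longrightarrow> f e + g e = 2 * h e"
  shows "divergence f v + divergence g v = 2 * divergence h v"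
  unfolding divergence_def sum.distrib[symmetric] sum_distrib_left
proof (rule sum.cong)
  fix e assume "e \<in> {0..<m}"
  then have "f e = 2 * h e - g e" using assms[of e] by simp
  then show "(if us e = v then f e else 0) - (if vs e = v then f e else 0) + ((if us e = v then g e else 0) - (if vs e = v then g e else 0))
    = 2 * ((if us e = v then h e else 0) - (if vs e = v then h e else 0))" by simp
qed simp

lemma divergence_half_diff:
  assumes "\<And>e. 0 \<le> e \<Longrightarrow> e < m \<Longrightarrow> f e - g e = 2 * h e"
  shows "divergence f v - divergence g v = 2 * divergence h v"
  unfolding divergence_def sum_subtractf[symmetric] sum_distrib_left
proof (rule sum.cong)
  fix e assume "e \<in> {0..<m}"
  then have "f e = 2 * h e + g e" using assms[of e] by simp
  then show "(if us e = v then f e else 0) - (if vs e = v then f e else 0) - ((if us e = v then g e else 0) - (if vs e = v then g e else 0))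
    = 2 * ((if us e = v then h e else 0) - (if vs e = v then h e else 0))" by simp
qed simp

lemma demand_even:
  assumes par: "parity_ok c s1 t1 s2 t2" and ev: "even (d1 - degree c s1)" "even (d2 - degree c s2)"
    and d: "distinct [s1, t1, s2, t2]" and xy: "(x, y) = (s2, t2) \<or> (x, y) = (t2, s2)" and v: "v \<in> {0..<n}"
  shows "even (demand d1 s1 t1 d2 x y v + degree c v)"
proof -
  have e: "even (d1 + degree c s1)" "even (d1 + degree c t1)" "even (d2 + degree c s2)" "even (d2 + degree c t2)"
    using par ev by (auto simp: parity_ok_def)
  have e': "even (degree c v)" if "v \<notin> {s1, t1, s2, t2}" using par v that by (auto simp: parity_ok_def)
  have "demand d1 s1 t1 d2 x y v = (if v = s1 then d1 else if v = t1 then - d1 else if v \<in> {s2, t2} then (if v = x then d2 else - d2) else 0)"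
    using xy d unfolding demand_def by (elim disjE) (simp_all add: eq_commute[of v])
  then show ?thesis using e e' by (simp split: if_splits)
qed

lemma decomposed_load:
  assumes dec: "decomposed P0 d s t P L" and P0: "\<And>a. a \<in> A \<Longrightarrow> P0 a = path_arcs f a" and e: "0 \<le> e" "e < m"
  shows "load_of L e \<le> \<bar>f e\<bar>"
proof -
  have eA: "e \<in> A" "e + M \<in> A" using e edge_bounds(1)[of e] M_pos by auto
  then have "0 \<le> P e" "0 \<le> P (e + M)" "P e + P (e + M) + load_of L e = P0 e + P0 (e + M)"
    using dec e unfolding decomposed_def by blast+
  then show ?thesis using P0[OF eA(1)] P0[OF eA(2)] path_arcs_simps(1,2)[OF e] by auto
qed

definition decompose_cost :: int where
  "decompose_cost = (2 * M + 1) * (search_cost + extract_cost + 10) + 10"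

definition output_cost :: int where
  "output_cost = 2 * (40 * M + 50 * m + 50) + 2 * decompose_cost + 10"

definition total_cost :: int where
  "total_cost = prepare_cost + adjust_cost + split_cost + 2 * demand_cost + output_cost + 20"

text \<open>Cubic terms come only from the rounds of the five flows, and m^2 from the searches per
  edge and per extracted path. Mixed terms are absorbed by 2nm \<le> n^2 + m^2, lower powers of n by
  the assumption that n is positive.\<close>

lemma total_cost_bound:
  assumes "1 \<le> n"
  shows "total_cost \<le> 1000000 * (n ^ 3 + m ^ 2)"
proof -
  have n1: "n \<le> n * n" using assms mult_mono[of 1 n n n] by simp
  have n2: "n * n \<le> n * n * n" using assms mult_mono[of 1 n "n * n" "n * n"] by (simp add: mult.commute)
  have m1: "m \<le> m * m" using m0 by (cases "m = 0") (auto simp: mult_le_cancel_left1)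
  have nm: "2 * (n * m) \<le> n * n + m * m" using zero_le_square[of "n - m"] by (simp add: algebra_simps)
  \<comment> \<open>The coefficients on the right are what remains of 1000000 after subtracting the
    leading terms of the cost, 560 for \<open>m * m\<close> and 2200 for \<open>n * n * n\<close>;
    the latter is 440 for each of the five flows.\<close>
  have poly: "11798 + 9676 * m + 4200 * (n * m) + 24776 * n + 11880 * (n * n) \<le> 999440 * (m * m) + 997800 * (n * n * n)"
    using n1 n2 m1 nm assms m0 by linarith
  have "total_cost \<le> 1000000 * (n * n * n + m * m)"
    unfolding total_cost_def output_cost_def decompose_cost_def prepare_cost_def adjust_cost_def split_cost_def
      demand_cost_def cut_flow_cost_def flow_cost_def init_cost_def reduce_cost_def join_cost_def search_cost_def
      extract_cost_def M_def ret_def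
    using poly by (simp add: algebra_simps)
  then show ?thesis by (simp add: power3_eq_cube power2_eq_square)
qed

end

context graph_network
begin

lemma wp_route:
  assumes r: "ready \<sigma>" and c: "\<And>e. 0 \<le> e \<Longrightarrow> e < m \<Longrightarrow> 0 \<le> arrs \<sigma> 2 e" and par: "parity_ok (arrs \<sigma> 2) s1 t1 s2 t2"
    and d: "regs \<sigma> 54 = d1" "regs \<sigma> 55 = d2" "0 \<le> d1" "0 \<le> d2" "even (d1 - degree (arrs \<sigma> 2) s1)" "even (d2 - degree (arrs \<sigma> 2) s2)"
    and cut: "\<And>X. s1 \<in> X \<Longrightarrow> t1 \<notin> X \<Longrightarrow> d1 \<le> cut (arrs \<sigma> 2) X" "\<And>X. (s2 \<in> X) \<noteq> (t2 \<in> X) \<Longrightarrow> d2 \<le> cut (arrs \<sigma> 2) X"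
      "\<And>X. bisep X \<Longrightarrow> d1 + d2 \<le> cut (arrs \<sigma> 2) X"
  shows "wp route (\<lambda>\<tau> k. ((\<forall>e. 0 \<le> e \<and> e < m \<longrightarrow> 0 \<le> arrs \<tau> 20 e \<and> arrs \<tau> 20 e \<le> arrs \<sigma> 2 e \<and>
         0 \<le> arrs \<tau> 21 e \<and> arrs \<tau> 21 e \<le> arrs \<sigma> 2 e) \<and>
      (\<forall>v\<in>{0..<n}. divergence (\<lambda>e. arrs \<sigma> 2 e - 2 * arrs \<tau> 20 e) v = demand d1 s1 t1 d2 s2 t2 v \<and>
         divergence (\<lambda>e. arrs \<sigma> 2 e - 2 * arrs \<tau> 21 e) v = demand d1 s1 t1 d2 t2 s2 v)) \<and> 0 \<le> k) \<sigma> (2 * demand_cost)"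
proof -
  note R = readyD[OF r] and tm = terminals
  have dc: "(\<Sum>v\<in>{0..<n} \<inter> X. demand d1 s1 t1 d2 s2 t2 v) \<le> cut (arrs \<sigma> 2) X" for X
    by (rule demand_cut) (use tm d cut c in \<open>auto simp: bisep_def\<close>)
  have dc': "(\<Sum>v\<in>{0..<n} \<inter> X. demand d1 s1 t1 d2 t2 s2 v) \<le> cut (arrs \<sigma> 2) X" for X
    by (rule demand_cut) (use tm d cut c in \<open>auto simp: bisep_def\<close>)
  note ev = demand_even[OF par d(5,6) tm(5)]
  show ?thesis
    unfolding route_def wp_Seq
  proof (rule wp_spec[OF wp_demand_flow[OF R(1), where dd = "demand d1 s1 t1 d2 s2 t2"]], goal_cases)
    case (12 \<tau>1 k1)
    have r1: "ready \<tau>1" by (rule ready_agree[OF r 12(2)]) simp_all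
    note R1 = readyD[OF r1]
    have a1: "arrs \<tau>1 2 = arrs \<sigma> 2" "regs \<tau>1 54 = d1" "regs \<tau>1 55 = d2"
      using d by (simp_all add: agree_arrs[OF 12(2)] agree_regs[OF 12(2)])
    note p1 = 12(1) and k1 = 12(3)
    show ?case
    proof (rule wp_spec[OF wp_demand_flow[OF R1(1), where dd = "demand d1 s1 t1 d2 t2 s2"]], goal_cases)
      case (12 \<tau>2 k2)
      have "arrs \<tau>2 20 = arrs \<tau>1 20" by (simp add: agree_arrs[OF 12(2)])
      then show ?case using p1 12(1,3) k1 a1 by simp
    next
      case (3 e) then show ?case using c by (simp add: a1)
    next
      case 10 show ?case unfolding a1 by (rule dc')
    next
      case (11 v) then show ?case unfolding a1 by (intro ev) simp_all
    qed (use tm in \<open>simp_all add: R1 a1\<close>)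
  next
    case (3 e) then show ?case by (rule c)
  next
    case 10 show ?case by (rule dc)
  next
    case (11 v) then show ?case by (intro ev) simp_all
  qed (use tm in \<open>simp_all add: R d\<close>)
qed

lemma wp_output_paths:
  assumes r: "ready \<sigma>" and f1: "f1 = (\<lambda>e. arrs \<sigma> 2 e - arrs \<sigma> 20 e - arrs \<sigma> 21 e)" and f2: "f2 = (\<lambda>e. arrs \<sigma> 21 e - arrs \<sigma> 20 e)"
    and div: "\<And>v. v \<in> {0..<n} \<Longrightarrow> divergence f1 v = d1 * (of_bool (v = s1) - of_bool (v = t1))"
      "\<And>v. v \<in> {0..<n} \<Longrightarrow> divergence f2 v = d2 * (of_bool (v = s2) - of_bool (v = t2))"
  shows "wp output_paths (\<lambda>\<tau> k. (\<exists>L. listed (arrs \<tau> 0) (regs \<tau> 60) (encode L) \<and> regs \<tau> 61 = int (length L) \<and>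
      distinct (map fst L) \<and> fst ` set L \<subseteq> terminal_paths G \<and>
      (\<forall>e. 0 \<le> e \<and> e < m \<longrightarrow> load_of L e \<le> \<bar>f1 e\<bar> + \<bar>f2 e\<bar>) \<and> d1 + d2 \<le> total L) \<and> 0 \<le> k) \<sigma> output_cost"
proof -
  note tm = terminals
  have st: "s1 \<noteq> t1" "s2 \<noteq> t2" using tm by auto
  define \<sigma>0 where "\<sigma>0 = \<sigma>\<lparr>regs := (regs \<sigma>)(60 := 0, 61 := 0)\<rparr>"
  have r0: "ready \<sigma>0" by (rule ready_cong[OF r]) (simp_all add: \<sigma>0_def)
  have a0: "arrs \<sigma>0 = arrs \<sigma>" "regs \<sigma>0 60 = 0" "regs \<sigma>0 61 = 0" by (simp_all add: \<sigma>0_def)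
  note R0 = readyD[OF r0]
  have start: "wp output_paths Q \<sigma> k \<longleftrightarrow> wp (set_path_arcs (Minus (Minus (Elem 2 (Reg 50)) (Elem 20 (Reg 50))) (Elem 21 (Reg 50))) ;; decompose 2 3 ;;
      set_path_arcs (Minus (Elem 21 (Reg 50)) (Elem 20 (Reg 50))) ;; decompose 4 5) Q \<sigma>0 (k - 4)" for Q k
    by (simp add: output_paths_def \<sigma>0_def)
  show ?thesis
    unfolding start wp_Seq
  proof (rule wp_spec[OF wp_set_path_arcs[OF R0(1), where f = f1]], goal_cases)
    case (3 \<tau>1 k1)
    have r1: "ready \<tau>1" by (rule ready_agree[OF r0 3(2)]) simp_all
    note R1 = readyD[OF r1] and k1 = 3(3)
    have a1: "arrs \<tau>1 2 = arrs \<sigma> 2" "arrs \<tau>1 20 = arrs \<sigma> 20" "arrs \<tau>1 21 = arrs \<sigma> 21" "regs \<tau>1 60 = 0" "regs \<tau>1 61 = 0"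
      by (simp_all add: agree_arrs[OF 3(2)] agree_regs[OF 3(2)] a0)
    have P1: "\<And>a. a \<in> A \<Longrightarrow> arrs \<tau>1 24 a = path_arcs f1 a" using 3(1) by blast
    have dec1: "decomposed (arrs \<tau>1 24) d1 s1 t1 (arrs \<tau>1 24) []" by (rule decomposed_init[OF P1 div(1) tm(1,2)])
    show ?case
      unfolding wp_Seq
    proof (rule wp_spec[OF wp_decompose[OF R1(1,2,3) tm(1,2) st(1) _ _ dec1, where ?L0.0 = "[]"]], goal_cases)
      case (5 \<tau>2 k2)
      have r2: "ready \<tau>2" by (rule ready_agree[OF r1 5(2)]) simp_all
      note R2 = readyD[OF r2] and k2 = 5(3)
      have a2: "arrs \<tau>2 2 = arrs \<sigma> 2" "arrs \<tau>2 20 = arrs \<sigma> 20" "arrs \<tau>2 21 = arrs \<sigma> 21"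
        by (simp_all add: agree_arrs[OF 5(2)] a1)
      obtain L1 P where L1: "decomposed (arrs \<tau>1 24) d1 s1 t1 P L1" "d1 \<le> total L1"
        "listed (arrs \<tau>2 0) (regs \<tau>2 60) (encode L1)" "regs \<tau>2 61 = int (length L1)" using 5(1) by auto
      show ?case
        unfolding wp_Seq
      proof (rule wp_spec[OF wp_set_path_arcs[OF R2(1), where f = f2]], goal_cases)
        case (3 \<tau>3 k3)
        have r3: "ready \<tau>3" by (rule ready_agree[OF r2 3(2)]) simp_all
        note R3 = readyD[OF r3] and k3 = 3(3)
        have a3: "arrs \<tau>3 0 = arrs \<tau>2 0" "regs \<tau>3 60 = regs \<tau>2 60" "regs \<tau>3 61 = regs \<tau>2 61"
          by (simp_all add: agree_arrs[OF 3(2)] agree_regs[OF 3(2)])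
        have P3: "\<And>a. a \<in> A \<Longrightarrow> arrs \<tau>3 24 a = path_arcs f2 a" using 3(1) by blast
        have dec2: "decomposed (arrs \<tau>3 24) d2 s2 t2 (arrs \<tau>3 24) []" by (rule decomposed_init[OF P3 div(2) tm(3,4)])
        show ?case
        proof (rule wp_spec[OF wp_decompose[OF R3(1,4,5) tm(3,4) st(2) _ _ dec2, where ?L0.0 = L1]], goal_cases)
          case (5 \<tau>4 k4)
          obtain L2 P' where L2: "decomposed (arrs \<tau>3 24) d2 s2 t2 P' L2" "d2 \<le> total L2"
            "listed (arrs \<tau>4 0) (regs \<tau>4 60) (encode (L1 @ L2))" "regs \<tau>4 61 = int (length (L1 @ L2))" using 5(1) by auto
          have sp: "simple_path G (source1 G) Q (sink1 G)" if "Q \<in> fst ` set L1" for Q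
            using L1(1) that edge_path_simple_path unfolding decomposed_def by blast
          have sp': "simple_path G (source2 G) Q (sink2 G)" if "Q \<in> fst ` set L2" for Q
            using L2(1) that edge_path_simple_path unfolding decomposed_def by blast
          have "distinct (map fst L1)" "distinct (map fst L2)" using L1(1) L2(1) unfolding decomposed_def by blast+
          moreover have "fst ` set L1 \<inter> fst ` set L2 = {}" using sp sp' commodities_disjoint by blast
          ultimately have "distinct (map fst (L1 @ L2))" by simp
          moreover have "fst ` set (L1 @ L2) \<subseteq> terminal_paths G"
            using sp sp' unfolding terminal_paths_def set_append image_Un by blast
          moreover have "load_of (L1 @ L2) e \<le> \<bar>f1 e\<bar> + \<bar>f2 e\<bar>" if "0 \<le> e" "e < m" for e
            using decomposed_load[OF L1(1) P1 that] decomposed_load[OF L2(1) P3 that] by (simp add: load_of_def)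
          moreover have "d1 + d2 \<le> total (L1 @ L2)" using L1(2) L2(2) by (simp add: total_def)
          moreover have "0 \<le> k4" using 5(3) k3 k2 k1 by (simp add: output_cost_def decompose_cost_def)
          ultimately show ?case using L2(3,4) by blast
        qed (use L1 a3 in simp_all)
      qed (simp_all add: a2 f2)
    qed (use a1 in \<open>simp_all add: listed_def encode_def\<close>)
  qed (simp_all add: a0 f1)
qed

lemma wp_biflow_algorithm:
  assumes G: "Seymour_graph G"
    and r: "regs \<sigma> 0 = n" "regs \<sigma> 1 = m" "regs \<sigma> 2 = s1" "regs \<sigma> 3 = t1" "regs \<sigma> 4 = s2" "regs \<sigma> 5 = t2"
    and a: "\<And>e. 0 \<le> e \<Longrightarrow> e < m \<Longrightarrow> arrs \<sigma> 0 e = us e" "\<And>e. 0 \<le> e \<Longrightarrow> e < m \<Longrightarrow> arrs \<sigma> 1 e = vs e"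
    and c: "\<And>e. 0 \<le> e \<Longrightarrow> e < m \<Longrightarrow> arrs \<sigma> 2 e = int (c (nat e))"
  shows "wp biflow_algorithm (\<lambda>\<tau> k. (\<exists>L. (\<forall>i<length (encode L). arrs \<tau> 0 (int i) = int (encode L ! i)) \<and> regs \<tau> 0 = int (length L) \<and>
      distinct (map fst L) \<and> fst ` set L \<subseteq> terminal_paths G \<and> max_integral_biflow G c (listed_biflow L)) \<and> 0 \<le> k) \<sigma> total_cost"
proof -
  note tm = terminals
  define c0 where "c0 = arrs \<sigma> 2"
  have cut0: "cut c0 X = cut (\<lambda>e. int (c (nat e))) X" for X
    unfolding cut_def by (rule sum.cong) (auto simp: c c0_def)
  have M0: "0 \<le> M" using M_pos by simp
  have pos: "0 \<le> adjust_cost" "0 \<le> split_cost" "0 \<le> demand_cost" "0 \<le> output_cost"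
    using M0 n0 m0 by (simp_all add: adjust_cost_def split_cost_def demand_cost_def output_cost_def decompose_cost_def
      cut_flow_cost_def flow_cost_def reduce_cost_def join_cost_def search_cost_def extract_cost_def)
  show ?thesis
    unfolding biflow_algorithm_def wp_Seq
  proof (rule wp_spec[OF wp_prepare[OF r a]], goal_cases)
    case (6 \<tau>1 k1)
    define \<mu> where "\<mu> = regs \<tau>1 52"
    have A1: "ready \<tau>1" "arrs \<tau>1 2 = c0" "(\<Sum>e\<in>{0..<m}. c0 e) < regs \<tau>1 9" "0 \<le> \<mu>" "\<mu> < regs \<tau>1 9"
      "reducing (regs \<tau>1 9) {s1, s2} {t1, t2} {s1, t2} {t1, s2} \<mu> c0 (arrs \<tau>1 20) (arrs \<tau>1 21)"
      "\<And>X. bisep X \<Longrightarrow> \<mu> \<le> cut c0 X" "\<exists>X. bisep X \<and> cut c0 X = \<mu>"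
      using 6(1) unfolding c0_def \<mu>_def by blast+
    obtain X0 where X0: "bisep X0" "cut c0 X0 = \<mu>" using A1(8) by blast
    have k1: "adjust_cost + split_cost + 2 * demand_cost + output_cost + 20 \<le> k1" using 6(3) by (simp add: total_cost_def)
    show ?case
    proof (cases "0 < \<mu>")
      case False
      then have "\<mu> = 0" using A1(4) by simp
      have "max_integral_biflow G c (listed_biflow [])"
        by (rule listed_biflow_maximum[OF _ _ _ X0(1)]) (use X0(2) \<open>\<mu> = 0\<close> in \<open>simp_all add: cut0 load_of_def total_def\<close>)
      then show ?thesis
        using False k1 pos by (simp add: \<mu>_def[symmetric] encode_def)
    next
      case True
      have start: "wp (If (Less (Num 0) (Reg 52)) C D) Q \<tau>1 k1 \<longleftrightarrow> wp C Q \<tau>1 (k1 - 4)" for C D Q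
        using True by (simp add: \<mu>_def[symmetric])
      show ?thesis
        unfolding start wp_Seq
      proof (rule wp_spec[OF wp_adjust[OF G A1(1)]], goal_cases)
        case (6 \<tau>2 k2)
        have r2: "ready \<tau>2" by (rule ready_agree[OF A1(1) 6(2)]) (use written_adjust in auto)
        define d where "d = arrs \<tau>2 2"
        have "52 \<notin> written_regs adjust" "9 \<notin> written_regs adjust" using written_adjust(1) by blast+
        then have a2: "regs \<tau>2 52 = \<mu>" "regs \<tau>2 9 = regs \<tau>1 9" by (simp_all add: agree_regs[OF 6(2)] \<mu>_def)
        have A2: "\<And>e. 0 \<le> e \<Longrightarrow> e < m \<Longrightarrow> 0 \<le> d e \<and> d e \<le> c0 e" "\<And>X. bisep X \<Longrightarrow> \<mu> \<le> cut d X" "parity_ok d s1 t1 s2 t2"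
          using 6(1) unfolding A1(2) d_def[symmetric] \<mu>_def[symmetric] by blast+
        have X0': "cut d X0 = \<mu>" using cut_mono[of d c0 X0] A2(1) A2(2)[OF X0(1)] X0(2) by fastforce
        have "(\<Sum>e\<in>{0..<m}. d e) \<le> (\<Sum>e\<in>{0..<m}. c0 e)" by (rule sum_mono) (use A2(1) in auto)
        then have sd: "(\<Sum>e\<in>{0..<m}. d e) < regs \<tau>1 9" using A1(3) by simp
        note k2 = 6(3)
        show ?case
          unfolding wp_Seq
        proof (rule wp_spec[OF wp_split_demand[OF r2 _ _ _ _ _ X0(1)]], goal_cases)
          case (7 \<tau>3 k3)
          have r3: "ready \<tau>3" by (rule ready_agree[OF r2 7(2)]) (use written_split_demand in auto)
          have "2 \<notin> written_arrs split_demand" using written_split_demand(2) by blast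
          then have a3: "arrs \<tau>3 2 = d" by (simp add: agree_arrs[OF 7(2)] d_def)
          define d1 where "d1 = regs \<tau>3 54"
          define d2 where "d2 = regs \<tau>3 55"
          have A3: "0 \<le> d1" "0 \<le> d2" "d1 + d2 = \<mu>" "even (d1 - degree d s1)" "even (d2 - degree d s2)"
            "\<And>X. s1 \<in> X \<Longrightarrow> t1 \<notin> X \<Longrightarrow> d1 \<le> cut d X" "\<And>X. (s2 \<in> X) \<noteq> (t2 \<in> X) \<Longrightarrow> d2 \<le> cut d X"
            using 7(1) unfolding d_def[symmetric] d1_def[symmetric] d2_def[symmetric] a2(1) by blast+
          note k3 = 7(3)
          show ?case
            unfolding wp_Seq
          proof (rule wp_spec[OF wp_route[OF r3 _ _ d1_def[symmetric] d2_def[symmetric] A3(1,2)]], goal_cases)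
            case (8 \<tau>4 k4)
            have r4: "ready \<tau>4" by (rule ready_agree[OF r3 8(2)]) (use written_route in auto)
            have "2 \<notin> written_arrs route" using written_route(2) by blast
            then have a4: "arrs \<tau>4 2 = d" by (simp add: agree_arrs[OF 8(2)] a3)
            let ?p = "arrs \<tau>4 20" and ?q = "arrs \<tau>4 21"
            have A4: "\<And>e. 0 \<le> e \<Longrightarrow> e < m \<Longrightarrow> 0 \<le> ?p e \<and> ?p e \<le> d e \<and> 0 \<le> ?q e \<and> ?q e \<le> d e"
              "\<And>v. v \<in> {0..<n} \<Longrightarrow> divergence (\<lambda>e. d e - 2 * ?p e) v = demand d1 s1 t1 d2 s2 t2 v"
              "\<And>v. v \<in> {0..<n} \<Longrightarrow> divergence (\<lambda>e. d e - 2 * ?q e) v = demand d1 s1 t1 d2 t2 s2 v"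
              using 8(1) unfolding a3 by blast+
            define f1 where "f1 = (\<lambda>e. arrs \<tau>4 2 e - ?p e - ?q e)"
            define f2 where "f2 = (\<lambda>e. ?q e - ?p e)"
            have v1: "divergence f1 v = d1 * (of_bool (v = s1) - of_bool (v = t1))" if "v \<in> {0..<n}" for v
            proof -
              have "demand d1 s1 t1 d2 s2 t2 v + demand d1 s1 t1 d2 t2 s2 v = 2 * divergence f1 v"
                unfolding A4(2,3)[OF that, symmetric] by (rule divergence_half_sum) (simp add: f1_def a4)
              moreover have "demand d1 s1 t1 d2 s2 t2 v + demand d1 s1 t1 d2 t2 s2 v = 2 * (d1 * (of_bool (v = s1) - of_bool (v = t1)))"
                unfolding demand_def by (simp add: algebra_simps)
              ultimately show ?thesis by simp
            qed
            have v2: "divergence f2 v = d2 * (of_bool (v = s2) - of_bool (v = t2))" if "v \<in> {0..<n}" for v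
            proof -
              have "demand d1 s1 t1 d2 s2 t2 v - demand d1 s1 t1 d2 t2 s2 v = 2 * divergence f2 v"
                unfolding A4(2,3)[OF that, symmetric] by (rule divergence_half_diff) (simp add: f2_def)
              moreover have "demand d1 s1 t1 d2 s2 t2 v - demand d1 s1 t1 d2 t2 s2 v = 2 * (d2 * (of_bool (v = s2) - of_bool (v = t2)))"
                unfolding demand_def by (simp add: algebra_simps)
              ultimately show ?thesis by simp
            qed
            \<comment> \<open>The sum of the absolute values of (g + h)/2 and (g - h)/2 is the
              larger of |g| and |h|, and both flows respect the capacities.\<close>
            have cap: "\<bar>f1 e\<bar> + \<bar>f2 e\<bar> \<le> int (c (nat e))" if e: "0 \<le> e" "e < m" for e
              using A4(1)[OF e] A2(1)[OF e] c[OF e] unfolding f1_def f2_def a4 c0_def by linarith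
            note k4 = 8(3)
            show ?case
              unfolding wp_Seq
            proof (rule wp_spec[OF wp_output_paths[OF r4 f1_def f2_def v1 v2]], goal_cases)
              case (3 \<tau>5 k5)
              then obtain L where L: "listed (arrs \<tau>5 0) (regs \<tau>5 60) (encode L)" "regs \<tau>5 61 = int (length L)"
                "distinct (map fst L)" "fst ` set L \<subseteq> terminal_paths G"
                "\<And>e. 0 \<le> e \<Longrightarrow> e < m \<Longrightarrow> load_of L e \<le> \<bar>f1 e\<bar> + \<bar>f2 e\<bar>" "d1 + d2 \<le> total L" by blast
              have "max_integral_biflow G c (listed_biflow L)"
                by (rule listed_biflow_maximum[OF L(3,4) _ X0(1)]) (use L(5,6) cap X0(2) A3(3) in \<open>auto simp: cut0 intro: order_trans\<close>)
              moreover have "2 \<le> k5" using 3(3) k4 k3 k2 k1 by simp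
              ultimately show ?case using L(1-4) by (auto simp: listed_def)
            qed
          qed (use A2 A3 a3 in auto)
        qed (use A2 a2 sd True X0' in \<open>auto simp: d_def[symmetric]\<close>)
      qed (use A1 X0 in \<open>auto simp: \<mu>_def[symmetric]\<close>)
    qed
  qed (use c in auto)
qed

end

theorem theorem1p2:
  "\<exists>(A::com) (C::nat).
     \<forall>(G::(nat, nat) terminal_graph) (u::nat \<Rightarrow> nat) (v::nat \<Rightarrow> nat) (c::nat \<Rightarrow> nat).
       Seymour_graph G \<and> numbered_graph G u v \<longrightarrow>
       (\<exists>t \<tau> f. exec A (input_store G u v c) t \<tau> \<and>
                t \<le> C * (card (verts G) ^ 3 + card (edges G) ^ 2) \<and>
                outputs_biflow G \<tau> f \<and> max_integral_biflow G c f)"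
proof (rule exI[of _ biflow_algorithm], rule exI[of _ 1000000], intro allI impI, elim conjE)
  fix G :: "(nat, nat) terminal_graph" and u v c :: "nat \<Rightarrow> nat"
  assume G: "Seymour_graph G" and num: "numbered_graph G u v"
  let ?n = "card (verts G)" and ?m = "card (edges G)" and ?\<sigma> = "input_store G u v c"
  define us where "us = (\<lambda>e. int (u (nat e)))"
  define vs where "vs = (\<lambda>e. int (v (nat e)))"
  have wf: "wf_terminal_graph G" using G by (simp add: Seymour_graph_def)
  have V: "verts G = {..<?n}" and E: "edges G = {..<?m}" and ends: "\<And>e. e \<in> edges G \<Longrightarrow> ends G e = {u e, v e}"
    using num unfolding numbered_graph_def by blast+
  have uv: "u e < ?n" "v e < ?n" if "e < ?m" for e
  proof -
    have e: "e \<in> edges G" using that by (subst E) simp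
    then have "ends G e \<subseteq> verts G" using wf unfolding wf_terminal_graph_def by fastforce
    then have "{u e, v e} \<subseteq> {..<?n}" unfolding ends[OF e] V[symmetric] .
    then show "u e < ?n" "v e < ?n" by auto
  qed
  interpret graph_network "int ?n" "int ?m" us vs G
  proof
    show "verts G = {..<nat (int ?n)}" using V by simp
    show "edges G = {..<nat (int ?m)}" using E by simp
    fix e assume "e < nat (int ?m)"
    then have "e \<in> edges G" by (subst E) simp
    then show "ends G e = {nat (us (int e)), nat (vs (int e))}" using ends by (simp add: us_def vs_def)
  qed (use wf uv in \<open>auto simp: us_def vs_def\<close>)
  have n1: "1 \<le> int ?n" using terminals(1) by simp
  have "wp biflow_algorithm (\<lambda>\<tau> k. (\<exists>L. (\<forall>i<length (encode L). arrs \<tau> 0 (int i) = int (encode L ! i)) \<and> regs \<tau> 0 = int (length L) \<and>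
      distinct (map fst L) \<and> fst ` set L \<subseteq> terminal_paths G \<and> max_integral_biflow G c (listed_biflow L)) \<and> 0 \<le> k) ?\<sigma> total_cost"
    by (rule wp_biflow_algorithm[OF G]) (auto simp: input_store_def Let_def list_array_def us_def vs_def)
  then obtain t \<tau> L where ex: "exec biflow_algorithm ?\<sigma> t \<tau>" "int t \<le> total_cost"
    and L: "\<forall>i<length (encode L). arrs \<tau> 0 (int i) = int (encode L ! i)" "regs \<tau> 0 = int (length L)"
      "distinct (map fst L)" "fst ` set L \<subseteq> terminal_paths G" "max_integral_biflow G c (listed_biflow L)"
    unfolding wp_def by auto
  have "int t \<le> int (1000000 * (?n ^ 3 + ?m ^ 2))" using ex(2) total_cost_bound[OF n1] by simp
  then have "t \<le> 1000000 * (?n ^ 3 + ?m ^ 2)" by (simp only: of_nat_le_iff)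
  moreover have "outputs_biflow G \<tau> (listed_biflow L)"
    unfolding outputs_biflow_def using L(1-4) by (intro exI[of _ L]) (simp add: encode_def)
  ultimately show "\<exists>t \<tau> f. exec biflow_algorithm ?\<sigma> t \<tau> \<and> t \<le> 1000000 * (?n ^ 3 + ?m ^ 2) \<and>
      outputs_biflow G \<tau> f \<and> max_integral_biflow G c f"
    using ex(1) L(5) by blast
qed

end
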